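(* Let $u,v$ be the solutions on $\mathbb R^{1+3}$ of the free initial value problems $$(\varepsilon^2\partial_t^2-\Delta)u=0,\quad u|_{t=0}=f,\quad \partial_tu|_{t=0}=0;\qquad L_\pm^\varepsilon v=0,\quad v|_{t=0}=g$$ (for either choice of sign), where $L_\pm^\varepsilon=i\partial_t\mp\frac{\sqrt{1-\varepsilon^2\Delta}-1}{\varepsilon^2}$. Then, for dyadic numbers $\mu,\lambda$, the following estimates hold: (i) $\|\Delta_\mu(u_\lambda v_\lambda)\|_{L^2_{t,x}}\lesssim\varepsilon^{1/2}\mu\,\|f_\lambda\|_{L^2}\|g_\lambda\|_{L^2}$ if $\mu\lesssim\lambda\lesssim1/\varepsilon$. (ii) $\|\Delta_\mu(u_\lambda v_\lambda)\|_{L^2_{t,x}}\lesssim\varepsilon^{1/2}\mu^{1/2}\lambda^{1/2}\,\|f_\lambda\|_{L^2}\|g_\lambda\|_{L^2}$ if $\mu\lesssim\lambda$ and $\lambda\gg1/\varepsilon$. (iii) $\|u_\mu v_\lambda\|_{L^2_{t,x}}\lesssim\varepsilon^{1/2}\min(\mu,\lambda)\,\|f_\mu\|_{L^2}\|g_\lambda\|_{L^2}$ for all $\mu,\lambda$.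
   Context: $0<\varepsilon<1$. Dyadic numbers are numbers $2^j$, $j\in\mathbb Z$. The Littlewood-Paley operator $\Delta_\mu$ acts in $x$ by $(\Delta_\mu f)^\wedge(\xi)=\beta(\xi/\mu)\widehat f(\xi)$, where $\beta$ is a fixed smooth bump function supported in $|\xi|\sim1$ with $\sum_{j\in\mathbb Z}\beta(\xi/2^j)=1$ for $\xi\ne0$. One writes $f_\mu=\Delta_\mu f$ and similarly for $g,u,v$. In the conclusions, $X\lesssim Y$ means $X\le CY$ with $C>0$ independent of $\varepsilon,\mu,\lambda,f,g$. In the hypotheses, $a\lesssim b$ means $a\le Ab$ for some fixed constant $A$ (on which $C$ may depend), and $a\gg b$ means $a\ge Ab$ for a fixed sufficiently large constant $A$. *)

theory Defs
  imports "HOL-Analysis.Analysis"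
begin

section \<open>Square-integrable functions\<close>

definition in_L2 :: "('a::euclidean_space \<Rightarrow> complex) \<Rightarrow> bool" where
  "in_L2 f \<longleftrightarrow> f \<in> borel_measurable lborel \<and> integrable lborel (\<lambda>x. (cmod (f x))\<^sup>2)"

definition norm_L2 :: "('a::euclidean_space \<Rightarrow> complex) \<Rightarrow> real" where
  "norm_L2 f = sqrt (LINT x|lborel. (cmod (f x))\<^sup>2)"


section \<open>Smooth functions and Schwartz functions\<close>

definition partial_deriv ::
    "3 \<Rightarrow> (real^3 \<Rightarrow> 'b::real_normed_vector) \<Rightarrow> real^3 \<Rightarrow> 'b" where
  "partial_deriv i f x = frechet_derivative f (at x) (axis i 1)"

primrec iter_partial ::
    "3 list \<Rightarrow> (real^3 \<Rightarrow> 'b::real_normed_vector) \<Rightarrow> real^3 \<Rightarrow> 'b" where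
  "iter_partial [] f = f"
| "iter_partial (i # is) f = partial_deriv i (iter_partial is f)"

text \<open>All iterated partial derivatives exist and are themselves (Frechet) differentiable,
  hence continuous; this is the class of infinitely differentiable functions.\<close>

definition smooth :: "(real^3 \<Rightarrow> 'b::real_normed_vector) \<Rightarrow> bool" where
  "smooth f \<longleftrightarrow> (\<forall>is x. iter_partial is f differentiable (at x))"

definition schwartz :: "(real^3 \<Rightarrow> complex) \<Rightarrow> bool" where
  "schwartz \<phi> \<longleftrightarrow> smooth \<phi> \<and>
     (\<forall>is n. bounded (range (\<lambda>x. (norm x ^ n) *\<^sub>R iter_partial is \<phi> x)))"

definition laplacian :: "(real^3 \<Rightarrow> complex) \<Rightarrow> real^3 \<Rightarrow> complex" where
  "laplacian \<phi> x = (\<Sum>i\<in>UNIV. partial_deriv i (partial_deriv i \<phi>) x)"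


section \<open>Fourier transform\<close>

definition fourier :: "(real^3 \<Rightarrow> complex) \<Rightarrow> real^3 \<Rightarrow> complex" where
  "fourier f \<xi> = (LINT x|lborel. cis (- (x \<bullet> \<xi>)) * f x)"

definition fourier_inv :: "(real^3 \<Rightarrow> complex) \<Rightarrow> real^3 \<Rightarrow> complex" where
  "fourier_inv F x = complex_of_real (1 / (2 * pi) ^ 3) * (LINT \<xi>|lborel. cis (x \<bullet> \<xi>) * F \<xi>)"

text \<open>The Fourier transform of an \<open>L\<^sup>2\<close> function, as the \<open>L\<^sup>2\<close> limit of the transforms of
  its truncations to balls.  It is determined up to null sets; \<open>fourier_L2\<close> picks a
  representative.\<close>

definition is_fourier_L2 :: "(real^3 \<Rightarrow> complex) \<Rightarrow> (real^3 \<Rightarrow> complex) \<Rightarrow> bool" where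
  "is_fourier_L2 f F \<longleftrightarrow> in_L2 F \<and>
     ((\<lambda>R::real. \<integral>\<^sup>+\<xi>. ennreal ((cmod (fourier (\<lambda>x. indicator (ball 0 R) x * f x) \<xi> - F \<xi>))\<^sup>2)
        \<partial>lborel) \<longlongrightarrow> 0) at_top"

definition fourier_L2 :: "(real^3 \<Rightarrow> complex) \<Rightarrow> real^3 \<Rightarrow> complex" where
  "fourier_L2 f = (SOME F. is_fourier_L2 f F)"


section \<open>Littlewood-Paley operators\<close>

definition dyadic :: "real \<Rightarrow> bool" where
  "dyadic \<mu> \<longleftrightarrow> (\<exists>j::int. \<mu> = 2 powi j)"

definition lp_bump :: "(real^3 \<Rightarrow> real) \<Rightarrow> bool" where
  "lp_bump \<beta> \<longleftrightarrow> smooth \<beta> \<and>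
     (\<exists>a b. 0 < a \<and> a \<le> b \<and> (\<forall>\<xi>. \<beta> \<xi> \<noteq> 0 \<longrightarrow> a \<le> norm \<xi> \<and> norm \<xi> \<le> b)) \<and>
     (\<forall>\<xi>. \<xi> \<noteq> 0 \<longrightarrow> ((\<lambda>j::int. \<beta> (\<xi> /\<^sub>R (2 powi j))) has_sum 1) UNIV)"

text \<open>For \<open>f\<close> in \<open>L\<^sup>2\<close> the function \<open>\<beta>(\<cdot>/\<mu>) f^\<close> is integrable, so the inverse Fourier
  integral converges absolutely and gives the continuous representative of the
  projection of \<open>f\<close>; it does not depend on the representative chosen by \<open>fourier_L2\<close>.\<close>

definition LP :: "(real^3 \<Rightarrow> real) \<Rightarrow> real \<Rightarrow> (real^3 \<Rightarrow> complex) \<Rightarrow> real^3 \<Rightarrow> complex" where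
  "LP \<beta> \<mu> f = fourier_inv (\<lambda>\<xi>. complex_of_real (\<beta> (\<xi> /\<^sub>R \<mu>)) * fourier_L2 f \<xi>)"


section \<open>Solutions of the free equations\<close>

text \<open>For data merely in \<open>L\<^sup>2\<close> the equations are understood in the sense of tempered
  distributions in \<open>x\<close>, for functions in \<open>C(\<real>; L\<^sup>2)\<close>.  The pairing is bilinear
  (no complex conjugation).\<close>

definition pairing :: "(real^3 \<Rightarrow> complex) \<Rightarrow> (real^3 \<Rightarrow> complex) \<Rightarrow> complex" where
  "pairing w \<phi> = (LINT x|lborel. w x * \<phi> x)"

definition continuous_into_L2 :: "(real \<Rightarrow> real^3 \<Rightarrow> complex) \<Rightarrow> bool" where
  "continuous_into_L2 w \<longleftrightarrow> (\<forall>t. in_L2 (w t)) \<and>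
     (\<forall>t. ((\<lambda>s. norm_L2 (\<lambda>x. w s x - w t x)) \<longlongrightarrow> 0) (at t))"

definition wave_solution ::
    "real \<Rightarrow> (real^3 \<Rightarrow> complex) \<Rightarrow> (real \<Rightarrow> real^3 \<Rightarrow> complex) \<Rightarrow> bool" where
  "wave_solution \<epsilon> f u \<longleftrightarrow> continuous_into_L2 u \<and> (AE x in lborel. u 0 x = f x) \<and>
     (\<forall>\<phi>. schwartz \<phi> \<longrightarrow> (\<exists>u1 u2.
        (\<forall>t. ((\<lambda>s. pairing (u s) \<phi>) has_vector_derivative u1 t) (at t)) \<and>
        (\<forall>t. (u1 has_vector_derivative u2 t) (at t)) \<and>
        u1 0 = 0 \<and>
        (\<forall>t. complex_of_real (\<epsilon>\<^sup>2) * u2 t - pairing (u t) (laplacian \<phi>) = 0)))"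

definition schrodinger_symbol :: "real \<Rightarrow> real^3 \<Rightarrow> real" where
  "schrodinger_symbol \<epsilon> \<xi> = (sqrt (1 + \<epsilon>\<^sup>2 * (norm \<xi>)\<^sup>2) - 1) / \<epsilon>\<^sup>2"

text \<open>The Fourier multiplier \<open>(sqrt (1 - \<epsilon>\<^sup>2 \<Delta>) - 1) / \<epsilon>\<^sup>2\<close> on Schwartz functions.  Its symbol is
  even, so it is its own transpose for \<open>pairing\<close>, and thus acts on tempered
  distributions by acting on the test function.\<close>

definition schrodinger_op :: "real \<Rightarrow> (real^3 \<Rightarrow> complex) \<Rightarrow> real^3 \<Rightarrow> complex" where
  "schrodinger_op \<epsilon> \<phi> =
     fourier_inv (\<lambda>\<xi>. complex_of_real (schrodinger_symbol \<epsilon> \<xi>) * fourier \<phi> \<xi>)"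

text \<open>The sign \<open>\<sigma> \<in> {1, -1}\<close> is the upper or lower sign in
  \<open>L\<^sub>\<plusminus> = i \<partial>\<^sub>t \<mp> (sqrt (1 - \<epsilon>\<^sup>2 \<Delta>) - 1) / \<epsilon>\<^sup>2\<close>.\<close>

definition half_kg_solution ::
    "real \<Rightarrow> real \<Rightarrow> (real^3 \<Rightarrow> complex) \<Rightarrow> (real \<Rightarrow> real^3 \<Rightarrow> complex) \<Rightarrow> bool" where
  "half_kg_solution \<epsilon> \<sigma> g v \<longleftrightarrow> continuous_into_L2 v \<and> (AE x in lborel. v 0 x = g x) \<and>
     (\<forall>\<phi>. schwartz \<phi> \<longrightarrow> (\<exists>v1.
        (\<forall>t. ((\<lambda>s. pairing (v s) \<phi>) has_vector_derivative v1 t) (at t)) \<and>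
        (\<forall>t. \<i> * v1 t - complex_of_real \<sigma> * pairing (v t) (schrodinger_op \<epsilon> \<phi>) = 0)))"

end

theory Submission
  imports Defs "HOL-Probability.Probability"
begin

text \<open>On the Fourier side \<open>u\<close> is a superposition of the phases \<open>\<plusminus> \<bar>\<xi>\<bar> / \<epsilon>\<close>, and \<open>v\<close> has the phase
  \<open>\<mp> (sqrt (1 + \<epsilon>\<^sup>2 \<bar>\<xi>\<bar>\<^sup>2) - 1) / \<epsilon>\<^sup>2\<close>.  Testing the space-time integral against Gaussians
  and applying Schur's test, the squared \<open>L\<^sup>2\<close> norm of a product of two such waves is controlled by the
  supremum over \<open>\<xi>\<close> and \<open>w\<close> of the measure of the sets of frequencies \<open>\<eta>\<close> of the first factor at
  which the combined phase \<open>\<phi>\<^sub>1(\<eta>) + \<phi>\<^sub>2(\<xi> - \<eta>)\<close> is \<open>l\<close>-close to \<open>w\<close>, divided by \<open>2 l\<close>.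

  This measure is estimated in three ways.  If the two frequencies have different sizes, then \<open>\<bar>\<eta>\<bar>\<close> and
  \<open>\<bar>\<xi> - \<eta>\<bar>\<close> are good coordinates (hat-box theorem).  If \<open>\<epsilon> \<lambda> \<lesssim> 1\<close>, the Klein--Gordon group velocity
  is smaller than the wave speed by a fixed factor, so that the combined phase is strictly monotone along rays.  If
  \<open>\<epsilon> \<lambda> \<ge> 1\<close>, the Cauchy--Schwarz inequality reduces the product to the squares of its two factors, whose
  combined phases are functions of \<open>\<bar>\<eta>\<bar>\<^sup>2\<close> and \<open>\<bar>\<xi> - \<eta>\<bar>\<^sup>2\<close> that increase in both.  For an output of
  frequency \<open>\<mu> \<lesssim> \<lambda>\<close> the two inputs are first cut into cubes of side \<open>\<mu>\<close>: each cube of one interacts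
  with boundedly many cubes of the other.\<close>

section \<open>Square-integrable functions\<close>

text \<open>The factor \<open>\<epsilon> powr (1/2)\<close> comes from one picture: the points
  \<eta> at which |\<eta>|/\<epsilon> is l-close to w form a shell of thickness of order \<epsilon>
  l, whose part in a ball of radius r has measure of order \<epsilon> r^2 l. The square root of
  \<epsilon> r^2 is the bound. The obstacle is the second phase: its gradient has length |\<zeta>| /
  sqrt(1 + \<epsilon>^2 |\<zeta>|^2), which tends to 1/\<epsilon>, so once \<epsilon> \<lambda> is
  large the two gradients can nearly cancel. Squaring pairs each phase with itself, with equal
  signs; the price is that \<epsilon> r^2 becomes \<epsilon> r \<lambda>, whence the factor
  \<mu>^(1/2) \<lambda>^(1/2) at high frequency. A second obstacle lies in the equations, which are
  given only against Schwartz functions, so the Fourier formulas for u and v have to be derived.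
  Modulated Gaussians serve as tests: the Laplacian and the Klein-Gordon multiplier, applied any
  number of times, leave them Schwartz, and the iterates grow slowly enough for the Taylor series in
  time to converge for all t.\<close>

definition N2 :: "('a::euclidean_space \<Rightarrow> complex) \<Rightarrow> ennreal" where
  "N2 f = (\<integral>\<^sup>+x. ennreal ((cmod (f x))\<^sup>2) \<partial>lborel)"

lemma in_L2_measurable: "in_L2 f \<Longrightarrow> f \<in> borel_measurable borel"
  by (simp add: in_L2_def)

lemma in_L2_iff: "in_L2 f \<longleftrightarrow> f \<in> borel_measurable borel \<and> N2 f < \<infinity>"
  unfolding in_L2_def N2_def by (auto simp: integrable_iff_bounded)

lemma norm_L2_nonneg [simp]: "0 \<le> norm_L2 f"
  by (simp add: norm_L2_def)

lemma N2_norm_L2: assumes "in_L2 f" shows "N2 f = ennreal ((norm_L2 f)\<^sup>2)"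
  using assms unfolding in_L2_def norm_L2_def N2_def by (simp add: nn_integral_eq_integral)

text \<open>\<open>N2\<close> is the squared norm with values in [0, \<infinity>]. Estimates are
  proved for it first, before finiteness is known; this lemma turns them into membership in L2 and a
  bound of the norm.\<close>

lemma in_L2_boundI:
  assumes "f \<in> borel_measurable borel" "N2 f \<le> ennreal (c\<^sup>2)" "0 \<le> c"
  shows "in_L2 f" "norm_L2 f \<le> c"
proof -
  show 1: "in_L2 f"
    using assms le_less_trans[OF assms(2) ennreal_less_top] by (auto simp: in_L2_iff)
  have "(norm_L2 f)\<^sup>2 \<le> c\<^sup>2"
    using assms(2) N2_norm_L2[OF 1] by simp
  then show "norm_L2 f \<le> c"
    using assms(3) by (rule power2_le_imp_le)
qed

lemma N2_mono:
  assumes "\<And>x. cmod (f x) \<le> cmod (g x)" shows "N2 f \<le> N2 g"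
  unfolding N2_def by (intro nn_integral_mono ennreal_leI power_mono assms) auto

lemma N2_cmult: "N2 (\<lambda>x. c * f x) = ennreal ((cmod c)\<^sup>2) * N2 f" if "f \<in> borel_measurable borel"
  unfolding N2_def using that by (subst nn_integral_cmult[symmetric]) (auto simp: norm_mult power_mult_distrib ennreal_mult)

lemma N2_cong_AE: "AE x in lborel. f x = g x \<Longrightarrow> N2 f = N2 g"
  unfolding N2_def by (intro nn_integral_cong_AE) auto

lemma N2_eq_0: "f \<in> borel_measurable borel \<Longrightarrow> N2 f = 0 \<longleftrightarrow> (AE x in lborel. f x = 0)"
  unfolding N2_def by (subst nn_integral_0_iff_AE) (auto simp: ennreal_eq_0_iff power2_less_eq_zero_iff)

lemma ennreal_power2_le_imp_le:
  assumes "a\<^sup>2 \<le> (ennreal b)\<^sup>2" "0 \<le> b" shows "a \<le> ennreal b"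
proof (cases a)
  case (real r)
  then have "r\<^sup>2 \<le> b\<^sup>2" using assms by (simp add: ennreal_power)
  then have "r \<le> b" using assms(2) by (rule power2_le_imp_le)
  then show ?thesis using real by (simp add: ennreal_leI)
next
  case top
  then show ?thesis using assms by (simp add: ennreal_power top_unique)
qed

lemma L2_Cauchy_Schwarz:
  assumes "in_L2 f" "in_L2 g"
  shows "integrable lborel (\<lambda>x. f x * g x)"
    and "(LINT x|lborel. cmod (f x * g x)) \<le> norm_L2 f * norm_L2 g"
    and "cmod (LINT x|lborel. f x * g x) \<le> norm_L2 f * norm_L2 g"
proof -
  note [measurable] = in_L2_measurable[OF assms(1)] in_L2_measurable[OF assms(2)]
  have "(\<integral>\<^sup>+x. ennreal (cmod (f x * g x)) \<partial>lborel)\<^sup>2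
      = (\<integral>\<^sup>+x. ennreal (cmod (f x)) * ennreal (cmod (g x)) \<partial>lborel)\<^sup>2"
    by (simp add: norm_mult ennreal_mult)
  also have "\<dots> \<le> N2 f * N2 g"
    unfolding N2_def by (rule order_trans[OF Cauchy_Schwarz_nn_integral]) (auto simp: ennreal_power)
  also have "\<dots> = ennreal ((norm_L2 f * norm_L2 g)\<^sup>2)"
    by (simp add: N2_norm_L2 assms ennreal_mult power_mult_distrib)
  finally have *: "(\<integral>\<^sup>+x. ennreal (cmod (f x * g x)) \<partial>lborel)\<^sup>2 \<le> (ennreal (norm_L2 f * norm_L2 g))\<^sup>2"
    by (simp add: ennreal_power)
  then have le: "(\<integral>\<^sup>+x. ennreal (cmod (f x * g x)) \<partial>lborel) \<le> ennreal (norm_L2 f * norm_L2 g)"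
    by (rule ennreal_power2_le_imp_le) simp
  show i: "integrable lborel (\<lambda>x. f x * g x)"
    using le by (auto simp: integrable_iff_bounded intro: le_less_trans[OF le])
  have "ennreal (LINT x|lborel. cmod (f x * g x)) \<le> ennreal (norm_L2 f * norm_L2 g)"
    using le i by (subst (asm) nn_integral_eq_integral) auto
  then show 1: "(LINT x|lborel. cmod (f x * g x)) \<le> norm_L2 f * norm_L2 g"
    by (subst (asm) ennreal_le_iff) auto
  show "cmod (LINT x|lborel. f x * g x) \<le> norm_L2 f * norm_L2 g"
    using 1 integral_norm_bound[of lborel "\<lambda>x. f x * g x"] by linarith
qed

lemma in_L2_add: assumes "in_L2 f" "in_L2 g" shows "in_L2 (\<lambda>x. f x + g x)"
  and "norm_L2 (\<lambda>x. f x + g x) \<le> norm_L2 f + norm_L2 g"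
proof -
  note [measurable] = in_L2_measurable[OF assms(1)] in_L2_measurable[OF assms(2)]
  have if2: "integrable lborel (\<lambda>x. (cmod (f x))\<^sup>2)" "integrable lborel (\<lambda>x. (cmod (g x))\<^sup>2)"
    using assms by (auto simp: in_L2_def)
  have ifg: "integrable lborel (\<lambda>x. cmod (f x * g x))"
    using L2_Cauchy_Schwarz(1)[OF assms] by (rule integrable_norm)
  have le: "(cmod (f x + g x))\<^sup>2 \<le> (cmod (f x))\<^sup>2 + (cmod (g x))\<^sup>2 + 2 * cmod (f x * g x)" for x
    using power_mono[OF norm_triangle_ineq[of "f x" "g x"], of 2] by (simp add: power2_sum norm_mult)
  have ib: "integrable lborel (\<lambda>x. (cmod (f x))\<^sup>2 + (cmod (g x))\<^sup>2 + 2 * cmod (f x * g x))"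
    using if2 ifg by auto
  have i: "integrable lborel (\<lambda>x. (cmod (f x + g x))\<^sup>2)"
    by (rule Bochner_Integration.integrable_bound[OF ib]) (use le in \<open>auto simp: add_nonneg_nonneg intro: order_trans[OF le]\<close>)
  show "in_L2 (\<lambda>x. f x + g x)" using i by (simp add: in_L2_def)
  have "(LINT x|lborel. (cmod (f x + g x))\<^sup>2)
     \<le> (LINT x|lborel. (cmod (f x))\<^sup>2 + (cmod (g x))\<^sup>2 + 2 * cmod (f x * g x))"
    using i ib le by (intro integral_mono) auto
  also have "\<dots> = (norm_L2 f)\<^sup>2 + (norm_L2 g)\<^sup>2 + 2 * (LINT x|lborel. cmod (f x * g x))"
    using if2 ifg by (simp add: norm_L2_def)
  also have "\<dots> \<le> (norm_L2 f + norm_L2 g)\<^sup>2"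
    using L2_Cauchy_Schwarz(2)[OF assms] by (simp add: power2_sum)
  finally have "(norm_L2 (\<lambda>x. f x + g x))\<^sup>2 \<le> (norm_L2 f + norm_L2 g)\<^sup>2"
    by (simp add: norm_L2_def)
  then show "norm_L2 (\<lambda>x. f x + g x) \<le> norm_L2 f + norm_L2 g"
    by (rule power2_le_imp_le) simp
qed

lemma in_L2_zero [simp]: "in_L2 (\<lambda>x. 0)" "norm_L2 (\<lambda>x. 0) = 0"
  by (auto simp: in_L2_def norm_L2_def)

lemma in_L2_sum:
  assumes "finite I" "\<And>i. i \<in> I \<Longrightarrow> in_L2 (f i)"
  shows "in_L2 (\<lambda>x. \<Sum>i\<in>I. f i x) \<and> norm_L2 (\<lambda>x. \<Sum>i\<in>I. f i x) \<le> (\<Sum>i\<in>I. norm_L2 (f i))"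
  using assms
proof (induction I rule: finite_induct)
  case (insert i I)
  then show ?case
    using in_L2_add[of "f i" "\<lambda>x. \<Sum>i\<in>I. f i x"] by auto
qed simp

lemma in_L2_bounded_mult:
  assumes "in_L2 f" "m \<in> borel_measurable borel" "\<And>x. cmod (m x) \<le> B"
  shows "in_L2 (\<lambda>x. m x * f x)" "norm_L2 (\<lambda>x. m x * f x) \<le> B * norm_L2 f"
proof -
  note [measurable] = in_L2_measurable[OF assms(1)] assms(2)
  have B: "0 \<le> B" using assms(3)[of undefined] norm_ge_zero order_trans by blast
  have "N2 (\<lambda>x. m x * f x) \<le> N2 (\<lambda>x. of_real B * f x)"
    by (rule N2_mono) (use B assms(3) in \<open>auto simp: norm_mult intro!: mult_right_mono\<close>)
  also have "\<dots> = ennreal ((B * norm_L2 f)\<^sup>2)"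
    using B by (simp add: N2_cmult N2_norm_L2 assms power_mult_distrib ennreal_mult)
  finally show "in_L2 (\<lambda>x. m x * f x)" "norm_L2 (\<lambda>x. m x * f x) \<le> B * norm_L2 f"
    using B by (auto intro!: in_L2_boundI)
qed

lemma in_L2_cmult:
  assumes "in_L2 f" shows "in_L2 (\<lambda>x. c * f x)" "norm_L2 (\<lambda>x. c * f x) = cmod c * norm_L2 f"
  using in_L2_bounded_mult(1)[OF assms, of "\<lambda>_. c" "cmod c"]
  by (auto simp: norm_L2_def norm_mult power_mult_distrib real_sqrt_mult)

lemma in_L2_diff: assumes "in_L2 f" "in_L2 g" shows "in_L2 (\<lambda>x. f x - g x)"
  and "norm_L2 (\<lambda>x. f x - g x) \<le> norm_L2 f + norm_L2 g"
  using in_L2_add[OF assms(1) in_L2_cmult(1)[OF assms(2), of "-1"]] in_L2_cmult(2)[OF assms(2), of "-1"]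
  by auto

lemma in_L2_cnj: "in_L2 f \<Longrightarrow> in_L2 (\<lambda>x. cnj (f x))" "norm_L2 (\<lambda>x. cnj (f x)) = norm_L2 f"
  by (auto simp: in_L2_def norm_L2_def borel_measurable_continuous_onI intro!: measurable_compose[of f _ borel cnj])

lemma cmod_add_sq: "(cmod (a + b))\<^sup>2 \<le> 2 * (cmod a)\<^sup>2 + 2 * (cmod b)\<^sup>2"
proof -
  have "(cmod (a + b))\<^sup>2 \<le> (cmod a + cmod b)\<^sup>2" by (simp add: norm_triangle_ineq power_mono)
  also have "\<dots> \<le> 2 * (cmod a)\<^sup>2 + 2 * (cmod b)\<^sup>2"
    using sum_squares_bound[of "cmod a" "cmod b"] by (simp add: power2_sum)
  finally show ?thesis .
qed

lemma N2_add_le: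
  assumes [measurable]: "f \<in> borel_measurable borel" "g \<in> borel_measurable borel"
  shows "N2 (\<lambda>x. f x + g x) \<le> 2 * N2 f + 2 * N2 g"
proof -
  have "N2 (\<lambda>x. f x + g x) \<le> (\<integral>\<^sup>+x. ennreal (2 * (cmod (f x))\<^sup>2 + 2 * (cmod (g x))\<^sup>2) \<partial>lborel)"
    unfolding N2_def by (intro nn_integral_mono ennreal_leI cmod_add_sq)
  also have "\<dots> = (\<integral>\<^sup>+x. 2 * ennreal ((cmod (f x))\<^sup>2) + 2 * ennreal ((cmod (g x))\<^sup>2) \<partial>lborel)"
    by (simp add: ennreal_plus ennreal_mult)
  also have "\<dots> = 2 * N2 f + 2 * N2 g"
    unfolding N2_def by (simp add: nn_integral_add nn_integral_cmult)
  finally show ?thesis .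
qed

section \<open>Fubini's theorem and integrability of products\<close>

lemma measurable_cis [measurable]: "cis \<in> borel_measurable borel"
  by (intro borel_measurable_continuous_onI continuous_on_cis continuous_on_id)

lemma measurable_fst_snd_borel [measurable]:
  "fst \<in> borel_measurable (borel :: ('a::second_countable_topology \<times> 'b::second_countable_topology) measure)"
  "snd \<in> borel_measurable (borel :: ('a::second_countable_topology \<times> 'b::second_countable_topology) measure)"
  by (auto intro!: borel_measurable_continuous_onI continuous_intros)

lemma lborel_Fubini:
  fixes f :: "'a::euclidean_space \<Rightarrow> 'b::euclidean_space \<Rightarrow> 'c::{banach, second_countable_topology}"
  assumes "integrable lborel (\<lambda>(x, y). f x y)"
  shows "(LINT x|lborel. LINT y|lborel. f x y) = (LINT p|lborel. f (fst p) (snd p))"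
    and "(LINT y|lborel. LINT x|lborel. f x y) = (LINT p|lborel. f (fst p) (snd p))"
  using lborel_pair.integral_fst[of f] lborel_pair.integral_snd[of f] assms
  by (auto simp: lborel_prod case_prod_beta')

lemma lborel_Fubini_nn:
  fixes f :: "'a::euclidean_space \<Rightarrow> 'b::euclidean_space \<Rightarrow> ennreal"
  assumes "(\<lambda>(x, y). f x y) \<in> borel_measurable borel"
  shows "(\<integral>\<^sup>+p. f (fst p) (snd p) \<partial>lborel) = (\<integral>\<^sup>+x. \<integral>\<^sup>+y. f x y \<partial>lborel \<partial>lborel)"
    and "(\<integral>\<^sup>+p. f (fst p) (snd p) \<partial>lborel) = (\<integral>\<^sup>+y. \<integral>\<^sup>+x. f x y \<partial>lborel \<partial>lborel)"
proof -
  have m: "(\<lambda>(x, y). f x y) \<in> borel_measurable (lborel \<Otimes>\<^sub>M lborel)"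
    using assms by (simp add: lborel_prod)
  show "(\<integral>\<^sup>+p. f (fst p) (snd p) \<partial>lborel) = (\<integral>\<^sup>+x. \<integral>\<^sup>+y. f x y \<partial>lborel \<partial>lborel)"
    using lborel.nn_integral_fst[OF m] by (simp add: lborel_prod case_prod_beta')
  show "(\<integral>\<^sup>+p. f (fst p) (snd p) \<partial>lborel) = (\<integral>\<^sup>+y. \<integral>\<^sup>+x. f x y \<partial>lborel \<partial>lborel)"
    using lborel_pair.nn_integral_snd[OF m] by (simp add: lborel_prod case_prod_beta')
qed

lemma integrable_borel: "integrable lborel f \<Longrightarrow> f \<in> borel_measurable borel"
  using borel_measurable_integrable by force

lemma lborel_integrable_product:
  fixes f :: "'a::euclidean_space \<Rightarrow> 'c::{real_normed_field, banach, second_countable_topology}"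
    and g :: "'b::euclidean_space \<Rightarrow> 'c"
  assumes "integrable lborel f" "integrable lborel g"
  shows "integrable lborel (\<lambda>(x, y). f x * g y)"
proof -
  note [measurable] = integrable_borel[OF assms(1)] integrable_borel[OF assms(2)]
  have "integrable (lborel \<Otimes>\<^sub>M lborel) (\<lambda>(x, y). f x * g y)"
    by (rule lborel_pair.Fubini_integrable) (use assms in \<open>auto simp: norm_mult\<close>)
  then show ?thesis by (simp add: lborel_prod)
qed

section \<open>Gaussians and their Fourier transforms\<close>

definition gauss :: "real \<Rightarrow> 'a::euclidean_space \<Rightarrow> real" where
  "gauss d x = exp (- (d * norm x)\<^sup>2 / 2)"

text \<open>The Fourier transform of \<open>gauss d\<close>. Its total mass is (2\<pi>)^n for every
  d, while \<open>gauss d\<close> tends to 1 as d tends to 0; inserting \<open>gauss d\<close> as a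
  weight therefore regularises a delta kernel.\<close>

definition gauss_ft :: "real \<Rightarrow> 'a::euclidean_space \<Rightarrow> real" where
  "gauss_ft d z = (sqrt (2 * pi) / d) ^ DIM('a) * gauss (1 / d) z"

lemma gauss_measurable [measurable]: "gauss d \<in> borel_measurable borel"
  unfolding gauss_def by measurable

lemma gauss_ft_measurable [measurable]: "gauss_ft d \<in> borel_measurable borel"
  unfolding gauss_ft_def[abs_def] by measurable

lemma gauss_pos: "0 < gauss d x" and gauss_le_1: "gauss d x \<le> 1"
  by (auto simp: gauss_def)

lemma gauss_ft_nonneg: "0 < d \<Longrightarrow> 0 \<le> gauss_ft d x"
  by (simp add: gauss_ft_def gauss_def)

lemma gauss_ft_minus: "gauss_ft d (- x) = gauss_ft d x"
  by (simp add: gauss_ft_def gauss_def)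

lemma gauss_ft_bound: "0 < d \<Longrightarrow> gauss_ft d (x::'a::euclidean_space) \<le> (sqrt (2 * pi) / d) ^ DIM('a)"
  unfolding gauss_ft_def using gauss_le_1[of "1/d" x] by (intro mult_left_le) auto

text \<open>This is the characteristic function of the standard normal distribution, whose density
  is the Gaussian divided by sqrt(2\<pi>).\<close>

lemma gauss_FT_std:
  "has_bochner_integral lborel (\<lambda>x::real. cis (x * z) * of_real (exp (- x\<^sup>2 / 2)))
     (of_real (sqrt (2 * pi) * exp (- z\<^sup>2 / 2)))"
proof (rule has_bochner_integral_integrable[THEN has_bochner_integral_cong[THEN iffD1, rotated -1]])
  have i: "integrable lborel (\<lambda>x. of_real (std_normal_density x) :: complex)"
    using integrable_std_normal_moment[of 0] by simp
  have "integrable lborel (\<lambda>x. sqrt (2 * pi) * (cis (x * z) * of_real (std_normal_density x)))"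
    by (intro integrable_mult_right Bochner_Integration.integrable_bound[OF i]) (auto simp: norm_mult)
  then show "integrable lborel (\<lambda>x. cis (x * z) * of_real (exp (- x\<^sup>2 / 2)))"
    by (simp add: std_normal_density_def field_simps)
  have "of_real (exp (- z\<^sup>2 / 2)) = char std_normal_distribution z"
    by (simp add: char_std_normal_distribution)
  also have "\<dots> = (LINT x|lborel. std_normal_density x *\<^sub>R iexp (z * x))"
    unfolding char_def by (subst integral_density) auto
  also have "\<dots> = (LINT x|lborel. of_real (1 / sqrt (2 * pi)) * (cis (x * z) * of_real (exp (- x\<^sup>2 / 2))))"
    by (intro Bochner_Integration.integral_cong) (auto simp: std_normal_density_def scaleR_conv_of_real cis_conv_exp mult_ac)
  also have "\<dots> = of_real (1 / sqrt (2 * pi)) * (LINT x|lborel. cis (x * z) * of_real (exp (- x\<^sup>2 / 2)))"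
    by (rule integral_mult_right_zero)
  finally have "of_real (sqrt (2 * pi)) * of_real (exp (- z\<^sup>2 / 2))
     = of_real (sqrt (2 * pi) * (1 / sqrt (2 * pi))) * (LINT x|lborel. cis (x * z) * of_real (exp (- x\<^sup>2 / 2)))"
    by (simp only: of_real_mult mult.assoc)
  then show "(LINT x|lborel. cis (x * z) * of_real (exp (- x\<^sup>2 / 2))) = of_real (sqrt (2 * pi) * exp (- z\<^sup>2 / 2))"
    by simp
qed auto

lemma gauss_FT_real:
  assumes "0 < d"
  shows "has_bochner_integral lborel (\<lambda>x::real. cis (x * z) * of_real (exp (- (d * x)\<^sup>2 / 2)))
     (of_real (sqrt (2 * pi) / d * exp (- (z / d)\<^sup>2 / 2)))"
proof -
  have "has_bochner_integral lborel (\<lambda>x. cis ((0 + d * x) * (z / d)) * of_real (exp (- (0 + d * x)\<^sup>2 / 2)))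
     (of_real (sqrt (2 * pi) * exp (- (z / d)\<^sup>2 / 2)) /\<^sub>R \<bar>d\<bar>)"
    using lborel_has_bochner_integral_real_affine_iff[of d "\<lambda>x. cis (x * (z/d)) * of_real (exp (- x\<^sup>2 / 2))" _ 0]
      gauss_FT_std[of "z / d"] assms by blast
  moreover have "(0 + d * x) * (z / d) = x * z" for x using assms by simp
  moreover have "complex_of_real (sqrt (2 * pi) * exp (- (z / d)\<^sup>2 / 2)) /\<^sub>R \<bar>d\<bar> = of_real (sqrt (2 * pi) / d * exp (- (z / d)\<^sup>2 / 2))"
  proof -
    have "complex_of_real X /\<^sub>R \<bar>d\<bar> = of_real (X / d)" for X
      using assms by (simp add: scaleR_conv_of_real divide_inverse)
    then show ?thesis by (metis times_divide_eq_left)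
  qed
  ultimately show ?thesis by (simp only: add_0)
qed

text \<open>Character and Gaussian both factor over the coordinates, and \<open>lborel\<close> is
  the image of a product of one-dimensional Lebesgue measures.\<close>

lemma gauss_FT:
  fixes z :: "'a::euclidean_space"
  assumes d: "0 < d"
  shows "integrable lborel (gauss d :: 'a \<Rightarrow> real)"
    and "(LINT x|lborel. cis (x \<bullet> z) * of_real (gauss d x)) = of_real (gauss_ft d z)"
proof -
  interpret product_sigma_finite "\<lambda>_::'a. lborel :: real measure" ..
  define F where "F z x = cis (x * z) * of_real (exp (- (d * x)\<^sup>2 / 2))" for z x :: real
  have F [measurable]: "F z \<in> borel_measurable borel" for z
    unfolding F_def by measurable
  have iF: "integrable lborel (F z)" for z
    unfolding F_def using gauss_FT_real[OF d] by (rule integrable.intros)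
  have vF: "(LINT x|lborel. F z x) = of_real (sqrt (2 * pi) / d * exp (- (z / d)\<^sup>2 / 2))" for z
    unfolding F_def using gauss_FT_real[OF d] by (rule has_bochner_integral_integral_eq)
  have cis_sum: "cis (sum f A) = (\<Prod>a\<in>A. cis (f a))" for f and A :: "'a set"
    by (induction A rule: infinite_finite_induct) (auto simp: cis_mult[symmetric])
  have norm2: "(norm x)\<^sup>2 = (\<Sum>b\<in>Basis. (x \<bullet> b)\<^sup>2)" for x :: 'a
    unfolding power2_norm_eq_inner by (subst euclidean_inner) (simp add: power2_eq_square)
  have prodF: "cis (x \<bullet> z) * of_real (gauss d x) = (\<Prod>b\<in>Basis. F (z \<bullet> b) (x \<bullet> b))" for x z :: 'a
  proof -
    have "gauss d x = (\<Prod>b\<in>Basis. exp (- (d * (x \<bullet> b))\<^sup>2 / 2))"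
      unfolding gauss_def by (simp add: exp_sum[symmetric] power_mult_distrib norm2 sum_distrib_left sum_negf sum_divide_distrib)
    moreover have "cis (x \<bullet> z) = (\<Prod>b\<in>Basis. cis ((x \<bullet> b) * (z \<bullet> b)))"
      by (subst euclidean_inner) (rule cis_sum)
    ultimately show ?thesis by (simp add: F_def prod.distrib)
  qed
  have comp: "(\<Sum>b\<in>Basis. f b *\<^sub>R b) \<bullet> c = f c" if "c \<in> Basis" for f and c :: 'a
    using that by (simp add: inner_sum_left inner_Basis sum.delta' if_distrib cong: if_cong)
  have m: "(\<lambda>f. \<Sum>b\<in>Basis. f b *\<^sub>R b) \<in> measurable (\<Pi>\<^sub>M b\<in>(Basis::'a set). lborel) borel"
    by measurable
  have mG: "(\<lambda>x. cis (x \<bullet> z) * of_real (gauss d x)) \<in> borel_measurable borel" for z :: 'a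
    by measurable
  have "integrable (\<Pi>\<^sub>M b\<in>(Basis::'a set). lborel) (\<lambda>x. \<Prod>b\<in>Basis. F (z \<bullet> b) (x b))" for z
    by (rule product_integrable_prod) (auto simp: iF)
  then have i: "integrable lborel (\<lambda>x. cis (x \<bullet> z) * of_real (gauss d x))" for z :: 'a
    by (subst lborel_eq, subst integrable_distr_eq[OF m mG]) (simp add: prodF comp cong: prod.cong)
  have "integrable lborel (\<lambda>x::'a. cmod (cis (x \<bullet> 0) * of_real (gauss d x)))"
    by (rule integrable_norm[OF i])
  then show "integrable lborel (gauss d :: 'a \<Rightarrow> real)"
    by (simp add: norm_mult less_imp_le[OF gauss_pos])
  have "(LINT x|lborel. cis (x \<bullet> z) * of_real (gauss d x)) = (LINT x|(\<Pi>\<^sub>M b\<in>(Basis::'a set). lborel). (\<Prod>b\<in>Basis. F (z \<bullet> b) (x b)))"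
    by (subst lborel_eq, subst integral_distr[OF m mG]) (simp add: prodF comp cong: prod.cong)
  also have "\<dots> = (\<Prod>b\<in>Basis. (LINT x|lborel. F (z \<bullet> b) x))"
    by (rule product_integral_prod) (auto simp: iF)
  also have "\<dots> = of_real (\<Prod>b\<in>Basis. sqrt (2 * pi) / d * exp (- ((z \<bullet> b) / d)\<^sup>2 / 2))"
    unfolding vF by (rule of_real_prod[symmetric])
  also have "(\<Prod>b\<in>Basis. sqrt (2 * pi) / d * exp (- ((z \<bullet> b) / d)\<^sup>2 / 2))
      = (\<Prod>b\<in>(Basis::'a set). sqrt (2 * pi) / d) * (\<Prod>b\<in>Basis. exp (- ((z \<bullet> b) / d)\<^sup>2 / 2))"
    by (rule prod.distrib)
  also have "(\<Prod>b\<in>Basis. exp (- ((z \<bullet> b) / d)\<^sup>2 / 2)) = gauss (1 / d) z"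
    unfolding gauss_def
    by (subst exp_sum[symmetric]) (simp_all add: power_divide norm2 sum_divide_distrib sum_negf)
  also have "(\<Prod>b\<in>(Basis::'a set). sqrt (2 * pi) / d) * gauss (1 / d) z = gauss_ft d z"
    by (simp add: gauss_ft_def)
  finally show "(LINT x|lborel. cis (x \<bullet> z) * of_real (gauss d x)) = of_real (gauss_ft d z)" .
qed

lemma gauss_ft_integral:
  assumes "0 < d"
  shows "integrable lborel (gauss_ft d :: 'a::euclidean_space \<Rightarrow> real)"
    and "(LINT x|lborel. gauss_ft d (x::'a)) = (2 * pi) ^ DIM('a)"
    and "(\<integral>\<^sup>+x. ennreal (gauss_ft d (x::'a)) \<partial>lborel) = ennreal ((2 * pi) ^ DIM('a))"
proof -
  show i: "integrable lborel (gauss_ft d :: 'a \<Rightarrow> real)"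
    unfolding gauss_ft_def using gauss_FT(1)[of "1/d"] assms by simp
  have "of_real (LINT x|lborel. gauss (1/d) (x::'a)) = (of_real (gauss_ft (1/d) (0::'a)) :: complex)"
    using gauss_FT(2)[of "1/d" "0::'a"] assms by simp
  then have "(LINT x|lborel. gauss (1/d) (x::'a)) = gauss_ft (1/d) (0::'a)"
    by (simp only: of_real_eq_iff)
  then have g: "(LINT x|lborel. gauss (1/d) (x::'a)) = (sqrt (2 * pi) * d) ^ DIM('a)"
    by (simp add: gauss_ft_def gauss_def)
  have "(LINT x|lborel. gauss_ft d (x::'a)) = (sqrt (2 * pi) / d) ^ DIM('a) * (sqrt (2 * pi) * d) ^ DIM('a)"
    unfolding gauss_ft_def g[symmetric] by (rule integral_mult_right_zero)
  also have "\<dots> = ((sqrt (2 * pi) / d) * (sqrt (2 * pi) * d)) ^ DIM('a)"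
    by (rule power_mult_distrib[symmetric])
  also have "(sqrt (2 * pi) / d) * (sqrt (2 * pi) * d) = 2 * pi"
    using assms by simp
  finally show v: "(LINT x|lborel. gauss_ft d (x::'a)) = (2 * pi) ^ DIM('a)" .
  show "(\<integral>\<^sup>+x. ennreal (gauss_ft d (x::'a)) \<partial>lborel) = ennreal ((2 * pi) ^ DIM('a))"
    using i v gauss_ft_nonneg[OF assms] by (subst nn_integral_eq_integral) auto
qed

section \<open>Oscillatory integrals\<close>

text \<open>One oscillatory integral serves three purposes: with \<Psi> the identity it is the
  Fourier transform, with \<Psi> the graph of a dispersion relation a free evolution, and with
  \<Psi> the sum of two graph points the product of two evolutions.\<close>

definition osc :: "('b::euclidean_space \<Rightarrow> 'a::euclidean_space) \<Rightarrow> ('b \<Rightarrow> complex) \<Rightarrow> 'a \<Rightarrow> complex" where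
  "osc \<Psi> A \<tau> = (LINT y|lborel. cis (\<tau> \<bullet> \<Psi> y) * A y)"

lemma osc_integrable:
  fixes \<Psi> :: "'b::euclidean_space \<Rightarrow> 'a::euclidean_space"
  assumes "\<Psi> \<in> borel_measurable borel" "integrable lborel A"
  shows "integrable lborel (\<lambda>y. cis (\<tau> \<bullet> \<Psi> y) * A y)"
proof -
  note [measurable] = assms(1) integrable_borel[OF assms(2)]
  show ?thesis by (rule Bochner_Integration.integrable_bound[OF assms(2)]) (auto simp: norm_mult)
qed

lemma osc_measurable:
  fixes \<Psi> :: "'b::euclidean_space \<Rightarrow> 'a::euclidean_space"
  assumes [measurable]: "\<Psi> \<in> borel_measurable borel" "A \<in> borel_measurable borel"
  shows "osc \<Psi> A \<in> borel_measurable borel"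
proof -
  show ?thesis unfolding osc_def[abs_def] by measurable
qed

lemma osc_bound:
  fixes \<Psi> :: "'b::euclidean_space \<Rightarrow> 'a::euclidean_space"
  assumes "\<Psi> \<in> borel_measurable borel" "integrable lborel A"
  shows "cmod (osc \<Psi> A \<tau>) \<le> (LINT y|lborel. cmod (A y))"
proof -
  have "cmod (osc \<Psi> A \<tau>) \<le> (LINT y|lborel. cmod (cis (\<tau> \<bullet> \<Psi> y) * A y))"
    unfolding osc_def by (rule integral_norm_bound)
  then show ?thesis by (simp add: norm_mult)
qed

text \<open>With the Gaussian weight the double integral converges absolutely, so Fubini applies and
  the integral over \<tau> produces the kernel \<open>gauss_ft d\<close> evaluated at the
  phase.\<close>

lemma gauss_osc:
  fixes D :: "'b::euclidean_space \<Rightarrow> 'a::euclidean_space"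
  assumes d: "0 < d" and D [measurable]: "D \<in> borel_measurable borel" and B: "integrable lborel B"
  shows "integrable lborel (\<lambda>\<tau>. of_real (gauss d \<tau>) * osc D B \<tau>)"
    "(LINT \<tau>|lborel. of_real (gauss d \<tau>) * osc D B \<tau>) = (LINT p|lborel. of_real (gauss_ft d (D p)) * B p)"
proof -
  note [measurable] = integrable_borel[OF B]
  have [measurable]: "osc D B \<in> borel_measurable borel" by (rule osc_measurable) auto
  have ig: "integrable lborel (\<lambda>\<tau>. of_real (gauss d (\<tau>::'a)) :: complex)"
    by (intro integrable_of_real gauss_FT(1)[OF d])
  have "integrable lborel (\<lambda>(\<tau>, p). of_real (gauss d (\<tau>::'a)) * B p)"
    by (rule lborel_integrable_product[OF ig B])
  then have i: "integrable lborel (\<lambda>(\<tau>::'a, p). cis (\<tau> \<bullet> D p) * (of_real (gauss d \<tau>) * B p))"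
    by (rule Bochner_Integration.integrable_bound) (auto simp: norm_mult case_prod_beta' borel_prod[symmetric])
  show "integrable lborel (\<lambda>\<tau>. of_real (gauss d \<tau>) * osc D B \<tau>)"
    by (rule Bochner_Integration.integrable_bound[OF integrable_mult_left[OF ig, of "of_real (LINT y|lborel. cmod (B y))"]])
       (use osc_bound[OF D B] in \<open>auto simp: norm_mult intro!: mult_left_mono\<close>)
  have "(LINT \<tau>|lborel. of_real (gauss d \<tau>) * osc D B \<tau>)
    = (LINT \<tau>|lborel. LINT p|lborel. cis (\<tau> \<bullet> D p) * (of_real (gauss d \<tau>) * B p))"
    unfolding osc_def by (subst integral_mult_right_zero[symmetric]) (simp add: mult_ac)
  also have "\<dots> = (LINT p|lborel. LINT \<tau>|lborel. cis (\<tau> \<bullet> D p) * (of_real (gauss d \<tau>) * B p))"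
    using lborel_Fubini[OF i] by simp
  also have "\<dots> = (LINT p|lborel. of_real (gauss_ft d (D p)) * B p)"
    unfolding gauss_FT(2)[OF d, symmetric] by (subst integral_mult_left_zero[symmetric]) (simp add: mult_ac)
  finally show "(LINT \<tau>|lborel. of_real (gauss d \<tau>) * osc D B \<tau>) = (LINT p|lborel. of_real (gauss_ft d (D p)) * B p)" .
qed

lemma osc_mult_cnj:
  fixes \<Psi> :: "'b::euclidean_space \<Rightarrow> 'a::euclidean_space"
  assumes [measurable]: "\<Psi> \<in> borel_measurable borel" "\<Psi>' \<in> borel_measurable borel"
    and A: "integrable lborel A" and A': "integrable lborel A'"
  shows "osc \<Psi> A \<tau> * cnj (osc \<Psi>' A' \<tau>) = osc (\<lambda>p. \<Psi> (fst p) - \<Psi>' (snd p)) (\<lambda>p. A (fst p) * cnj (A' (snd p))) \<tau>"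
    "integrable lborel (\<lambda>p. A (fst p) * cnj (A' (snd p)))"
proof -
  have cA': "integrable lborel (\<lambda>y. cnj (A' y))" using A' by simp
  show "integrable lborel (\<lambda>p. A (fst p) * cnj (A' (snd p)))"
    using lborel_integrable_product[OF A cA'] by (simp add: case_prod_beta')
  have i1: "integrable lborel (\<lambda>y. cis (\<tau> \<bullet> \<Psi> y) * A y)" and i2: "integrable lborel (\<lambda>y. cnj (cis (\<tau> \<bullet> \<Psi>' y) * A' y))"
    using osc_integrable[OF _ A, of \<Psi> \<tau>] osc_integrable[OF _ A', of \<Psi>' \<tau>] by (auto simp del: complex_cnj_mult)
  have "osc \<Psi> A \<tau> * cnj (osc \<Psi>' A' \<tau>) = (LINT y|lborel. LINT y'|lborel. (cis (\<tau> \<bullet> \<Psi> y) * A y) * cnj (cis (\<tau> \<bullet> \<Psi>' y') * A' y'))"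
  proof -
    have "cnj (osc \<Psi>' A' \<tau>) = (LINT y'|lborel. cnj (cis (\<tau> \<bullet> \<Psi>' y') * A' y'))"
      unfolding osc_def by (rule Bochner_Integration.integral_cnj[symmetric])
    then show ?thesis
      unfolding osc_def by (simp only: integral_mult_left_zero[symmetric] integral_mult_right_zero)
  qed
  also have "\<dots> = (LINT p|lborel. (cis (\<tau> \<bullet> \<Psi> (fst p)) * A (fst p)) * cnj (cis (\<tau> \<bullet> \<Psi>' (snd p)) * A' (snd p)))"
    by (rule lborel_Fubini(1)[OF lborel_integrable_product[OF i1 i2]])
  also have "\<dots> = osc (\<lambda>p. \<Psi> (fst p) - \<Psi>' (snd p)) (\<lambda>p. A (fst p) * cnj (A' (snd p))) \<tau>"
  proof -
    have "cis (\<tau> \<bullet> (a - b)) = cis (\<tau> \<bullet> a) * cnj (cis (\<tau> \<bullet> b))" for a b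
      by (simp add: inner_diff_right cis_cnj cis_mult)
    then show ?thesis unfolding osc_def by (simp add: mult_ac)
  qed
  finally show "osc \<Psi> A \<tau> * cnj (osc \<Psi>' A' \<tau>) = osc (\<lambda>p. \<Psi> (fst p) - \<Psi>' (snd p)) (\<lambda>p. A (fst p) * cnj (A' (snd p))) \<tau>" .
qed

lemma gauss_tendsto_1: "(\<lambda>n. gauss (1 / Suc n) x) \<longlonglongrightarrow> 1"
proof -
  have "(\<lambda>n. exp (- ((1 / Suc n) * norm x)\<^sup>2 / 2)) \<longlonglongrightarrow> exp (- (0 * norm x)\<^sup>2 / 2)"
    using LIMSEQ_inverse_real_of_nat by (intro tendsto_intros) (auto simp: divide_inverse)
  then show ?thesis by (simp add: gauss_def)
qed

text \<open>The TT* method. Expanding the square under the weight \<open>gauss d\<close> produces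
  the kernel \<open>gauss_ft d\<close> at \<Psi> x - \<Psi> y, which is nonnegative and symmetric.
  Schur's test bounds the quadratic form by the row sums, and C is independent of d, so the weight
  can be removed at the end.\<close>

proposition osc_Schur:
  fixes \<Psi> :: "'b::euclidean_space \<Rightarrow> 'a::euclidean_space"
  assumes [measurable]: "\<Psi> \<in> borel_measurable borel" and A: "integrable lborel A"
    and K: "\<And>d w. 0 < d \<Longrightarrow> (\<integral>\<^sup>+y. indicator {y. A y \<noteq> 0} y * ennreal (gauss_ft d (\<Psi> y - w)) \<partial>lborel) \<le> C"
  shows "N2 (osc \<Psi> A) \<le> C * N2 A"
proof -
  note [measurable] = integrable_borel[OF A]
  have mO [measurable]: "osc \<Psi> A \<in> borel_measurable borel" by (rule osc_measurable) auto
  define D where "D p = \<Psi> (fst p) - \<Psi> (snd p)" for p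
  define B where "B p = A (fst p) * cnj (A (snd p))" for p
  have D [measurable]: "D \<in> borel_measurable borel" unfolding D_def borel_prod[symmetric] by measurable
  have B: "integrable lborel B" unfolding B_def by (rule osc_mult_cnj(2)[OF assms(1) assms(1) A A])
  note [measurable] = integrable_borel[OF B]
  define S where "S = {y. A y \<noteq> 0}"
  have S [measurable]: "S \<in> sets borel" unfolding S_def by measurable
  note K = K[folded S_def]
  have main: "(\<integral>\<^sup>+\<tau>. ennreal (gauss d \<tau> * (cmod (osc \<Psi> A \<tau>))\<^sup>2) \<partial>lborel) \<le> C * N2 A" if d: "0 < d" for d
  proof -
    have eq: "of_real (gauss d \<tau> * (cmod (osc \<Psi> A \<tau>))\<^sup>2) = of_real (gauss d \<tau>) * osc D B \<tau>" for \<tau>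
      unfolding D_def B_def osc_mult_cnj(1)[OF assms(1,1) A A, symmetric] by (simp only: of_real_mult complex_norm_square)
    have i: "integrable lborel (\<lambda>\<tau>. gauss d \<tau> * (cmod (osc \<Psi> A \<tau>))\<^sup>2)"
      using integrable_Re[OF gauss_osc(1)[OF d D B]] unfolding eq[symmetric] by simp
    have ib: "integrable lborel (\<lambda>p. of_real (gauss_ft d (D p)) * B p)"
    proof (rule Bochner_Integration.integrable_bound[OF integrable_mult_right[OF B, of "of_real ((sqrt (2 * pi) / d) ^ DIM('a))"]])
      have "cmod (of_real (gauss_ft d (D p)) * B p) \<le> cmod (of_real ((sqrt (2 * pi) / d) ^ DIM('a)) * B p)" for p
        unfolding norm_mult norm_of_real using gauss_ft_bound[OF d, of "D p"] gauss_ft_nonneg[OF d, of "D p"]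
        by (intro mult_right_mono) auto
      then show "AE p in lborel. cmod (of_real (gauss_ft d (D p)) * B p) \<le> cmod (of_real ((sqrt (2 * pi) / d) ^ DIM('a)) * B p)"
        by simp
    qed simp
    have "(\<integral>\<^sup>+\<tau>. ennreal (gauss d \<tau> * (cmod (osc \<Psi> A \<tau>))\<^sup>2) \<partial>lborel)
       = ennreal (LINT \<tau>|lborel. gauss d \<tau> * (cmod (osc \<Psi> A \<tau>))\<^sup>2)"
      by (rule nn_integral_eq_integral[OF i]) (simp add: gauss_def)
    also have "(LINT \<tau>|lborel. gauss d \<tau> * (cmod (osc \<Psi> A \<tau>))\<^sup>2) \<le> cmod (LINT \<tau>|lborel. of_real (gauss d \<tau>) * osc D B \<tau>)"
      unfolding eq[symmetric] integral_complex_of_real by simp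
    also have "(LINT \<tau>|lborel. of_real (gauss d \<tau>) * osc D B \<tau>) = (LINT p|lborel. of_real (gauss_ft d (D p)) * B p)"
      by (rule gauss_osc(2)[OF d D B])
    also have "ennreal (cmod \<dots>) \<le> (\<integral>\<^sup>+p. ennreal (cmod (of_real (gauss_ft d (D p)) * B p)) \<partial>lborel)"
      by (rule integral_norm_bound_ennreal[OF ib])
    also have "\<dots> \<le> (\<integral>\<^sup>+p. ennreal (gauss_ft d (D p)) * (indicator S (snd p) * (ennreal ((cmod (A (fst p)))\<^sup>2) / 2)
          + indicator S (fst p) * (ennreal ((cmod (A (snd p)))\<^sup>2) / 2)) \<partial>lborel)"
    proof (rule nn_integral_mono)
      fix p :: "'b \<times> 'b"
      \<comment> \<open>This is 2 a b \<le> a^2 + b^2. The indicators may be inserted because the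
        left side vanishes off the support of A; they restrict the row sums to that support, as in
        \<open>K\<close>.\<close>
      have "cmod (A (fst p)) * cmod (A (snd p)) \<le> indicator S (snd p) * ((cmod (A (fst p)))\<^sup>2 / 2)
          + indicator S (fst p) * ((cmod (A (snd p)))\<^sup>2 / 2)"
        using sum_squares_bound[of "cmod (A (fst p))" "cmod (A (snd p))"]
        by (cases "A (fst p) = 0"; cases "A (snd p) = 0") (auto simp: S_def)
      then have "ennreal (cmod (of_real (gauss_ft d (D p)) * B p)) \<le>
         ennreal (gauss_ft d (D p) * (indicator S (snd p) * ((cmod (A (fst p)))\<^sup>2 / 2)
          + indicator S (fst p) * ((cmod (A (snd p)))\<^sup>2 / 2)))"
        using gauss_ft_nonneg[OF d, of "D p"] by (intro ennreal_leI) (auto simp: norm_mult B_def intro!: mult_left_mono)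
      also have "\<dots> = ennreal (gauss_ft d (D p)) * (indicator S (snd p) * (ennreal ((cmod (A (fst p)))\<^sup>2) / 2)
          + indicator S (fst p) * (ennreal ((cmod (A (snd p)))\<^sup>2) / 2))"
        using gauss_ft_nonneg[OF d, of "D p"]
        by (auto simp: ennreal_mult ennreal_plus divide_ennreal[symmetric] indicator_def)
      finally show "ennreal (cmod (of_real (gauss_ft d (D p)) * B p)) \<le> ennreal (gauss_ft d (D p)) * (indicator S (snd p) * (ennreal ((cmod (A (fst p)))\<^sup>2) / 2)
          + indicator S (fst p) * (ennreal ((cmod (A (snd p)))\<^sup>2) / 2))" .
    qed
    also have "\<dots> = (\<integral>\<^sup>+p. ennreal (gauss_ft d (D p)) * (indicator S (snd p) * (ennreal ((cmod (A (fst p)))\<^sup>2) / 2)) \<partial>lborel)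
       + (\<integral>\<^sup>+p. ennreal (gauss_ft d (D p)) * (indicator S (fst p) * (ennreal ((cmod (A (snd p)))\<^sup>2) / 2)) \<partial>lborel)" (is "_ = ?I1 + ?I2")
      unfolding distrib_left by (rule nn_integral_add) auto
    also have "?I1 \<le> C * N2 A / 2"
    proof -
      have "?I1 = (\<integral>\<^sup>+x. \<integral>\<^sup>+y. ennreal (gauss_ft d (\<Psi> x - \<Psi> y)) * (indicator S y * (ennreal ((cmod (A x))\<^sup>2) / 2)) \<partial>lborel \<partial>lborel)"
        unfolding D_def by (rule lborel_Fubini_nn(1)) (simp add: case_prod_beta')
      also have "\<dots> = (\<integral>\<^sup>+x. (\<integral>\<^sup>+y. indicator S y * ennreal (gauss_ft d (\<Psi> y - \<Psi> x)) \<partial>lborel) * (ennreal ((cmod (A x))\<^sup>2) / 2) \<partial>lborel)"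
      proof (rule nn_integral_cong)
        fix x
        have "ennreal (gauss_ft d (\<Psi> x - \<Psi> y)) * (indicator S y * c) = (indicator S y * ennreal (gauss_ft d (\<Psi> y - \<Psi> x))) * c" for y c
          by (metis (no_types, lifting) gauss_ft_minus minus_diff_eq mult.assoc mult.left_commute)
        then show "(\<integral>\<^sup>+y. ennreal (gauss_ft d (\<Psi> x - \<Psi> y)) * (indicator S y * (ennreal ((cmod (A x))\<^sup>2) / 2)) \<partial>lborel)
           = (\<integral>\<^sup>+y. indicator S y * ennreal (gauss_ft d (\<Psi> y - \<Psi> x)) \<partial>lborel) * (ennreal ((cmod (A x))\<^sup>2) / 2)"
          by (subst nn_integral_multc[symmetric]) simp_all
      qed
      also have "\<dots> \<le> (\<integral>\<^sup>+x. C * (ennreal ((cmod (A x))\<^sup>2) / 2) \<partial>lborel)"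
        by (intro nn_integral_mono mult_right_mono K d) simp
      also have "\<dots> = C * N2 A / 2"
        by (simp add: nn_integral_cmult N2_def ennreal_times_divide nn_integral_divide)
      finally show ?thesis .
    qed
    also have "?I2 \<le> C * N2 A / 2"
    proof -
      have "?I2 = (\<integral>\<^sup>+y. \<integral>\<^sup>+x. ennreal (gauss_ft d (\<Psi> x - \<Psi> y)) * (indicator S x * (ennreal ((cmod (A y))\<^sup>2) / 2)) \<partial>lborel \<partial>lborel)"
        unfolding D_def by (rule lborel_Fubini_nn(2)) (simp add: case_prod_beta')
      also have "\<dots> = (\<integral>\<^sup>+y. (\<integral>\<^sup>+x. indicator S x * ennreal (gauss_ft d (\<Psi> x - \<Psi> y)) \<partial>lborel) * (ennreal ((cmod (A y))\<^sup>2) / 2) \<partial>lborel)"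
        by (subst nn_integral_multc[symmetric]) (auto intro!: nn_integral_cong simp: mult_ac)
      also have "\<dots> \<le> (\<integral>\<^sup>+x. C * (ennreal ((cmod (A x))\<^sup>2) / 2) \<partial>lborel)"
        by (intro nn_integral_mono mult_right_mono K d) simp
      also have "\<dots> = C * N2 A / 2"
        by (simp add: nn_integral_cmult N2_def ennreal_times_divide nn_integral_divide)
      finally show ?thesis .
    qed
    also have "C * N2 A / 2 + C * N2 A / 2 = C * N2 A"
      by (simp only: mult_2_right[symmetric] ennreal_divide_times) (simp add: ennreal_divide_self)
    finally show ?thesis by (simp add: ennreal_leI add_mono)
  qed
  \<comment> \<open>Fatou's lemma along d = 1/(n+1) removes the weight; at this point |osc|^2 is not
    yet known to be integrable.\<close>
  have lim: "(\<lambda>n. ennreal (gauss (1 / Suc n) \<tau> * (cmod (osc \<Psi> A \<tau>))\<^sup>2)) \<longlonglongrightarrow> ennreal ((cmod (osc \<Psi> A \<tau>))\<^sup>2)" for \<tau>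
    using tendsto_ennrealI[OF tendsto_mult_right[OF gauss_tendsto_1[of \<tau>], of "(cmod (osc \<Psi> A \<tau>))\<^sup>2"]] by simp
  have "N2 (osc \<Psi> A) = (\<integral>\<^sup>+\<tau>. liminf (\<lambda>n. ennreal (gauss (1 / Suc n) \<tau> * (cmod (osc \<Psi> A \<tau>))\<^sup>2)) \<partial>lborel)"
    unfolding N2_def by (intro nn_integral_cong lim_imp_Liminf[OF _ lim, symmetric]) simp
  also have "\<dots> \<le> liminf (\<lambda>n. \<integral>\<^sup>+\<tau>. ennreal (gauss (1 / Suc n) \<tau> * (cmod (osc \<Psi> A \<tau>))\<^sup>2) \<partial>lborel)"
    by (rule nn_integral_liminf) simp
  also have "\<dots> \<le> liminf (\<lambda>n. C * N2 A)"
    by (intro Liminf_mono always_eventually allI main) simp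
  finally show ?thesis by (simp add: Liminf_const)
qed

lemma gauss_abs_le_1: "\<bar>gauss d x\<bar> \<le> 1" and gauss_nonneg: "0 \<le> gauss d x"
  by (auto simp: gauss_def)

lemma measurable_cnj [measurable]: "cnj \<in> borel_measurable borel"
  by (intro borel_measurable_continuous_onI continuous_intros)

section \<open>Plancherel's theorem\<close>

lemma lborel_nn_affine:
  fixes f :: "'a::euclidean_space \<Rightarrow> ennreal"
  assumes [measurable]: "f \<in> borel_measurable borel" and c: "c \<noteq> 0"
  shows "(\<integral>\<^sup>+x. f x \<partial>lborel) = ennreal (\<bar>c\<bar> ^ DIM('a)) * (\<integral>\<^sup>+x. f (t + c *\<^sub>R x) \<partial>lborel)"
  by (subst lborel_affine[OF c, of t], subst nn_integral_density, simp, simp, subst nn_integral_distr)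
     (simp_all add: nn_integral_cmult)

lemma lborel_integral_affine:
  fixes f :: "'a::euclidean_space \<Rightarrow> complex"
  assumes [measurable]: "f \<in> borel_measurable borel" and c: "c \<noteq> 0"
  shows "(LINT x|lborel. f x) = of_real (\<bar>c\<bar> ^ DIM('a)) * (LINT x|lborel. f (t + c *\<^sub>R x))"
  by (subst lborel_affine[OF c, of t], subst integral_density, simp, simp, simp, subst integral_distr)
     (simp_all add: scaleR_conv_of_real)

lemma lborel_integrable_affine:
  fixes f :: "'a::euclidean_space \<Rightarrow> complex"
  assumes f: "integrable lborel f" and c: "c \<noteq> 0"
  shows "integrable lborel (\<lambda>x. f (t + c *\<^sub>R x))"
proof -
  note [measurable] = integrable_borel[OF f]
  have "ennreal (\<bar>c\<bar> ^ DIM('a)) * (\<integral>\<^sup>+x. ennreal (cmod (f (t + c *\<^sub>R x))) \<partial>lborel) < \<infinity>"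
    using f lborel_nn_affine[of "\<lambda>x. ennreal (cmod (f x))" c t] c by (simp add: integrable_iff_bounded)
  moreover have "0 < \<bar>c\<bar> ^ DIM('a)" using c by simp
  ultimately show ?thesis
    by (auto simp: integrable_iff_bounded ennreal_mult_less_top)
qed

lemma N2_reflect: "f \<in> borel_measurable borel \<Longrightarrow> N2 (\<lambda>x. f (- x)) = N2 f"
  unfolding N2_def using lborel_nn_affine[of "\<lambda>x. ennreal ((cmod (f x))\<^sup>2)" "-1" 0] by simp

lemma in_L2_reflect:
  assumes "in_L2 f" shows "in_L2 (\<lambda>x. f (- x))" "norm_L2 (\<lambda>x. f (- x)) = norm_L2 f"
proof -
  have [measurable]: "f \<in> borel_measurable borel" using assms by (rule in_L2_measurable)
  show 1: "in_L2 (\<lambda>x. f (- x))" using assms N2_reflect[of f] by (auto simp: in_L2_iff)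
  have "(norm_L2 (\<lambda>x. f (- x)))\<^sup>2 = (norm_L2 f)\<^sup>2"
    using N2_norm_L2[OF 1] N2_norm_L2[OF assms] N2_reflect[of f] by simp
  then show "norm_L2 (\<lambda>x. f (- x)) = norm_L2 f" by (simp add: power2_eq_iff_nonneg)
qed

lemma AE_reflect:
  fixes P :: "'a::euclidean_space \<Rightarrow> bool"
  assumes "AE x in lborel. f x = (0::complex)" and [measurable]: "f \<in> borel_measurable borel"
  shows "AE x in lborel. f (- x) = 0"
  using N2_eq_0[of "\<lambda>x. f (- x)"] N2_reflect[of f] N2_eq_0[of f] assms by simp

definition L12 :: "('a::euclidean_space \<Rightarrow> complex) \<Rightarrow> bool" where
  "L12 f \<longleftrightarrow> integrable lborel f \<and> in_L2 f"

text \<open>Positive exponent and no normalisation: \<open>fourier_inv\<close> is a multiple of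
  \<open>ft\<close>, and \<open>fourier\<close> is \<open>ft\<close> composed with the
  reflection.\<close>

abbreviation ft :: "('a::euclidean_space \<Rightarrow> complex) \<Rightarrow> 'a \<Rightarrow> complex" where
  "ft \<equiv> osc (\<lambda>x. x)"

lemma ft_measurable [measurable]: "f \<in> borel_measurable borel \<Longrightarrow> ft f \<in> borel_measurable borel"
  by (rule osc_measurable) auto

lemma ft_add: "integrable lborel f \<Longrightarrow> integrable lborel g \<Longrightarrow> ft (\<lambda>x. f x + g x) \<tau> = ft f \<tau> + ft g \<tau>"
  using osc_integrable[of "\<lambda>x. x" f \<tau>] osc_integrable[of "\<lambda>x. x" g \<tau>]
  by (simp add: osc_def distrib_left)

lemma ft_diff: "integrable lborel f \<Longrightarrow> integrable lborel g \<Longrightarrow> ft (\<lambda>x. f x - g x) \<tau> = ft f \<tau> - ft g \<tau>"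
  using osc_integrable[of "\<lambda>x. x" f \<tau>] osc_integrable[of "\<lambda>x. x" g \<tau>]
  by (simp add: osc_def right_diff_distrib)

lemma ft_cmult: "ft (\<lambda>x. c * f x) \<tau> = c * ft f \<tau>"
  unfolding osc_def by (subst integral_mult_right_zero[symmetric]) (simp add: mult.left_commute)

lemma ft_cnj: "cnj (ft f \<tau>) = ft (\<lambda>x. cnj (f x)) (- \<tau>)"
  unfolding osc_def by (subst Bochner_Integration.integral_cnj[symmetric]) (simp add: cis_cnj)

lemma ft_reflect: assumes [measurable]: "f \<in> borel_measurable borel" shows "ft (\<lambda>x. f (- x)) \<tau> = ft f (- \<tau>)"
proof -
  have "ft f (- \<tau>) = (LINT x|lborel. cis ((- \<tau>) \<bullet> (0 + (-1) *\<^sub>R x)) * f (0 + (-1) *\<^sub>R x))"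
    unfolding osc_def by (subst lborel_integral_affine[of _ "-1" 0]) simp_all
  then show ?thesis by (simp add: osc_def)
qed

lemma ft_cong_AE:
  assumes "AE x in lborel. f x = g x" "f \<in> borel_measurable borel" "g \<in> borel_measurable borel"
  shows "ft f \<tau> = ft g \<tau>"
proof -
  note [measurable] = assms(2,3)
  show ?thesis unfolding osc_def by (rule integral_cong_AE) (use assms(1) in auto)
qed

text \<open>For \<Psi> the identity every row sum is at most the mass (2\<pi>)^n of
  \<open>gauss_ft d\<close>. Schur's test thus already yields the sharp constant of Plancherel's
  theorem; only the opposite inequality remains.\<close>

lemma N2_ft_le:
  fixes f :: "'a::euclidean_space \<Rightarrow> complex"
  assumes "integrable lborel f"
  shows "N2 (ft f) \<le> ennreal ((2 * pi) ^ DIM('a)) * N2 f"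
proof (rule osc_Schur)
  fix d :: real and w :: 'a assume d: "0 < d"
  have [measurable]: "f \<in> borel_measurable borel" using assms by (rule integrable_borel)
  have "(\<integral>\<^sup>+y. indicator {y. f y \<noteq> 0} y * ennreal (gauss_ft d (y - w)) \<partial>lborel)
      \<le> (\<integral>\<^sup>+y. ennreal (gauss_ft d (- w + 1 *\<^sub>R y)) \<partial>lborel)"
    by (intro nn_integral_mono) (auto simp: indicator_def)
  also have "\<dots> = (\<integral>\<^sup>+y. ennreal (gauss_ft d (y::'a)) \<partial>lborel)"
    by (subst lborel_nn_affine[of _ 1 "- w"]) auto
  also have "\<dots> = ennreal ((2 * pi) ^ DIM('a))" by (rule gauss_ft_integral(3)[OF d])
  finally show "(\<integral>\<^sup>+y. indicator {y. f y \<noteq> 0} y * ennreal (gauss_ft d (y - w)) \<partial>lborel) \<le> ennreal ((2 * pi) ^ DIM('a))" .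
qed (use assms in auto)

lemma ft_L2:
  fixes f :: "'a::euclidean_space \<Rightarrow> complex"
  assumes "L12 f"
  shows "in_L2 (ft f)" "norm_L2 (ft f) \<le> sqrt ((2 * pi) ^ DIM('a)) * norm_L2 f"
proof -
  have f: "integrable lborel f" "in_L2 f" using assms by (auto simp: L12_def)
  have "N2 (ft f) \<le> ennreal ((2 * pi) ^ DIM('a)) * N2 f"
    by (rule N2_ft_le[OF f(1)])
  also have "\<dots> = ennreal ((sqrt ((2 * pi) ^ DIM('a)) * norm_L2 f)\<^sup>2)"
    by (simp add: N2_norm_L2[OF f(2)] power_mult_distrib ennreal_mult)
  finally show "in_L2 (ft f)" "norm_L2 (ft f) \<le> sqrt ((2 * pi) ^ DIM('a)) * norm_L2 f"
    using in_L2_boundI[of "ft f" "sqrt ((2 * pi) ^ DIM('a)) * norm_L2 f"] f integrable_borel[OF f(1)] by auto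
qed

lemma L12_diff: "L12 f \<Longrightarrow> L12 g \<Longrightarrow> L12 (\<lambda>x. f x - g x)"
  by (auto simp: L12_def in_L2_diff)

text \<open>The second function ranges over all of \<open>L12\<close>, so that the class of
  admissible f is closed under L2 limits within \<open>L12\<close> and can be enlarged step by
  step.\<close>

definition parseval :: "('a::euclidean_space \<Rightarrow> complex) \<Rightarrow> bool" where
  "parseval f \<longleftrightarrow> (\<forall>h. L12 h \<longrightarrow> (LINT \<tau>|lborel. ft f \<tau> * cnj (ft h \<tau>)) = of_real ((2 * pi) ^ DIM('a)) * (LINT x|lborel. f x * cnj (h x)))"

text \<open>Both sides are continuous in f for the L2 norm: the right side by the Cauchy-Schwarz
  inequality, the left side by the same inequality together with the bound
  \<open>ft_L2\<close>.\<close>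

lemma parseval_closed:
  fixes f :: "'a::euclidean_space \<Rightarrow> complex"
  assumes F: "\<And>n. parseval (F n)" "\<And>n. L12 (F n)" and f: "L12 f"
    and lim: "(\<lambda>n. norm_L2 (\<lambda>x. F n x - f x)) \<longlonglongrightarrow> 0"
  shows "parseval f"
  unfolding parseval_def
proof (intro allI impI)
  fix h :: "'a \<Rightarrow> complex" assume h: "L12 h"
  define c where "c = (2 * pi) ^ DIM('a)"
  have hL: "in_L2 (\<lambda>x. cnj (h x))" "in_L2 (\<lambda>x. cnj (ft h x))" using h ft_L2[OF h] by (auto simp: L12_def intro: in_L2_cnj)
  have d: "L12 (\<lambda>x. F n x - f x)" for n by (rule L12_diff[OF F(2) f])
  have lim1: "(\<lambda>n. norm_L2 (\<lambda>x. F n x - f x) * b) \<longlonglongrightarrow> 0" for b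
    using tendsto_mult_left_zero[OF lim] by blast
  have "(\<lambda>n. (LINT \<tau>|lborel. ft (F n) \<tau> * cnj (ft h \<tau>)) - (LINT \<tau>|lborel. ft f \<tau> * cnj (ft h \<tau>))) \<longlonglongrightarrow> 0"
  proof (rule Lim_null_comparison[OF always_eventually lim1], rule allI)
    fix n
    have "(LINT \<tau>|lborel. ft (F n) \<tau> * cnj (ft h \<tau>)) - (LINT \<tau>|lborel. ft f \<tau> * cnj (ft h \<tau>))
      = (LINT \<tau>|lborel. ft (F n) \<tau> * cnj (ft h \<tau>) - ft f \<tau> * cnj (ft h \<tau>))"
      by (intro Bochner_Integration.integral_diff[symmetric] L2_Cauchy_Schwarz hL ft_L2 F f)
    also have "\<dots> = (LINT \<tau>|lborel. ft (\<lambda>x. F n x - f x) \<tau> * cnj (ft h \<tau>))"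
      using F(2)[of n] f by (subst ft_diff) (auto simp: L12_def left_diff_distrib)
    also have "cmod \<dots> \<le> norm_L2 (ft (\<lambda>x. F n x - f x)) * norm_L2 (\<lambda>x. cnj (ft h x))"
      by (intro L2_Cauchy_Schwarz ft_L2 d hL)
    also have "\<dots> \<le> (sqrt c * norm_L2 (\<lambda>x. F n x - f x)) * norm_L2 (\<lambda>x. cnj (ft h x))"
      unfolding c_def by (intro mult_right_mono ft_L2 d) simp
    finally show "cmod ((LINT \<tau>|lborel. ft (F n) \<tau> * cnj (ft h \<tau>)) - (LINT \<tau>|lborel. ft f \<tau> * cnj (ft h \<tau>)))
       \<le> norm_L2 (\<lambda>x. F n x - f x) * (sqrt c * norm_L2 (\<lambda>x. cnj (ft h x)))" by (simp only: mult_ac)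
  qed
  then have l1: "(\<lambda>n. (LINT \<tau>|lborel. ft (F n) \<tau> * cnj (ft h \<tau>))) \<longlonglongrightarrow> (LINT \<tau>|lborel. ft f \<tau> * cnj (ft h \<tau>))"
    by (simp add: LIM_zero_iff)
  have "(\<lambda>n. (LINT x|lborel. F n x * cnj (h x)) - (LINT x|lborel. f x * cnj (h x))) \<longlonglongrightarrow> 0"
  proof (rule Lim_null_comparison[OF always_eventually lim1], rule allI)
    fix n
    have "(LINT x|lborel. F n x * cnj (h x)) - (LINT x|lborel. f x * cnj (h x)) = (LINT x|lborel. F n x * cnj (h x) - f x * cnj (h x))"
      using F(2)[of n] f by (intro Bochner_Integration.integral_diff[symmetric] L2_Cauchy_Schwarz hL) (auto simp: L12_def)
    also have "\<dots> = (LINT x|lborel. (F n x - f x) * cnj (h x))" by (simp add: left_diff_distrib)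
    also have "cmod \<dots> \<le> norm_L2 (\<lambda>x. F n x - f x) * norm_L2 (\<lambda>x. cnj (h x))"
      using d[of n] by (intro L2_Cauchy_Schwarz hL) (auto simp: L12_def)
    finally show "cmod ((LINT x|lborel. F n x * cnj (h x)) - (LINT x|lborel. f x * cnj (h x))) \<le> norm_L2 (\<lambda>x. F n x - f x) * norm_L2 (\<lambda>x. cnj (h x))" .
  qed
  then have "(\<lambda>n. (LINT x|lborel. F n x * cnj (h x))) \<longlonglongrightarrow> (LINT x|lborel. f x * cnj (h x))"
    by (simp add: LIM_zero_iff)
  then have l2: "(\<lambda>n. of_real c * (LINT x|lborel. F n x * cnj (h x))) \<longlonglongrightarrow> of_real c * (LINT x|lborel. f x * cnj (h x))"
    by (rule tendsto_mult_left)
  have "(LINT \<tau>|lborel. ft (F n) \<tau> * cnj (ft h \<tau>)) = of_real c * (LINT x|lborel. F n x * cnj (h x))" for n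
    using F(1)[of n] h by (simp add: parseval_def c_def)
  then show "(LINT \<tau>|lborel. ft f \<tau> * cnj (ft h \<tau>)) = of_real ((2 * pi) ^ DIM('a)) * (LINT x|lborel. f x * cnj (h x))"
    using l1 l2 unfolding c_def[symmetric] by (simp add: LIMSEQ_unique)
qed

lemma gauss_ft_scale: "0 < d \<Longrightarrow> d ^ DIM('a) * gauss_ft d (d *\<^sub>R z) = gauss_ft 1 (z::'a::euclidean_space)"
  by (simp add: gauss_ft_def gauss_def power_divide)

text \<open>The weight \<open>gauss (d n)\<close> turns the left side into the pairing of the
  conjugate of h with f averaged by \<open>gauss_ft (d n)\<close>, an approximate identity of mass
  (2\<pi>)^n. Continuity of f gives the pointwise limit, boundedness the domination.\<close>

lemma parseval_continuous:
  fixes f :: "'a::euclidean_space \<Rightarrow> complex"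
  assumes cont: "continuous_on UNIV f" and bd: "\<And>x. cmod (f x) \<le> M" and f: "L12 f"
  shows "parseval f"
  unfolding parseval_def
proof (intro allI impI)
  fix h :: "'a \<Rightarrow> complex" assume h: "L12 h"
  have i: "integrable lborel f" "integrable lborel h" using f h by (auto simp: L12_def)
  note [measurable] = integrable_borel[OF i(1)] integrable_borel[OF i(2)]
  have L: "in_L2 (\<lambda>x. cnj (ft h x))" by (intro in_L2_cnj ft_L2 h)
  define d where "d n = 1 / real (Suc n)" for n
  have d: "0 < d n" for n by (simp add: d_def)
  define D where "D p = fst p - snd p" for p :: "'a \<times> 'a"
  have D [measurable]: "D \<in> borel_measurable borel" unfolding D_def[abs_def] by measurable
  define B where "B p = f (fst p) * cnj (h (snd p))" for p
  have osc: "ft f \<tau> * cnj (ft h \<tau>) = osc D B \<tau>" "integrable lborel B" for \<tau>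
    using osc_mult_cnj(1)[of "\<lambda>x::'a. x" "\<lambda>x. x" f h \<tau>] osc_mult_cnj(2)[of "\<lambda>x::'a. x" "\<lambda>x. x" f h] i unfolding D_def[abs_def] B_def[abs_def] by auto
  have lim1: "(\<lambda>n. LINT \<tau>|lborel. of_real (gauss (d n) \<tau>) * (ft f \<tau> * cnj (ft h \<tau>))) \<longlonglongrightarrow> (LINT \<tau>|lborel. ft f \<tau> * cnj (ft h \<tau>))"
  proof (rule integral_dominated_convergence[where w="\<lambda>\<tau>. cmod (ft f \<tau> * cnj (ft h \<tau>))"])
    show "integrable lborel (\<lambda>\<tau>. cmod (ft f \<tau> * cnj (ft h \<tau>)))"
      by (intro integrable_norm L2_Cauchy_Schwarz ft_L2 f L)
    show "AE x in lborel. (\<lambda>n. of_real (gauss (d n) x) * (ft f x * cnj (ft h x))) \<longlonglongrightarrow> ft f x * cnj (ft h x)"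
    proof (rule AE_I2)
      fix x :: 'a
      have "(\<lambda>n. complex_of_real (gauss (d n) x)) \<longlonglongrightarrow> of_real 1"
        unfolding d_def by (intro tendsto_of_real gauss_tendsto_1)
      from tendsto_mult_right[OF this, of "ft f x * cnj (ft h x)"]
      show "(\<lambda>n. of_real (gauss (d n) x) * (ft f x * cnj (ft h x))) \<longlonglongrightarrow> ft f x * cnj (ft h x)" by simp
    qed
    show "AE x in lborel. cmod (of_real (gauss (d n) x) * (ft f x * cnj (ft h x))) \<le> cmod (ft f x * cnj (ft h x))" for n
      by (intro AE_I2) (auto simp: norm_mult gauss_abs_le_1 intro!: mult_left_le_one_le)
  qed auto
  have eq: "(LINT \<tau>|lborel. of_real (gauss (d n) \<tau>) * (ft f \<tau> * cnj (ft h \<tau>)))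
     = (LINT y|lborel. (LINT z|lborel. of_real (gauss_ft 1 z) * f (y + d n *\<^sub>R z)) * cnj (h y))" for n
  proof -
    have ib: "integrable lborel (\<lambda>p. of_real (gauss_ft (d n) (D p)) * B p)"
    proof (rule Bochner_Integration.integrable_bound[OF integrable_mult_right[OF osc(2), of "of_real ((sqrt (2 * pi) / d n) ^ DIM('a))"]])
      have "cmod (of_real (gauss_ft (d n) (D p)) * B p) \<le> cmod (of_real ((sqrt (2 * pi) / d n) ^ DIM('a)) * B p)" for p
        unfolding norm_mult norm_of_real using gauss_ft_bound[OF d, of n "D p"] gauss_ft_nonneg[OF d, of n "D p"]
        by (intro mult_right_mono) auto
      then show "AE p in lborel. cmod (of_real (gauss_ft (d n) (D p)) * B p) \<le> cmod (of_real ((sqrt (2 * pi) / d n) ^ DIM('a)) * B p)"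
        by simp
    qed (simp add: B_def)
    have "(LINT \<tau>|lborel. of_real (gauss (d n) \<tau>) * (ft f \<tau> * cnj (ft h \<tau>))) = (LINT p|lborel. of_real (gauss_ft (d n) (D p)) * B p)"
      unfolding osc(1) by (rule gauss_osc(2)[OF d D osc(2)])
    also have "\<dots> = (LINT y|lborel. LINT x|lborel. of_real (gauss_ft (d n) (x - y)) * (f x * cnj (h y)))"
      unfolding D_def B_def using ib unfolding D_def B_def
      by (intro lborel_Fubini(2)[symmetric]) (simp add: case_prod_beta')
    \<comment> \<open>Substituting x = y + d z removes d from the kernel
      (\<open>gauss_ft_scale\<close>) and moves it into the argument of f.\<close>
    also have "\<dots> = (LINT y|lborel. (LINT z|lborel. of_real (gauss_ft 1 z) * f (y + d n *\<^sub>R z)) * cnj (h y))"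
    proof (rule Bochner_Integration.integral_cong)
      fix y :: 'a
      have "(LINT x|lborel. of_real (gauss_ft (d n) (x - y)) * (f x * cnj (h y)))
        = of_real (\<bar>d n\<bar> ^ DIM('a)) * (LINT z|lborel. of_real (gauss_ft (d n) ((y + d n *\<^sub>R z) - y)) * (f (y + d n *\<^sub>R z) * cnj (h y)))"
        using d[of n] by (intro lborel_integral_affine) auto
      also have "\<dots> = (LINT z|lborel. of_real (\<bar>d n\<bar> ^ DIM('a)) * (of_real (gauss_ft (d n) ((y + d n *\<^sub>R z) - y)) * (f (y + d n *\<^sub>R z) * cnj (h y))))"
        by (rule integral_mult_right_zero[symmetric])
      also have "\<dots> = (LINT z|lborel. (of_real (gauss_ft 1 z) * f (y + d n *\<^sub>R z)) * cnj (h y))"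
      proof (rule Bochner_Integration.integral_cong[OF refl])
        fix z
        have "gauss_ft 1 z = \<bar>d n\<bar> ^ DIM('a) * gauss_ft (d n) ((y + d n *\<^sub>R z) - y)"
          using gauss_ft_scale[OF d, of n z] d[of n] by simp
        then show "of_real (\<bar>d n\<bar> ^ DIM('a)) * (of_real (gauss_ft (d n) ((y + d n *\<^sub>R z) - y)) * (f (y + d n *\<^sub>R z) * cnj (h y)))
          = (of_real (gauss_ft 1 z) * f (y + d n *\<^sub>R z)) * cnj (h y)"
          by (simp only: of_real_mult mult.assoc)
      qed
      also have "\<dots> = (LINT z|lborel. of_real (gauss_ft 1 z) * f (y + d n *\<^sub>R z)) * cnj (h y)"
        by (rule integral_mult_left_zero)
      finally show "(LINT x|lborel. of_real (gauss_ft (d n) (x - y)) * (f x * cnj (h y))) = (LINT z|lborel. of_real (gauss_ft 1 z) * f (y + d n *\<^sub>R z)) * cnj (h y)" .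
    qed simp
    finally show ?thesis .
  qed
  have M: "0 \<le> M" using bd[of undefined] norm_ge_zero order_trans by blast
  have iK: "integrable lborel (\<lambda>z. M * gauss_ft 1 (z::'a))" by (intro integrable_mult_right gauss_ft_integral(1)) simp
  define c where "c = (2 * pi) ^ DIM('a)"
  have inner: "(\<lambda>n. LINT z|lborel. of_real (gauss_ft 1 z) * f (y + d n *\<^sub>R z)) \<longlonglongrightarrow> of_real c * f y" for y
  proof -
    have "(\<lambda>n. LINT z|lborel. of_real (gauss_ft 1 z) * f (y + d n *\<^sub>R z)) \<longlonglongrightarrow> (LINT z|lborel. of_real (gauss_ft 1 (z::'a)) * f y)"
    proof (rule integral_dominated_convergence[OF _ _ iK])
      show "AE z in lborel. (\<lambda>n. of_real (gauss_ft 1 z) * f (y + d n *\<^sub>R z)) \<longlonglongrightarrow> of_real (gauss_ft 1 z) * f y"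
      proof (rule AE_I2)
        fix z :: 'a
        have "(\<lambda>n. y + d n *\<^sub>R z) \<longlonglongrightarrow> y + 0 *\<^sub>R z"
          unfolding d_def using LIMSEQ_inverse_real_of_nat by (intro tendsto_intros) (simp add: divide_inverse)
        then have "(\<lambda>n. f (y + d n *\<^sub>R z)) \<longlonglongrightarrow> f y"
          using cont by (intro isCont_tendsto_compose[of _ f]) (auto simp: continuous_on_eq_continuous_at)
        then show "(\<lambda>n. of_real (gauss_ft 1 z) * f (y + d n *\<^sub>R z)) \<longlonglongrightarrow> of_real (gauss_ft 1 z) * f y"
          by (rule tendsto_mult_left)
      qed
      show "AE z in lborel. cmod (of_real (gauss_ft 1 z) * f (y + d n *\<^sub>R z)) \<le> M * gauss_ft 1 z" for n
      proof (rule AE_I2)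
        fix z :: 'a
        have "cmod (of_real (gauss_ft 1 z) * f (y + d n *\<^sub>R z)) = gauss_ft 1 z * cmod (f (y + d n *\<^sub>R z))"
          using gauss_ft_nonneg[of 1 z] by (simp add: norm_mult)
        also have "\<dots> \<le> gauss_ft 1 z * M" using bd gauss_ft_nonneg[of 1 z] by (intro mult_left_mono) auto
        finally show "cmod (of_real (gauss_ft 1 z) * f (y + d n *\<^sub>R z)) \<le> M * gauss_ft 1 z" by (simp add: mult.commute)
      qed
    qed measurable
    also have "(LINT z|lborel. of_real (gauss_ft 1 (z::'a)) * f y) = (LINT z|lborel. of_real (gauss_ft 1 (z::'a))) * f y"
      by (rule integral_mult_left_zero)
    also have "(LINT z|lborel. of_real (gauss_ft 1 (z::'a))) = complex_of_real c"
      using gauss_ft_integral(2)[of 1, where 'a='a] by (simp add: c_def)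
    finally show ?thesis .
  qed
  have innerb: "cmod (LINT z|lborel. of_real (gauss_ft 1 z) * f (y + d n *\<^sub>R z)) \<le> M * c" for y n
  proof -
    have "cmod (LINT z|lborel. of_real (gauss_ft 1 z) * f (y + d n *\<^sub>R z)) \<le> (LINT z|lborel. M * gauss_ft 1 (z::'a))"
    proof (rule Bochner_Integration.integral_norm_bound_integral[OF _ iK])
      have bz: "cmod (of_real (gauss_ft 1 z) * f (y + d n *\<^sub>R z)) \<le> M * gauss_ft 1 z" for z
        using mult_left_mono[OF bd gauss_ft_nonneg, of 1 z "y + d n *\<^sub>R z"] gauss_ft_nonneg[of 1 z]
        by (simp add: norm_mult mult.commute)
      show "cmod (of_real (gauss_ft 1 z) * f (y + d n *\<^sub>R z)) \<le> M * gauss_ft 1 z" for z by (rule bz)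
      show "integrable lborel (\<lambda>z. of_real (gauss_ft 1 z) * f (y + d n *\<^sub>R z))"
      proof (rule Bochner_Integration.integrable_bound[OF iK])
        have "cmod (of_real (gauss_ft 1 z) * f (y + d n *\<^sub>R z)) \<le> norm (M * gauss_ft 1 z)" for z
          using bz[of z] by (rule order_trans) simp
        then show "AE z in lborel. cmod (of_real (gauss_ft 1 z) * f (y + d n *\<^sub>R z)) \<le> norm (M * gauss_ft 1 z)" by simp
      qed measurable
    qed
    also have "\<dots> = M * c" using gauss_ft_integral(2)[of 1, where 'a='a] by (simp add: c_def)
    finally show ?thesis .
  qed
  have "(\<lambda>n. LINT y|lborel. (LINT z|lborel. of_real (gauss_ft 1 z) * f (y + d n *\<^sub>R z)) * cnj (h y)) \<longlonglongrightarrow> (LINT y|lborel. (of_real c * f y) * cnj (h y))"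
  proof (rule integral_dominated_convergence[where w="\<lambda>y. (M * c) * cmod (h y)"])
    show "integrable lborel (\<lambda>y. (M * c) * cmod (h y))" using i(2) by simp
    show "AE y in lborel. (\<lambda>n. (LINT z|lborel. of_real (gauss_ft 1 z) * f (y + d n *\<^sub>R z)) * cnj (h y)) \<longlonglongrightarrow> (of_real c * f y) * cnj (h y)"
      by (intro AE_I2 tendsto_mult_right inner)
    show "AE y in lborel. cmod ((LINT z|lborel. of_real (gauss_ft 1 z) * f (y + d n *\<^sub>R z)) * cnj (h y)) \<le> (M * c) * cmod (h y)" for n
      unfolding norm_mult complex_mod_cnj by (intro AE_I2 mult_right_mono innerb) auto
  qed measurable
  also have "(LINT y|lborel. (of_real c * f y) * cnj (h y)) = of_real c * (LINT y|lborel. f y * cnj (h y))"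
    unfolding mult.assoc by (rule integral_mult_right_zero)
  finally show "(LINT \<tau>|lborel. ft f \<tau> * cnj (ft h \<tau>)) = of_real ((2 * pi) ^ DIM('a)) * (LINT x|lborel. f x * cnj (h x))"
    using lim1 unfolding eq c_def by (rule LIMSEQ_unique[rotated])
qed

lemma L12_bounded_support:
  fixes f :: "'a::euclidean_space \<Rightarrow> complex"
  assumes [measurable]: "f \<in> borel_measurable borel" and b: "\<And>x. cmod (f x) \<le> M" and s: "\<And>x. R < norm x \<Longrightarrow> f x = 0"
  shows "L12 f"
proof -
  have M: "0 \<le> M" using b[of undefined] norm_ge_zero order_trans by blast
  have fin: "emeasure lborel (cball (0::'a) R) < \<infinity>" by (rule emeasure_lborel_cball_finite)
  have i: "integrable lborel (\<lambda>x. k * indicator (cball (0::'a) R) x :: real)" for k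
    using fin by (intro integrable_mult_right integrable_real_indicator) auto
  have "integrable lborel f"
    by (rule Bochner_Integration.integrable_bound[OF i[of M]]) (use b s M in \<open>auto simp: indicator_def\<close>)
  moreover have "integrable lborel (\<lambda>x. (cmod (f x))\<^sup>2)"
    by (rule Bochner_Integration.integrable_bound[OF i[of "M\<^sup>2"]]) (use b s M in \<open>auto simp: indicator_def intro!: power_mono\<close>)
  ultimately show ?thesis by (simp add: L12_def in_L2_def)
qed

text \<open>A measurable function is an almost everywhere limit of continuous ones, but these may be
  unbounded or spread out. They are clipped to the bound M and cut off outside a ball, so that
  dominated convergence gives convergence in L2.\<close>

lemma parseval_bounded:
  fixes f :: "'a::euclidean_space \<Rightarrow> complex"
  assumes m: "f \<in> borel_measurable borel" and b: "\<And>x. cmod (f x) \<le> M" and s: "\<And>x. R < norm x \<Longrightarrow> f x = 0" and M: "0 < M"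
  shows "parseval f"
proof -
  note [measurable] = m
  have "f \<in> borel_measurable lebesgue" using m by (simp add: measurable_completion)
  then have "f measurable_on UNIV"
    by (subst measurable_on_iff_borel_measurable) auto
  then obtain N g where N: "negligible N" and g: "\<And>n. continuous_on UNIV (g n)" and lim: "\<And>x. x \<notin> N \<Longrightarrow> (\<lambda>n. g n x) \<longlonglongrightarrow> f x"
    unfolding measurable_on_def by auto
  \<comment> \<open>The radial retraction onto the disc of radius M: continuous, and the identity on
    the values of f. The cutoff \<open>chi\<close> is 1 up to radius R and 0 beyond radius R +
    1.\<close>
  define clip where "clip z = (1 / max 1 (norm z / M)) *\<^sub>R z" for z :: complex
  have clipc: "continuous_on UNIV clip"
    unfolding clip_def using M by (intro continuous_intros) auto
  have clipb: "cmod (clip z) \<le> M" for z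
  proof -
    have "cmod z \<le> M * max 1 (cmod z / M)" using M by (auto simp: max_def field_simps)
    then show ?thesis using M by (simp add: clip_def divide_simps mult.commute)
  qed
  have clipf: "clip z = z" if "cmod z \<le> M" for z using that M by (simp add: clip_def max_def field_simps)
  define chi where "chi x = max 0 (min 1 (R + 1 - norm x))" for x :: 'a
  define F where "F n x = of_real (chi x) * clip (g n x)" for n x
  have Fc: "continuous_on UNIV (F n)" for n
    unfolding F_def chi_def by (intro continuous_intros continuous_on_compose2[OF clipc g]) auto
  have mF [measurable]: "F n \<in> borel_measurable borel" for n by (rule borel_measurable_continuous_onI[OF Fc])
  have Fb: "cmod (F n x) \<le> M" for n x
  proof -
    have "cmod (F n x) = chi x * cmod (clip (g n x))" by (simp add: F_def norm_mult chi_def)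
    also have "\<dots> \<le> 1 * M" by (intro mult_mono clipb) (auto simp: chi_def)
    finally show ?thesis by simp
  qed
  have Fs: "F n x = 0" if "R + 1 < norm x" for n x using that by (simp add: F_def chi_def)
  have F12: "L12 (F n)" for n by (rule L12_bounded_support[OF mF Fb Fs])
  have f12: "L12 f" by (rule L12_bounded_support[OF m b s])
  have "(\<lambda>n. LINT x|lborel. (cmod (F n x - f x))\<^sup>2) \<longlonglongrightarrow> (LINT x|(lborel::'a measure). 0)"
  proof (rule integral_dominated_convergence[where w="\<lambda>x. (2 * M)\<^sup>2 * indicator (cball 0 (R + 1)) x"])
    have "emeasure lborel (cball (0::'a) (R+1)) < \<infinity>" by (rule emeasure_lborel_cball_finite)
    then show "integrable lborel (\<lambda>x. (2 * M)\<^sup>2 * indicator (cball (0::'a) (R + 1)) x)"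
      by (intro integrable_mult_right integrable_real_indicator) auto
    show "AE x in lborel. (\<lambda>n. (cmod (F n x - f x))\<^sup>2) \<longlonglongrightarrow> 0"
    proof -
      have imp: "(\<lambda>n. (cmod (F n x - f x))\<^sup>2) \<longlonglongrightarrow> 0" if "x \<notin> N" for x
      proof -
        have "(\<lambda>n. clip (g n x)) \<longlonglongrightarrow> clip (f x)"
          using clipc lim[OF that] by (intro isCont_tendsto_compose[of _ clip]) (auto simp: continuous_on_eq_continuous_at)
        then have "(\<lambda>n. F n x) \<longlonglongrightarrow> of_real (chi x) * f x"
          unfolding F_def using clipf[OF b[of x]] by (auto intro: tendsto_mult_left)
        moreover have "of_real (chi x) * f x = f x" using s[of x] by (cases "norm x \<le> R") (auto simp: chi_def)
        ultimately have "(\<lambda>n. F n x) \<longlonglongrightarrow> f x" by simp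
        then have "(\<lambda>n. (cmod (F n x - f x))\<^sup>2) \<longlonglongrightarrow> (cmod (f x - f x))\<^sup>2" by (intro tendsto_intros)
        then show ?thesis by simp
      qed
      have "AE x in lebesgue. x \<notin> N" using N by (intro AE_not_in) (simp add: negligible_iff_null_sets)
      then have "AE x in lebesgue. (\<lambda>n. (cmod (F n x - f x))\<^sup>2) \<longlonglongrightarrow> 0" by (rule eventually_mono) (rule imp)
      then show ?thesis by (simp add: AE_completion_iff)
    qed
    show "AE x in lborel. norm ((cmod (F n x - f x))\<^sup>2) \<le> (2 * M)\<^sup>2 * indicator (cball 0 (R + 1)) x" for n
    proof (rule AE_I2)
      fix x
      have "cmod (F n x - f x) \<le> 2 * M" using norm_triangle_ineq4[of "F n x" "f x"] Fb[of n x] b[of x] by linarith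
      then have "(cmod (F n x - f x))\<^sup>2 \<le> (2 * M)\<^sup>2" by (intro power_mono) auto
      then show "norm ((cmod (F n x - f x))\<^sup>2) \<le> (2 * M)\<^sup>2 * indicator (cball 0 (R + 1)) x"
        using Fs[of x n] s[of x] by (cases "norm x \<le> R + 1") (auto simp: indicator_def)
    qed
  qed measurable
  then have "(\<lambda>n. norm_L2 (\<lambda>x. F n x - f x)) \<longlonglongrightarrow> sqrt (LINT x|(lborel::'a measure). 0)"
    unfolding norm_L2_def by (rule tendsto_real_sqrt)
  then have l0: "(\<lambda>n. norm_L2 (\<lambda>x. F n x - f x)) \<longlonglongrightarrow> 0"
    by (simp only: integral_zero real_sqrt_zero)
  have P: "parseval (F n)" for n by (rule parseval_continuous[OF Fc Fb F12])
  show ?thesis by (rule parseval_closed[where F=F and f=f, OF P F12 f12 l0])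
qed

theorem Plancherel:
  fixes f :: "'a::euclidean_space \<Rightarrow> complex"
  assumes f: "L12 f" shows "parseval f"
proof -
  have [measurable]: "f \<in> borel_measurable borel" using f by (auto simp: L12_def intro: in_L2_measurable)
  define S where "S n = {x. cmod (f x) \<le> real (Suc n) \<and> norm x \<le> real (Suc n)}" for n
  have [measurable]: "S n \<in> sets borel" for n unfolding S_def by measurable
  define F where "F n x = indicator (S n) x * f x" for n x
  have mF [measurable]: "F n \<in> borel_measurable borel" for n unfolding F_def by measurable
  have Fb: "cmod (F n x) \<le> real (Suc n)" "real (Suc n) < norm x \<Longrightarrow> F n x = 0" for n x
    by (auto simp: F_def S_def indicator_def norm_mult)
  have F12: "L12 (F n)" for n by (rule L12_bounded_support[OF mF Fb])
  have P: "parseval (F n)" for n by (rule parseval_bounded[OF mF Fb]) simp_all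
  have "(\<lambda>n. LINT x|lborel. (cmod (F n x - f x))\<^sup>2) \<longlonglongrightarrow> (LINT x|(lborel::'a measure). 0)"
  proof (rule integral_dominated_convergence[where w="\<lambda>x. (cmod (f x))\<^sup>2"])
    show "integrable lborel (\<lambda>x. (cmod (f x))\<^sup>2)" using f by (simp add: L12_def in_L2_def)
    show "AE x in lborel. (\<lambda>n. (cmod (F n x - f x))\<^sup>2) \<longlonglongrightarrow> 0"
    proof (rule AE_I2)
      fix x
      obtain m where m: "cmod (f x) \<le> real m" "norm x \<le> real m"
        using real_arch_simple[of "max (cmod (f x)) (norm x)"] by auto
      have "\<forall>\<^sub>F n in sequentially. (cmod (F n x - f x))\<^sup>2 = 0"
        using eventually_ge_at_top[of m]
        by eventually_elim (use m in \<open>auto simp: F_def S_def indicator_def\<close>)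
      then show "(\<lambda>n. (cmod (F n x - f x))\<^sup>2) \<longlonglongrightarrow> 0" by (rule tendsto_eventually)
    qed
    show "AE x in lborel. norm ((cmod (F n x - f x))\<^sup>2) \<le> (cmod (f x))\<^sup>2" for n
      by (intro AE_I2) (auto simp: F_def indicator_def)
  qed measurable
  then have "(\<lambda>n. norm_L2 (\<lambda>x. F n x - f x)) \<longlonglongrightarrow> sqrt (LINT x|(lborel::'a measure). 0)"
    unfolding norm_L2_def by (rule tendsto_real_sqrt)
  then have l0: "(\<lambda>n. norm_L2 (\<lambda>x. F n x - f x)) \<longlonglongrightarrow> 0"
    by (simp only: integral_zero real_sqrt_zero)
  show ?thesis by (rule parseval_closed[where F=F and f=f, OF P F12 f l0])
qed

corollary Plancherel_norm:
  fixes f :: "'a::euclidean_space \<Rightarrow> complex"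
  assumes f: "L12 f" shows "norm_L2 (ft f) = sqrt ((2 * pi) ^ DIM('a)) * norm_L2 f"
proof -
  have "complex_of_real (LINT \<tau>|lborel. (cmod (ft f \<tau>))\<^sup>2) = of_real ((2 * pi) ^ DIM('a) * (LINT x|lborel. (cmod (f x))\<^sup>2))"
  proof -
    have sq: "(LINT x|lborel. of_real ((cmod (g x))\<^sup>2)) = (LINT x|lborel. g x * cnj (g x))" for g :: "'a \<Rightarrow> complex"
      by (simp only: complex_norm_square)
    have "(LINT \<tau>|lborel. ft f \<tau> * cnj (ft f \<tau>)) = of_real ((2 * pi) ^ DIM('a)) * (LINT x|lborel. f x * cnj (f x))"
      using Plancherel[OF f] f unfolding parseval_def by blast
    then show ?thesis
      unfolding sq[symmetric] integral_complex_of_real of_real_mult .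
  qed
  then have "(LINT \<tau>|lborel. (cmod (ft f \<tau>))\<^sup>2) = (2 * pi) ^ DIM('a) * (LINT x|lborel. (cmod (f x))\<^sup>2)"
    by (simp only: of_real_eq_iff)
  then show ?thesis by (simp add: norm_L2_def real_sqrt_mult)
qed

section \<open>The Fourier transform on square-integrable functions\<close>

lemma measurable_uminus_borel [measurable]: "(uminus :: 'a::euclidean_space \<Rightarrow> 'a) \<in> borel_measurable borel"
  by (intro borel_measurable_continuous_onI continuous_intros)

lemma ball_measurable [measurable]: "ball (x::'a::euclidean_space) r \<in> sets borel" "cball x r \<in> sets borel"
  by auto

lemma fourier_ft: "fourier f \<xi> = ft f (- \<xi>)"
  by (simp add: fourier_def osc_def inner_commute)

lemma fourier_inv_ft: "fourier_inv F x = complex_of_real (1 / (2 * pi) ^ 3) * ft F x"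
  unfolding fourier_inv_def osc_def by (simp add: inner_commute)

lemma N2_ft:
  fixes h :: "'a::euclidean_space \<Rightarrow> complex"
  assumes "L12 h" shows "N2 (ft h) = ennreal ((2 * pi) ^ DIM('a)) * N2 h"
proof -
  have "N2 (ft h) = ennreal ((sqrt ((2 * pi) ^ DIM('a)) * norm_L2 h)\<^sup>2)"
    unfolding N2_norm_L2[OF ft_L2(1)[OF assms]] Plancherel_norm[OF assms] ..
  also have "\<dots> = ennreal ((2 * pi) ^ DIM('a) * (norm_L2 h)\<^sup>2)"
    by (simp add: power_mult_distrib)
  also have "\<dots> = ennreal ((2 * pi) ^ DIM('a)) * ennreal ((norm_L2 h)\<^sup>2)"
    by (rule ennreal_mult) simp_all
  also have "ennreal ((norm_L2 h)\<^sup>2) = N2 h"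
    using assms by (simp add: N2_norm_L2 L12_def)
  finally show ?thesis .
qed

lemma ft_inj:
  assumes "L12 f" "\<And>x. ft f x = 0" shows "AE x in lborel. f x = 0"
proof -
  have "norm_L2 (\<lambda>x. ft f x) = 0" using assms(2) by simp
  then have "norm_L2 f = 0" using Plancherel_norm[OF assms(1)] by simp
  then have "N2 f = 0" using assms(1) by (simp add: N2_norm_L2 L12_def)
  then show ?thesis using N2_eq_0[of f] assms(1) by (auto simp: L12_def dest: in_L2_measurable)
qed

lemma L12_measurable: "L12 f \<Longrightarrow> f \<in> borel_measurable borel"
  by (auto simp: L12_def dest: in_L2_measurable)

lemma fourier_measurable: "f \<in> borel_measurable borel \<Longrightarrow> fourier f \<in> borel_measurable borel"
  unfolding fourier_ft[abs_def] by (rule measurable_compose[OF measurable_uminus_borel ft_measurable])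

lemma N2_fourier_diff:
  assumes "L12 f" "L12 g"
  shows "N2 (\<lambda>\<xi>. fourier f \<xi> - fourier g \<xi>) = ennreal ((2 * pi) ^ 3) * N2 (\<lambda>x. f x - g x)"
proof -
  have d: "L12 (\<lambda>x. f x - g x)" by (rule L12_diff[OF assms])
  note [measurable] = L12_measurable[OF d]
  have "(\<lambda>\<xi>. fourier f \<xi> - fourier g \<xi>) = (\<lambda>\<xi>. ft (\<lambda>x. f x - g x) (- \<xi>))"
    using assms unfolding fourier_ft by (subst ft_diff) (auto simp: L12_def)
  then have "N2 (\<lambda>\<xi>. fourier f \<xi> - fourier g \<xi>) = N2 (ft (\<lambda>x. f x - g x))"
    by (simp only:) (rule N2_reflect, measurable)
  then show ?thesis unfolding N2_ft[OF d] by simp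
qed

section \<open>Truncations and existence of the L2 transform\<close>

definition trunc :: "real \<Rightarrow> ('a::euclidean_space \<Rightarrow> complex) \<Rightarrow> 'a \<Rightarrow> complex" where
  "trunc R f x = indicator (ball 0 R) x * f x"

lemma trunc_measurable [measurable]: "f \<in> borel_measurable borel \<Longrightarrow> trunc R f \<in> borel_measurable borel"
  unfolding trunc_def[abs_def] by measurable

lemma trunc_L12: assumes "in_L2 f" shows "L12 (trunc R f)"
proof -
  have 1: "L12 (indicator (ball 0 R) :: 'a \<Rightarrow> complex)"
    by (rule L12_bounded_support[where M=1 and R=R]) (auto simp: indicator_def)
  have "integrable lborel (\<lambda>x. indicator (ball 0 R) x * f x)"
    using 1 assms by (intro L2_Cauchy_Schwarz) (auto simp: L12_def)
  moreover have "in_L2 (\<lambda>x. indicator (ball 0 R) x * f x)"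
    by (rule in_L2_bounded_mult(1)[OF assms, where B=1]) (auto simp: indicator_def)
  ultimately show ?thesis by (simp add: L12_def trunc_def[abs_def])
qed

lemma trunc_tail_antimono:
  assumes "R \<le> R'" shows "N2 (\<lambda>x. trunc R' f x - f x) \<le> N2 (\<lambda>x. trunc R f x - f x)"
  using assms by (intro N2_mono) (auto simp: trunc_def indicator_def)

lemma trunc_tail:
  fixes f :: "'a::euclidean_space \<Rightarrow> complex"
  assumes "in_L2 f" shows "((\<lambda>R. N2 (\<lambda>x. trunc R f x - f x)) \<longlongrightarrow> 0) at_top"
proof (rule order_tendstoI)
  have m [measurable]: "f \<in> borel_measurable borel" using assms by (rule in_L2_measurable)
  fix e :: ennreal assume e: "0 < e"
  have "(\<lambda>n. \<integral>\<^sup>+x. ennreal ((cmod (trunc (real n) f x - f x))\<^sup>2) \<partial>lborel) \<longlonglongrightarrow> (\<integral>\<^sup>+x. 0 \<partial>(lborel :: 'a measure))"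
  proof (rule nn_integral_dominated_convergence[where w="\<lambda>x. ennreal ((cmod (f x))\<^sup>2)"])
    show "(\<integral>\<^sup>+x. ennreal ((cmod (f x))\<^sup>2) \<partial>lborel) < \<infinity>" using assms by (simp add: in_L2_iff N2_def)
    show "AE x in lborel. ennreal ((cmod (trunc (real n) f x - f x))\<^sup>2) \<le> ennreal ((cmod (f x))\<^sup>2)" for n
      by (intro AE_I2 ennreal_leI) (auto simp: trunc_def indicator_def)
    show "AE x in lborel. (\<lambda>n. ennreal ((cmod (trunc (real n) f x - f x))\<^sup>2)) \<longlonglongrightarrow> 0"
    proof (rule AE_I2)
      fix x :: 'a
      obtain m where "norm x < real m" using reals_Archimedean2 by blast
      then have "\<forall>\<^sub>F n in sequentially. ennreal ((cmod (trunc (real n) f x - f x))\<^sup>2) = 0"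
        by (intro eventually_mono[OF eventually_ge_at_top[of m]]) (auto simp: trunc_def indicator_def)
      then show "(\<lambda>n. ennreal ((cmod (trunc (real n) f x - f x))\<^sup>2)) \<longlonglongrightarrow> 0" by (rule tendsto_eventually)
    qed
  qed measurable
  then have "(\<lambda>n. N2 (\<lambda>x. trunc (real n) f x - f x)) \<longlonglongrightarrow> 0" by (simp add: N2_def)
  then have "\<forall>\<^sub>F n in sequentially. N2 (\<lambda>x. trunc (real n) f x - f x) < e" using e by (rule order_tendstoD)
  then obtain n where n: "N2 (\<lambda>x. trunc (real n) f x - f x) < e" by (auto simp: eventually_sequentially)
  show "\<forall>\<^sub>F R in at_top. N2 (\<lambda>x. trunc R f x - f x) < e"
    using eventually_ge_at_top[of "real n"]
    by eventually_elim (rule le_less_trans[OF trunc_tail_antimono n])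
qed simp

lemma is_fourier_L2_iff:
  "is_fourier_L2 f F \<longleftrightarrow> in_L2 F \<and> ((\<lambda>R. N2 (\<lambda>\<xi>. fourier (trunc R f) \<xi> - F \<xi>)) \<longlongrightarrow> 0) at_top"
  unfolding is_fourier_L2_def N2_def trunc_def[abs_def] ..

lemma N2_triangle:
  assumes [measurable]: "f \<in> borel_measurable borel" "g \<in> borel_measurable borel" "h \<in> borel_measurable borel"
  shows "N2 (\<lambda>x. f x - h x) \<le> 2 * N2 (\<lambda>x. f x - g x) + 2 * N2 (\<lambda>x. h x - g x)"
proof -
  have "N2 (\<lambda>x. f x - h x) = N2 (\<lambda>x. (f x - g x) + (g x - h x))" by simp
  also have "\<dots> \<le> 2 * N2 (\<lambda>x. f x - g x) + 2 * N2 (\<lambda>x. g x - h x)" by (rule N2_add_le) measurable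
  also have "N2 (\<lambda>x. g x - h x) = N2 (\<lambda>x. h x - g x)" by (simp add: N2_def norm_minus_commute)
  finally show ?thesis .
qed

text \<open>The weight 2^k is affordable against the decay 4^-k: the sum of 2^k |g_(k+1) - g_k|^2
  has finite integral, hence is finite almost everywhere, and at such points the increments are
  bounded by a geometric series of ratio sqrt(1/2).\<close>

lemma AE_convergent_of_summable_N2:
  fixes g :: "nat \<Rightarrow> 'a::euclidean_space \<Rightarrow> complex"
  assumes [measurable]: "\<And>k. g k \<in> borel_measurable borel"
    and C: "0 \<le> C" and le: "\<And>k. N2 (\<lambda>x. g (Suc k) x - g k x) \<le> ennreal (C * (1/4) ^ k)"
  shows "AE x in lborel. convergent (\<lambda>k. g k x)"
proof -
  define d where "d k x = g (Suc k) x - g k x" for k x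
  have [measurable]: "d k \<in> borel_measurable borel" for k unfolding d_def by measurable
  have "(\<integral>\<^sup>+x. (\<Sum>k. ennreal (2 ^ k * (cmod (d k x))\<^sup>2)) \<partial>lborel) = (\<Sum>k. \<integral>\<^sup>+x. ennreal (2 ^ k * (cmod (d k x))\<^sup>2) \<partial>lborel)"
    by (rule nn_integral_suminf) measurable
  also have "\<dots> \<le> (\<Sum>k. ennreal (C * (1/2) ^ k))"
  proof (rule suminf_le)
    fix k
    have "(\<integral>\<^sup>+x. ennreal (2 ^ k * (cmod (d k x))\<^sup>2) \<partial>lborel) = ennreal (2 ^ k) * N2 (d k)"
      unfolding N2_def by (subst nn_integral_cmult[symmetric]) (auto simp: ennreal_mult)
    also have "\<dots> \<le> ennreal (2 ^ k) * ennreal (C * (1/4) ^ k)"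
      using le[of k] unfolding d_def by (rule mult_left_mono) simp
    also have "\<dots> = ennreal (2 ^ k * (C * (1/4) ^ k))" using C by (intro ennreal_mult[symmetric]) auto
    also have "2 ^ k * (C * (1/4) ^ k) = C * (1/2) ^ k"
      using power_mult_distrib[of 2 "1/4::real" k] by simp
    finally show "(\<integral>\<^sup>+x. ennreal (2 ^ k * (cmod (d k x))\<^sup>2) \<partial>lborel) \<le> ennreal (C * (1/2) ^ k)" .
  qed auto
  also have "\<dots> < \<infinity>"
  proof -
    have "(\<Sum>k. ennreal (C * (1/2) ^ k)) \<noteq> top"
      using C by (intro ennreal_suminf_neq_top summable_mult summable_geometric) auto
    then show ?thesis by (simp add: less_top)
  qed
  finally have "AE x in lborel. (\<Sum>k. ennreal (2 ^ k * (cmod (d k x))\<^sup>2)) \<noteq> \<infinity>"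
    by (intro nn_integral_noteq_infinite) auto
  then show ?thesis
  proof (rule eventually_mono)
    fix x assume *: "(\<Sum>k. ennreal (2 ^ k * (cmod (d k x))\<^sup>2)) \<noteq> \<infinity>"
    define s where "s = enn2real (\<Sum>k. ennreal (2 ^ k * (cmod (d k x))\<^sup>2))"
    have s0: "0 \<le> s" by (simp add: s_def)
    have s: "ennreal s = (\<Sum>k. ennreal (2 ^ k * (cmod (d k x))\<^sup>2))"
      unfolding s_def by (rule ennreal_enn2real) (rule *[unfolded infinity_ennreal_def less_top])
    have b: "cmod (d k x) \<le> sqrt s * (sqrt (1/2)) ^ k" for k
    proof -
      have "ennreal (2 ^ k * (cmod (d k x))\<^sup>2) \<le> ennreal s"
      proof -
        have "(\<Sum>k\<in>{k}. ennreal (2 ^ k * (cmod (d k x))\<^sup>2)) \<le> ennreal s"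
          unfolding s by (rule sum_le_suminf[OF summableI]) auto
        then show ?thesis by (simp only: sum.insert[OF finite.emptyI] sum.empty empty_iff not_False_eq_True add_0_right)
      qed
      then have "2 ^ k * (cmod (d k x))\<^sup>2 \<le> s" unfolding ennreal_le_iff[OF s0] .
      then have "(1/2) ^ k * (2 ^ k * (cmod (d k x))\<^sup>2) \<le> (1/2) ^ k * s" by (rule mult_left_mono) simp
      moreover have "(1/2) ^ k * (2 ^ k * (cmod (d k x))\<^sup>2) = (cmod (d k x))\<^sup>2"
        using power_mult_distrib[of "1/2::real" 2 k] by (simp add: mult.assoc[symmetric])
      ultimately have "(cmod (d k x))\<^sup>2 \<le> s * (1/2) ^ k" by (simp only: mult.commute)
      then have "sqrt ((cmod (d k x))\<^sup>2) \<le> sqrt (s * (1/2) ^ k)" by (rule real_sqrt_le_mono)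
      then show ?thesis by (simp add: real_sqrt_mult real_sqrt_power)
    qed
    have "summable (\<lambda>k. sqrt s * (sqrt (1/2)) ^ k)"
      by (intro summable_mult summable_geometric) (simp add: real_sqrt_divide)
    then have "summable (\<lambda>k. d k x)" using b by (rule summable_comparison_test'[where N=0]) 
    have tele: "(\<Sum>k<n. d k x) = g n x - g 0 x" for n unfolding d_def by (rule sum_lessThan_telescope)
    from \<open>summable (\<lambda>k. d k x)\<close> have "(\<lambda>n. \<Sum>k<n. d k x) \<longlonglongrightarrow> (\<Sum>k. d k x)" by (rule summable_LIMSEQ)
    then have "(\<lambda>n. g n x - g 0 x) \<longlonglongrightarrow> (\<Sum>k. d k x)" unfolding tele .
    then have "(\<lambda>n. (g n x - g 0 x) + g 0 x) \<longlonglongrightarrow> (\<Sum>k. d k x) + g 0 x" by (intro tendsto_intros)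
    then show "convergent (\<lambda>k. g k x)" by (auto simp: convergent_def)
  qed
qed

text \<open>Completeness of L2 made explicit. Radii \<open>r k\<close> with tails below 4^-k give
  transforms that converge almost everywhere; Fatou's lemma then bounds the distance to the limit
  for every R \<ge> \<open>r j\<close>, not only along the chosen radii. The factor 4 c is the
  constant c of Plancherel's theorem times the 2 + 2 of \<open>N2_triangle\<close>.\<close>

lemma fourier_L2_exists:
  assumes f: "in_L2 f" shows "\<exists>F. is_fourier_L2 f F"
proof -
  have m [measurable]: "f \<in> borel_measurable borel" using f by (rule in_L2_measurable)
  define c where "c = (2 * pi) ^ 3"
  have c: "0 < c" by (simp add: c_def)
  have ex: "\<exists>r. \<forall>R\<ge>r. N2 (\<lambda>x. trunc R f x - f x) \<le> ennreal ((1/4) ^ k)" for k :: nat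
  proof -
    have "\<forall>\<^sub>F R in at_top. N2 (\<lambda>x. trunc R f x - f x) < ennreal ((1/4) ^ k)"
      by (rule order_tendstoD(2)[OF trunc_tail[OF f]]) simp
    then show ?thesis by (auto simp: eventually_at_top_linorder intro: less_imp_le)
  qed
  then obtain r where r: "\<And>k R. r k \<le> R \<Longrightarrow> N2 (\<lambda>x. trunc R f x - f x) \<le> ennreal ((1/4) ^ k)"
    by metis
  have diff: "N2 (\<lambda>\<xi>. fourier (trunc R f) \<xi> - fourier (trunc R' f) \<xi>) \<le> ennreal (4 * c * (1/4) ^ j)"
    if "N2 (\<lambda>x. trunc R f x - f x) \<le> ennreal ((1/4) ^ j)" "N2 (\<lambda>x. trunc R' f x - f x) \<le> ennreal ((1/4) ^ j)" for R R' j
  proof -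
    have "N2 (\<lambda>\<xi>. fourier (trunc R f) \<xi> - fourier (trunc R' f) \<xi>) = ennreal c * N2 (\<lambda>x. trunc R f x - trunc R' f x)"
      unfolding c_def by (intro N2_fourier_diff trunc_L12 f)
    also have "\<dots> \<le> ennreal c * (2 * N2 (\<lambda>x. trunc R f x - f x) + 2 * N2 (\<lambda>x. trunc R' f x - f x))"
      by (intro mult_left_mono N2_triangle) auto
    also have "\<dots> \<le> ennreal c * (2 * ennreal ((1/4) ^ j) + 2 * ennreal ((1/4) ^ j))"
      by (intro mult_left_mono add_mono that) auto
    also have "\<dots> = ennreal (4 * c * (1/4) ^ j)"
    proof -
      have "2 * ennreal ((1/4) ^ j) = ennreal (2 * (1/4) ^ j)" by (subst ennreal_mult) auto
      then have "2 * ennreal ((1/4) ^ j) + 2 * ennreal ((1/4) ^ j) = ennreal (4 * (1/4) ^ j)"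
        by (simp only:) (subst ennreal_plus[symmetric], auto)
      then show ?thesis using c by (simp only:) (subst ennreal_mult[symmetric], auto simp: mult_ac)
    qed
    finally show ?thesis .
  qed
  define g where "g k = fourier (trunc (r k) f)" for k
  have mg [measurable]: "g k \<in> borel_measurable borel" for k unfolding g_def by (intro fourier_measurable trunc_measurable m)
  have mono: "N2 (\<lambda>x. trunc (r k) f x - f x) \<le> ennreal ((1/4) ^ j)" if "j \<le> k" for j k
    using r[of k "r k"] power_decreasing[OF that, of "1/4::real"] by (auto intro: order_trans ennreal_leI)
  have conv: "AE x in lborel. convergent (\<lambda>k. g k x)"
    by (rule AE_convergent_of_summable_N2[where C="4 * c"]) (use c in \<open>auto simp: g_def intro!: diff mono fourier_measurable trunc_measurable m\<close>)
  define F where "F x = lim (\<lambda>k. g k x)" for x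
  have mF [measurable]: "F \<in> borel_measurable borel" unfolding F_def[abs_def] by measurable
  have bound: "N2 (\<lambda>\<xi>. fourier (trunc R f) \<xi> - F \<xi>) \<le> ennreal (4 * c * (1/4) ^ j)" if R: "r j \<le> R" for R j
  proof -
    define G where "G = fourier (trunc R f)"
    have mG [measurable]: "G \<in> borel_measurable borel" unfolding G_def by (intro fourier_measurable trunc_measurable m)
    have "N2 (\<lambda>\<xi>. G \<xi> - F \<xi>) = (\<integral>\<^sup>+x. liminf (\<lambda>k. ennreal ((cmod (G x - g k x))\<^sup>2)) \<partial>lborel)"
      unfolding N2_def
    proof (rule nn_integral_cong_AE, rule eventually_mono[OF conv])
      fix x assume "convergent (\<lambda>k. g k x)"
      then have "(\<lambda>k. g k x) \<longlonglongrightarrow> F x" by (simp add: F_def convergent_LIMSEQ_iff)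
      then have "(\<lambda>k. ennreal ((cmod (G x - g k x))\<^sup>2)) \<longlonglongrightarrow> ennreal ((cmod (G x - F x))\<^sup>2)"
        by (intro tendsto_ennrealI tendsto_intros)
      then show "ennreal ((cmod (G x - F x))\<^sup>2) = liminf (\<lambda>k. ennreal ((cmod (G x - g k x))\<^sup>2))"
        by (intro lim_imp_Liminf[symmetric]) auto
    qed
    also have "\<dots> \<le> liminf (\<lambda>k. \<integral>\<^sup>+x. ennreal ((cmod (G x - g k x))\<^sup>2) \<partial>lborel)"
      by (rule nn_integral_liminf) measurable
    also have "\<dots> \<le> liminf (\<lambda>k::nat. ennreal (4 * c * (1/4) ^ j))"
    proof (rule Liminf_mono, rule eventually_mono[OF eventually_ge_at_top[of j]])
      fix k assume "j \<le> k"
      then show "(\<integral>\<^sup>+x. ennreal ((cmod (G x - g k x))\<^sup>2) \<partial>lborel) \<le> ennreal (4 * c * (1/4) ^ j)"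
        using diff[OF r[OF R] mono] unfolding N2_def G_def g_def by blast
    qed
    also have "\<dots> = ennreal (4 * c * (1/4) ^ j)" by (simp add: Liminf_const)
    finally show ?thesis unfolding G_def .
  qed
  have lim: "((\<lambda>R. N2 (\<lambda>\<xi>. fourier (trunc R f) \<xi> - F \<xi>)) \<longlongrightarrow> 0) at_top"
  proof (rule order_tendstoI)
    fix e :: ennreal assume e: "0 < e"
    have "(\<lambda>j. 4 * c * (1/4::real) ^ j) \<longlonglongrightarrow> 4 * c * 0" by (intro tendsto_mult_left LIMSEQ_power_zero) simp
    then have "(\<lambda>j. ennreal (4 * c * (1/4::real) ^ j)) \<longlonglongrightarrow> ennreal 0" by (intro tendsto_ennrealI) simp
    then have "\<forall>\<^sub>F j in sequentially. ennreal (4 * c * (1/4::real) ^ j) < e" using e by (intro order_tendstoD) auto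
    then obtain j where j: "ennreal (4 * c * (1/4::real) ^ j) < e" by (auto simp: eventually_sequentially)
    show "\<forall>\<^sub>F R in at_top. N2 (\<lambda>\<xi>. fourier (trunc R f) \<xi> - F \<xi>) < e"
      by (rule eventually_mono[OF eventually_ge_at_top[of "r j"]]) (rule le_less_trans[OF bound j])
  qed simp
  have "in_L2 F"
  proof -
    define G where "G = fourier (trunc (r 0) f)"
    have G: "in_L2 G" unfolding G_def fourier_ft[abs_def] by (intro in_L2_reflect ft_L2 trunc_L12 f)
    note [measurable] = in_L2_measurable[OF G]
    have "in_L2 (\<lambda>\<xi>. G \<xi> - F \<xi>)"
      using le_less_trans[OF bound[OF order_refl, of 0] ennreal_less_top] unfolding in_L2_iff G_def[symmetric] by simp
    from in_L2_diff(1)[OF G this] show ?thesis by simp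
  qed
  then show ?thesis using lim by (auto simp: is_fourier_L2_iff)
qed

lemma is_fourier_L2_fourier_L2: "in_L2 f \<Longrightarrow> is_fourier_L2 f (fourier_L2 f)"
  unfolding fourier_L2_def by (rule someI_ex[OF fourier_L2_exists])

lemma fourier_L2_in_L2: "in_L2 f \<Longrightarrow> in_L2 (fourier_L2 f)"
  using is_fourier_L2_fourier_L2 by (auto simp: is_fourier_L2_iff)

lemma is_fourier_L2_unique:
  assumes f: "in_L2 f" and F: "is_fourier_L2 f F" "is_fourier_L2 f G"
  shows "AE \<xi> in lborel. F \<xi> = G \<xi>"
proof -
  have L: "in_L2 F" "in_L2 G" using F by (auto simp: is_fourier_L2_iff)
  note [measurable] = in_L2_measurable[OF f] in_L2_measurable[OF L(1)] in_L2_measurable[OF L(2)]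
  have lim: "((\<lambda>R. 2 * N2 (\<lambda>\<xi>. fourier (trunc R f) \<xi> - F \<xi>) + 2 * N2 (\<lambda>\<xi>. fourier (trunc R f) \<xi> - G \<xi>)) \<longlongrightarrow> 2 * 0 + 2 * 0) at_top"
    using F unfolding is_fourier_L2_iff by (intro tendsto_add ennreal_tendsto_cmult) auto
  have le: "N2 (\<lambda>\<xi>. F \<xi> - G \<xi>) \<le> 2 * N2 (\<lambda>\<xi>. fourier (trunc R f) \<xi> - F \<xi>) + 2 * N2 (\<lambda>\<xi>. fourier (trunc R f) \<xi> - G \<xi>)" for R
  proof -
    have [measurable]: "fourier (trunc R f) \<in> borel_measurable borel" by (intro fourier_measurable trunc_measurable in_L2_measurable f)
    have "N2 (\<lambda>\<xi>. F \<xi> - G \<xi>) \<le> 2 * N2 (\<lambda>\<xi>. F \<xi> - fourier (trunc R f) \<xi>) + 2 * N2 (\<lambda>\<xi>. G \<xi> - fourier (trunc R f) \<xi>)"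
      by (rule N2_triangle) measurable
    then show ?thesis by (simp add: N2_def norm_minus_commute)
  qed
  have "N2 (\<lambda>\<xi>. F \<xi> - G \<xi>) \<le> 2 * 0 + 2 * 0"
    by (rule tendsto_lowerbound[OF lim]) (intro always_eventually allI le, simp)
  then have "N2 (\<lambda>\<xi>. F \<xi> - G \<xi>) = 0" by simp
  then show ?thesis using N2_eq_0[of "\<lambda>\<xi>. F \<xi> - G \<xi>"] by simp
qed

lemma fourier_L2_AE:
  assumes "in_L2 f" "is_fourier_L2 f F" shows "AE \<xi> in lborel. fourier_L2 f \<xi> = F \<xi>"
  by (rule is_fourier_L2_unique[OF assms(1) is_fourier_L2_fourier_L2 assms(2)]) fact

lemma fourier_L2_L12:
  assumes "L12 f" shows "AE \<xi> in lborel. fourier_L2 f \<xi> = fourier f \<xi>"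
proof (rule fourier_L2_AE)
  show f: "in_L2 f" using assms by (simp add: L12_def)
  have "((\<lambda>R. ennreal ((2 * pi) ^ 3) * N2 (\<lambda>x. trunc R f x - f x)) \<longlongrightarrow> ennreal ((2 * pi) ^ 3) * 0) at_top"
    by (intro ennreal_tendsto_cmult trunc_tail f) simp
  moreover have "in_L2 (fourier f)" unfolding fourier_ft[abs_def] by (intro in_L2_reflect ft_L2 assms)
  ultimately show "is_fourier_L2 f (fourier f)"
    by (simp add: is_fourier_L2_iff N2_fourier_diff[OF trunc_L12[OF f] assms])
qed

lemma fourier_inv_in_L2:
  assumes "L12 a" shows "in_L2 (fourier_inv a)" "norm_L2 (fourier_inv a) = norm_L2 a / sqrt ((2 * pi) ^ 3)"
proof -
  show "in_L2 (fourier_inv a)" unfolding fourier_inv_ft[abs_def] by (intro in_L2_cmult ft_L2 assms)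
  define c where "c = (2 * pi) ^ 3"
  have c: "0 < c" by (simp add: c_def)
  have "norm_L2 (fourier_inv a) = 1 / c * (sqrt c * norm_L2 a)"
    unfolding fourier_inv_ft[abs_def] in_L2_cmult(2)[OF ft_L2(1)[OF assms]] Plancherel_norm[OF assms]
    using c by (simp add: c_def norm_divide norm_power)
  also have "\<dots> = norm_L2 a / sqrt c" using c real_sqrt_mult_self[of c] by (simp add: field_simps)
  finally show "norm_L2 (fourier_inv a) = norm_L2 a / sqrt ((2 * pi) ^ 3)" by (simp add: c_def)
qed

section \<open>Fourier inversion\<close>

lemma multiplication_formula:
  assumes "integrable lborel f" "integrable lborel g"
  shows "(LINT x|lborel. f x * ft g x) = (LINT \<xi>|lborel. g \<xi> * ft f \<xi>)"
proof -
  note [measurable] = integrable_borel[OF assms(1)] integrable_borel[OF assms(2)]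
  have i: "integrable lborel (\<lambda>(x, \<xi>). f x * g \<xi>)" by (rule lborel_integrable_product[OF assms])
  have i: "integrable lborel (\<lambda>(x, \<xi>). cis (x \<bullet> \<xi>) * (f x * g \<xi>))"
    by (rule Bochner_Integration.integrable_bound[OF i]) (auto simp: norm_mult case_prod_beta')
  have "(LINT x|lborel. f x * ft g x) = (LINT x|lborel. LINT \<xi>|lborel. cis (x \<bullet> \<xi>) * (f x * g \<xi>))"
    unfolding osc_def by (subst integral_mult_right_zero[symmetric]) (simp add: mult.left_commute)
  also have "\<dots> = (LINT \<xi>|lborel. LINT x|lborel. cis (x \<bullet> \<xi>) * (f x * g \<xi>))"
    using lborel_Fubini[OF i] by simp
  also have "\<dots> = (LINT \<xi>|lborel. g \<xi> * ft f \<xi>)"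
    unfolding osc_def by (subst integral_mult_right_zero[symmetric]) (simp add: mult_ac inner_commute)
  finally show ?thesis .
qed

text \<open>The multiplication formula, extended from the truncations of f to f by L2 continuity of
  both sides. The pairing has no conjugate and \<open>fourier\<close> has the negative exponent,
  whence the argument -\<xi>.\<close>

lemma pairing_fourier_inv:
  assumes f: "in_L2 f" and h: "L12 h"
  shows "pairing f (fourier_inv h) = complex_of_real (1 / (2 * pi) ^ 3) * (LINT \<xi>|lborel. h \<xi> * fourier_L2 f (- \<xi>))"
proof -
  define k where "k = complex_of_real (1 / (2 * pi) ^ 3)"
  define F where "F = fourier_L2 f"
  have F: "is_fourier_L2 f F" "in_L2 F" unfolding F_def using is_fourier_L2_fourier_L2[OF f] fourier_L2_in_L2[OF f] by auto
  have hL: "in_L2 h" "integrable lborel h" "in_L2 (fourier_inv h)" using h fourier_inv_in_L2 by (auto simp: L12_def)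
  note [measurable] = in_L2_measurable[OF f] in_L2_measurable[OF F(2)] in_L2_measurable[OF hL(1)]
  have T: "L12 (trunc R f)" "in_L2 (trunc R f)" for R using trunc_L12[OF f] by (auto simp: L12_def)
  have eq: "pairing (trunc R f) (fourier_inv h) = k * (LINT \<xi>|lborel. h \<xi> * fourier (trunc R f) (- \<xi>))" for R
  proof -
    have "pairing (trunc R f) (fourier_inv h) = (LINT x|lborel. k * (trunc R f x * ft h x))"
      unfolding pairing_def fourier_inv_ft k_def by (simp add: mult.left_commute)
    also have "\<dots> = k * (LINT x|lborel. trunc R f x * ft h x)" by (rule integral_mult_right_zero)
    also have "(LINT x|lborel. trunc R f x * ft h x) = (LINT \<xi>|lborel. h \<xi> * ft (trunc R f) \<xi>)"
      using T(1)[of R] hL by (intro multiplication_formula) (auto simp: L12_def)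
    finally show ?thesis by (simp add: fourier_ft)
  qed
  have lim_norm: "((\<lambda>R. norm_L2 (w R)) \<longlongrightarrow> 0) at_top"
    if "\<And>R. in_L2 (w R)" "((\<lambda>R. N2 (w R)) \<longlongrightarrow> 0) at_top" for w :: "real \<Rightarrow> real^3 \<Rightarrow> complex"
  proof -
    have "((\<lambda>R. enn2real (N2 (w R))) \<longlongrightarrow> enn2real 0) at_top" using that(2) by (intro tendsto_enn2real) auto
    then have "((\<lambda>R. sqrt (enn2real (N2 (w R)))) \<longlongrightarrow> sqrt (enn2real 0)) at_top" by (rule tendsto_real_sqrt)
    then show ?thesis using that(1) by (simp add: N2_norm_L2)
  qed
  have Gd: "in_L2 (\<lambda>\<xi>. fourier (trunc R f) (- \<xi>))" for R
    unfolding fourier_ft minus_minus by (rule ft_L2(1)[OF T(1)])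
  have Fd: "in_L2 (\<lambda>\<xi>. F (- \<xi>))" by (rule in_L2_reflect(1)[OF F(2)])
  have l1: "((\<lambda>R. pairing (trunc R f) (fourier_inv h) - pairing f (fourier_inv h)) \<longlongrightarrow> 0) at_top"
  proof (rule Lim_null_comparison[OF always_eventually])
    show "\<forall>R. norm (pairing (trunc R f) (fourier_inv h) - pairing f (fourier_inv h)) \<le> norm_L2 (\<lambda>x. trunc R f x - f x) * norm_L2 (fourier_inv h)"
    proof
      fix R
      have "pairing (trunc R f) (fourier_inv h) - pairing f (fourier_inv h) = (LINT x|lborel. trunc R f x * fourier_inv h x - f x * fourier_inv h x)"
        unfolding pairing_def by (intro Bochner_Integration.integral_diff[symmetric] L2_Cauchy_Schwarz T f hL)
      also have "\<dots> = (LINT x|lborel. (trunc R f x - f x) * fourier_inv h x)" by (simp add: left_diff_distrib)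
      also have "cmod \<dots> \<le> norm_L2 (\<lambda>x. trunc R f x - f x) * norm_L2 (fourier_inv h)"
        by (intro L2_Cauchy_Schwarz in_L2_diff T f hL)
      finally show "norm (pairing (trunc R f) (fourier_inv h) - pairing f (fourier_inv h)) \<le> norm_L2 (\<lambda>x. trunc R f x - f x) * norm_L2 (fourier_inv h)" .
    qed
    have "((\<lambda>R. norm_L2 (\<lambda>x. trunc R f x - f x)) \<longlongrightarrow> 0) at_top"
      by (intro lim_norm in_L2_diff T f trunc_tail)
    then show "((\<lambda>R. norm_L2 (\<lambda>x. trunc R f x - f x) * norm_L2 (fourier_inv h)) \<longlongrightarrow> 0) at_top"
      by (rule tendsto_mult_left_zero)
  qed
  have l2: "((\<lambda>R. (LINT \<xi>|lborel. h \<xi> * fourier (trunc R f) (- \<xi>)) - (LINT \<xi>|lborel. h \<xi> * F (- \<xi>))) \<longlongrightarrow> 0) at_top"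
  proof (rule Lim_null_comparison[OF always_eventually])
    show "\<forall>R. norm ((LINT \<xi>|lborel. h \<xi> * fourier (trunc R f) (- \<xi>)) - (LINT \<xi>|lborel. h \<xi> * F (- \<xi>))) \<le> norm_L2 h * norm_L2 (\<lambda>\<xi>. fourier (trunc R f) \<xi> - F \<xi>)"
    proof
      fix R
      have d: "in_L2 (\<lambda>\<xi>. fourier (trunc R f) \<xi> - F \<xi>)"
        using in_L2_reflect(1)[OF in_L2_diff(1)[OF Gd Fd], of R] by simp
      have "(LINT \<xi>|lborel. h \<xi> * fourier (trunc R f) (- \<xi>)) - (LINT \<xi>|lborel. h \<xi> * F (- \<xi>)) = (LINT \<xi>|lborel. h \<xi> * fourier (trunc R f) (- \<xi>) - h \<xi> * F (- \<xi>))"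
        by (intro Bochner_Integration.integral_diff[symmetric] L2_Cauchy_Schwarz hL Gd Fd)
      also have "\<dots> = (LINT \<xi>|lborel. h \<xi> * (fourier (trunc R f) (- \<xi>) - F (- \<xi>)))" by (simp add: right_diff_distrib)
      also have "cmod \<dots> \<le> norm_L2 h * norm_L2 (\<lambda>\<xi>. fourier (trunc R f) (- \<xi>) - F (- \<xi>))"
        by (intro L2_Cauchy_Schwarz in_L2_diff Gd Fd hL)
      also have "norm_L2 (\<lambda>\<xi>. fourier (trunc R f) (- \<xi>) - F (- \<xi>)) = norm_L2 (\<lambda>\<xi>. fourier (trunc R f) \<xi> - F \<xi>)"
        by (rule in_L2_reflect(2)[OF d])
      finally show "norm ((LINT \<xi>|lborel. h \<xi> * fourier (trunc R f) (- \<xi>)) - (LINT \<xi>|lborel. h \<xi> * F (- \<xi>))) \<le> norm_L2 h * norm_L2 (\<lambda>\<xi>. fourier (trunc R f) \<xi> - F \<xi>)" .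
    qed
    have "in_L2 (\<lambda>\<xi>. fourier (trunc R f) \<xi> - F \<xi>)" for R
      using in_L2_reflect(1)[OF in_L2_diff(1)[OF Gd Fd], of R] by simp
    then have "((\<lambda>R. norm_L2 (\<lambda>\<xi>. fourier (trunc R f) \<xi> - F \<xi>)) \<longlongrightarrow> 0) at_top"
      using F(1) by (intro lim_norm) (auto simp: is_fourier_L2_iff)
    then show "((\<lambda>R. norm_L2 h * norm_L2 (\<lambda>\<xi>. fourier (trunc R f) \<xi> - F \<xi>)) \<longlongrightarrow> 0) at_top"
      by (rule tendsto_mult_right_zero)
  qed
  have "((\<lambda>R. pairing (trunc R f) (fourier_inv h)) \<longlongrightarrow> k * (LINT \<xi>|lborel. h \<xi> * F (- \<xi>))) at_top"
    unfolding eq using l2 by (intro tendsto_mult_left) (simp add: LIM_zero_iff)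
  moreover have "((\<lambda>R. pairing (trunc R f) (fourier_inv h)) \<longlongrightarrow> pairing f (fourier_inv h)) at_top"
    using l1 by (simp add: LIM_zero_iff)
  ultimately show ?thesis unfolding k_def F_def by (intro tendsto_unique[of at_top]) auto
qed

text \<open>The pairing of two inverse transforms is computed twice, by
  \<open>pairing_fourier_inv\<close> and by Parseval's identity. The difference D is therefore
  annihilated by every h in \<open>L12\<close>; choosing for h the conjugate of a truncation of D
  gives D = 0.\<close>

theorem fourier_L2_fourier_inv:
  assumes a: "L12 a" shows "AE \<xi> in lborel. fourier_L2 (fourier_inv a) \<xi> = a \<xi>"
proof -
  define F where "F = fourier_L2 (fourier_inv a)"
  define k where "k = complex_of_real (1 / (2 * pi) ^ 3)"
  have k: "k * of_real ((2 * pi) ^ 3) = 1" by (simp add: k_def)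
  have w: "in_L2 (fourier_inv a)" by (rule fourier_inv_in_L2(1)[OF a])
  have L: "in_L2 F" "in_L2 a" using a w by (auto simp: F_def L12_def fourier_L2_in_L2)
  note [measurable] = in_L2_measurable[OF L(1)] in_L2_measurable[OF L(2)]
  define D where "D \<xi> = F (- \<xi>) - a (- \<xi>)" for \<xi>
  have D: "in_L2 D" unfolding D_def[abs_def] by (intro in_L2_diff in_L2_reflect L)
  have mD [measurable]: "D \<in> borel_measurable borel" using D by (rule in_L2_measurable)
  have orth: "(LINT \<xi>|lborel. h \<xi> * D \<xi>) = 0" if h: "L12 h" for h
  proof -
    have hL: "in_L2 h" "integrable lborel h" using h by (auto simp: L12_def)
    note [measurable] = in_L2_measurable[OF hL(1)]
    \<comment> \<open>With this conjugated reflection \<open>cnj (ft h')\<close> equals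
      \<open>ft h\<close>, which supplies the conjugate that Parseval's identity asks for.\<close>
    define h' where "h' \<xi> = cnj (h (- \<xi>))" for \<xi>
    have h': "L12 h'" unfolding h'_def[abs_def] L12_def
      using hL lborel_integrable_affine[OF hL(2), of "-1" 0] by (auto intro!: in_L2_cnj in_L2_reflect)
    have "cnj (ft h' x) = ft h x" for x
      unfolding ft_cnj h'_def by (simp add: ft_reflect[of "\<lambda>x. h x"])
    then have "pairing (fourier_inv a) (fourier_inv h) = (LINT x|lborel. (k * k) * (ft a x * cnj (ft h' x)))"
      unfolding pairing_def fourier_inv_ft k_def[symmetric] by (simp add: mult_ac)
    also have "\<dots> = (k * k) * (LINT x|lborel. ft a x * cnj (ft h' x))" by (rule integral_mult_right_zero)
    also have "(LINT x|lborel. ft a x * cnj (ft h' x)) = of_real ((2 * pi) ^ 3) * (LINT x|lborel. a x * cnj (h' x))"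
      using Plancherel[OF a] h' unfolding parseval_def by simp
    also have "(k * k) * (of_real ((2 * pi) ^ 3) * (LINT x|lborel. a x * cnj (h' x))) = k * (LINT x|lborel. a x * h (- x))"
    proof -
      have "(k * k) * (of_real ((2 * pi) ^ 3) * X) = k * (k * of_real ((2 * pi) ^ 3)) * X" for X
        by (simp only: mult_ac)
      then show ?thesis unfolding k h'_def by simp
    qed
    also have "(LINT x|lborel. a x * h (- x)) = (LINT x|lborel. h x * a (- x))"
      by (subst lborel_integral_affine[of _ "-1" 0]) (simp_all add: mult.commute)
    finally have "k * (LINT \<xi>|lborel. h \<xi> * F (- \<xi>)) = k * (LINT x|lborel. h x * a (- x))"
      using pairing_fourier_inv[OF w h] unfolding k_def F_def by simp
    then have "(LINT \<xi>|lborel. h \<xi> * F (- \<xi>)) = (LINT x|lborel. h x * a (- x))" by (simp add: k_def)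
    moreover have "(LINT \<xi>|lborel. h \<xi> * D \<xi>) = (LINT \<xi>|lborel. h \<xi> * F (- \<xi>)) - (LINT x|lborel. h x * a (- x))"
      unfolding D_def right_diff_distrib by (intro Bochner_Integration.integral_diff L2_Cauchy_Schwarz in_L2_reflect L hL)
    ultimately show ?thesis by simp
  qed
  have "AE x in lborel. trunc (real n) D x = 0" for n
  proof -
    have T: "L12 (\<lambda>x. cnj (trunc (real n) D x))" using trunc_L12[OF D, of "real n"] by (auto simp: L12_def in_L2_cnj)
    have "cnj (trunc (real n) D x) * D x = of_real ((cmod (trunc (real n) D x))\<^sup>2)" for x
      by (auto simp: trunc_def indicator_def complex_norm_square mult.commute simp del: of_real_power)
    then have "of_real (LINT x|lborel. (cmod (trunc (real n) D x))\<^sup>2) = (0::complex)"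
      using orth[OF T] by (simp only: integral_complex_of_real)
    then have z: "norm_L2 (trunc (real n) D) = 0" by (simp add: norm_L2_def del: of_real_power)
    have "in_L2 (trunc (real n) D)" using trunc_L12[OF D] by (simp add: L12_def)
    then have "N2 (trunc (real n) D) = 0" using z by (simp add: N2_norm_L2)
    then show ?thesis by (subst (asm) N2_eq_0) auto
  qed
  then have "AE x in lborel. \<forall>n. trunc (real n) D x = 0" by (simp add: AE_all_countable)
  then have "AE x in lborel. D x = 0"
  proof (rule eventually_mono)
    fix x assume *: "\<forall>n. trunc (real n) D x = 0"
    obtain n where "norm x < real n" using reals_Archimedean2 by blast
    then show "D x = 0" using *[rule_format, of n] by (simp add: trunc_def)
  qed
  from AE_reflect[OF this] have "AE x in lborel. D (- x) = 0" by simp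
  then show ?thesis by (simp add: D_def F_def)
qed

section \<open>Test functions with rapidly decaying Fourier transform\<close>

text \<open>The Japanese bracket of e \<xi>; \<open>schrodinger_symbol e\<close> is
  (\<open>jb e\<close> - 1) / e^2.\<close>

definition jb :: "real \<Rightarrow> real^3 \<Rightarrow> real" where
  "jb e \<xi> = sqrt (1 + e\<^sup>2 * (norm \<xi>)\<^sup>2)"

lemma jb_ge_1: "1 \<le> jb e \<xi>"
  by (simp add: jb_def)

lemma jb_pos: "0 < jb e \<xi>"
  using jb_ge_1[of e \<xi>] by linarith

text \<open>Frequency profiles of the test functions: Gaussians modulated by x0, closed under the
  multipliers of both equations and under partial differentiation. The rule \<open>jbi\<close> is
  forced by the latter, since the derivative of \<open>jb e\<close> in the j-th variable is e^2
  \<xi>_j / \<open>jb e\<close>.\<close>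

inductive nice :: "real \<Rightarrow> real^3 \<Rightarrow> (real^3 \<Rightarrow> complex) \<Rightarrow> bool" for e x0 where
  base: "nice e x0 (\<lambda>\<xi>. of_real (gauss 1 \<xi>) * cis (- (x0 \<bullet> \<xi>)))"
| coord: "nice e x0 F \<Longrightarrow> nice e x0 (\<lambda>\<xi>. of_real (\<xi> $ k) * F \<xi>)"
| jbm: "nice e x0 F \<Longrightarrow> nice e x0 (\<lambda>\<xi>. of_real (jb e \<xi>) * F \<xi>)"
| jbi: "nice e x0 F \<Longrightarrow> nice e x0 (\<lambda>\<xi>. of_real (1 / jb e \<xi>) * F \<xi>)"
| scale: "nice e x0 F \<Longrightarrow> nice e x0 (\<lambda>\<xi>. c * F \<xi>)"
| add: "nice e x0 F \<Longrightarrow> nice e x0 G \<Longrightarrow> nice e x0 (\<lambda>\<xi>. F \<xi> + G \<xi>)"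

lemma jb_measurable [measurable]: "jb e \<in> borel_measurable borel"
  unfolding jb_def[abs_def] by measurable

lemma nice_measurable: "nice e x0 F \<Longrightarrow> F \<in> borel_measurable borel"
proof (induction rule: nice.induct)
  case base then show ?case by measurable
next
  case (coord F k) then show ?case by measurable
next
  case (jbm F) then show ?case by measurable
next
  case (jbi F) then show ?case by measurable
next
  case (scale F c) then show ?case by measurable
next
  case (add F G) then show ?case by measurable
qed

definition gbounded :: "nat \<Rightarrow> real \<Rightarrow> (real^3 \<Rightarrow> complex) \<Rightarrow> bool" where
  "gbounded n C F \<longleftrightarrow> 0 \<le> C \<and> (\<forall>\<xi>. cmod (F \<xi>) \<le> C * (1 + norm \<xi>) ^ n * gauss 1 \<xi>)"

lemma gbounded_mult:
  assumes F: "gbounded n C F" and m: "\<And>\<xi>. \<bar>m \<xi>\<bar> \<le> B * (1 + norm \<xi>) ^ l" and B: "0 \<le> B"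
  shows "gbounded (l + n) (B * C) (\<lambda>\<xi>. of_real (m \<xi>) * F \<xi>)"
  unfolding gbounded_def
proof (intro conjI allI)
  show "0 \<le> B * C" using B F by (simp add: gbounded_def)
  fix \<xi>
  have "cmod (of_real (m \<xi>) * F \<xi>) = \<bar>m \<xi>\<bar> * cmod (F \<xi>)" by (simp add: norm_mult)
  also have "\<dots> \<le> (B * (1 + norm \<xi>) ^ l) * (C * (1 + norm \<xi>) ^ n * gauss 1 \<xi>)"
    using F B by (intro mult_mono m) (auto simp: gbounded_def gauss_def)
  also have "\<dots> = B * C * (1 + norm \<xi>) ^ (l + n) * gauss 1 \<xi>"
    by (simp only: power_add mult_ac)
  finally show "cmod (of_real (m \<xi>) * F \<xi>) \<le> B * C * (1 + norm \<xi>) ^ (l + n) * gauss 1 \<xi>" .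
qed

lemma jb_le: "jb e \<xi> \<le> (1 + \<bar>e\<bar>) * (1 + norm \<xi>)"
proof -
  have "1 + e\<^sup>2 * (norm \<xi>)\<^sup>2 \<le> (1 + \<bar>e\<bar> * norm \<xi>)\<^sup>2"
    by (simp add: power2_sum power_mult_distrib)
  then have "jb e \<xi> \<le> 1 + \<bar>e\<bar> * norm \<xi>"
    unfolding jb_def by (intro real_le_lsqrt) auto
  also have "\<dots> \<le> (1 + \<bar>e\<bar>) * (1 + norm \<xi>)" by (simp add: algebra_simps)
  finally show ?thesis .
qed

lemma nice_gbounded: "nice e x0 F \<Longrightarrow> \<exists>n C. gbounded n C F"
proof (induction rule: nice.induct)
  case base
  have "gbounded 0 1 (\<lambda>\<xi>. of_real (gauss 1 \<xi>) * cis (- (x0 \<bullet> \<xi>)))"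
    by (simp add: gbounded_def norm_mult gauss_nonneg)
  then show ?case by blast
next
  case (coord F k)
  then obtain n C where "gbounded n C F" by blast
  moreover have "\<bar>\<xi> $ k\<bar> \<le> 1 * (1 + norm \<xi>) ^ 1" for \<xi> :: "real^3"
    using component_le_norm_cart[of \<xi> k] by simp
  ultimately have "gbounded (1 + n) (1 * C) (\<lambda>\<xi>. of_real (\<xi> $ k) * F \<xi>)" by (rule gbounded_mult) simp
  then show ?case by blast
next
  case (jbm F)
  then obtain n C where "gbounded n C F" by blast
  moreover have "\<bar>jb e \<xi>\<bar> \<le> (1 + \<bar>e\<bar>) * (1 + norm \<xi>) ^ 1" for \<xi>
    using jb_le[of e \<xi>] jb_pos[of e \<xi>] by simp
  ultimately have "gbounded (1 + n) ((1 + \<bar>e\<bar>) * C) (\<lambda>\<xi>. of_real (jb e \<xi>) * F \<xi>)" by (rule gbounded_mult) simp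
  then show ?case by blast
next
  case (jbi F)
  then obtain n C where "gbounded n C F" by blast
  moreover have "\<bar>1 / jb e \<xi>\<bar> \<le> 1 * (1 + norm \<xi>) ^ 0" for \<xi>
    using jb_ge_1[of e \<xi>] by simp
  ultimately have "gbounded (0 + n) (1 * C) (\<lambda>\<xi>. of_real (1 / jb e \<xi>) * F \<xi>)" by (rule gbounded_mult) simp
  then show ?case by blast
next
  case (scale F c)
  then obtain n C where *: "gbounded n C F" by blast
  have "gbounded n (cmod c * C) (\<lambda>\<xi>. c * F \<xi>)"
    using * unfolding gbounded_def norm_mult mult.assoc by (auto intro: mult_left_mono)
  then show ?case by blast
next
  case (add F G)
  then obtain n C n' C' where 1: "gbounded n C F" and 2: "gbounded n' C' G" by blast
  have "gbounded (max n n') (C + C') (\<lambda>\<xi>. F \<xi> + G \<xi>)"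
    unfolding gbounded_def
  proof (intro conjI allI)
    show "0 \<le> C + C'" using 1 2 by (simp add: gbounded_def)
    fix \<xi>
    have "cmod (F \<xi>) \<le> C * (1 + norm \<xi>) ^ n * gauss 1 \<xi>" using 1 by (simp add: gbounded_def)
    also have "\<dots> \<le> C * (1 + norm \<xi>) ^ max n n' * gauss 1 \<xi>"
      using 1 by (intro mult_right_mono mult_left_mono power_increasing) (auto simp: gbounded_def gauss_nonneg)
    finally have a: "cmod (F \<xi>) \<le> C * (1 + norm \<xi>) ^ max n n' * gauss 1 \<xi>" .
    have "cmod (G \<xi>) \<le> C' * (1 + norm \<xi>) ^ n' * gauss 1 \<xi>" using 2 by (simp add: gbounded_def)
    also have "\<dots> \<le> C' * (1 + norm \<xi>) ^ max n n' * gauss 1 \<xi>"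
      using 2 by (intro mult_right_mono mult_left_mono power_increasing) (auto simp: gbounded_def gauss_nonneg)
    finally have b: "cmod (G \<xi>) \<le> C' * (1 + norm \<xi>) ^ max n n' * gauss 1 \<xi>" .
    have "cmod (F \<xi> + G \<xi>) \<le> cmod (F \<xi>) + cmod (G \<xi>)" by (rule norm_triangle_ineq)
    also have "\<dots> \<le> (C + C') * (1 + norm \<xi>) ^ max n n' * gauss 1 \<xi>" using a b by (simp add: distrib_right)
    finally show "cmod (F \<xi> + G \<xi>) \<le> (C + C') * (1 + norm \<xi>) ^ max n n' * gauss 1 \<xi>" .
  qed
  then show ?case by blast
qed

lemma power_le_fact_exp: "0 \<le> (x::real) \<Longrightarrow> x ^ n \<le> fact n * exp x"
proof -
  assume x: "0 \<le> x"
  have "(\<Sum>k\<in>{n}. x ^ k /\<^sub>R fact k) \<le> exp x"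
    unfolding exp_def by (rule sum_le_suminf[OF summable_exp_generic]) (use x in auto)
  then show ?thesis by (simp add: field_simps)
qed

text \<open>Apply x^n \<le> n! exp x at x = 1 + r with r = |\<xi>|, then 1 + r - r^2/2 \<le> 2 -
  r^2/4, which is (r/2 - 1)^2 \<ge> 0.\<close>

lemma gauss_absorb:
  fixes \<xi> :: "'a::euclidean_space"
  shows "(1 + norm \<xi>) ^ n * gauss 1 \<xi> \<le> fact n * exp 2 * exp (- (norm \<xi>)\<^sup>2 / 4)"
proof -
  have "(1 + norm \<xi>) ^ n * gauss 1 \<xi> \<le> (fact n * exp (1 + norm \<xi>)) * gauss 1 \<xi>"
    by (intro mult_right_mono power_le_fact_exp) (auto simp: gauss_nonneg)
  also have "\<dots> = fact n * exp (1 + norm \<xi> - (norm \<xi>)\<^sup>2 / 2)"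
  proof -
    have "exp (1 + norm \<xi>) * gauss 1 \<xi> = exp (1 + norm \<xi> + (- (norm \<xi>)\<^sup>2 / 2))"
      unfolding gauss_def mult_1 by (rule exp_add[symmetric])
    then show ?thesis by (simp only: mult.assoc) simp
  qed
  also have "\<dots> \<le> fact n * exp (2 + (- (norm \<xi>)\<^sup>2 / 4))"
  proof -
    have "0 \<le> (norm \<xi> / 2 - 1)\<^sup>2" by simp
    then have "1 + norm \<xi> - (norm \<xi>)\<^sup>2 / 2 \<le> 2 + (- (norm \<xi>)\<^sup>2 / 4)"
      by (simp add: power2_diff power_divide)
    then show ?thesis by simp
  qed
  finally show ?thesis by (simp only: exp_add mult.assoc)
qed

lemma exp_quarter_integrable: "integrable lborel (\<lambda>\<xi> :: 'a::euclidean_space. C * exp (- (norm \<xi>)\<^sup>2 / c))" if "0 < c"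
proof -
  have "gauss (sqrt (2 / c)) = (\<lambda>\<xi>::'a. exp (- (norm \<xi>)\<^sup>2 / c))"
    using that by (auto simp: gauss_def power_mult_distrib)
  then show ?thesis using gauss_FT(1)[of "sqrt (2 / c)", where 'a='a] that by simp
qed

lemma nice_bound: "nice e x0 F \<Longrightarrow> \<exists>C\<ge>0. \<forall>\<xi>. (1 + norm \<xi>) ^ k * cmod (F \<xi>) \<le> C * exp (- (norm \<xi>)\<^sup>2 / 4)"
proof -
  assume "nice e x0 F"
  then obtain n C where g: "gbounded n C F" using nice_gbounded by blast
  have "(1 + norm \<xi>) ^ k * cmod (F \<xi>) \<le> (C * (fact (k + n) * exp 2)) * exp (- (norm \<xi>)\<^sup>2 / 4)" for \<xi>
  proof -
    have "(1 + norm \<xi>) ^ k * cmod (F \<xi>) \<le> (1 + norm \<xi>) ^ k * (C * (1 + norm \<xi>) ^ n * gauss 1 \<xi>)"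
      using g by (intro mult_left_mono) (auto simp: gbounded_def)
    also have "\<dots> = C * ((1 + norm \<xi>) ^ (k + n) * gauss 1 \<xi>)" by (simp only: power_add mult_ac)
    also have "\<dots> \<le> C * (fact (k + n) * exp 2 * exp (- (norm \<xi>)\<^sup>2 / 4))"
      using g by (intro mult_left_mono gauss_absorb) (auto simp: gbounded_def)
    finally show ?thesis by (simp only: mult_ac)
  qed
  moreover have "0 \<le> C * (fact (k + n) * exp 2)" using g by (simp add: gbounded_def)
  ultimately show ?thesis by blast
qed

lemma nice_integrable_weighted:
  assumes "nice e x0 F" shows "integrable lborel (\<lambda>\<xi>. (1 + norm \<xi>) ^ k * cmod (F \<xi>))"
proof -
  note [measurable] = nice_measurable[OF assms]
  obtain C where "0 \<le> C" and C: "\<And>\<xi>. (1 + norm \<xi>) ^ k * cmod (F \<xi>) \<le> C * exp (- (norm \<xi>)\<^sup>2 / 4)"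
    using nice_bound[OF assms] by blast
  have "norm ((1 + norm \<xi>) ^ k * cmod (F \<xi>)) \<le> norm (C * exp (- (norm \<xi>)\<^sup>2 / 4))" for \<xi>
    using C[of \<xi>] by simp
  then show ?thesis
    by (intro Bochner_Integration.integrable_bound[OF exp_quarter_integrable[of 4 C]]) auto
qed

lemma nice_L12: assumes "nice e x0 F" shows "L12 F"
proof -
  note [measurable] = nice_measurable[OF assms]
  have i: "integrable lborel F"
    using nice_integrable_weighted[OF assms, of 0] by (simp add: integrable_norm_iff)
  obtain C where C0: "0 \<le> C" and C: "\<And>\<xi>. (1 + norm \<xi>) ^ 0 * cmod (F \<xi>) \<le> C * exp (- (norm \<xi>)\<^sup>2 / 4)"
    using nice_bound[OF assms] by blast
  have le: "cmod (F \<xi>) \<le> C" for \<xi>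
  proof -
    have "cmod (F \<xi>) \<le> C * exp (- (norm \<xi>)\<^sup>2 / 4)" using C[of \<xi>] by simp
    also have "\<dots> \<le> C * 1" using C0 by (intro mult_left_mono) auto
    finally show ?thesis by simp
  qed
  have "norm ((cmod (F \<xi>))\<^sup>2) \<le> norm (C * cmod (F \<xi>))" for \<xi>
    using le[of \<xi>] C0 by (simp add: power2_eq_square mult_right_mono)
  then have "integrable lborel (\<lambda>\<xi>. (cmod (F \<xi>))\<^sup>2)"
    by (intro Bochner_Integration.integrable_bound[OF integrable_mult_right[OF integrable_norm[OF i], of C]]) auto
  then show ?thesis using i by (simp add: L12_def in_L2_def)
qed

text \<open>Differentiability along one coordinate direction, at all points of all its lines: the
  form in which a factor x_j is traded for a derivative of F.\<close>

definition ldiff :: "3 \<Rightarrow> (real^3 \<Rightarrow> complex) \<Rightarrow> (real^3 \<Rightarrow> complex) \<Rightarrow> bool" where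
  "ldiff j F F' \<longleftrightarrow> (\<forall>\<xi> s. ((\<lambda>s. F (\<xi> + s *\<^sub>R axis j 1)) has_vector_derivative F' (\<xi> + s *\<^sub>R axis j 1)) (at s))"

lemma ldiff_mult:
  assumes "ldiff j F F'"
    and "\<And>\<xi> s. ((\<lambda>s. r (\<xi> + s *\<^sub>R axis j 1)) has_real_derivative r' (\<xi> + s *\<^sub>R axis j 1)) (at s)"
  shows "ldiff j (\<lambda>\<xi>. of_real (r \<xi>) * F \<xi>) (\<lambda>\<xi>. of_real (r \<xi>) * F' \<xi> + of_real (r' \<xi>) * F \<xi>)"
  unfolding ldiff_def
  by (intro allI has_vector_derivative_mult has_vector_derivative_of_real assms(2) assms(1)[unfolded ldiff_def, rule_format])

lemma norm_line: "(norm (\<xi> + s *\<^sub>R axis j 1))\<^sup>2 = (norm \<xi>)\<^sup>2 + 2 * s * \<xi> $ j + s\<^sup>2" for \<xi> :: "real^3"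
  unfolding power2_norm_eq_inner
  by (simp add: inner_add_left inner_add_right inner_axis inner_commute[of "axis j 1" \<xi>] inner_axis_axis power2_eq_square distrib_left)

lemma nth_line: "(\<xi> + s *\<^sub>R axis j 1) $ k = \<xi> $ k + (if k = j then s else 0)" for \<xi> :: "real^3"
  by (simp add: axis_def)

lemma jb_deriv:
  "((\<lambda>s. jb e (\<xi> + s *\<^sub>R axis j 1)) has_real_derivative (e\<^sup>2 * (\<xi> + s *\<^sub>R axis j 1) $ j * (1 / jb e (\<xi> + s *\<^sub>R axis j 1)))) (at s)"
proof -
  have pos: "0 < 1 + e\<^sup>2 * ((norm \<xi>)\<^sup>2 + 2 * s * \<xi> $ j + s\<^sup>2)"
    unfolding norm_line[symmetric] by (simp add: add_pos_nonneg)
  have d: "((\<lambda>s. 1 + e\<^sup>2 * ((norm \<xi>)\<^sup>2 + 2 * s * \<xi> $ j + s\<^sup>2)) has_real_derivative e\<^sup>2 * (2 * (\<xi> $ j + s))) (at s)"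
    by (auto intro!: derivative_eq_intros)
  have "inverse S / 2 * (E * (2 * a)) = E * a * (1 / S)" for S E a :: real
  proof -
    have "inverse S / 2 * (E * (2 * a)) = inverse S * (E * a) * (2 / 2)" by (simp only: divide_inverse mult_ac)
    also have "\<dots> = E * a * (1 / S)" by (simp only: divide_self_if) (simp add: inverse_eq_divide)
    finally show ?thesis .
  qed
  note eq = this
  have "((\<lambda>s. sqrt (1 + e\<^sup>2 * ((norm \<xi>)\<^sup>2 + 2 * s * \<xi> $ j + s\<^sup>2))) has_real_derivative
      e\<^sup>2 * (\<xi> $ j + s) * (1 / sqrt (1 + e\<^sup>2 * ((norm \<xi>)\<^sup>2 + 2 * s * \<xi> $ j + s\<^sup>2)))) (at s)"
    using DERIV_chain2[OF DERIV_real_sqrt[OF pos] d] unfolding eq .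
  then show ?thesis unfolding jb_def norm_line nth_line by (simp only: if_True simp_thms)
qed

lemma jb_inv_deriv:
  "((\<lambda>s. 1 / jb e (\<xi> + s *\<^sub>R axis j 1)) has_real_derivative
     - ((e\<^sup>2 * (\<xi> + s *\<^sub>R axis j 1) $ j * (1 / jb e (\<xi> + s *\<^sub>R axis j 1))) * (1 / jb e (\<xi> + s *\<^sub>R axis j 1)) * (1 / jb e (\<xi> + s *\<^sub>R axis j 1)))) (at s)"
proof -
  have "((\<lambda>s. inverse (jb e (\<xi> + s *\<^sub>R axis j 1))) has_real_derivative
     - (inverse (jb e (\<xi> + s *\<^sub>R axis j 1)) * (e\<^sup>2 * (\<xi> + s *\<^sub>R axis j 1) $ j * (1 / jb e (\<xi> + s *\<^sub>R axis j 1))) * inverse (jb e (\<xi> + s *\<^sub>R axis j 1)))) (at s)"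
    using jb_pos[of e "\<xi> + s *\<^sub>R axis j 1"] by (intro DERIV_inverse' jb_deriv) simp
  then show ?thesis by (simp only: inverse_eq_divide mult_ac)
qed

lemma gauss_deriv:
  "((\<lambda>s. gauss 1 (\<xi> + s *\<^sub>R axis j 1)) has_real_derivative - ((\<xi> + s *\<^sub>R axis j 1) $ j) * gauss 1 (\<xi> + s *\<^sub>R axis j 1)) (at s)" for \<xi> :: "real^3"
proof -
  have "((\<lambda>s. exp (- ((norm \<xi>)\<^sup>2 + 2 * s * \<xi> $ j + s\<^sup>2) / 2)) has_real_derivative
     exp (- ((norm \<xi>)\<^sup>2 + 2 * s * \<xi> $ j + s\<^sup>2) / 2) * (- (2 * \<xi> $ j + 2 * s) / 2)) (at s)"
    by (auto intro!: derivative_eq_intros)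
  moreover have "- (2 * \<xi> $ j + 2 * s) / 2 = - ((\<xi> + s *\<^sub>R axis j 1) $ j)" by (simp add: nth_line)
  ultimately show ?thesis unfolding gauss_def mult_1 norm_line by (simp only: mult.commute)
qed

lemma cis_line_deriv:
  "((\<lambda>s. cis (- (b + s * m))) has_vector_derivative - (\<i> * of_real m) * cis (- (b + s * m))) (at s)"
proof -
  have "((\<lambda>z. exp (- (\<i> * (of_real b + z * of_real m)))) has_field_derivative - (\<i> * of_real m) * exp (- (\<i> * (of_real b + of_real s * of_real m)))) (at (of_real s))"
    by (auto intro!: derivative_eq_intros)
  from has_vector_derivative_real_field[OF this, where s=UNIV]
  have "((\<lambda>s. exp (- (\<i> * (of_real b + of_real s * of_real m)))) has_vector_derivative - (\<i> * of_real m) * exp (- (\<i> * (of_real b + of_real s * of_real m)))) (at s)" .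
  moreover have "exp (- (\<i> * (of_real b + of_real s * of_real m))) = cis (- (b + s * m))" for s
    unfolding cis_conv_exp by (rule arg_cong[of _ _ exp]) (simp add: algebra_simps)
  ultimately show ?thesis by (simp only:)
qed

lemma nice_ldiff: "nice e x0 F \<Longrightarrow> \<exists>F'. nice e x0 F' \<and> ldiff j F F'"
proof (induction rule: nice.induct)
  case base
  define B where "B = (\<lambda>\<xi>. of_real (gauss 1 \<xi>) * cis (- (x0 \<bullet> \<xi>)))"
  define C where "C = (\<lambda>\<xi>. cis (- (x0 \<bullet> \<xi>)))"
  have B: "nice e x0 B" unfolding B_def by (rule nice.base)
  have "ldiff j C (\<lambda>\<xi>. - (\<i> * of_real (x0 $ j)) * C \<xi>)"
    unfolding ldiff_def C_def using cis_line_deriv[of "x0 \<bullet> _" "x0 $ j"]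
    by (simp add: inner_add_right inner_axis)
  from ldiff_mult[OF this gauss_deriv]
  have "ldiff j B (\<lambda>\<xi>. of_real (gauss 1 \<xi>) * (- (\<i> * of_real (x0 $ j)) * C \<xi>) + of_real (- (\<xi> $ j) * gauss 1 \<xi>) * C \<xi>)"
    unfolding B_def C_def .
  also have "(\<lambda>\<xi>. of_real (gauss 1 \<xi>) * (- (\<i> * of_real (x0 $ j)) * C \<xi>) + of_real (- (\<xi> $ j) * gauss 1 \<xi>) * C \<xi>)
     = (\<lambda>\<xi>. (- (\<i> * of_real (x0 $ j))) * B \<xi> + (- 1) * (of_real (\<xi> $ j) * B \<xi>))"
    by (auto simp: B_def C_def fun_eq_iff)
  finally have l: "ldiff j B (\<lambda>\<xi>. (- (\<i> * of_real (x0 $ j))) * B \<xi> + (- 1) * (of_real (\<xi> $ j) * B \<xi>))" .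
  have "nice e x0 (\<lambda>\<xi>. (- (\<i> * of_real (x0 $ j))) * B \<xi> + (- 1) * (of_real (\<xi> $ j) * B \<xi>))"
    by (intro nice.add nice.scale nice.coord B)
  then show ?case using l unfolding B_def by blast
next
  case (coord F k)
  then obtain F' where F': "nice e x0 F'" "ldiff j F F'" by blast
  have d: "((\<lambda>s. (\<xi> + s *\<^sub>R axis j 1) $ k) has_real_derivative (if k = j then 1 else 0)) (at s)" for \<xi> :: "real^3" and s
    unfolding nth_line by (auto intro!: derivative_eq_intros)
  have "nice e x0 (\<lambda>\<xi>. of_real (\<xi> $ k) * F' \<xi> + of_real (if k = j then 1 else 0) * F \<xi>)"
    by (intro nice.add nice.coord nice.scale F' coord)
  then show ?case using ldiff_mult[OF F'(2), of "\<lambda>\<xi>. \<xi> $ k", OF d] by blast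
next
  case (jbm F)
  then obtain F' where F': "nice e x0 F'" "ldiff j F F'" by blast
  have "nice e x0 (\<lambda>\<xi>. of_real (jb e \<xi>) * F' \<xi> + (of_real (e\<^sup>2) * (of_real (\<xi> $ j) * (of_real (1 / jb e \<xi>) * F \<xi>))))"
    by (intro nice.add nice.coord nice.scale nice.jbm nice.jbi F' jbm)
  also have "(\<lambda>\<xi>. of_real (jb e \<xi>) * F' \<xi> + (of_real (e\<^sup>2) * (of_real (\<xi> $ j) * (of_real (1 / jb e \<xi>) * F \<xi>))))
    = (\<lambda>\<xi>. of_real (jb e \<xi>) * F' \<xi> + of_real (e\<^sup>2 * \<xi> $ j * (1 / jb e \<xi>)) * F \<xi>)"
    by (simp only: of_real_mult mult.assoc)
  finally show ?case using ldiff_mult[OF F'(2), of "jb e", OF jb_deriv] by blast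
next
  case (jbi F)
  then obtain F' where F': "nice e x0 F'" "ldiff j F F'" by blast
  have "nice e x0 (\<lambda>\<xi>. of_real (1 / jb e \<xi>) * F' \<xi> + (- 1) * (of_real (e\<^sup>2) * (of_real (\<xi> $ j) * (of_real (1 / jb e \<xi>) * (of_real (1 / jb e \<xi>) * (of_real (1 / jb e \<xi>) * F \<xi>))))))"
    by (intro nice.add nice.coord nice.scale nice.jbm nice.jbi F' jbi)
  also have "(\<lambda>\<xi>. of_real (1 / jb e \<xi>) * F' \<xi> + (- 1) * (of_real (e\<^sup>2) * (of_real (\<xi> $ j) * (of_real (1 / jb e \<xi>) * (of_real (1 / jb e \<xi>) * (of_real (1 / jb e \<xi>) * F \<xi>))))))
    = (\<lambda>\<xi>. of_real (1 / jb e \<xi>) * F' \<xi> + of_real (- ((e\<^sup>2 * \<xi> $ j * (1 / jb e \<xi>)) * (1 / jb e \<xi>) * (1 / jb e \<xi>))) * F \<xi>)"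
    by (simp only: of_real_mult of_real_minus mult.assoc mult_minus_left mult_1)
  finally show ?case using ldiff_mult[OF F'(2), of "\<lambda>\<xi>. 1 / jb e \<xi>", OF jb_inv_deriv] by blast
next
  case (scale F c)
  then obtain F' where F': "nice e x0 F'" "ldiff j F F'" by blast
  have "ldiff j (\<lambda>\<xi>. c * F \<xi>) (\<lambda>\<xi>. c * F' \<xi>)"
    using F'(2) unfolding ldiff_def by (auto intro: has_vector_derivative_mult_right)
  then show ?case using nice.scale[OF F'(1)] by blast
next
  case (add F G)
  then obtain F' G' where F': "nice e x0 F'" "ldiff j F F'" and G': "nice e x0 G'" "ldiff j G G'" by blast
  have "ldiff j (\<lambda>\<xi>. F \<xi> + G \<xi>) (\<lambda>\<xi>. F' \<xi> + G' \<xi>)"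
    using F'(2) G'(2) unfolding ldiff_def by (auto intro: has_vector_derivative_add)
  then show ?case using nice.add[OF F'(1) G'(1)] by blast
qed

text \<open>Difference quotients along the sequence 1/(n+1), the form in which dominated convergence
  can use a derivative.\<close>

lemma seq_of_vector_derivative:
  fixes f :: "real \<Rightarrow> complex"
  assumes "(f has_vector_derivative D) (at 0)"
  shows "(\<lambda>n. (f (1 / real (Suc n)) - f 0) / of_real (1 / real (Suc n))) \<longlonglongrightarrow> D"
proof -
  have "((\<lambda>y. norm ((f y - f 0) - (y - 0) *\<^sub>R D) / norm (y - 0)) \<longlongrightarrow> 0) (at 0)"
    using assms unfolding has_vector_derivative_def has_derivative_iff_norm by blast
  moreover have "filterlim (\<lambda>n. 1 / real (Suc n)) (at 0) sequentially"
    using LIMSEQ_inverse_real_of_nat by (intro filterlim_atI) (auto simp: divide_inverse)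
  ultimately have lim: "(\<lambda>n. norm ((f (1 / real (Suc n)) - f 0) - (1 / real (Suc n) - 0) *\<^sub>R D) / norm (1 / real (Suc n) - 0)) \<longlonglongrightarrow> 0"
    by (rule filterlim_compose)
  have q: "norm ((f s - f 0) - (s - 0) *\<^sub>R D) / norm (s - 0) = norm ((f s - f 0) / of_real s - D)" if "0 < s" for s
  proof -
    have "of_real s * (X / of_real s) = X" for X :: complex using that by simp
    then have "(f s - f 0) - s *\<^sub>R D = of_real s * ((f s - f 0) / of_real s - D)"
      by (simp only: scaleR_conv_of_real right_diff_distrib)
    then have "norm ((f s - f 0) - s *\<^sub>R D) = s * norm ((f s - f 0) / of_real s - D)"
      using that by (simp only: norm_mult norm_of_real abs_of_pos)
    then show ?thesis using that by simp
  qed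
  have eq: "norm ((f (1 / real (Suc n)) - f 0) - (1 / real (Suc n) - 0) *\<^sub>R D) / norm (1 / real (Suc n) - 0)
     = norm ((f (1 / real (Suc n)) - f 0) / of_real (1 / real (Suc n)) - D)" for n
    by (rule q) simp
  show ?thesis using lim unfolding eq by (simp only: tendsto_norm_zero_iff LIM_zero_iff)
qed

lemma cis_approx: "cmod (cis s - 1 - \<i> * of_real s) \<le> s\<^sup>2 / 2"
proof -
  have "cmod (iexp s - (\<Sum>k\<le>1. (\<i> * s) ^ k / fact k)) \<le> \<bar>s\<bar> ^ Suc 1 / fact (Suc 1)"
    by (rule iexp_approx1)
  then show ?thesis by (simp add: cis_conv_exp numeral_2_eq_2 diff_diff_eq)
qed

lemma nice_weighted_integrable:
  assumes "nice e x0 F" "m \<in> borel_measurable borel" "\<And>\<xi>. cmod (m \<xi>) \<le> B * (1 + norm \<xi>) ^ k"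
  shows "integrable lborel (\<lambda>\<xi>. m \<xi> * F \<xi>)"
proof -
  note [measurable] = nice_measurable[OF assms(1)] assms(2)
  have i: "integrable lborel (\<lambda>\<xi>. B * ((1 + norm \<xi>) ^ k * cmod (F \<xi>)))"
    by (intro integrable_mult_right nice_integrable_weighted[OF assms(1)])
  have "cmod (m \<xi> * F \<xi>) \<le> norm (B * ((1 + norm \<xi>) ^ k * cmod (F \<xi>)))" for \<xi>
  proof -
    have "cmod (m \<xi> * F \<xi>) \<le> (B * (1 + norm \<xi>) ^ k) * cmod (F \<xi>)"
      unfolding norm_mult by (intro mult_right_mono assms(3)) simp
    then show ?thesis by (simp add: mult.assoc)
  qed
  then show ?thesis by (intro Bochner_Integration.integrable_bound[OF i]) auto
qed

text \<open>The remainder estimate |cis s - 1 - i s| \<le> s^2/2 under the integral leaves an error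
  |h|^2 K, where K is a second moment of |F|; divided by |h| it is sandwiched by |h| K.\<close>

lemma ft_has_derivative:
  assumes F: "nice e x0 F"
  shows "(ft F has_derivative (\<lambda>h. LINT \<xi>|lborel. cis (x \<bullet> \<xi>) * (\<i> * of_real (h \<bullet> \<xi>) * F \<xi>))) (at x)"
proof -
  note [measurable] = nice_measurable[OF F]
  define G where "G h = (LINT \<xi>|lborel. cis (x \<bullet> \<xi>) * (\<i> * of_real (h \<bullet> \<xi>) * F \<xi>))" for h
  have iF: "integrable lborel F" using nice_L12[OF F] by (simp add: L12_def)
  have iG: "integrable lborel (\<lambda>\<xi>. cis (x \<bullet> \<xi>) * (\<i> * of_real (h \<bullet> \<xi>) * F \<xi>))" for h
  proof -
    have "integrable lborel (\<lambda>\<xi>. (\<i> * of_real (h \<bullet> \<xi>)) * F \<xi>)"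
    proof (rule nice_weighted_integrable[OF F, where B="norm h" and k=1])
      fix \<xi> :: "real^3"
      have "cmod (\<i> * of_real (h \<bullet> \<xi>)) = \<bar>h \<bullet> \<xi>\<bar>" by (simp add: norm_mult)
      also have "\<dots> \<le> norm h * norm \<xi>" by (rule Cauchy_Schwarz_ineq2)
      also have "\<dots> \<le> norm h * (1 + norm \<xi>) ^ 1" by (intro mult_left_mono) auto
      finally show "cmod (\<i> * of_real (h \<bullet> \<xi>)) \<le> norm h * (1 + norm \<xi>) ^ 1" .
    qed measurable
    then show ?thesis by (rule osc_integrable[of "\<lambda>x. x", rotated]) simp
  qed
  define K where "K = (LINT \<xi>|lborel. (1 + norm \<xi>) ^ 2 * cmod (F \<xi>))"
  have iK: "integrable lborel (\<lambda>\<xi>. (1 + norm \<xi>) ^ 2 * cmod (F \<xi>))" by (rule nice_integrable_weighted[OF F])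
  have pw: "norm \<xi> \<le> (1 + norm \<xi>) ^ 2" "(norm \<xi>)\<^sup>2 \<le> (1 + norm \<xi>) ^ 2" for \<xi> :: "real^3"
    by (auto simp: power2_sum intro: order_trans[of _ "2 * norm \<xi>"])
  have bl: "bounded_linear G"
  proof (rule bounded_linear_intro[where K=K])
    fix h h' :: "real^3" and r :: real
    have "G (h + h') = (LINT \<xi>|lborel. cis (x \<bullet> \<xi>) * (\<i> * of_real (h \<bullet> \<xi>) * F \<xi>) + cis (x \<bullet> \<xi>) * (\<i> * of_real (h' \<bullet> \<xi>) * F \<xi>))"
      unfolding G_def by (simp add: inner_add_left ring_distribs)
    also have "\<dots> = G h + G h'" unfolding G_def by (rule Bochner_Integration.integral_add[OF iG iG])
    finally show "G (h + h') = G h + G h'" .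
    have "G (r *\<^sub>R h) = (LINT \<xi>|lborel. of_real r * (cis (x \<bullet> \<xi>) * (\<i> * of_real (h \<bullet> \<xi>) * F \<xi>)))"
      unfolding G_def by (simp add: mult_ac)
    also have "\<dots> = r *\<^sub>R G h" unfolding G_def scaleR_conv_of_real by (rule integral_mult_right_zero)
    finally show "G (r *\<^sub>R h) = r *\<^sub>R G h" .
    have "cmod (G h) \<le> (LINT \<xi>|lborel. norm h * ((1 + norm \<xi>) ^ 2 * cmod (F \<xi>)))"
      unfolding G_def
    proof (rule Bochner_Integration.integral_norm_bound_integral[OF iG integrable_mult_right[OF iK]])
      fix \<xi> :: "real^3"
      have "cmod (cis (x \<bullet> \<xi>) * (\<i> * of_real (h \<bullet> \<xi>) * F \<xi>)) = \<bar>h \<bullet> \<xi>\<bar> * cmod (F \<xi>)"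
        by (simp add: norm_mult)
      also have "\<dots> \<le> (norm h * norm \<xi>) * cmod (F \<xi>)" by (intro mult_right_mono Cauchy_Schwarz_ineq2) simp
      also have "\<dots> \<le> (norm h * (1 + norm \<xi>) ^ 2) * cmod (F \<xi>)" by (intro mult_right_mono mult_left_mono pw) auto
      finally show "cmod (cis (x \<bullet> \<xi>) * (\<i> * of_real (h \<bullet> \<xi>) * F \<xi>)) \<le> norm h * ((1 + norm \<xi>) ^ 2 * cmod (F \<xi>))"
        by (simp only: mult.assoc)
    qed
    also have "\<dots> = norm h * K" unfolding K_def by (rule integral_mult_right_zero)
    finally show "cmod (G h) \<le> norm h * K" .
  qed
  have "(ft F has_derivative G) (at x)"
  proof (rule has_derivativeI_sandwich[where e=1 and H="\<lambda>y. norm (y - x) * K"])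
    fix y assume "y \<noteq> x"
    define h where "h = y - x"
    have h: "0 < norm h" using \<open>y \<noteq> x\<close> by (simp add: h_def)
    have i1: "integrable lborel (\<lambda>\<xi>. cis (z \<bullet> \<xi>) * F \<xi>)" for z by (rule osc_integrable[of "\<lambda>x. x", OF _ iF]) simp
    have eq: "ft F y - ft F x - G (y - x) = (LINT \<xi>|lborel. cis (x \<bullet> \<xi>) * (cis (h \<bullet> \<xi>) - 1 - \<i> * of_real (h \<bullet> \<xi>)) * F \<xi>)"
    proof -
      have cy: "cis (y \<bullet> \<xi>) = cis (x \<bullet> \<xi>) * cis (h \<bullet> \<xi>)" for \<xi>
        by (simp add: cis_mult h_def inner_diff_left)
      have "ft F y - ft F x - G h = (LINT \<xi>|lborel. cis (y \<bullet> \<xi>) * F \<xi> - cis (x \<bullet> \<xi>) * F \<xi> - cis (x \<bullet> \<xi>) * (\<i> * of_real (h \<bullet> \<xi>) * F \<xi>))"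
        unfolding osc_def G_def using i1 iG by (subst Bochner_Integration.integral_diff) (auto intro: Bochner_Integration.integrable_diff)
      then show ?thesis unfolding h_def[symmetric] cy by (simp add: ring_distribs mult.assoc)
    qed
    have "cmod (ft F y - ft F x - G (y - x)) \<le> (LINT \<xi>|lborel. (norm h)\<^sup>2 * ((1 + norm \<xi>) ^ 2 * cmod (F \<xi>)))"
      unfolding eq
    proof (rule Bochner_Integration.integral_norm_bound_integral[OF _ integrable_mult_right[OF iK]])
      have b: "cmod (cis (x \<bullet> \<xi>) * (cis (h \<bullet> \<xi>) - 1 - \<i> * of_real (h \<bullet> \<xi>)) * F \<xi>) \<le> (norm h)\<^sup>2 * ((1 + norm \<xi>) ^ 2 * cmod (F \<xi>))" for \<xi>
      proof -
        have "cmod (cis (x \<bullet> \<xi>) * (cis (h \<bullet> \<xi>) - 1 - \<i> * of_real (h \<bullet> \<xi>)) * F \<xi>) \<le> ((h \<bullet> \<xi>)\<^sup>2 / 2) * cmod (F \<xi>)"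
          unfolding norm_mult norm_cis mult_1 by (intro mult_right_mono cis_approx) simp
        also have "(h \<bullet> \<xi>)\<^sup>2 / 2 \<le> (norm h)\<^sup>2 * (1 + norm \<xi>) ^ 2"
        proof -
          have "(h \<bullet> \<xi>)\<^sup>2 = \<bar>h \<bullet> \<xi>\<bar>\<^sup>2" by simp
          also have "\<dots> \<le> (norm h * norm \<xi>)\<^sup>2" by (intro power_mono Cauchy_Schwarz_ineq2) simp
          also have "\<dots> \<le> (norm h)\<^sup>2 * (1 + norm \<xi>) ^ 2" unfolding power_mult_distrib by (intro mult_left_mono pw) simp
          finally have "(h \<bullet> \<xi>)\<^sup>2 \<le> (norm h)\<^sup>2 * (1 + norm \<xi>) ^ 2" .
          moreover have "(h \<bullet> \<xi>)\<^sup>2 / 2 \<le> (h \<bullet> \<xi>)\<^sup>2" by simp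
          ultimately show ?thesis by linarith
        qed
        then have "((h \<bullet> \<xi>)\<^sup>2 / 2) * cmod (F \<xi>) \<le> ((norm h)\<^sup>2 * (1 + norm \<xi>) ^ 2) * cmod (F \<xi>)" by (intro mult_right_mono) auto
        finally show ?thesis by (simp only: mult.assoc)
      qed
      show "integrable lborel (\<lambda>\<xi>. cis (x \<bullet> \<xi>) * (cis (h \<bullet> \<xi>) - 1 - \<i> * of_real (h \<bullet> \<xi>)) * F \<xi>)"
        by (rule Bochner_Integration.integrable_bound[OF integrable_mult_right[OF iK, of "(norm h)\<^sup>2"]]) (use b in \<open>auto intro: order_trans\<close>)
      show "cmod (cis (x \<bullet> \<xi>) * (cis (h \<bullet> \<xi>) - 1 - \<i> * of_real (h \<bullet> \<xi>)) * F \<xi>) \<le> (norm h)\<^sup>2 * ((1 + norm \<xi>) ^ 2 * cmod (F \<xi>))" for \<xi> by (rule b)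
    qed
    also have "\<dots> = (norm h)\<^sup>2 * K" unfolding K_def by (rule integral_mult_right_zero)
    finally show "norm (ft F y - ft F x - G (y - x)) / norm (y - x) \<le> norm (y - x) * K"
      using h unfolding h_def[symmetric] by (simp add: divide_simps power2_eq_square mult_ac)
  next
    have "((\<lambda>y. norm (y - x) * K) \<longlongrightarrow> norm (x - x) * K) (at x)" by (intro tendsto_intros)
    then show "((\<lambda>y. norm (y - x) * K) \<longlongrightarrow> 0) (at x)" by simp
  qed (use bl in auto)
  then show ?thesis unfolding G_def .
qed

lemma partial_fourier_inv:
  assumes "nice e x0 F"
  shows "fourier_inv F differentiable (at x)"
    and "partial_deriv j (fourier_inv F) = fourier_inv (\<lambda>\<xi>. \<i> * (of_real (\<xi> $ j) * F \<xi>))"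
proof -
  define k where "k = complex_of_real (1 / (2 * pi) ^ 3)"
  have d: "(fourier_inv F has_derivative (\<lambda>h. k * (LINT \<xi>|lborel. cis (x \<bullet> \<xi>) * (\<i> * of_real (h \<bullet> \<xi>) * F \<xi>)))) (at x)" for x
    unfolding fourier_inv_ft[abs_def] k_def by (intro has_derivative_mult_right ft_has_derivative[OF assms])
  then show "fourier_inv F differentiable (at x)" by (auto simp: differentiable_def)
  show "partial_deriv j (fourier_inv F) = fourier_inv (\<lambda>\<xi>. \<i> * (of_real (\<xi> $ j) * F \<xi>))"
  proof
    fix x
    have "partial_deriv j (fourier_inv F) x = k * (LINT \<xi>|lborel. cis (x \<bullet> \<xi>) * (\<i> * of_real (axis j 1 \<bullet> \<xi>) * F \<xi>))"
      unfolding partial_deriv_def by (simp only: frechet_derivative_at[OF d, symmetric])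
    also have "\<dots> = k * (LINT \<xi>|lborel. cis (x \<bullet> \<xi>) * (\<i> * (of_real (\<xi> $ j) * F \<xi>)))"
      by (simp add: inner_axis inner_commute[of "axis j 1"] mult.assoc)
    finally show "partial_deriv j (fourier_inv F) x = fourier_inv (\<lambda>\<xi>. \<i> * (of_real (\<xi> $ j) * F \<xi>)) x"
      unfolding fourier_inv_ft osc_def k_def .
  qed
qed

lemma nice_partial: "nice e x0 F \<Longrightarrow> nice e x0 (\<lambda>\<xi>. \<i> * (of_real (\<xi> $ j) * F \<xi>))"
  by (intro nice.scale nice.coord)

lemma iter_partial_fourier_inv:
  "nice e x0 F \<Longrightarrow> \<exists>G. nice e x0 G \<and> iter_partial is (fourier_inv F) = fourier_inv G"
proof (induction "is")
  case (Cons i js)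
  then obtain G where "nice e x0 G" "iter_partial js (fourier_inv F) = fourier_inv G" by blast
  then show ?case using partial_fourier_inv(2)[of e x0 G i] nice_partial[of e x0 G i] by auto
qed auto

text \<open>Integration by parts done by translation: shifting F by s in direction j multiplies its
  transform at x by a character in s, and the difference quotients of both sides at s = 0 are
  compared.\<close>

lemma ft_coord:
  assumes F: "nice e x0 F" and F': "nice e x0 F'" and d: "ldiff j F F'"
  shows "- (\<i> * of_real (x $ j)) * ft F x = ft F' x"
proof -
  define v where "v = (axis j 1 :: real^3)"
  have nv: "norm v = 1" by (simp add: v_def)
  note [measurable] = nice_measurable[OF F] nice_measurable[OF F']
  have iF: "integrable lborel F" using nice_L12[OF F] by (simp add: L12_def)
  define s where "s n = 1 / real (Suc n)" for n
  have s: "0 < s n" "s n \<le> 1" for n by (auto simp: s_def)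
  have iFs: "integrable lborel (\<lambda>\<xi>. F (\<xi> + r *\<^sub>R v))" for r
    using lborel_integrable_affine[OF iF, of 1 "r *\<^sub>R v"] by (simp add: add.commute)
  have shift: "cis (- (0 + r * (x $ j))) * ft F x = (LINT \<xi>|lborel. cis (x \<bullet> \<xi>) * F (\<xi> + r *\<^sub>R v))" for r
  proof -
    have "ft F x = (LINT \<xi>|lborel. cis (x \<bullet> (r *\<^sub>R v + 1 *\<^sub>R \<xi>)) * F (r *\<^sub>R v + 1 *\<^sub>R \<xi>))"
      unfolding osc_def by (subst lborel_integral_affine[of _ 1 "r *\<^sub>R v"]) simp_all
    also have "\<dots> = (LINT \<xi>|lborel. cis (r * (x $ j)) * (cis (x \<bullet> \<xi>) * F (\<xi> + r *\<^sub>R v)))"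
      unfolding mult.assoc[symmetric] cis_mult by (simp add: inner_add_right v_def inner_axis add.commute)
    also have "\<dots> = cis (r * (x $ j)) * (LINT \<xi>|lborel. cis (x \<bullet> \<xi>) * F (\<xi> + r *\<^sub>R v))" by (rule integral_mult_right_zero)
    finally have "cis (- (0 + r * (x $ j))) * ft F x = (cis (- (0 + r * (x $ j))) * cis (r * (x $ j))) * (LINT \<xi>|lborel. cis (x \<bullet> \<xi>) * F (\<xi> + r *\<^sub>R v))"
      by (simp only: mult.assoc)
    then show ?thesis by (simp add: cis_mult)
  qed
  have q: "(cis (- (0 + s n * (x $ j))) - cis (- (0 + 0 * (x $ j)))) / of_real (s n) * ft F x
     = (LINT \<xi>|lborel. cis (x \<bullet> \<xi>) * ((F (\<xi> + s n *\<^sub>R v) - F (\<xi> + 0 *\<^sub>R v)) / of_real (s n)))" for n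
  proof -
    have i: "integrable lborel (\<lambda>\<xi>. cis (x \<bullet> \<xi>) * F (\<xi> + r *\<^sub>R v))" for r
      by (rule osc_integrable[of "\<lambda>x. x", OF _ iFs]) simp
    have "(cis (- (0 + s n * (x $ j))) - cis (- (0 + 0 * (x $ j)))) / of_real (s n) * ft F x
      = (cis (- (0 + s n * (x $ j))) * ft F x - cis (- (0 + 0 * (x $ j))) * ft F x) / of_real (s n)"
      by (simp only: left_diff_distrib times_divide_eq_left)
    also have "\<dots> = (LINT \<xi>|lborel. cis (x \<bullet> \<xi>) * F (\<xi> + s n *\<^sub>R v) - cis (x \<bullet> \<xi>) * F (\<xi> + 0 *\<^sub>R v)) / of_real (s n)"
      unfolding shift by (subst Bochner_Integration.integral_diff[OF i i]) simp
    also have "\<dots> = (LINT \<xi>|lborel. (cis (x \<bullet> \<xi>) * F (\<xi> + s n *\<^sub>R v) - cis (x \<bullet> \<xi>) * F (\<xi> + 0 *\<^sub>R v)) / of_real (s n))"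
      by (rule integral_divide_zero[symmetric])
    also have "\<dots> = (LINT \<xi>|lborel. cis (x \<bullet> \<xi>) * ((F (\<xi> + s n *\<^sub>R v) - F (\<xi> + 0 *\<^sub>R v)) / of_real (s n)))"
      by (simp only: right_diff_distrib[symmetric] times_divide_eq_right)
    finally show ?thesis .
  qed
  have l1: "(\<lambda>n. (cis (- (0 + s n * (x $ j))) - cis (- (0 + 0 * (x $ j)))) / of_real (s n) * ft F x) \<longlonglongrightarrow> (- (\<i> * of_real (x $ j)) * cis (- (0 + 0 * (x $ j)))) * ft F x"
    unfolding s_def by (intro tendsto_mult_right seq_of_vector_derivative cis_line_deriv)
  obtain C where C0: "0 \<le> C" and C: "\<And>\<xi>. (1 + norm \<xi>) ^ 0 * cmod (F' \<xi>) \<le> C * exp (- (norm \<xi>)\<^sup>2 / 4)"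
    using nice_bound[OF F'] by blast
  \<comment> \<open>Domination of the difference quotients. By the mean value inequality they are
    bounded by F' at a point shifted by at most 1, and |\<xi>|^2 \<le> 2 |\<xi> + r v|^2 + 2 turns
    its Gaussian bound into one at \<xi> with half the exponent.\<close>
  have mv: "cmod ((F (\<xi> + s n *\<^sub>R v) - F (\<xi> + 0 *\<^sub>R v)) / of_real (s n)) \<le> (C * exp (1/2)) * exp (- (norm \<xi>)\<^sup>2 / 8)" for n \<xi>
  proof -
    have dd: "((\<lambda>r. F (\<xi> + r *\<^sub>R v)) has_vector_derivative F' (\<xi> + r *\<^sub>R v)) (at r)" for r
      using d unfolding ldiff_def v_def by blast
    have "\<exists>r\<in>{0<..<s n}. norm (F (\<xi> + s n *\<^sub>R v) - F (\<xi> + 0 *\<^sub>R v)) \<le> norm ((s n - 0) *\<^sub>R F' (\<xi> + r *\<^sub>R v))"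
      by (rule mvt_general[OF s(1), of _ "\<lambda>r. F (\<xi> + r *\<^sub>R v)" "\<lambda>r h. h *\<^sub>R F' (\<xi> + r *\<^sub>R v)"])
         (auto intro!: continuous_at_imp_continuous_on has_vector_derivative_continuous[OF dd] dd[unfolded has_vector_derivative_def])
    then obtain r where r: "0 < r" "r < s n" and le: "norm (F (\<xi> + s n *\<^sub>R v) - F (\<xi> + 0 *\<^sub>R v)) \<le> s n * cmod (F' (\<xi> + r *\<^sub>R v))"
      using s(1)[of n] by auto
    have "cmod ((F (\<xi> + s n *\<^sub>R v) - F (\<xi> + 0 *\<^sub>R v)) / of_real (s n)) = norm (F (\<xi> + s n *\<^sub>R v) - F (\<xi> + 0 *\<^sub>R v)) / s n"
      using s(1)[of n] by (simp add: norm_divide)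
    also have "\<dots> \<le> cmod (F' (\<xi> + r *\<^sub>R v))" using le s(1)[of n] by (simp add: divide_le_eq mult.commute)
    also have "\<dots> \<le> C * exp (- (norm (\<xi> + r *\<^sub>R v))\<^sup>2 / 4)" using C[of "\<xi> + r *\<^sub>R v"] by simp
    also have "\<dots> \<le> C * exp (1/2 + (- (norm \<xi>)\<^sup>2 / 8))"
    proof -
      have "norm \<xi> \<le> norm (\<xi> + r *\<^sub>R v) + 1"
      proof -
        have "norm \<xi> = norm ((\<xi> + r *\<^sub>R v) - r *\<^sub>R v)" by simp
        also have "\<dots> \<le> norm (\<xi> + r *\<^sub>R v) + norm (r *\<^sub>R v)" by (rule norm_triangle_ineq4)
        also have "norm (r *\<^sub>R v) \<le> 1" using r s(2)[of n] nv by simp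
        finally show ?thesis by simp
      qed
      then have "(norm \<xi>)\<^sup>2 \<le> (norm (\<xi> + r *\<^sub>R v) + 1)\<^sup>2" by (intro power_mono) auto
      also have "\<dots> \<le> 2 * (norm (\<xi> + r *\<^sub>R v))\<^sup>2 + 2"
        using sum_squares_bound[of "norm (\<xi> + r *\<^sub>R v)" 1] by (simp add: power2_sum)
      finally have "- (norm (\<xi> + r *\<^sub>R v))\<^sup>2 / 4 \<le> 1/2 + (- (norm \<xi>)\<^sup>2 / 8)" by simp
      then show ?thesis using C0 by (intro mult_left_mono) auto
    qed
    also have "\<dots> = (C * exp (1/2)) * exp (- (norm \<xi>)\<^sup>2 / 8)" by (simp only: exp_add mult.assoc)
    finally show ?thesis .
  qed
  have l2: "(\<lambda>n. LINT \<xi>|lborel. cis (x \<bullet> \<xi>) * ((F (\<xi> + s n *\<^sub>R v) - F (\<xi> + 0 *\<^sub>R v)) / of_real (s n))) \<longlonglongrightarrow> (LINT \<xi>|lborel. cis (x \<bullet> \<xi>) * F' \<xi>)"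
  proof (rule integral_dominated_convergence[where w="\<lambda>\<xi>. (C * exp (1/2)) * exp (- (norm \<xi>)\<^sup>2 / 8)"])
    show "integrable lborel (\<lambda>\<xi>::real^3. (C * exp (1/2)) * exp (- (norm \<xi>)\<^sup>2 / 8))" by (rule exp_quarter_integrable) simp
    show "AE \<xi> in lborel. cmod (cis (x \<bullet> \<xi>) * ((F (\<xi> + s n *\<^sub>R v) - F (\<xi> + 0 *\<^sub>R v)) / of_real (s n))) \<le> (C * exp (1/2)) * exp (- (norm \<xi>)\<^sup>2 / 8)" for n
      unfolding norm_mult[of "cis _"] norm_cis mult_1 by (intro AE_I2 mv)
    show "AE \<xi> in lborel. (\<lambda>n. cis (x \<bullet> \<xi>) * ((F (\<xi> + s n *\<^sub>R v) - F (\<xi> + 0 *\<^sub>R v)) / of_real (s n))) \<longlonglongrightarrow> cis (x \<bullet> \<xi>) * F' \<xi>"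
    proof (rule AE_I2)
      fix \<xi>
      have "((\<lambda>r. F (\<xi> + r *\<^sub>R v)) has_vector_derivative F' (\<xi> + 0 *\<^sub>R v)) (at 0)"
        using d unfolding ldiff_def v_def by blast
      from seq_of_vector_derivative[OF this]
      show "(\<lambda>n. cis (x \<bullet> \<xi>) * ((F (\<xi> + s n *\<^sub>R v) - F (\<xi> + 0 *\<^sub>R v)) / of_real (s n))) \<longlonglongrightarrow> cis (x \<bullet> \<xi>) * F' \<xi>"
        unfolding s_def by (intro tendsto_mult_left) simp
    qed
  qed measurable
  show ?thesis using LIMSEQ_unique[OF l1[unfolded q] l2] by (simp add: osc_def)
qed

text \<open>Induction on the power: one factor |x| is at most the sum of the |x_j|, and each |x_j|
  is absorbed into a derivative of F by \<open>ft_coord\<close>.\<close>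

lemma fourier_inv_rapid:
  "nice e x0 F \<Longrightarrow> \<exists>B. \<forall>x. norm x ^ n * cmod (fourier_inv F x) \<le> B"
proof (induction n arbitrary: F)
  case 0
  then have "integrable lborel F" using nice_L12 by (auto simp: L12_def)
  then have "cmod (ft F x) \<le> (LINT y|lborel. cmod (F y))" for x by (intro osc_bound) auto
  then have "norm x ^ 0 * cmod (fourier_inv F x) \<le> cmod (complex_of_real (1 / (2 * pi) ^ 3)) * (LINT y|lborel. cmod (F y))" for x
    unfolding fourier_inv_ft norm_mult power_0 mult_1 by (intro mult_left_mono) auto
  then show ?case by blast
next
  case (Suc n)
  have "\<exists>B. \<forall>x. norm x ^ n * (\<bar>x $ j\<bar> * cmod (fourier_inv F x)) \<le> B" for j
  proof -
    obtain F' where F': "nice e x0 F'" "ldiff j F F'" using nice_ldiff[OF Suc.prems] by blast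
    obtain B where B: "\<And>x. norm x ^ n * cmod (fourier_inv F' x) \<le> B" using Suc.IH[OF F'(1)] by blast
    have "\<bar>x $ j\<bar> * cmod (fourier_inv F x) = cmod (fourier_inv F' x)" for x
    proof -
      have "cmod (- (\<i> * of_real (x $ j)) * ft F x) = cmod (ft F' x)" by (simp only: ft_coord[OF Suc.prems F'])
      then have "\<bar>x $ j\<bar> * cmod (ft F x) = cmod (ft F' x)" by (simp add: norm_mult)
      then show ?thesis unfolding fourier_inv_ft norm_mult by (metis mult.left_commute)
    qed
    then show ?thesis using B by auto
  qed
  then obtain B where B: "\<And>j x. norm x ^ n * (\<bar>x $ j\<bar> * cmod (fourier_inv F x)) \<le> B j" by metis
  have "norm x ^ Suc n * cmod (fourier_inv F x) \<le> (\<Sum>j\<in>UNIV. B j)" for x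
  proof -
    have "norm x ^ Suc n * cmod (fourier_inv F x) \<le> (\<Sum>j\<in>UNIV. \<bar>x $ j\<bar>) * (norm x ^ n * cmod (fourier_inv F x))"
      unfolding power_Suc mult.assoc by (intro mult_right_mono norm_le_l1_cart) auto
    also have "\<dots> = (\<Sum>j\<in>UNIV. norm x ^ n * (\<bar>x $ j\<bar> * cmod (fourier_inv F x)))"
      unfolding sum_distrib_right by (simp only: mult.left_commute)
    also have "\<dots> \<le> (\<Sum>j\<in>UNIV. B j)" by (intro sum_mono B)
    finally show ?thesis .
  qed
  then show ?case by blast
qed

lemma schwartz_fourier_inv: assumes "nice e x0 F" shows "schwartz (fourier_inv F)"
  unfolding schwartz_def smooth_def
proof (intro conjI allI)
  fix "is" :: "3 list" and n :: nat
  obtain G where G: "nice e x0 G" "iter_partial is (fourier_inv F) = fourier_inv G"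
    using iter_partial_fourier_inv[OF assms] by blast
  show "iter_partial is (fourier_inv F) differentiable (at x)" for x
    unfolding G(2) by (rule partial_fourier_inv(1)[OF G(1)])
  obtain B where "\<And>x. norm x ^ n * cmod (fourier_inv G x) \<le> B" using fourier_inv_rapid[OF G(1)] by blast
  then show "bounded (range (\<lambda>x. (norm x ^ n) *\<^sub>R iter_partial is (fourier_inv F) x))"
    unfolding G(2) bounded_iff by (auto simp: norm_mult)
qed

lemma laplacian_fourier_inv:
  assumes "nice e x0 F"
  shows "laplacian (fourier_inv F) = fourier_inv (\<lambda>\<xi>. - of_real ((norm \<xi>)\<^sup>2) * F \<xi>)"
    and "nice e x0 (\<lambda>\<xi>. - of_real ((norm \<xi>)\<^sup>2) * F \<xi>)"
proof -
  define H where "H j \<xi> = \<i> * (of_real (\<xi> $ j) * (\<i> * (of_real (\<xi> $ j) * F \<xi>)))" for j :: 3 and \<xi> :: "real^3"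
  have H: "nice e x0 (H j)" for j unfolding H_def by (intro nice_partial assms)
  have iH: "integrable lborel (H j)" for j using nice_L12[OF H] by (simp add: L12_def)
  have sumH: "(\<Sum>j\<in>UNIV. H j \<xi>) = - of_real ((norm \<xi>)\<^sup>2) * F \<xi>" for \<xi>
  proof -
    have "(norm \<xi>)\<^sup>2 = (\<Sum>j\<in>UNIV. (\<xi> $ j)\<^sup>2)"
      unfolding power2_norm_eq_inner by (simp add: inner_vec_def power2_eq_square)
    moreover have "H j \<xi> = - (of_real ((\<xi> $ j)\<^sup>2) * F \<xi>)" for j
    proof -
      have "\<i> * (a * (\<i> * (a * b))) = (\<i> * \<i>) * (a\<^sup>2 * b)" for a b :: complex
        by (simp only: power2_eq_square mult_ac)
      then show ?thesis unfolding H_def by simp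
    qed
    ultimately show ?thesis by (simp add: sum_distrib_right sum_negf)
  qed
  show "nice e x0 (\<lambda>\<xi>. - of_real ((norm \<xi>)\<^sup>2) * F \<xi>)"
    unfolding sumH[symmetric] sum_3 by (intro nice.add H)
  show "laplacian (fourier_inv F) = fourier_inv (\<lambda>\<xi>. - of_real ((norm \<xi>)\<^sup>2) * F \<xi>)"
  proof
    fix x
    have "laplacian (fourier_inv F) x = (\<Sum>j\<in>UNIV. fourier_inv (H j) x)"
      unfolding laplacian_def partial_fourier_inv(2)[OF assms] partial_fourier_inv(2)[OF nice_partial[OF assms]] H_def[abs_def] ..
    also have "\<dots> = fourier_inv (\<lambda>\<xi>. H 1 \<xi> + H 2 \<xi> + H 3 \<xi>) x"
      unfolding sum_3 fourier_inv_ft using iH by (simp add: ft_add distrib_left)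
    also have "(\<lambda>\<xi>. H 1 \<xi> + H 2 \<xi> + H 3 \<xi>) = (\<lambda>\<xi>. - of_real ((norm \<xi>)\<^sup>2) * F \<xi>)"
      using sumH unfolding sum_3 by auto
    finally show "laplacian (fourier_inv F) x = fourier_inv (\<lambda>\<xi>. - of_real ((norm \<xi>)\<^sup>2) * F \<xi>) x" .
  qed
qed

text \<open>(1 + |x|^2)^3 dominates the product of the three factors 1 + x_b^2, so the integral is
  at most the cube of a one-dimensional one.\<close>

lemma integrable_inverse_poly: "integrable lborel (\<lambda>x::real^3. 1 / (1 + (norm x)\<^sup>2) ^ 3)"
proof -
  have "set_integrable lborel (einterval (-\<infinity>) \<infinity>) (\<lambda>x. inverse (1 + x^2))" by (rule integrable_inverse_1_plus_square)
  then have i: "integrable lborel (\<lambda>x::real. inverse (1 + x\<^sup>2))" by (simp add: set_integrable_def einterval_def)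
  have "(\<integral>\<^sup>+x. ennreal (norm (1 / (1 + (norm (x::real^3))\<^sup>2) ^ 3)) \<partial>lborel) \<le> (\<integral>\<^sup>+x. (\<Prod>b\<in>Basis. ennreal (inverse (1 + ((x::real^3) \<bullet> b)\<^sup>2))) \<partial>lborel)"
  proof (rule nn_integral_mono)
    fix x :: "real^3"
    have "1 / (1 + (norm x)\<^sup>2) ^ 3 = (\<Prod>b\<in>(Basis::(real^3) set). inverse (1 + (norm x)\<^sup>2))"
      by (simp add: power_one_over inverse_eq_divide)
    also have "\<dots> \<le> (\<Prod>b\<in>Basis. inverse (1 + (x \<bullet> b)\<^sup>2))"
    proof (rule prod_mono, intro conjI)
      fix b :: "real^3" assume "b \<in> Basis"
      then have "(x \<bullet> b)\<^sup>2 \<le> (norm x)\<^sup>2"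
        using Basis_le_norm[of b x] by (metis abs_ge_zero power2_abs power_mono)
      then show "inverse (1 + (norm x)\<^sup>2) \<le> inverse (1 + (x \<bullet> b)\<^sup>2)"
        by (intro le_imp_inverse_le) (auto intro: add_pos_nonneg)
    qed (simp add: add_nonneg_nonneg)
    finally have "ennreal (1 / (1 + (norm x)\<^sup>2) ^ 3) \<le> ennreal (\<Prod>b\<in>Basis. inverse (1 + (x \<bullet> b)\<^sup>2))" by (rule ennreal_leI)
    also have "\<dots> = (\<Prod>b\<in>Basis. ennreal (inverse (1 + (x \<bullet> b)\<^sup>2)))" by (rule prod_ennreal[symmetric]) (simp add: add_nonneg_nonneg)
    finally show "ennreal (norm (1 / (1 + (norm x)\<^sup>2) ^ 3)) \<le> (\<Prod>b\<in>Basis. ennreal (inverse (1 + (x \<bullet> b)\<^sup>2)))"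
      by (simp add: add_nonneg_nonneg)
  qed
  also have "\<dots> = (\<Prod>b\<in>(Basis::(real^3) set). (\<integral>\<^sup>+x. ennreal (inverse (1 + x\<^sup>2)) \<partial>lborel))"
    by (rule nn_integral_lborel_prod) auto
  also have "\<dots> < \<infinity>"
  proof -
    have "(\<integral>\<^sup>+x. ennreal (inverse (1 + x\<^sup>2)) \<partial>lborel) = ennreal (LINT x|lborel. inverse (1 + x\<^sup>2))"
      using i by (rule nn_integral_eq_integral) (simp add: add_nonneg_nonneg)
    then show ?thesis by (simp add: power_less_top_ennreal)
  qed
  finally show ?thesis by (intro integrableI_bounded) auto
qed

text \<open>Decay of order 6 is enough because (1 + r^2)^3 \<le> 8 (1 + r^6), by the cases r \<le> 1
  and r > 1.\<close>

lemma fourier_inv_L12: assumes F: "nice e x0 F" shows "L12 (fourier_inv F)"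
proof -
  have L2: "in_L2 (fourier_inv F)" by (rule fourier_inv_in_L2(1)[OF nice_L12[OF F]])
  obtain B0 where B0: "\<And>x. norm x ^ 0 * cmod (fourier_inv F x) \<le> B0" using fourier_inv_rapid[OF F] by blast
  obtain B6 where B6: "\<And>x. norm x ^ 6 * cmod (fourier_inv F x) \<le> B6" using fourier_inv_rapid[OF F] by blast
  have le: "cmod (fourier_inv F x) \<le> norm ((8 * (B0 + B6)) * (1 / (1 + (norm x)\<^sup>2) ^ 3))" for x
  proof -
    have "(1 + (norm x)\<^sup>2) ^ 3 \<le> 8 * (1 + norm x ^ 6)"
    proof (cases "norm x \<le> 1")
      case True
      then have "(norm x)\<^sup>2 \<le> 1" by (simp add: power_le_one)
      then have "(1 + (norm x)\<^sup>2) ^ 3 \<le> 2 ^ 3" by (intro power_mono) auto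
      also have "(2::real) ^ 3 \<le> 8 * (1 + norm x ^ 6)" by simp
      finally show ?thesis .
    next
      case False
      then have "1 \<le> (norm x)\<^sup>2" by (intro one_le_power) simp
      then have "(1 + (norm x)\<^sup>2) ^ 3 \<le> (2 * (norm x)\<^sup>2) ^ 3" by (intro power_mono) auto
      also have "(2 * (norm x)\<^sup>2) ^ 3 = 8 * norm x ^ 6" by (simp add: power_mult_distrib power_mult[symmetric])
      finally show ?thesis by simp
    qed
    then have "cmod (fourier_inv F x) * (1 + (norm x)\<^sup>2) ^ 3 \<le> cmod (fourier_inv F x) * (8 * (1 + norm x ^ 6))" by (rule mult_left_mono) simp
    also have "\<dots> = 8 * (norm x ^ 0 * cmod (fourier_inv F x) + norm x ^ 6 * cmod (fourier_inv F x))" by (simp add: algebra_simps)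
    also have "\<dots> \<le> 8 * (B0 + B6)" by (intro mult_left_mono add_mono B0 B6) simp
    finally have *: "cmod (fourier_inv F x) * (1 + (norm x)\<^sup>2) ^ 3 \<le> 8 * (B0 + B6)" .
    have pos: "0 < (1 + (norm x)\<^sup>2) ^ 3" by (simp add: add_pos_nonneg)
    have "cmod (fourier_inv F x) \<le> (8 * (B0 + B6)) * (1 / (1 + (norm x)\<^sup>2) ^ 3)"
      using * pos by (simp add: pos_le_divide_eq)
    then show ?thesis unfolding real_norm_def by (rule order_trans) (rule abs_ge_self)
  qed
  have "integrable lborel (fourier_inv F)"
    by (rule Bochner_Integration.integrable_bound[OF integrable_mult_right[OF integrable_inverse_poly, of "8 * (B0 + B6)"]])
       (use le in_L2_measurable[OF L2] in auto)
  then show ?thesis using L2 by (simp add: L12_def)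
qed

lemma fourier_inv_cong_AE:
  assumes "AE \<xi> in lborel. F \<xi> = G \<xi>" "F \<in> borel_measurable borel" "G \<in> borel_measurable borel"
  shows "fourier_inv F = fourier_inv G"
  using ft_cong_AE[OF assms] by (auto simp: fourier_inv_ft)

lemma schrodinger_symbol_measurable [measurable]: "schrodinger_symbol e \<in> borel_measurable borel"
  unfolding schrodinger_symbol_def[abs_def] by measurable

text \<open>\<open>schrodinger_op\<close> applies the integral \<open>fourier\<close> to
  \<open>fourier_inv F\<close>. Since that function is in \<open>L12\<close>, the inversion theorem
  identifies the result with F almost everywhere, which is enough under the outer integral.\<close>

lemma schrodinger_op_fourier_inv:
  assumes F: "nice e x0 F"
  shows "schrodinger_op e (fourier_inv F) = fourier_inv (\<lambda>\<xi>. of_real (schrodinger_symbol e \<xi>) * F \<xi>)"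
    and "nice e x0 (\<lambda>\<xi>. of_real (schrodinger_symbol e \<xi>) * F \<xi>)"
proof -
  have L: "L12 (fourier_inv F)" by (rule fourier_inv_L12[OF F])
  have "AE \<xi> in lborel. fourier_L2 (fourier_inv F) \<xi> = F \<xi>" by (rule fourier_L2_fourier_inv[OF nice_L12[OF F]])
  moreover have "AE \<xi> in lborel. fourier_L2 (fourier_inv F) \<xi> = fourier (fourier_inv F) \<xi>" by (rule fourier_L2_L12[OF L])
  ultimately have AE: "AE \<xi> in lborel. of_real (schrodinger_symbol e \<xi>) * fourier (fourier_inv F) \<xi> = of_real (schrodinger_symbol e \<xi>) * F \<xi>"
    by eventually_elim simp
  have [measurable]: "fourier (fourier_inv F) \<in> borel_measurable borel" "F \<in> borel_measurable borel"
    using L by (auto intro: fourier_measurable L12_measurable nice_measurable[OF F])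
  show "schrodinger_op e (fourier_inv F) = fourier_inv (\<lambda>\<xi>. of_real (schrodinger_symbol e \<xi>) * F \<xi>)"
    unfolding schrodinger_op_def by (rule fourier_inv_cong_AE[OF AE]) measurable
  have "(\<lambda>\<xi>. of_real (schrodinger_symbol e \<xi>) * F \<xi>) = (\<lambda>\<xi>. of_real (1 / e\<^sup>2) * (of_real (jb e \<xi>) * F \<xi> + (- 1) * F \<xi>))"
    by (auto simp: schrodinger_symbol_def jb_def fun_eq_iff diff_divide_distrib algebra_simps)
  then show "nice e x0 (\<lambda>\<xi>. of_real (schrodinger_symbol e \<xi>) * F \<xi>)"
    by (simp only:) (intro nice.scale nice.add nice.jbm F)
qed

section \<open>The solutions in Fourier variables\<close>

text \<open>The Lagrange remainder is applied to real and imaginary part at different intermediate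
  points, which costs the factor 2.\<close>

lemma taylor_complex:
  fixes y :: "nat \<Rightarrow> real \<Rightarrow> complex"
  assumes d: "\<And>n t. (y n has_vector_derivative y (Suc n) t) (at t)"
    and M: "\<And>s. \<bar>s\<bar> \<le> \<bar>t\<bar> \<Longrightarrow> cmod (y n s) \<le> M"
  shows "cmod (y 0 t - (\<Sum>k<n. of_real (t ^ k / fact k) * y k 0)) \<le> 2 * (M * (\<bar>t\<bar> ^ n / fact n))"
proof -
  define R where "R = y 0 t - (\<Sum>k<n. of_real (t ^ k / fact k) * y k 0)"
  have dRe: "\<forall>m x. ((\<lambda>s. Re (y m s)) has_real_derivative Re (y (Suc m) x)) (at x)"
    using bounded_linear.has_vector_derivative[OF bounded_linear_Re d] by (simp add: has_real_derivative_iff_has_vector_derivative)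
  have dIm: "\<forall>m x. ((\<lambda>s. Im (y m s)) has_real_derivative Im (y (Suc m) x)) (at x)"
    using bounded_linear.has_vector_derivative[OF bounded_linear_Im d] by (simp add: has_real_derivative_iff_has_vector_derivative)
  obtain a where a: "\<bar>a\<bar> \<le> \<bar>t\<bar>" "Re (y 0 t) = (\<Sum>m<n. Re (y m 0) / fact m * t ^ m) + Re (y n a) / fact n * t ^ n"
    using Maclaurin_all_le[where diff="\<lambda>m s. Re (y m s)" and f="\<lambda>s. Re (y 0 s)" and x=t and n=n, OF _ dRe] by auto
  obtain b where b: "\<bar>b\<bar> \<le> \<bar>t\<bar>" "Im (y 0 t) = (\<Sum>m<n. Im (y m 0) / fact m * t ^ m) + Im (y n b) / fact n * t ^ n"
    using Maclaurin_all_le[where diff="\<lambda>m s. Im (y m s)" and f="\<lambda>s. Im (y 0 s)" and x=t and n=n, OF _ dIm] by auto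
  have rmul: "Re (of_real r * z) = r * Re z" "Im (of_real r * z) = r * Im z" for r z by simp_all
  have ReR: "Re R = Re (y n a) / fact n * t ^ n"
  proof -
    have "Re (\<Sum>k<n. of_real (t ^ k / fact k) * y k 0) = (\<Sum>m<n. Re (y m 0) / fact m * t ^ m)"
      unfolding Re_sum rmul by (intro sum.cong refl) simp
    then show ?thesis unfolding R_def using a(2) by simp
  qed
  have ImR: "Im R = Im (y n b) / fact n * t ^ n"
  proof -
    have "Im (\<Sum>k<n. of_real (t ^ k / fact k) * y k 0) = (\<Sum>m<n. Im (y m 0) / fact m * t ^ m)"
      unfolding Im_sum rmul by (intro sum.cong refl) simp
    then show ?thesis unfolding R_def using b(2) by simp
  qed
  have 1: "\<bar>Re R\<bar> \<le> M * (\<bar>t\<bar> ^ n / fact n)"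
  proof -
    have "\<bar>Re R\<bar> = \<bar>Re (y n a)\<bar> * (\<bar>t\<bar> ^ n / fact n)" unfolding ReR by (simp add: abs_mult power_abs)
    also have "\<dots> \<le> M * (\<bar>t\<bar> ^ n / fact n)"
      using order_trans[OF abs_Re_le_cmod M[OF a(1)]] by (rule mult_right_mono) simp
    finally show ?thesis .
  qed
  have 2: "\<bar>Im R\<bar> \<le> M * (\<bar>t\<bar> ^ n / fact n)"
  proof -
    have "\<bar>Im R\<bar> = \<bar>Im (y n b)\<bar> * (\<bar>t\<bar> ^ n / fact n)" unfolding ImR by (simp add: abs_mult power_abs)
    also have "\<dots> \<le> M * (\<bar>t\<bar> ^ n / fact n)"
      using order_trans[OF abs_Im_le_cmod M[OF b(1)]] by (rule mult_right_mono) simp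
    finally show ?thesis .
  qed
  have "cmod R \<le> \<bar>Re R\<bar> + \<bar>Im R\<bar>" by (rule cmod_le)
  then show ?thesis using 1 2 unfolding R_def by linarith
qed

lemma continuous_into_L2_bounded:
  assumes "continuous_into_L2 w" shows "\<exists>W\<ge>0. \<forall>s. \<bar>s\<bar> \<le> T \<longrightarrow> norm_L2 (w s) \<le> W"
proof -
  have L: "in_L2 (w s)" for s using assms by (simp add: continuous_into_L2_def)
  have tri: "norm_L2 (w a) \<le> norm_L2 (\<lambda>x. w a x - w b x) + norm_L2 (w b)" for a b
    using in_L2_add(2)[OF in_L2_diff(1)[OF L L] L, of a b b] by simp
  have le: "norm (norm_L2 (w s) - norm_L2 (w t)) \<le> norm_L2 (\<lambda>x. w s x - w t x)" for s t
  proof -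
    have "norm_L2 (\<lambda>x. w t x - w s x) = norm_L2 (\<lambda>x. w s x - w t x)"
      by (simp add: norm_L2_def norm_minus_commute)
    then show ?thesis using tri[of s t] tri[of t s] by (simp add: abs_le_iff)
  qed
  have "isCont (\<lambda>s. norm_L2 (w s)) t" for t
  proof -
    have "((\<lambda>s. norm_L2 (\<lambda>x. w s x - w t x)) \<longlongrightarrow> 0) (at t)" using assms by (simp add: continuous_into_L2_def)
    then have "((\<lambda>s. norm_L2 (w s) - norm_L2 (w t)) \<longlongrightarrow> 0) (at t)"
      by (rule Lim_null_comparison[OF always_eventually, rotated]) (intro allI le)
    then show ?thesis unfolding isCont_def by (simp only: LIM_zero_iff)
  qed
  then have "continuous_on {-T..T} (\<lambda>s. norm_L2 (w s))" by (intro continuous_at_imp_continuous_on) auto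
  then have "compact ((\<lambda>s. norm_L2 (w s)) ` {-T..T})" by (rule compact_continuous_image) simp
  then have "bounded ((\<lambda>s. norm_L2 (w s)) ` {-T..T})" by (rule compact_imp_bounded)
  then obtain W where "\<And>s. s \<in> {-T..T} \<Longrightarrow> norm (norm_L2 (w s)) \<le> W" by (meson bounded_iff imageI)
  then have "norm_L2 (w s) \<le> max W 0" if "\<bar>s\<bar> \<le> T" for s
  proof -
    have "s \<in> {-T..T}" using that by auto
    from \<open>\<And>s. s \<in> {-T..T} \<Longrightarrow> norm (norm_L2 (w s)) \<le> W\<close>[OF this] show ?thesis by simp
  qed
  then show ?thesis by (intro exI[of _ "max W 0"]) auto
qed

lemma L12_gauss_dominated:
  fixes H :: "'a::euclidean_space \<Rightarrow> complex"
  assumes [measurable]: "H \<in> borel_measurable borel" and le: "\<And>\<xi>. cmod (H \<xi>) \<le> C * exp (- (norm \<xi>)\<^sup>2 / 4)"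
  shows "L12 H"
proof -
  have C: "0 \<le> C" using order_trans[OF norm_ge_zero le[of 0]] by simp
  have i: "integrable lborel H"
    by (rule Bochner_Integration.integrable_bound[OF exp_quarter_integrable[of 4 C]]) (use le C in auto)
  have "norm ((cmod (H \<xi>))\<^sup>2) \<le> norm (C\<^sup>2 * exp (- (norm \<xi>)\<^sup>2 / 2))" for \<xi>
  proof -
    have "(cmod (H \<xi>))\<^sup>2 \<le> (C * exp (- (norm \<xi>)\<^sup>2 / 4))\<^sup>2" by (intro power_mono le) simp
    also have "\<dots> = C\<^sup>2 * exp (- (norm \<xi>)\<^sup>2 / 2)" by (simp add: power_mult_distrib exp_double[symmetric])
    finally show ?thesis by simp
  qed
  then have "integrable lborel (\<lambda>\<xi>. (cmod (H \<xi>))\<^sup>2)"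
    by (intro Bochner_Integration.integrable_bound[OF exp_quarter_integrable[of 2 "C\<^sup>2"]]) auto
  then show ?thesis using i by (simp add: L12_def in_L2_def)
qed

lemma pairing_le:
  assumes "in_L2 w" "L12 H" shows "cmod (pairing w (fourier_inv H)) \<le> norm_L2 w * (norm_L2 H / sqrt ((2 * pi) ^ 3))"
  unfolding pairing_def fourier_inv_in_L2(2)[OF assms(2), symmetric]
  by (rule L2_Cauchy_Schwarz(3)[OF assms(1) fourier_inv_in_L2(1)[OF assms(2)]])

section \<open>Uniqueness of the weakly formulated evolutions\<close>

definition wpacket :: "real^3 \<Rightarrow> real^3 \<Rightarrow> complex" where
  "wpacket x0 \<xi> = of_real (gauss 1 \<xi>) * cis (- (x0 \<bullet> \<xi>))"

lemma wpacket_measurable [measurable]: "wpacket x0 \<in> borel_measurable borel"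
  unfolding wpacket_def[abs_def] by measurable

lemma cmod_wpacket: "cmod (wpacket x0 \<xi>) = gauss 1 \<xi>"
  by (simp add: wpacket_def norm_mult gauss_nonneg)

text \<open>Uniqueness through analyticity in time. The Taylor coefficients at t = 0 of the pairing
  \<open>y 0\<close> are the integrals of the coefficients \<open>q k\<close> of the multiplier E,
  so both sides have the same Taylor polynomials. Both remainders of order 2n are at most a constant
  times t^(2n)/(2n)! (8/e^2)^n n!, which tends to 0. Even orders are used because for the wave
  equation the even time derivatives are again pairings with Gaussian-bounded profiles.\<close>

lemma evolution_pairing:
  fixes w :: "real \<Rightarrow> real^3 \<Rightarrow> complex"
  assumes e: "0 < e" and w: "continuous_into_L2 w"
    and m [measurable]: "m \<in> borel_measurable borel" and mb: "\<And>\<xi>. \<bar>m \<xi>\<bar> \<le> norm \<xi> / e"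
    and q [measurable]: "\<And>k. q k \<in> borel_measurable borel" and qb: "\<And>k \<xi>. cmod (q k \<xi>) \<le> \<bar>m \<xi>\<bar> ^ k"
    and E [measurable]: "E \<in> borel_measurable borel" and Eb: "\<And>\<xi>. cmod (E \<xi>) \<le> 1"
    and Ea: "\<And>n \<xi>. cmod (E \<xi> - (\<Sum>k<2 * n. of_real (t ^ k / fact k) * q k \<xi>)) \<le> \<bar>t * m \<xi>\<bar> ^ (2 * n) / fact (2 * n)"
    and y: "\<And>n t. (y n has_vector_derivative y (Suc n) t) (at t)"
    and y0: "\<And>t. y 0 t = pairing (w t) (fourier_inv (wpacket x0))"
    and y2: "\<And>n. \<exists>H. H \<in> borel_measurable borel \<and> (\<forall>\<xi>. cmod (H \<xi>) \<le> \<bar>m \<xi>\<bar> ^ (2 * n) * gauss 1 \<xi>) \<and> (\<forall>t. y (2 * n) t = pairing (w t) (fourier_inv H))"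
    and yi: "\<And>k. y k 0 = pairing (w 0) (fourier_inv (\<lambda>\<xi>. q k \<xi> * wpacket x0 \<xi>))"
  shows "pairing (w t) (fourier_inv (wpacket x0)) = of_real (1 / (2 * pi) ^ 3) * (LINT \<xi>|lborel. E \<xi> * wpacket x0 \<xi> * fourier_L2 (w 0) (- \<xi>))"
proof -
  \<comment> \<open>From |\<xi>|^(2n) \<le> 8^n n! exp(|\<xi>|^2/8): the exponent 3/8 is what
    remains of 1/2 after 1/8 has been spent on the polynomial factor.\<close>
  define g where "g \<xi> = complex_of_real (exp (- 3 * (norm \<xi>)\<^sup>2 / 8))" for \<xi> :: "real^3"
  have mg: "g \<in> borel_measurable borel" unfolding g_def[abs_def] by measurable
  have g: "L12 g"
    by (rule L12_gauss_dominated[OF mg, where C=1]) (simp add: g_def)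
  have gL: "in_L2 g" using g by (simp add: L12_def)
  have wL: "in_L2 (w s)" for s using w by (simp add: continuous_into_L2_def)
  define F where "F = fourier_L2 (w 0)"
  have FL: "in_L2 (\<lambda>\<xi>. F (- \<xi>))" unfolding F_def by (intro in_L2_reflect fourier_L2_in_L2 wL)
  note [measurable] = in_L2_measurable[OF FL]
  have mpow: "\<bar>m \<xi>\<bar> ^ (2 * n) * gauss 1 \<xi> \<le> ((8 / e\<^sup>2) ^ n * fact n) * cmod (g \<xi>)" for n \<xi>
  proof -
    have "\<bar>m \<xi>\<bar> ^ (2 * n) \<le> (norm \<xi> / e) ^ (2 * n)" by (intro power_mono mb) simp
    also have "\<dots> = (8 / e\<^sup>2) ^ n * ((norm \<xi>)\<^sup>2 / 8) ^ n"
      unfolding power_mult power_mult_distrib[symmetric] by (simp add: power_divide)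
    also have "\<dots> \<le> (8 / e\<^sup>2) ^ n * (fact n * exp ((norm \<xi>)\<^sup>2 / 8))" by (intro mult_left_mono power_le_fact_exp) auto
    finally have "\<bar>m \<xi>\<bar> ^ (2 * n) * gauss 1 \<xi> \<le> ((8 / e\<^sup>2) ^ n * (fact n * exp ((norm \<xi>)\<^sup>2 / 8))) * gauss 1 \<xi>"
      by (intro mult_right_mono) (auto simp: gauss_nonneg)
    also have "\<dots> = ((8 / e\<^sup>2) ^ n * fact n) * (exp ((norm \<xi>)\<^sup>2 / 8) * gauss 1 \<xi>)" by (simp only: mult.assoc)
    also have "exp ((norm \<xi>)\<^sup>2 / 8) * gauss 1 \<xi> = cmod (g \<xi>)"
      unfolding gauss_def g_def exp_add[symmetric] norm_of_real by simp
    finally show ?thesis .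
  qed
  have dom: "L12 H \<and> norm_L2 H \<le> ((8 / e\<^sup>2) ^ n * fact n) * norm_L2 g"
    if mH [measurable]: "H \<in> borel_measurable borel" and "\<And>\<xi>. cmod (H \<xi>) \<le> \<bar>m \<xi>\<bar> ^ (2 * n) * gauss 1 \<xi>" for H :: "real^3 \<Rightarrow> complex" and n
  proof -
    define A where "A = (8 / e\<^sup>2) ^ n * fact n"
    have A0: "0 \<le> A" by (simp add: A_def)
    have le: "cmod (H \<xi>) \<le> A * cmod (g \<xi>)" for \<xi> using order_trans[OF that(2) mpow] by (simp add: A_def)
    have "L12 H"
    proof (rule L12_gauss_dominated[OF mH, where C=A])
      fix \<xi>
      have "cmod (g \<xi>) \<le> exp (- (norm \<xi>)\<^sup>2 / 4)" by (simp add: g_def)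
      then show "cmod (H \<xi>) \<le> A * exp (- (norm \<xi>)\<^sup>2 / 4)"
        using le[of \<xi>] mult_left_mono[OF _ A0] by (meson order_trans)
    qed
    moreover have "N2 H \<le> N2 (\<lambda>\<xi>. of_real A * g \<xi>)" by (rule N2_mono) (use le A0 in \<open>simp add: norm_mult\<close>)
    then have "norm_L2 H \<le> norm_L2 (\<lambda>\<xi>. of_real A * g \<xi>)"
      by (intro in_L2_boundI(2) mH) (auto simp: N2_norm_L2[OF in_L2_cmult(1)[OF gL]])
    moreover have "norm_L2 (\<lambda>\<xi>. of_real A * g \<xi>) = A * norm_L2 g"
      using in_L2_cmult(2)[OF gL, of "of_real A"] A0 by simp
    ultimately show ?thesis by (simp add: A_def[symmetric])
  qed
  obtain W where W0: "0 \<le> W" and W: "\<And>s. \<bar>s\<bar> \<le> \<bar>t\<bar> \<Longrightarrow> norm_L2 (w s) \<le> W"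
    using continuous_into_L2_bounded[OF w, of "\<bar>t\<bar>"] by blast
  define c where "c = sqrt ((2 * pi) ^ 3)"
  have c: "0 < c" by (simp add: c_def)
  define \<kappa> where "\<kappa> = complex_of_real (1 / (2 * pi) ^ 3)"
  define a where "a n = \<bar>t\<bar> ^ (2 * n) / fact (2 * n) * (((8 / e\<^sup>2) ^ n * fact n) * norm_L2 g)" for n
  have T1: "cmod (y 0 t - (\<Sum>k<2 * n. of_real (t ^ k / fact k) * y k 0)) \<le> 2 * (W / c) * a n" for n
  proof -
    obtain H where H: "H \<in> borel_measurable borel" "\<And>\<xi>. cmod (H \<xi>) \<le> \<bar>m \<xi>\<bar> ^ (2 * n) * gauss 1 \<xi>" "\<And>t. y (2 * n) t = pairing (w t) (fourier_inv H)"
      using y2[of n] by blast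
    have "cmod (y (2 * n) s) \<le> W * ((((8 / e\<^sup>2) ^ n * fact n) * norm_L2 g) / c)" if s: "\<bar>s\<bar> \<le> \<bar>t\<bar>" for s
    proof -
      have "cmod (y (2 * n) s) \<le> norm_L2 (w s) * (norm_L2 H / c)"
        unfolding H(3) c_def using dom[OF H(1,2)] by (intro pairing_le wL) auto
      also have "\<dots> \<le> W * ((((8 / e\<^sup>2) ^ n * fact n) * norm_L2 g) / c)"
        using dom[OF H(1,2)] c W0 by (intro mult_mono W s divide_right_mono) auto
      finally show ?thesis .
    qed
    from taylor_complex[OF y this]
    show ?thesis unfolding a_def by (simp add: mult_ac)
  qed
  define S where "S n \<xi> = (\<Sum>k<2 * n. of_real (t ^ k / fact k) * q k \<xi>)" for n \<xi>
  have [measurable]: "S n \<in> borel_measurable borel" for n unfolding S_def[abs_def] by measurable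
  have qL: "L12 (\<lambda>\<xi>. q k \<xi> * wpacket x0 \<xi>)" for k
  proof (rule L12_gauss_dominated[where C="(1 / e) ^ k * (fact k * exp 2)"])
    fix \<xi> :: "real^3"
    have "cmod (q k \<xi> * wpacket x0 \<xi>) \<le> (norm \<xi> / e) ^ k * gauss 1 \<xi>"
      unfolding norm_mult cmod_wpacket by (intro mult_right_mono order_trans[OF qb] power_mono mb) (auto simp: gauss_nonneg)
    also have "\<dots> = (1 / e) ^ k * (norm \<xi> ^ k * gauss 1 \<xi>)" by (simp add: power_divide)
    also have "\<dots> \<le> (1 / e) ^ k * ((1 + norm \<xi>) ^ k * gauss 1 \<xi>)"
      using e by (intro mult_left_mono mult_right_mono power_mono) (auto simp: gauss_nonneg)
    also have "\<dots> \<le> (1 / e) ^ k * (fact k * exp 2 * exp (- (norm \<xi>)\<^sup>2 / 4))"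
      using e by (intro mult_left_mono gauss_absorb) auto
    finally show "cmod (q k \<xi> * wpacket x0 \<xi>) \<le> (1 / e) ^ k * (fact k * exp 2) * exp (- (norm \<xi>)\<^sup>2 / 4)" by (simp only: mult.assoc)
  qed measurable
  have qi: "integrable lborel (\<lambda>\<xi>. q k \<xi> * wpacket x0 \<xi> * F (- \<xi>))" for k
    using qL[of k] by (intro L2_Cauchy_Schwarz FL) (simp add: L12_def)
  have S: "(\<Sum>k<2 * n. of_real (t ^ k / fact k) * y k 0) = \<kappa> * (LINT \<xi>|lborel. S n \<xi> * wpacket x0 \<xi> * F (- \<xi>))"
    and Si: "integrable lborel (\<lambda>\<xi>. S n \<xi> * wpacket x0 \<xi> * F (- \<xi>))" for n
  proof -
    have yk: "y k 0 = \<kappa> * (LINT \<xi>|lborel. q k \<xi> * wpacket x0 \<xi> * F (- \<xi>))" for k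
      unfolding yi \<kappa>_def F_def by (rule pairing_fourier_inv[OF wL qL])
    have ex: "S n \<xi> * wpacket x0 \<xi> * F (- \<xi>) = (\<Sum>k<2 * n. of_real (t ^ k / fact k) * (q k \<xi> * wpacket x0 \<xi> * F (- \<xi>)))" for \<xi>
      unfolding S_def sum_distrib_right by (simp only: mult.assoc)
    show "integrable lborel (\<lambda>\<xi>. S n \<xi> * wpacket x0 \<xi> * F (- \<xi>))"
      unfolding ex by (intro Bochner_Integration.integrable_sum integrable_mult_right qi)
    have "(LINT \<xi>|lborel. S n \<xi> * wpacket x0 \<xi> * F (- \<xi>)) = (\<Sum>k<2 * n. LINT \<xi>|lborel. of_real (t ^ k / fact k) * (q k \<xi> * wpacket x0 \<xi> * F (- \<xi>)))"
      unfolding ex by (intro Bochner_Integration.integral_sum integrable_mult_right qi)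
    also have "\<dots> = (\<Sum>k<2 * n. of_real (t ^ k / fact k) * (LINT \<xi>|lborel. q k \<xi> * wpacket x0 \<xi> * F (- \<xi>)))"
      by (simp only: integral_mult_right_zero)
    finally show "(\<Sum>k<2 * n. of_real (t ^ k / fact k) * y k 0) = \<kappa> * (LINT \<xi>|lborel. S n \<xi> * wpacket x0 \<xi> * F (- \<xi>))"
      unfolding yk by (simp only: sum_distrib_left mult.left_commute[of \<kappa>])
  qed
  have wpL: "in_L2 (wpacket x0)"
  proof -
    have "L12 (wpacket x0)" by (rule L12_gauss_dominated[where C=1]) (auto simp: cmod_wpacket, auto simp: gauss_def)
    then show ?thesis by (simp add: L12_def)
  qed
  have Ei: "integrable lborel (\<lambda>\<xi>. E \<xi> * wpacket x0 \<xi> * F (- \<xi>))"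
    by (intro L2_Cauchy_Schwarz FL in_L2_bounded_mult(1)[OF wpL E Eb])
  have T2: "cmod ((LINT \<xi>|lborel. E \<xi> * wpacket x0 \<xi> * F (- \<xi>)) - (LINT \<xi>|lborel. S n \<xi> * wpacket x0 \<xi> * F (- \<xi>))) \<le> norm_L2 (\<lambda>\<xi>. F (- \<xi>)) * a n" for n
  proof -
    define b where "b = \<bar>t\<bar> ^ (2 * n) / fact (2 * n)"
    have b: "0 \<le> b" by (simp add: b_def)
    define H where "H \<xi> = (E \<xi> - S n \<xi>) * wpacket x0 \<xi>" for \<xi>
    have mH [measurable]: "H \<in> borel_measurable borel" unfolding H_def[abs_def] by measurable
    have le: "cmod (H \<xi>) \<le> (b * ((8 / e\<^sup>2) ^ n * fact n)) * cmod (g \<xi>)" for \<xi>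
    proof -
      have "cmod (H \<xi>) \<le> (\<bar>t * m \<xi>\<bar> ^ (2 * n) / fact (2 * n)) * gauss 1 \<xi>"
        unfolding H_def norm_mult cmod_wpacket S_def by (intro mult_right_mono Ea) (simp add: gauss_nonneg)
      also have "\<dots> = b * (\<bar>m \<xi>\<bar> ^ (2 * n) * gauss 1 \<xi>)" unfolding b_def abs_mult power_mult_distrib by simp
      also have "\<dots> \<le> b * (((8 / e\<^sup>2) ^ n * fact n) * cmod (g \<xi>))" by (intro mult_left_mono mpow b)
      finally show ?thesis by (simp only: mult.assoc)
    qed
    define A where "A = b * ((8 / e\<^sup>2) ^ n * fact n)"
    have A0: "0 \<le> A" using b by (simp add: A_def)
    have "N2 H \<le> N2 (\<lambda>\<xi>. of_real A * g \<xi>)" by (rule N2_mono) (use le[folded A_def] A0 in \<open>simp add: norm_mult\<close>)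
    then have HL: "in_L2 H" "norm_L2 H \<le> norm_L2 (\<lambda>\<xi>. of_real A * g \<xi>)"
      using in_L2_boundI[OF mH, of "norm_L2 (\<lambda>\<xi>. of_real A * g \<xi>)"] by (auto simp: N2_norm_L2[OF in_L2_cmult(1)[OF gL]])
    have "norm_L2 (\<lambda>\<xi>. of_real A * g \<xi>) = a n"
    proof -
      have "norm_L2 (\<lambda>\<xi>. of_real A * g \<xi>) = A * norm_L2 g"
        using in_L2_cmult(2)[OF gL, of "of_real A"] A0 by simp
      then show ?thesis by (simp add: A_def a_def b_def)
    qed
    then have Ha: "norm_L2 H \<le> a n" using HL(2) by simp
    have "(LINT \<xi>|lborel. E \<xi> * wpacket x0 \<xi> * F (- \<xi>)) - (LINT \<xi>|lborel. S n \<xi> * wpacket x0 \<xi> * F (- \<xi>))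
      = (LINT \<xi>|lborel. E \<xi> * wpacket x0 \<xi> * F (- \<xi>) - S n \<xi> * wpacket x0 \<xi> * F (- \<xi>))"
      by (rule Bochner_Integration.integral_diff[OF Ei Si, symmetric])
    also have "\<dots> = (LINT \<xi>|lborel. H \<xi> * F (- \<xi>))" by (simp add: H_def left_diff_distrib)
    also have "cmod \<dots> \<le> norm_L2 H * norm_L2 (\<lambda>\<xi>. F (- \<xi>))" by (rule L2_Cauchy_Schwarz(3)[OF HL(1) FL])
    also have "\<dots> \<le> a n * norm_L2 (\<lambda>\<xi>. F (- \<xi>))" by (rule mult_right_mono[OF Ha]) simp
    finally show ?thesis by (simp only: mult.commute)
  qed
  have a0: "a \<longlonglongrightarrow> 0"
  proof (rule Lim_null_comparison[OF always_eventually])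
    define z where "z = t\<^sup>2 * (8 / e\<^sup>2)"
    show "\<forall>n. norm (a n) \<le> (z ^ n /\<^sub>R fact n) * norm_L2 g"
    proof
      fix n
      \<comment> \<open>(n!)^2 \<le> (2n)! leaves \<open>a n\<close> bounded by a multiple of
        z^n/n!, a term of an exponential series.\<close>
      have f: "fact n * fact n \<le> (fact (2 * n) :: real)"
      proof -
        have "fact n * fact n * (2 * n choose n) = (fact (2 * n) :: nat)"
          using binomial_fact_lemma[of n "2 * n"] by simp
        then have "real (fact n * fact n * (2 * n choose n)) = real (fact (2 * n))" by (simp only:)
        then have eq: "fact n * fact n * real (2 * n choose n) = fact (2 * n)" by (simp only: of_nat_mult of_nat_fact)
        have "1 \<le> real (2 * n choose n)" using zero_less_binomial[of n "2 * n"] by linarith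
        then have "fact n * fact n * 1 \<le> fact n * fact n * real (2 * n choose n)" by (rule mult_left_mono) simp
        then show ?thesis unfolding eq by simp
      qed
      have "norm (a n) = a n" by (simp add: a_def)
      also have "a n = z ^ n * (fact n / fact (2 * n)) * norm_L2 g"
      proof -
        have "\<bar>t\<bar> ^ (2 * n) = (t\<^sup>2) ^ n" by (simp add: power_mult)
        moreover have "z ^ n = (t\<^sup>2) ^ n * (8 / e\<^sup>2) ^ n" unfolding z_def by (rule power_mult_distrib)
        ultimately show ?thesis unfolding a_def by (simp only: times_divide_eq_left times_divide_eq_right mult_ac)
      qed
      also have "\<dots> \<le> z ^ n * (1 / fact n) * norm_L2 g"
      proof (intro mult_right_mono mult_left_mono)
        have "fact n / fact (2 * n) \<le> fact n / (fact n * fact n :: real)" by (rule divide_left_mono[OF f]) auto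
        then show "fact n / fact (2 * n) \<le> 1 / (fact n :: real)" by simp
      qed (auto simp: z_def)
      finally show "norm (a n) \<le> (z ^ n /\<^sub>R fact n) * norm_L2 g" by (simp only: divide_inverse mult_1 scaleR_conv_of_real of_real_eq_id id_apply mult.commute)
    qed
    have "(\<lambda>n. z ^ n /\<^sub>R fact n) \<longlonglongrightarrow> 0" by (rule summable_LIMSEQ_zero[OF summable_exp_generic])
    then show "(\<lambda>n. (z ^ n /\<^sub>R fact n) * norm_L2 g) \<longlonglongrightarrow> 0" by (rule tendsto_mult_left_zero)
  qed
  have "cmod (y 0 t - \<kappa> * (LINT \<xi>|lborel. E \<xi> * wpacket x0 \<xi> * F (- \<xi>))) \<le> (2 * (W / c) + cmod \<kappa> * norm_L2 (\<lambda>\<xi>. F (- \<xi>))) * a n" for n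
  proof -
    define P where "P = (LINT \<xi>|lborel. E \<xi> * wpacket x0 \<xi> * F (- \<xi>))"
    define Q where "Q = (LINT \<xi>|lborel. S n \<xi> * wpacket x0 \<xi> * F (- \<xi>))"
    have "y 0 t - \<kappa> * P = (y 0 t - \<kappa> * Q) - \<kappa> * (P - Q)" by (simp add: right_diff_distrib)
    then have "cmod (y 0 t - \<kappa> * P) \<le> cmod (y 0 t - \<kappa> * Q) + cmod \<kappa> * cmod (P - Q)"
      using norm_triangle_ineq4[of "y 0 t - \<kappa> * Q" "\<kappa> * (P - Q)"] by (simp only: norm_mult)
    also have "\<dots> \<le> 2 * (W / c) * a n + cmod \<kappa> * (norm_L2 (\<lambda>\<xi>. F (- \<xi>)) * a n)"
      using T1[of n] T2[of n] unfolding S P_def Q_def by (intro add_mono mult_left_mono) auto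
    finally show ?thesis unfolding P_def by (simp only: distrib_right mult.assoc)
  qed
  moreover have "(\<lambda>n. (2 * (W / c) + cmod \<kappa> * norm_L2 (\<lambda>\<xi>. F (- \<xi>))) * a n) \<longlonglongrightarrow> 0"
    using a0 by (rule tendsto_mult_right_zero)
  ultimately have "cmod (y 0 t - \<kappa> * (LINT \<xi>|lborel. E \<xi> * wpacket x0 \<xi> * F (- \<xi>))) \<le> 0"
    by (intro tendsto_lowerbound[OF _ always_eventually]) auto
  then show ?thesis using y0[of t] by (simp add: \<kappa>_def F_def)
qed

text \<open>The integrals of D against \<open>wpacket x0\<close>, for all x0, are the values of the
  transform of \<open>gauss 1\<close> times D. Injectivity of \<open>ft\<close> and positivity of
  the Gaussian then give D = 0. Evenness of E enters because \<open>pairing_fourier_inv\<close>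
  evaluates transforms at -\<xi>.\<close>

lemma fourier_L2_eqI:
  assumes w: "in_L2 w" and w0: "in_L2 w0"
    and E [measurable]: "E \<in> borel_measurable borel" and Eb: "\<And>\<xi>. cmod (E \<xi>) \<le> 1" and even: "\<And>\<xi>. E (- \<xi>) = E \<xi>"
    and eq: "\<And>x0. pairing w (fourier_inv (wpacket x0)) = of_real (1 / (2 * pi) ^ 3) * (LINT \<xi>|lborel. E \<xi> * wpacket x0 \<xi> * fourier_L2 w0 (- \<xi>))"
  shows "AE \<xi> in lborel. fourier_L2 w \<xi> = E \<xi> * fourier_L2 w0 \<xi>"
proof -
  define D where "D \<xi> = fourier_L2 w (- \<xi>) - E \<xi> * fourier_L2 w0 (- \<xi>)" for \<xi>
  have L: "in_L2 (\<lambda>\<xi>. fourier_L2 w (- \<xi>))" "in_L2 (\<lambda>\<xi>. E \<xi> * fourier_L2 w0 (- \<xi>))"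
    by (intro in_L2_reflect fourier_L2_in_L2 w) (intro in_L2_bounded_mult(1)[OF _ E Eb] in_L2_reflect fourier_L2_in_L2 w0)
  have D: "in_L2 D" unfolding D_def[abs_def] by (rule in_L2_diff(1)[OF L])
  have mD [measurable]: "D \<in> borel_measurable borel" by (rule in_L2_measurable[OF D])
  have wp: "L12 (wpacket x0)" for x0 by (rule L12_gauss_dominated[where C=1]) (auto simp: cmod_wpacket, auto simp: gauss_def)
  have g: "L12 (\<lambda>\<xi> :: real^3. complex_of_real (gauss 1 \<xi>))" by (rule L12_gauss_dominated[where C=1]) (auto simp: gauss_nonneg, auto simp: gauss_def)
  have gD: "L12 (\<lambda>\<xi>. of_real (gauss 1 \<xi>) * D \<xi>)"
    unfolding L12_def using g D
    by (auto simp: L12_def intro!: L2_Cauchy_Schwarz(1) in_L2_bounded_mult(1)[OF D, where B=1] simp: gauss_abs_le_1)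
  have "ft (\<lambda>\<xi>. of_real (gauss 1 \<xi>) * D \<xi>) x = 0" for x
  proof -
    define x0 where "x0 = - x"
    have wL: "in_L2 (wpacket x0)" using wp by (simp add: L12_def)
    have "ft (\<lambda>\<xi>. of_real (gauss 1 \<xi>) * D \<xi>) x = (LINT \<xi>|lborel. wpacket x0 \<xi> * D \<xi>)"
      unfolding osc_def wpacket_def x0_def by (simp add: mult_ac)
    also have "\<dots> = (LINT \<xi>|lborel. wpacket x0 \<xi> * fourier_L2 w (- \<xi>) - wpacket x0 \<xi> * (E \<xi> * fourier_L2 w0 (- \<xi>)))"
      unfolding D_def right_diff_distrib ..
    also have "\<dots> = (LINT \<xi>|lborel. wpacket x0 \<xi> * fourier_L2 w (- \<xi>)) - (LINT \<xi>|lborel. wpacket x0 \<xi> * (E \<xi> * fourier_L2 w0 (- \<xi>)))"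
      by (intro Bochner_Integration.integral_diff L2_Cauchy_Schwarz(1) wL L)
    also have "(LINT \<xi>|lborel. wpacket x0 \<xi> * (E \<xi> * fourier_L2 w0 (- \<xi>))) = (LINT \<xi>|lborel. E \<xi> * wpacket x0 \<xi> * fourier_L2 w0 (- \<xi>))"
      by (simp only: mult_ac)
    also have "(LINT \<xi>|lborel. wpacket x0 \<xi> * fourier_L2 w (- \<xi>)) = \<dots>"
      using eq[of x0] unfolding pairing_fourier_inv[OF w wp] by simp
    finally show ?thesis by simp
  qed
  from ft_inj[OF gD this] have "AE \<xi> in lborel. D \<xi> = 0"
    by (rule eventually_mono) (use gauss_pos in \<open>auto simp: gauss_def\<close>)
  from AE_reflect[OF this mD] show ?thesis
    by (rule eventually_mono) (simp add: D_def even)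
qed

lemma pairing_cmult: "pairing w (fourier_inv (\<lambda>\<xi>. c * F \<xi>)) = c * pairing w (fourier_inv F)"
proof -
  have "pairing w (fourier_inv (\<lambda>\<xi>. c * F \<xi>)) = (LINT x|lborel. c * (w x * fourier_inv F x))"
    unfolding pairing_def fourier_inv_ft ft_cmult by (simp only: mult.left_commute)
  also have "\<dots> = c * pairing w (fourier_inv F)"
    unfolding pairing_def by (rule integral_mult_right_zero)
  finally show ?thesis .
qed

lemma pairing_cong_AE:
  assumes "AE x in lborel. w x = w' x" "w \<in> borel_measurable borel" "w' \<in> borel_measurable borel" "\<phi> \<in> borel_measurable borel"
  shows "pairing w \<phi> = pairing w' \<phi>"
proof -
  note [measurable] = assms(2-4)
  show ?thesis unfolding pairing_def by (rule integral_cong_AE) (use assms(1) in auto)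
qed

lemma fourier_L2_cong_AE:
  assumes "AE x in lborel. w x = w' x" and w: "in_L2 w" and w': "in_L2 w'"
  shows "AE \<xi> in lborel. fourier_L2 w \<xi> = fourier_L2 w' \<xi>"
proof -
  note m [measurable] = in_L2_measurable[OF w] in_L2_measurable[OF w']
  have "AE \<xi> in lborel. fourier_L2 w \<xi> = 1 * fourier_L2 w' \<xi>"
  proof (rule fourier_L2_eqI[OF w w'])
    fix x0
    have wp: "L12 (wpacket x0)" by (rule L12_gauss_dominated[where C=1]) (auto simp: cmod_wpacket, auto simp: gauss_def)
    have "pairing w (fourier_inv (wpacket x0)) = pairing w' (fourier_inv (wpacket x0))"
      by (rule pairing_cong_AE[OF assms(1) m in_L2_measurable[OF fourier_inv_in_L2(1)[OF wp]]])
    then show "pairing w (fourier_inv (wpacket x0)) = of_real (1 / (2 * pi) ^ 3) * (LINT \<xi>|lborel. 1 * wpacket x0 \<xi> * fourier_L2 w' (- \<xi>))"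
      by (simp add: pairing_fourier_inv[OF w' wp])
  qed auto
  then show ?thesis by simp
qed

lemma nice_wpacket: "nice e x0 (wpacket x0)"
  unfolding wpacket_def[abs_def] by (rule nice.base)

theorem wave_solution_fourier:
  assumes e: "0 < e" and f: "in_L2 f" and u: "wave_solution e f u"
  shows "AE \<xi> in lborel. fourier_L2 (u t) \<xi> = of_real (cos (t * (norm \<xi> / e))) * fourier_L2 f \<xi>"
proof -
  have cont: "continuous_into_L2 u" and AE0: "AE x in lborel. u 0 x = f x" using u by (auto simp: wave_solution_def)
  have uL: "in_L2 (u s)" for s using cont by (simp add: continuous_into_L2_def)
  have "AE \<xi> in lborel. fourier_L2 (u t) \<xi> = of_real (cos (t * (norm \<xi> / e))) * fourier_L2 (u 0) \<xi>"
  proof (rule fourier_L2_eqI[OF uL uL])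
    fix x0
    define \<Phi> where "\<Phi> n \<xi> = (- of_real ((norm \<xi>)\<^sup>2)) ^ n * wpacket x0 \<xi>" for n and \<xi> :: "real^3"
    have P0: "\<Phi> 0 = wpacket x0" by (rule ext) (simp add: \<Phi>_def)
    have PSuc: "\<Phi> (Suc n) = (\<lambda>\<xi>. - of_real ((norm \<xi>)\<^sup>2) * \<Phi> n \<xi>)" for n
      by (auto simp: \<Phi>_def)
    have nice: "nice e x0 (\<Phi> n)" for n
    proof (induction n)
      case 0 show ?case unfolding \<Phi>_def power_0 mult_1 using nice_wpacket[of e x0] .
    next
      case (Suc n) show ?case unfolding PSuc by (rule laplacian_fourier_inv(2)[OF Suc.IH])
    qed
    have lap: "laplacian (fourier_inv (\<Phi> n)) = fourier_inv (\<Phi> (Suc n))" for n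
      unfolding PSuc by (rule laplacian_fourier_inv(1)[OF nice])
    have "\<forall>n. \<exists>u1 u2. (\<forall>t. ((\<lambda>s. pairing (u s) (fourier_inv (\<Phi> n))) has_vector_derivative u1 t) (at t)) \<and>
        (\<forall>t. (u1 has_vector_derivative u2 t) (at t)) \<and> u1 0 = 0 \<and>
        (\<forall>t. complex_of_real (e\<^sup>2) * u2 t - pairing (u t) (laplacian (fourier_inv (\<Phi> n))) = 0)"
      using u schwartz_fourier_inv[OF nice] unfolding wave_solution_def by blast
    then obtain u1 u2 where u1: "\<And>n t. ((\<lambda>s. pairing (u s) (fourier_inv (\<Phi> n))) has_vector_derivative u1 n t) (at t)"
      and u2: "\<And>n t. (u1 n has_vector_derivative u2 n t) (at t)" and u10: "\<And>n. u1 n 0 = 0"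
      and eq: "\<And>n t. complex_of_real (e\<^sup>2) * u2 n t - pairing (u t) (fourier_inv (\<Phi> (Suc n))) = 0"
      unfolding lap by metis
    define c where "c = complex_of_real (1 / e\<^sup>2)"
    have u2': "u2 n t = c * pairing (u t) (fourier_inv (\<Phi> (Suc n)))" for n t
    proof -
      have "c * (complex_of_real (e\<^sup>2) * u2 n t) = c * pairing (u t) (fourier_inv (\<Phi> (Suc n)))" using eq[of n t] by simp
      moreover have "c * complex_of_real (e\<^sup>2) = 1" using e by (simp add: c_def)
      ultimately show ?thesis by (simp only: mult.assoc[symmetric] mult_1)
    qed
    \<comment> \<open>The k-th time derivative of the pairing. Each use of the equation raises the
      order by two and replaces \<open>\<Phi> n\<close> by \<open>\<Phi> (Suc n)\<close>. Odd
      derivatives are multiples of the functions \<open>u1\<close>, which vanish at t = 0 like the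
      odd Taylor coefficients of the cosine.\<close>
    define y where "y k t = c ^ (k div 2) * (if even k then pairing (u t) (fourier_inv (\<Phi> (k div 2))) else u1 (k div 2) t)" for k t
    have pow: "(c * - of_real ((norm \<xi>)\<^sup>2)) ^ n = of_real ((- 1) ^ n * (norm \<xi> / e) ^ (2 * n))" for n and \<xi> :: "real^3"
    proof -
      have "c * - of_real ((norm \<xi>)\<^sup>2) = of_real (- 1 * (norm \<xi> / e)\<^sup>2)" by (simp add: c_def power_divide)
      then show ?thesis by (simp only: of_real_power[symmetric] power_mult_distrib power_mult)
    qed
    have cPhi: "c ^ n * pairing w (fourier_inv (\<Phi> n)) = pairing w (fourier_inv (\<lambda>\<xi>. of_real ((- 1) ^ n * (norm \<xi> / e) ^ (2 * n)) * wpacket x0 \<xi>))" for n w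
      unfolding pairing_cmult[symmetric] \<Phi>_def mult.assoc[symmetric] power_mult_distrib[symmetric] pow ..
    \<comment> \<open>The k-th derivative in t, at t = 0, of cos(t |\<xi>| / e).\<close>
    define q where "q k \<xi> = complex_of_real (fact k * cos_coeff k * (norm \<xi> / e) ^ k)" for k and \<xi> :: "real^3"
    show "pairing (u t) (fourier_inv (wpacket x0)) = of_real (1 / (2 * pi) ^ 3) *
       (LINT \<xi>|lborel. of_real (cos (t * (norm \<xi> / e))) * wpacket x0 \<xi> * fourier_L2 (u 0) (- \<xi>))"
    proof (rule evolution_pairing[OF e cont, where m="\<lambda>\<xi>. norm \<xi> / e" and q=q and y=y])
      show "\<bar>norm \<xi> / e\<bar> \<le> norm \<xi> / e" for \<xi> :: "real^3" using e by simp
      show "q k \<in> borel_measurable borel" for k unfolding q_def[abs_def] by measurable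
      show "cmod (q k \<xi>) \<le> \<bar>norm \<xi> / e\<bar> ^ k" for k \<xi>
      proof -
        have "\<bar>fact k * cos_coeff k\<bar> \<le> 1" by (simp add: cos_coeff_def)
        then have "\<bar>fact k * cos_coeff k\<bar> * \<bar>norm \<xi> / e\<bar> ^ k \<le> 1 * \<bar>norm \<xi> / e\<bar> ^ k" by (rule mult_right_mono) simp
        then show ?thesis unfolding q_def norm_of_real abs_mult power_abs by simp
      qed
      show "cmod (complex_of_real (cos (t * (norm \<xi> / e)))) \<le> 1" for \<xi> :: "real^3" by simp
      show "cmod (complex_of_real (cos (t * (norm \<xi> / e))) - (\<Sum>k<2 * n. of_real (t ^ k / fact k) * q k \<xi>)) \<le> \<bar>t * (norm \<xi> / e)\<bar> ^ (2 * n) / fact (2 * n)" for n \<xi>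
      proof -
        define z where "z = t * (norm \<xi> / e)"
        obtain r where r: "cos z = (\<Sum>m<2 * n. cos_coeff m * z ^ m) + (cos (r + 1/2 * real (2 * n) * pi) / fact (2 * n)) * z ^ (2 * n)"
          using Maclaurin_cos_expansion[of z "2 * n"] by blast
        have s: "(\<Sum>k<2 * n. of_real (t ^ k / fact k) * q k \<xi>) = of_real (\<Sum>m<2 * n. cos_coeff m * z ^ m)"
          unfolding of_real_sum
        proof (rule sum.cong[OF refl])
          fix k
          have "t ^ k / fact k * (fact k * cos_coeff k * (norm \<xi> / e) ^ k) = cos_coeff k * z ^ k"
          proof -
            have "z ^ k = t ^ k * (norm \<xi> / e) ^ k" unfolding z_def by (rule power_mult_distrib)
            then show ?thesis by simp
          qed
          then show "of_real (t ^ k / fact k) * q k \<xi> = of_real (cos_coeff k * z ^ k)"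
            unfolding q_def of_real_mult[symmetric] by (rule arg_cong[of _ _ of_real])
        qed
        have "cmod (complex_of_real (cos z) - of_real (\<Sum>m<2 * n. cos_coeff m * z ^ m)) = \<bar>(cos (r + 1/2 * real (2 * n) * pi) / fact (2 * n)) * z ^ (2 * n)\<bar>"
          unfolding of_real_diff[symmetric] norm_of_real r by simp
        also have "\<dots> = \<bar>cos (r + 1/2 * real (2 * n) * pi)\<bar> * (\<bar>z\<bar> ^ (2 * n) / fact (2 * n))"
          unfolding abs_mult abs_divide power_abs by simp
        also have "\<dots> \<le> 1 * (\<bar>z\<bar> ^ (2 * n) / fact (2 * n))" by (intro mult_right_mono) auto
        finally show ?thesis unfolding s z_def[symmetric] by simp
      qed
      show "(y n has_vector_derivative y (Suc n) t) (at t)" for n t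
      proof (cases "even n")
        case True
        then obtain k where k: "n = 2 * k" by blast
        have "((\<lambda>s. c ^ k * pairing (u s) (fourier_inv (\<Phi> k))) has_vector_derivative c ^ k * u1 k t) (at t)"
          by (intro has_vector_derivative_mult_right u1)
        then show ?thesis unfolding k y_def[abs_def] by simp
      next
        case False
        then obtain k where k: "n = 2 * k + 1" by (auto elim: oddE)
        have "((\<lambda>s. c ^ k * u1 k s) has_vector_derivative c ^ k * (c * pairing (u t) (fourier_inv (\<Phi> (Suc k))))) (at t)"
          unfolding u2'[symmetric] by (intro has_vector_derivative_mult_right u2)
        then show ?thesis unfolding k y_def[abs_def] by (simp add: mult_ac)
      qed
      show "y 0 t = pairing (u t) (fourier_inv (wpacket x0))" for t by (simp add: y_def P0)
      show "\<exists>H. H \<in> borel_measurable borel \<and> (\<forall>\<xi>. cmod (H \<xi>) \<le> \<bar>norm \<xi> / e\<bar> ^ (2 * n) * gauss 1 \<xi>) \<and> (\<forall>t. y (2 * n) t = pairing (u t) (fourier_inv H))" for n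
      proof (intro exI[of _ "\<lambda>\<xi>. of_real ((- 1) ^ n * (norm \<xi> / e) ^ (2 * n)) * wpacket x0 \<xi>"] conjI allI)
        show "y (2 * n) t = pairing (u t) (fourier_inv (\<lambda>\<xi>. of_real ((- 1) ^ n * (norm \<xi> / e) ^ (2 * n)) * wpacket x0 \<xi>))" for t
          unfolding cPhi[symmetric] y_def by simp
        show "cmod (of_real ((- 1) ^ n * (norm \<xi> / e) ^ (2 * n)) * wpacket x0 \<xi>) \<le> \<bar>norm \<xi> / e\<bar> ^ (2 * n) * gauss 1 \<xi>" for \<xi>
          unfolding norm_mult cmod_wpacket norm_of_real abs_mult power_abs by simp
      qed measurable
      show "y k 0 = pairing (u 0) (fourier_inv (\<lambda>\<xi>. q k \<xi> * wpacket x0 \<xi>))" for k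
      proof (cases "even k")
        case True
        then obtain n where n: "k = 2 * n" by blast
        have "q k \<xi> = of_real ((- 1) ^ n * (norm \<xi> / e) ^ (2 * n))" for \<xi> by (simp add: q_def n cos_coeff_def)
        then have "pairing (u 0) (fourier_inv (\<lambda>\<xi>. q k \<xi> * wpacket x0 \<xi>)) = c ^ n * pairing (u 0) (fourier_inv (\<Phi> n))"
          unfolding cPhi by (simp only:)
        then show ?thesis by (simp add: y_def n)
      next
        case False
        then have "q k \<xi> = 0" for \<xi> by (simp add: q_def cos_coeff_def)
        then have "pairing (u 0) (fourier_inv (\<lambda>\<xi>. q k \<xi> * wpacket x0 \<xi>)) = 0" by (simp add: pairing_def fourier_inv_def)
        then show ?thesis using False by (simp add: y_def u10)
      qed
    qed measurable
  qed auto
  then show ?thesis using fourier_L2_cong_AE[OF AE0 uL f] by eventually_elim simp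
qed

lemma schrodinger_symbol_bounds:
  assumes "0 < e" shows "0 \<le> schrodinger_symbol e \<xi>" "schrodinger_symbol e \<xi> \<le> norm \<xi> / e"
proof -
  have "1 \<le> jb e \<xi>" by (rule jb_ge_1)
  then show "0 \<le> schrodinger_symbol e \<xi>" by (simp add: schrodinger_symbol_def jb_def)
  have "1 + e\<^sup>2 * (norm \<xi>)\<^sup>2 \<le> (1 + e * norm \<xi>)\<^sup>2"
    using assms by (simp add: power2_sum power_mult_distrib)
  then have "sqrt (1 + e\<^sup>2 * (norm \<xi>)\<^sup>2) \<le> 1 + e * norm \<xi>"
    using assms by (intro real_le_lsqrt) auto
  then have "schrodinger_symbol e \<xi> \<le> (e * norm \<xi>) / e\<^sup>2"
    unfolding schrodinger_symbol_def by (intro divide_right_mono) auto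
  then show "schrodinger_symbol e \<xi> \<le> norm \<xi> / e" using assms by (simp add: power2_eq_square)
qed

text \<open>The equation is of first order, so every time derivative is a pairing; each one brings
  out the factor -i \<sigma> times the symbol, which yields the exponential series.\<close>

theorem half_kg_solution_fourier:
  assumes e: "0 < e" and g: "in_L2 g" and \<sigma>: "\<sigma> \<in> {1, - 1}" and v: "half_kg_solution e \<sigma> g v"
  shows "AE \<xi> in lborel. fourier_L2 (v t) \<xi> = cis (t * (- \<sigma> * schrodinger_symbol e \<xi>)) * fourier_L2 g \<xi>"
proof -
  have cont: "continuous_into_L2 v" and AE0: "AE x in lborel. v 0 x = g x" using v by (auto simp: half_kg_solution_def)
  have vL: "in_L2 (v s)" for s using cont by (simp add: continuous_into_L2_def)
  define h where "h \<xi> = - \<sigma> * schrodinger_symbol e \<xi>" for \<xi>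
  have mh [measurable]: "h \<in> borel_measurable borel" unfolding h_def[abs_def] by measurable
  have hb: "\<bar>h \<xi>\<bar> \<le> norm \<xi> / e" for \<xi>
    using \<sigma> schrodinger_symbol_bounds[OF e, of \<xi>] by (auto simp: h_def abs_mult)
  have "AE \<xi> in lborel. fourier_L2 (v t) \<xi> = cis (t * h \<xi>) * fourier_L2 (v 0) \<xi>"
  proof (rule fourier_L2_eqI[OF vL vL])
    show "cis (t * h (- \<xi>)) = cis (t * h \<xi>)" for \<xi> by (simp add: h_def schrodinger_symbol_def)
  next
    fix x0
    define \<Phi> where "\<Phi> n \<xi> = of_real (schrodinger_symbol e \<xi>) ^ n * wpacket x0 \<xi>" for n \<xi>
    have P0: "\<Phi> 0 = wpacket x0" by (rule ext) (simp add: \<Phi>_def)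
    have PSuc: "\<Phi> (Suc n) = (\<lambda>\<xi>. of_real (schrodinger_symbol e \<xi>) * \<Phi> n \<xi>)" for n
      by (auto simp: \<Phi>_def)
    have nice: "nice e x0 (\<Phi> n)" for n
    proof (induction n)
      case 0 show ?case unfolding \<Phi>_def power_0 mult_1 using nice_wpacket[of e x0] .
    next
      case (Suc n) show ?case unfolding PSuc by (rule schrodinger_op_fourier_inv(2)[OF Suc.IH])
    qed
    have op: "schrodinger_op e (fourier_inv (\<Phi> n)) = fourier_inv (\<Phi> (Suc n))" for n
      unfolding PSuc by (rule schrodinger_op_fourier_inv(1)[OF nice])
    have "\<forall>n. \<exists>v1. (\<forall>t. ((\<lambda>s. pairing (v s) (fourier_inv (\<Phi> n))) has_vector_derivative v1 t) (at t)) \<and>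
        (\<forall>t. \<i> * v1 t - complex_of_real \<sigma> * pairing (v t) (schrodinger_op e (fourier_inv (\<Phi> n))) = 0)"
      using v schwartz_fourier_inv[OF nice] unfolding half_kg_solution_def by blast
    then obtain v1 where v1: "\<And>n t. ((\<lambda>s. pairing (v s) (fourier_inv (\<Phi> n))) has_vector_derivative v1 n t) (at t)"
      and eq: "\<And>n t. \<i> * v1 n t - complex_of_real \<sigma> * pairing (v t) (fourier_inv (\<Phi> (Suc n))) = 0"
      unfolding op by metis
    define c where "c = \<i> * complex_of_real (- \<sigma>)"
    have v1': "v1 n t = c * pairing (v t) (fourier_inv (\<Phi> (Suc n)))" for n t
    proof -
      have "\<i> * v1 n t = complex_of_real \<sigma> * pairing (v t) (fourier_inv (\<Phi> (Suc n)))" using eq[of n t] by simp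
      then have "- \<i> * (\<i> * v1 n t) = - \<i> * (complex_of_real \<sigma> * pairing (v t) (fourier_inv (\<Phi> (Suc n))))" by simp
      then show ?thesis by (simp add: c_def mult.assoc[symmetric])
    qed
    define y where "y k t = c ^ k * pairing (v t) (fourier_inv (\<Phi> k))" for k t
    have y: "y k t = pairing (v t) (fourier_inv (\<lambda>\<xi>. (\<i> * of_real (h \<xi>)) ^ k * wpacket x0 \<xi>))" for k t
    proof -
      have "c * of_real (schrodinger_symbol e \<xi>) = \<i> * of_real (h \<xi>)" for \<xi> by (simp add: c_def h_def)
      then show ?thesis
        unfolding y_def pairing_cmult[symmetric] \<Phi>_def mult.assoc[symmetric] power_mult_distrib[symmetric] by (simp only: mult.assoc)
    qed
    show "pairing (v t) (fourier_inv (wpacket x0)) = of_real (1 / (2 * pi) ^ 3) *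
       (LINT \<xi>|lborel. cis (t * h \<xi>) * wpacket x0 \<xi> * fourier_L2 (v 0) (- \<xi>))"
    proof (rule evolution_pairing[OF e cont mh hb, where q="\<lambda>k \<xi>. (\<i> * of_real (h \<xi>)) ^ k" and y=y])
      show "cmod ((\<i> * of_real (h \<xi>)) ^ k) \<le> \<bar>h \<xi>\<bar> ^ k" for k \<xi> by (simp add: norm_power norm_mult)
      show "cmod (cis (t * h \<xi>) - (\<Sum>k<2 * n. of_real (t ^ k / fact k) * (\<i> * of_real (h \<xi>)) ^ k)) \<le> \<bar>t * h \<xi>\<bar> ^ (2 * n) / fact (2 * n)" for n \<xi>
      proof (cases n)
        case 0 then show ?thesis by simp
      next
        case (Suc l)
        have tm: "of_real (t ^ k / fact k) * (\<i> * of_real (h \<xi>)) ^ k = (\<i> * of_real (t * h \<xi>)) ^ k / fact k" for k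
          by (simp add: power_mult_distrib)
        have N: "2 * n = Suc (2 * l + 1)" using Suc by simp
        have "cmod (iexp (t * h \<xi>) - (\<Sum>k\<le>2 * l + 1. (\<i> * of_real (t * h \<xi>)) ^ k / fact k)) \<le> \<bar>t * h \<xi>\<bar> ^ Suc (2 * l + 1) / fact (Suc (2 * l + 1))"
          by (rule iexp_approx1)
        then show ?thesis unfolding tm N lessThan_Suc_atMost cis_conv_exp .
      qed
      show "(y n has_vector_derivative y (Suc n) t) (at t)" for n t
      proof -
        have "((\<lambda>s. c ^ n * pairing (v s) (fourier_inv (\<Phi> n))) has_vector_derivative c ^ n * (c * pairing (v t) (fourier_inv (\<Phi> (Suc n))))) (at t)"
          unfolding v1'[symmetric] by (intro has_vector_derivative_mult_right v1)
        then show ?thesis unfolding y_def[abs_def] by (simp add: mult_ac)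
      qed
      show "y 0 t = pairing (v t) (fourier_inv (wpacket x0))" for t by (simp add: y_def P0)
      show "\<exists>H. H \<in> borel_measurable borel \<and> (\<forall>\<xi>. cmod (H \<xi>) \<le> \<bar>h \<xi>\<bar> ^ (2 * n) * gauss 1 \<xi>) \<and> (\<forall>t. y (2 * n) t = pairing (v t) (fourier_inv H))" for n
      proof (intro exI[of _ "\<lambda>\<xi>. (\<i> * of_real (h \<xi>)) ^ (2 * n) * wpacket x0 \<xi>"] conjI allI y)
        show "cmod ((\<i> * of_real (h \<xi>)) ^ (2 * n) * wpacket x0 \<xi>) \<le> \<bar>h \<xi>\<bar> ^ (2 * n) * gauss 1 \<xi>" for \<xi>
          unfolding norm_mult cmod_wpacket norm_power by simp
      qed measurable
      show "y k 0 = pairing (v 0) (fourier_inv (\<lambda>\<xi>. (\<i> * of_real (h \<xi>)) ^ k * wpacket x0 \<xi>))" for k by (rule y)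
    qed auto
  qed auto
  then show ?thesis using fourier_L2_cong_AE[OF AE0 vL g] unfolding h_def by eventually_elim simp
qed

section \<open>A bilinear estimate for oscillatory integrals\<close>

text \<open>M bounds the density of the image of Lebesgue measure on S under \<Phi>: the number 2 l
  is the length of the window of admissible values.\<close>

definition thin :: "real \<Rightarrow> 'b::euclidean_space set \<Rightarrow> ('b \<Rightarrow> real) \<Rightarrow> bool" where
  "thin M S \<Phi> \<longleftrightarrow> (\<forall>w l. 0 < l \<longrightarrow> emeasure lborel {\<eta> \<in> S. \<bar>\<Phi> \<eta> - w\<bar> < l} \<le> ennreal (M * (2 * l)))"

lemma ennreal_layer: "0 \<le> x \<Longrightarrow> ennreal x = (\<integral>\<^sup>+t. indicator {0<..<x} t \<partial>lborel)"
  by simp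

lemma gauss_ft_superlevel:
  assumes "0 < d" "0 < t"
  shows "\<exists>l\<ge>0. {s :: real. t < gauss_ft d s} = {s. \<bar>s\<bar> < l}"
proof -
  define c where "c = sqrt (2 * pi) / d"
  have c: "0 < c" using assms by (simp add: c_def)
  have g: "gauss_ft d s = c * exp (- (s / d)\<^sup>2 / 2)" for s :: real
    unfolding gauss_ft_def gauss_def c_def by (simp add: power_divide)
  show ?thesis
  proof (cases "t < c")
    case False
    have "\<not> t < gauss_ft d s" for s :: real
    proof -
      have "c * exp (- (s / d)\<^sup>2 / 2) \<le> c * 1" using c by (intro mult_left_mono) auto
      then show ?thesis using False unfolding g by linarith
    qed
    then show ?thesis by (intro exI[of _ 0]) auto
  next
    case True
    define l where "l = d * sqrt (2 * ln (c / t))"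
    have ln0: "0 < ln (c / t)" using True assms by simp
    have "t < gauss_ft d s \<longleftrightarrow> \<bar>s\<bar> < l" for s :: real
    proof -
      have "t < gauss_ft d s \<longleftrightarrow> ln t < ln (c * exp (- (s / d)\<^sup>2 / 2))"
        unfolding g using assms c by (intro ln_less_cancel_iff[symmetric]) auto
      also have "\<dots> \<longleftrightarrow> ln t < ln c + - (s / d)\<^sup>2 / 2" using c by (simp add: ln_mult)
      also have "\<dots> \<longleftrightarrow> (s / d)\<^sup>2 < 2 * ln (c / t)" using assms c by (auto simp: ln_div)
      also have "\<dots> \<longleftrightarrow> sqrt ((s / d)\<^sup>2) < sqrt (2 * ln (c / t))" by (simp only: real_sqrt_less_iff)
      also have "\<dots> \<longleftrightarrow> \<bar>s\<bar> < l" using assms by (simp add: l_def pos_divide_less_eq mult.commute)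
      finally show ?thesis .
    qed
    moreover have "0 \<le> l" using assms ln0 by (simp add: l_def)
    ultimately show ?thesis by auto
  qed
qed

text \<open>Layer cake. The superlevel sets of a one-dimensional Gaussian are centred intervals, for
  which \<open>thin\<close> compares the measure on S with M times the length; integrating over the
  level gives M times the mass 2\<pi>.\<close>

lemma thin_gauss:
  fixes \<Phi> :: "'b::euclidean_space \<Rightarrow> real"
  assumes thin: "thin M S \<Phi>" and S [measurable]: "S \<in> sets borel" and P [measurable]: "\<Phi> \<in> borel_measurable borel"
    and d: "0 < d" and M: "0 \<le> M"
  shows "(\<integral>\<^sup>+\<eta>. indicator S \<eta> * ennreal (gauss_ft d (\<Phi> \<eta> - w)) \<partial>lborel) \<le> ennreal (M * (2 * pi))"
proof -
  have g [measurable]: "gauss_ft d \<in> borel_measurable (borel :: real measure)" by measurable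
  have m1: "(\<lambda>(\<eta>, t). indicator S \<eta> * indicator {0<..<gauss_ft d (\<Phi> \<eta> - w)} t :: ennreal) \<in> borel_measurable borel"
  proof -
    have "(\<lambda>(\<eta>, t). indicator S \<eta> * indicator {0<..<gauss_ft d (\<Phi> \<eta> - w)} t :: ennreal)
       = (\<lambda>p. indicator S (fst p) * (if 0 < snd p \<and> snd p < gauss_ft d (\<Phi> (fst p) - w) then 1 else 0))"
      by (auto simp: indicator_def fun_eq_iff)
    then show ?thesis by (simp only:) measurable
  qed
  have "(\<integral>\<^sup>+\<eta>. indicator S \<eta> * ennreal (gauss_ft d (\<Phi> \<eta> - w)) \<partial>lborel)
    = (\<integral>\<^sup>+\<eta>. (\<integral>\<^sup>+t. indicator S \<eta> * indicator {0<..<gauss_ft d (\<Phi> \<eta> - w)} t \<partial>lborel) \<partial>lborel)"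
    by (subst nn_integral_cmult, simp, subst ennreal_layer[OF gauss_ft_nonneg[OF d], symmetric]) simp
  also have "\<dots> = (\<integral>\<^sup>+t. (\<integral>\<^sup>+\<eta>. indicator S \<eta> * indicator {0<..<gauss_ft d (\<Phi> \<eta> - w)} t \<partial>lborel) \<partial>lborel)"
    using lborel_Fubini_nn[OF m1] by simp
  also have "\<dots> \<le> (\<integral>\<^sup>+t. ennreal M * (\<integral>\<^sup>+s. indicator {0<..<gauss_ft d (s::real)} t \<partial>lborel) \<partial>lborel)"
  proof (rule nn_integral_mono)
    fix t :: real
    show "(\<integral>\<^sup>+\<eta>. indicator S \<eta> * indicator {0<..<gauss_ft d (\<Phi> \<eta> - w)} t \<partial>lborel) \<le> ennreal M * (\<integral>\<^sup>+s. indicator {0<..<gauss_ft d (s::real)} t \<partial>lborel)"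
    proof (cases "0 < t")
      case True
      obtain l where l0: "0 \<le> l" and l: "{s :: real. t < gauss_ft d s} = {s. \<bar>s\<bar> < l}" using gauss_ft_superlevel[OF d True] by blast
      have l': "t < gauss_ft d s \<longleftrightarrow> \<bar>s\<bar> < l" for s :: real using l by blast
      have "(\<integral>\<^sup>+\<eta>. indicator S \<eta> * indicator {0<..<gauss_ft d (\<Phi> \<eta> - w)} t \<partial>lborel) = (\<integral>\<^sup>+\<eta>. indicator {\<eta> \<in> S. \<bar>\<Phi> \<eta> - w\<bar> < l} \<eta> \<partial>lborel)"
        using True by (intro nn_integral_cong) (auto simp: indicator_def l')
      also have "\<dots> = emeasure lborel {\<eta> \<in> S. \<bar>\<Phi> \<eta> - w\<bar> < l}" by (rule nn_integral_indicator) measurable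
      also have "\<dots> \<le> ennreal (M * (2 * l))"
      proof (cases "l = 0")
        case False
        then show ?thesis using thin l0 unfolding thin_def by simp
      qed simp
      also have "\<dots> = ennreal M * ennreal (2 * l)" using M l0 by (intro ennreal_mult) auto
      also have "ennreal (2 * l) = emeasure lborel {-l<..<l}" using l0 by simp
      also have "\<dots> = (\<integral>\<^sup>+s. indicator {-l<..<l} s \<partial>lborel)" by simp
      also have "\<dots> = (\<integral>\<^sup>+s. indicator {0<..<gauss_ft d (s::real)} t \<partial>lborel)"
        using True by (intro nn_integral_cong) (auto simp: indicator_def l' abs_less_iff)
      finally show ?thesis .
    qed (simp add: indicator_def)
  qed
  also have "\<dots> = ennreal M * (\<integral>\<^sup>+t. (\<integral>\<^sup>+s. indicator {0<..<gauss_ft d (s::real)} t \<partial>lborel) \<partial>lborel)"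
  proof (rule nn_integral_cmult)
    have "(\<lambda>p. if 0 < fst p \<and> fst p < gauss_ft d (snd p) then 1 else 0 :: ennreal) \<in> borel_measurable (borel \<Otimes>\<^sub>M (borel :: real measure))"
      by measurable
    then have "(\<lambda>(t, s). indicator {0<..<gauss_ft d (s::real)} t :: ennreal) \<in> borel_measurable (lborel \<Otimes>\<^sub>M lborel)"
      by (simp add: indicator_def case_prod_beta' cong: if_cong)
    then show "(\<lambda>t. \<integral>\<^sup>+s. indicator {0<..<gauss_ft d (s::real)} t \<partial>lborel) \<in> borel_measurable lborel"
      by (rule lborel.borel_measurable_nn_integral)
  qed
  also have "(\<integral>\<^sup>+t. (\<integral>\<^sup>+s. indicator {0<..<gauss_ft d (s::real)} t \<partial>lborel) \<partial>lborel) = (\<integral>\<^sup>+s. (\<integral>\<^sup>+t. indicator {0<..<gauss_ft d (s::real)} t \<partial>lborel) \<partial>lborel)"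
  proof -
    have "(\<lambda>p. if 0 < snd p \<and> snd p < gauss_ft d (fst p) then 1 else 0 :: ennreal) \<in> borel_measurable (borel :: (real \<times> real) measure)"
      by measurable
    then have "(\<lambda>(s, t). indicator {0<..<gauss_ft d (s::real)} t :: ennreal) \<in> borel_measurable borel"
      by (simp add: indicator_def case_prod_beta' cong: if_cong)
    from lborel_Fubini_nn[OF this] show ?thesis by simp
  qed
  also have "\<dots> = (\<integral>\<^sup>+s. ennreal (gauss_ft d (s::real)) \<partial>lborel)"
    by (simp only: ennreal_layer[OF gauss_ft_nonneg[OF d], symmetric])
  also have "\<dots> = ennreal (2 * pi)" using gauss_ft_integral(3)[OF d, where 'a=real] by simp
  also have "ennreal M * ennreal (2 * pi) = ennreal (M * (2 * pi))" using M by (intro ennreal_mult[symmetric]) auto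
  finally show ?thesis .
qed

lemma gauss_ft_Pair: "gauss_ft d (s, z) = gauss_ft d s * gauss_ft d z" for s :: "'a::euclidean_space" and z :: "'b::euclidean_space"
proof -
  have "exp (- (1 / d * norm (s, z))\<^sup>2 / 2) = exp (- (1 / d * norm s)\<^sup>2 / 2) * exp (- (1 / d * norm z)\<^sup>2 / 2)"
    unfolding exp_add[symmetric] by (simp add: norm_Pair power_mult_distrib power_divide add_divide_distrib distrib_left)
  then show ?thesis by (simp add: gauss_ft_def gauss_def power_add)
qed

text \<open>The free evolution with phase \<phi> as a function of (t, x). Integrating over the graph
  of \<phi> treats time and space frequency alike, so that Schur's test acts on all of
  space-time.\<close>

definition Eop :: "(real^3 \<Rightarrow> real) \<Rightarrow> (real^3 \<Rightarrow> complex) \<Rightarrow> real \<times> (real^3) \<Rightarrow> complex" where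
  "Eop \<phi> \<alpha> = osc (\<lambda>\<xi>. (\<phi> \<xi>, \<xi>)) \<alpha>"

lemma Eop_eq: "Eop \<phi> \<alpha> (t, x) = ft (\<lambda>\<xi>. cis (t * \<phi> \<xi>) * \<alpha> \<xi>) x"
  unfolding Eop_def osc_def by (simp add: cis_mult[symmetric] mult_ac)

lemma Eop_measurable:
  "\<phi> \<in> borel_measurable borel \<Longrightarrow> \<alpha> \<in> borel_measurable borel \<Longrightarrow> Eop \<phi> \<alpha> \<in> borel_measurable borel"
  unfolding Eop_def by (intro osc_measurable) auto

text \<open>The product is one oscillatory integral over pairs (\<eta>, \<zeta>) with space-time
  frequency (\<phi>1 \<eta> + \<phi>2 \<zeta>, \<eta> + \<zeta>). In a row sum of Schur's test the
  Gaussian factors into time and space. With \<xi> = \<eta> + \<zeta> fixed, \<open>thin\<close>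
  bounds the \<eta>-integral of the time factor by 2\<pi> M, and the space factor integrates to
  (2\<pi>)^3.\<close>

proposition bilinear_estimate:
  assumes A: "L12 \<alpha>" "L12 \<gamma>" and mp [measurable]: "\<phi>1 \<in> borel_measurable borel" "\<phi>2 \<in> borel_measurable borel"
    and thin: "\<And>\<xi>. thin M {\<eta>. \<alpha> \<eta> \<noteq> 0 \<and> \<gamma> (\<xi> - \<eta>) \<noteq> 0} (\<lambda>\<eta>. \<phi>1 \<eta> + \<phi>2 (\<xi> - \<eta>))" and M: "0 \<le> M"
  shows "N2 (\<lambda>p. Eop \<phi>1 \<alpha> p * Eop \<phi>2 \<gamma> p) \<le> ennreal (M * (2 * pi) ^ 4) * (N2 \<alpha> * N2 \<gamma>)"
proof -
  note [measurable] = L12_measurable[OF A(1)] L12_measurable[OF A(2)]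
  have i: "integrable lborel \<alpha>" "integrable lborel \<gamma>" using A by (auto simp: L12_def)
  define \<Psi> where "\<Psi> p = (\<phi>1 (fst p) + \<phi>2 (snd p), fst p + snd p)" for p :: "(real^3) \<times> (real^3)"
  define B where "B p = \<alpha> (fst p) * \<gamma> (snd p)" for p
  have mPsi [measurable]: "\<Psi> \<in> borel_measurable borel" unfolding \<Psi>_def[abs_def] by measurable
  have iB: "integrable lborel B" using lborel_integrable_product[OF i] unfolding B_def[abs_def] by (simp add: case_prod_beta')
  note [measurable] = integrable_borel[OF iB]
  have eq: "Eop \<phi>1 \<alpha> p * Eop \<phi>2 \<gamma> p = osc \<Psi> B p" for p
  proof -
    have 1: "integrable lborel (\<lambda>\<xi>. cis (p \<bullet> (\<phi>1 \<xi>, \<xi>)) * \<alpha> \<xi>)" "integrable lborel (\<lambda>\<xi>. cis (p \<bullet> (\<phi>2 \<xi>, \<xi>)) * \<gamma> \<xi>)"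
      by (intro osc_integrable i; measurable)+
    have "Eop \<phi>1 \<alpha> p * Eop \<phi>2 \<gamma> p = (LINT \<eta>|lborel. LINT \<zeta>|lborel. (cis (p \<bullet> (\<phi>1 \<eta>, \<eta>)) * \<alpha> \<eta>) * (cis (p \<bullet> (\<phi>2 \<zeta>, \<zeta>)) * \<gamma> \<zeta>))"
      unfolding Eop_def osc_def by (simp only: integral_mult_left_zero[symmetric] integral_mult_right_zero)
    also have "\<dots> = (LINT q|lborel. (cis (p \<bullet> (\<phi>1 (fst q), fst q)) * \<alpha> (fst q)) * (cis (p \<bullet> (\<phi>2 (snd q), snd q)) * \<gamma> (snd q)))"
      by (rule lborel_Fubini(1)[OF lborel_integrable_product[OF 1]])
    also have "\<dots> = osc \<Psi> B p"
    proof -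
      have "cis (p \<bullet> \<Psi> q) = cis (p \<bullet> (\<phi>1 (fst q), fst q)) * cis (p \<bullet> (\<phi>2 (snd q), snd q))" for q
        by (cases p) (simp add: cis_mult \<Psi>_def inner_add_right distrib_left add_ac)
      then show ?thesis unfolding osc_def B_def by (simp add: mult_ac)
    qed
    finally show ?thesis .
  qed
  have "N2 (osc \<Psi> B) \<le> ennreal (M * (2 * pi) ^ 4) * N2 B"
  proof (rule osc_Schur[OF mPsi iB])
    fix d :: real and w :: "real \<times> (real^3)" assume d: "0 < d"
    obtain \<tau> x where w: "w = (\<tau>, x)" by (cases w)
    define S where "S \<xi> = {\<eta>. \<alpha> \<eta> \<noteq> 0 \<and> \<gamma> (\<xi> - \<eta>) \<noteq> 0}" for \<xi>
    have [measurable]: "S \<xi> \<in> sets borel" for \<xi> unfolding S_def by measurable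
    define G where "G \<eta> \<zeta> = indicator {\<eta>. \<alpha> \<eta> \<noteq> 0} \<eta> * indicator {\<zeta>. \<gamma> \<zeta> \<noteq> 0} \<zeta> * ennreal (gauss_ft d (\<phi>1 \<eta> + \<phi>2 \<zeta> - \<tau>) * gauss_ft d (\<eta> + \<zeta> - x))" for \<eta> \<zeta>
    have mG: "(\<lambda>p. G (fst p) (snd p)) \<in> borel_measurable borel"
      unfolding G_def by measurable
    have mG2: "G \<eta> \<in> borel_measurable borel" for \<eta> unfolding G_def[abs_def] by measurable
    have "(\<integral>\<^sup>+q. indicator {q. B q \<noteq> 0} q * ennreal (gauss_ft d (\<Psi> q - w)) \<partial>lborel) = (\<integral>\<^sup>+q. G (fst q) (snd q) \<partial>lborel)"
      by (intro nn_integral_cong) (auto simp: G_def B_def \<Psi>_def w gauss_ft_Pair indicator_def)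
    also have "\<dots> = (\<integral>\<^sup>+\<eta>. \<integral>\<^sup>+\<zeta>. G \<eta> \<zeta> \<partial>lborel \<partial>lborel)"
      by (rule lborel_Fubini_nn(1)) (use mG in \<open>simp add: case_prod_beta'\<close>)
    also have "\<dots> = (\<integral>\<^sup>+\<eta>. \<integral>\<^sup>+\<xi>. G \<eta> (\<xi> - \<eta>) \<partial>lborel \<partial>lborel)"
    proof (rule nn_integral_cong)
      fix \<eta> :: "real^3"
      show "(\<integral>\<^sup>+\<zeta>. G \<eta> \<zeta> \<partial>lborel) = (\<integral>\<^sup>+\<xi>. G \<eta> (\<xi> - \<eta>) \<partial>lborel)"
        using lborel_nn_affine[OF mG2[of \<eta>], of 1 "- \<eta>"] by simp
    qed
    also have "\<dots> = (\<integral>\<^sup>+\<xi>. \<integral>\<^sup>+\<eta>. G \<eta> (\<xi> - \<eta>) \<partial>lborel \<partial>lborel)"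
    proof -
      have "(\<lambda>p. G (fst p) (snd p - fst p)) \<in> borel_measurable borel" unfolding G_def by measurable
      then have "(\<lambda>(\<eta>, \<xi>). G \<eta> (\<xi> - \<eta>)) \<in> borel_measurable borel" by (simp add: case_prod_beta')
      from lborel_Fubini_nn[OF this] show ?thesis by simp
    qed
    also have "\<dots> \<le> (\<integral>\<^sup>+\<xi>. ennreal (M * (2 * pi)) * ennreal (gauss_ft d (\<xi> - x)) \<partial>lborel)"
    proof (rule nn_integral_mono)
      fix \<xi> :: "real^3"
      have "G \<eta> (\<xi> - \<eta>) = (indicator (S \<xi>) \<eta> * ennreal (gauss_ft d (\<phi>1 \<eta> + \<phi>2 (\<xi> - \<eta>) - \<tau>))) * ennreal (gauss_ft d (\<xi> - x))" for \<eta>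
        by (auto simp: G_def S_def indicator_def ennreal_mult[OF gauss_ft_nonneg[OF d] gauss_ft_nonneg[OF d]])
      then have "(\<integral>\<^sup>+\<eta>. G \<eta> (\<xi> - \<eta>) \<partial>lborel) = (\<integral>\<^sup>+\<eta>. indicator (S \<xi>) \<eta> * ennreal (gauss_ft d (\<phi>1 \<eta> + \<phi>2 (\<xi> - \<eta>) - \<tau>)) \<partial>lborel) * ennreal (gauss_ft d (\<xi> - x))"
        by (simp add: nn_integral_multc)
      also have "\<dots> \<le> ennreal (M * (2 * pi)) * ennreal (gauss_ft d (\<xi> - x))"
        using thin[of \<xi>] by (intro mult_right_mono thin_gauss d M) (auto simp: S_def)
      finally show "(\<integral>\<^sup>+\<eta>. G \<eta> (\<xi> - \<eta>) \<partial>lborel) \<le> ennreal (M * (2 * pi)) * ennreal (gauss_ft d (\<xi> - x))" .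
    qed
    also have "\<dots> = ennreal (M * (2 * pi)) * (\<integral>\<^sup>+\<xi>. ennreal (gauss_ft d (- x + 1 *\<^sub>R \<xi>)) \<partial>lborel)"
      by (subst nn_integral_cmult) simp_all
    also have "(\<integral>\<^sup>+\<xi>. ennreal (gauss_ft d (- x + 1 *\<^sub>R \<xi>)) \<partial>lborel) = (\<integral>\<^sup>+\<xi>. ennreal (gauss_ft d (\<xi> :: real^3)) \<partial>lborel)"
      by (subst lborel_nn_affine[of _ 1 "- x"]) auto
    also have "\<dots> = ennreal ((2 * pi) ^ 3)" using gauss_ft_integral(3)[OF d, where 'a="real^3"] by simp
    also have "ennreal (M * (2 * pi)) * ennreal ((2 * pi) ^ 3) = ennreal (M * (2 * pi) ^ 4)"
      using M by (subst ennreal_mult[symmetric]) (auto simp: power4_eq_xxxx power3_eq_cube)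
    finally show "(\<integral>\<^sup>+q. indicator {q. B q \<noteq> 0} q * ennreal (gauss_ft d (\<Psi> q - w)) \<partial>lborel) \<le> ennreal (M * (2 * pi) ^ 4)" .
  qed
  also have "N2 B = N2 \<alpha> * N2 \<gamma>"
  proof -
    have "N2 B = (\<integral>\<^sup>+\<eta>. \<integral>\<^sup>+\<zeta>. ennreal ((cmod (\<alpha> \<eta>))\<^sup>2) * ennreal ((cmod (\<gamma> \<zeta>))\<^sup>2) \<partial>lborel \<partial>lborel)"
      unfolding N2_def B_def norm_mult power_mult_distrib ennreal_mult[OF zero_le_power2 zero_le_power2]
      by (rule lborel_Fubini_nn(1)) (simp add: case_prod_beta')
    also have "\<dots> = N2 \<alpha> * N2 \<gamma>" unfolding N2_def by (simp add: nn_integral_cmult nn_integral_multc)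
    finally show ?thesis .
  qed
  finally show ?thesis unfolding eq[abs_def] .
qed

section \<open>Estimates for the thickness of level sets\<close>

lemma thin_subset:
  assumes "thin M S \<Phi>" "S' \<subseteq> S" "S \<in> sets borel" "\<Phi> \<in> borel_measurable borel" shows "thin M S' \<Phi>"
  unfolding thin_def
proof (intro allI impI)
  fix w l :: real assume l: "0 < l"
  note [measurable] = assms(3,4)
  have "emeasure lborel {\<eta> \<in> S'. \<bar>\<Phi> \<eta> - w\<bar> < l} \<le> emeasure lborel {\<eta> \<in> S. \<bar>\<Phi> \<eta> - w\<bar> < l}"
    using assms(2) by (intro emeasure_mono) auto
  also have "\<dots> \<le> ennreal (M * (2 * l))" using assms(1) l by (simp add: thin_def)
  finally show "emeasure lborel {\<eta> \<in> S'. \<bar>\<Phi> \<eta> - w\<bar> < l} \<le> ennreal (M * (2 * l))" .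
qed

lemma thin_mono: "thin M S \<Phi> \<Longrightarrow> M \<le> M' \<Longrightarrow> thin M' S \<Phi>"
  unfolding thin_def by (meson ennreal_leI mult_right_mono order_trans less_imp_le zero_le_numeral mult_nonneg_nonneg)

lemma thin_uminus: assumes "thin M S \<Phi>" shows "thin M S (\<lambda>\<eta>. - \<Phi> \<eta>)"
  unfolding thin_def
proof (intro allI impI)
  fix w l :: real assume l: "0 < l"
  have "{\<eta> \<in> S. \<bar>- \<Phi> \<eta> - w\<bar> < l} = {\<eta> \<in> S. \<bar>\<Phi> \<eta> - (- w)\<bar> < l}" by auto
  then show "emeasure lborel {\<eta> \<in> S. \<bar>- \<Phi> \<eta> - w\<bar> < l} \<le> ennreal (M * (2 * l))"
    using assms l by (simp only: thin_def)
qed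

text \<open>Slices will be measured by how far apart two of their points can be, which is the
  quantity that a monotone phase controls.\<close>

lemma emeasure_diameter:
  fixes A :: "real set"
  assumes "\<And>x y. x \<in> A \<Longrightarrow> y \<in> A \<Longrightarrow> x \<le> y \<Longrightarrow> y - x \<le> \<delta>" "0 \<le> \<delta>"
  shows "emeasure lborel A \<le> ennreal \<delta>"
proof (cases "A = {}")
  case False
  then obtain a where a: "a \<in> A" by blast
  have bdd: "bdd_below A"
  proof (rule bdd_belowI[of _ "a - \<delta>"])
    fix x assume "x \<in> A"
    then show "a - \<delta> \<le> x" using assms(1)[OF _ a, of x] assms(2) by (cases "x \<le> a") auto
  qed
  have "A \<subseteq> {Inf A..Inf A + \<delta>}"
  proof
    fix x assume x: "x \<in> A"
    have "x - \<delta> \<le> Inf A"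
    proof (rule cInf_greatest[OF False])
      fix y assume y: "y \<in> A"
      show "x - \<delta> \<le> y" using assms(1)[OF y x] assms(2) by (cases "y \<le> x") auto
    qed
    then show "x \<in> {Inf A..Inf A + \<delta>}" using cInf_lower[OF x bdd] by simp
  qed
  then have "emeasure lborel A \<le> emeasure lborel {Inf A..Inf A + \<delta>}" by (intro emeasure_mono) auto
  then show ?thesis using assms(2) by simp
qed simp

section \<open>Rotations and the hat-box theorem\<close>

lemma lborel_orthogonal:
  fixes f :: "real^3 \<Rightarrow> real^3"
  assumes f: "orthogonal_transformation f" shows "distr lborel borel f = lborel"
proof -
  have lin: "linear f" by (rule orthogonal_transformation_linear[OF f])
  have mf [measurable]: "f \<in> borel_measurable borel"
    by (intro borel_measurable_continuous_onI linear_continuous_on linear_conv_bounded_linear[THEN iffD1] lin)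
  have bij: "bij f" by (rule orthogonal_transformation_bij[OF f])
  have oi: "orthogonal_transformation (inv f)" by (rule orthogonal_transformation_inv[OF f])
  show ?thesis
  proof (rule lborel_eqI[symmetric])
    fix l u :: "real^3" assume lu: "\<And>b. b \<in> Basis \<Longrightarrow> l \<bullet> b \<le> u \<bullet> b"
    have pre: "f -` box l u = inv f ` box l u" using bij by (simp add: bij_vimage_eq_inv_image)
    have S: "box l u \<in> lmeasurable" by simp
    have "inv f ` box l u \<in> lmeasurable" by (rule measurable_orthogonal_image[OF oi S])
    moreover have "measure lebesgue (inv f ` box l u) = measure lebesgue (box l u)" by (rule measure_orthogonal_image[OF oi S])
    ultimately have "emeasure lebesgue (inv f ` box l u) = emeasure lebesgue (box l u)"
      using S by (simp add: emeasure_eq_measure2)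
    moreover have "inv f ` box l u \<in> sets borel" unfolding pre[symmetric] using measurable_sets[OF mf, of "box l u"] by simp
    ultimately have "emeasure lborel (inv f ` box l u) = emeasure lborel (box l u)" by simp
    then show "emeasure (distr lborel borel f) (box l u) = (\<Prod>b\<in>Basis. (u - l) \<bullet> b)"
      using lu by (subst emeasure_distr) (auto simp: pre emeasure_lborel_box)
  qed simp
qed

lemma real3_Basis_prod: "(\<Prod>b\<in>(Basis::(real^3) set). f b) = f (axis 1 1) * f (axis 2 1) * f (axis 3 1)" for f :: "real^3 \<Rightarrow> real"
proof -
  have B: "(Basis::(real^3) set) = range (\<lambda>i. axis i 1)" by (auto simp: Basis_vec_def)
  have "inj (\<lambda>i::3. axis i (1::real))" by (auto simp: inj_def axis_eq_axis)
  then have "(\<Prod>b\<in>(Basis::(real^3) set). f b) = prod (f \<circ> (\<lambda>i. axis i 1)) (UNIV :: 3 set)" unfolding B by (rule prod.reindex)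
  also have "\<dots> = f (axis 1 1) * f (axis 2 1) * f (axis 3 1)" unfolding UNIV_3 by (simp add: mult.assoc)
  finally show ?thesis .
qed

text \<open>Splits space into a line and a plane, the form in which Fubini is applied along the axis
  in \<open>hat_box\<close>.\<close>

definition vec3 :: "real \<times> (real \<times> real) \<Rightarrow> real^3" where
  "vec3 p = fst p *\<^sub>R axis 1 1 + (fst (snd p) *\<^sub>R axis 2 1 + snd (snd p) *\<^sub>R axis 3 1)"

lemma vec3_nth [simp]: "vec3 p $ 1 = fst p" "vec3 p $ 2 = fst (snd p)" "vec3 p $ 3 = snd (snd p)"
  by (simp_all add: vec3_def axis_def)

lemma vec3_measurable [measurable]: "vec3 \<in> borel_measurable borel"
  unfolding vec3_def[abs_def] by (intro borel_measurable_continuous_onI continuous_intros)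

lemma emeasure_lborel_Times:
  fixes A :: "'a::euclidean_space set" and B :: "'b::euclidean_space set"
  assumes "A \<in> sets borel" "B \<in> sets borel"
  shows "emeasure lborel (A \<times> B) = emeasure lborel A * emeasure lborel B"
  using lborel.emeasure_pair_measure_Times[of A lborel B] assms by (simp add: lborel_prod)

lemma lborel_vec3: "distr lborel borel vec3 = lborel"
proof (rule lborel_eqI[symmetric])
  fix l u :: "real^3" assume lu: "\<And>b. b \<in> Basis \<Longrightarrow> l \<bullet> b \<le> u \<bullet> b"
  have le: "l $ i \<le> u $ i" for i using lu[of "axis i 1"] by (simp add: inner_axis axis_in_Basis_iff)
  have pre: "vec3 -` box l u = {l $ 1<..<u $ 1} \<times> ({l $ 2<..<u $ 2} \<times> {l $ 3<..<u $ 3})"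
    by (auto simp: mem_box_cart forall_3)
  have "emeasure lborel (vec3 -` box l u) = ennreal (u $ 1 - l $ 1) * (ennreal (u $ 2 - l $ 2) * ennreal (u $ 3 - l $ 3))"
  proof -
    have o: "{l $ 2<..<u $ 2} \<times> {l $ 3<..<u $ 3} \<in> sets borel" by (intro borel_open open_Times) auto
    show ?thesis unfolding pre
      by (subst emeasure_lborel_Times[OF _ o], simp, subst emeasure_lborel_Times, simp, simp) (simp add: le)
  qed
  also have "\<dots> = ennreal ((u $ 1 - l $ 1) * (u $ 2 - l $ 2) * (u $ 3 - l $ 3))"
    using le by (simp add: ennreal_mult[symmetric] mult.assoc)
  also have "\<dots> = (\<Prod>b\<in>Basis. (u - l) \<bullet> b)"
    unfolding real3_Basis_prod by (simp add: inner_axis)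
  finally show "emeasure (distr lborel borel vec3) (box l u) = (\<Prod>b\<in>Basis. (u - l) \<bullet> b)"
    by (subst emeasure_distr) auto
qed simp

text \<open>The disc of radius sqrt a has area \<pi> a, linear in a: the squared norm of a planar
  vector is distributed with constant density \<pi> on [0, \<infinity>). The half-lines generate the
  Borel sets, so they determine the image measure.\<close>

lemma planar_norm_sq:
  fixes g :: "real \<Rightarrow> ennreal"
  assumes [measurable]: "g \<in> borel_measurable borel"
  shows "(\<integral>\<^sup>+z. g ((norm (z :: real \<times> real))\<^sup>2) \<partial>lborel) \<le> ennreal pi * (\<integral>\<^sup>+q. g q \<partial>lborel)"
proof -
  define \<mu> where "\<mu> = distr lborel borel (\<lambda>z :: real \<times> real. (norm z)\<^sup>2)"
  define \<nu> where "\<nu> = density lborel (\<lambda>q::real. ennreal pi * indicator {0..} q)"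
  have dim: "DIM(real \<times> real) = 2" by simp
  have "\<mu> = \<nu>"
  proof (rule measure_eqI_generator_eq[where E="range (\<lambda>a. {..a})" and \<Omega>=UNIV and A="\<lambda>n::nat. {..real n}"])
    show "Int_stable (range (\<lambda>a. {..a::real}))" by (auto simp: Int_stable_def)
    show "range (\<lambda>a. {..a::real}) \<subseteq> Pow UNIV" by simp
    show "sets \<mu> = sigma_sets UNIV (range (\<lambda>a. {..a}))" "sets \<nu> = sigma_sets UNIV (range (\<lambda>a. {..a}))"
      unfolding \<mu>_def \<nu>_def sets_distr sets_density sets_lborel by (subst borel_eq_atMost, simp)+
    have M: "emeasure \<mu> {..a} = ennreal (pi * max 0 a)" for a
    proof (cases "0 \<le> a")
      case True
      have "(\<lambda>z :: real \<times> real. (norm z)\<^sup>2) -` {..a} = cball 0 (sqrt a)"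
      proof -
        have "(norm z)\<^sup>2 \<le> a \<longleftrightarrow> sqrt ((norm z)\<^sup>2) \<le> sqrt a" for z :: "real \<times> real" by (simp only: real_sqrt_le_iff)
        then show ?thesis by (auto simp: set_eq_iff)
      qed
      then have "emeasure \<mu> {..a} = ennreal (unit_ball_vol (real 2) * (sqrt a) ^ 2)"
        unfolding \<mu>_def using emeasure_cball[of "sqrt a" "0 :: real \<times> real"] True by (subst emeasure_distr) (auto simp: dim)
      then show ?thesis using True by (simp add: eval_unit_ball_vol)
    next
      case False
      then have "(\<lambda>z :: real \<times> real. (norm z)\<^sup>2) -` {..a} = {}"
      proof -
        have "\<not> (norm z)\<^sup>2 \<le> a" for z :: "real \<times> real" using False zero_le_power2[of "norm z"] by linarith
        then show ?thesis by auto
      qed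
      then show ?thesis using False unfolding \<mu>_def by (subst emeasure_distr) auto
    qed
    have N: "emeasure \<nu> {..a} = ennreal (pi * max 0 a)" for a
    proof -
      have "emeasure \<nu> {..a} = (\<integral>\<^sup>+q. ennreal pi * indicator {0..a} q \<partial>lborel)"
        unfolding \<nu>_def by (subst emeasure_density) (auto intro!: nn_integral_cong simp: indicator_def)
      also have "\<dots> = ennreal pi * emeasure lborel {0..a}" by (rule nn_integral_cmult_indicator) simp
      also have "\<dots> = ennreal (pi * max 0 a)" by (cases "0 \<le> a") (auto simp: ennreal_mult)
      finally show ?thesis .
    qed
    show "emeasure \<mu> X = emeasure \<nu> X" if "X \<in> range (\<lambda>a. {..a})" for X using that M N by auto
    show "range (\<lambda>n::nat. {..real n}) \<subseteq> range (\<lambda>a. {..a})" by auto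
    show "(\<Union>n::nat. {..real n}) = UNIV" using real_arch_simple by auto
    show "emeasure \<mu> {..real n} \<noteq> \<infinity>" for n :: nat unfolding M by simp
  qed
  then have "(\<integral>\<^sup>+z. g ((norm (z :: real \<times> real))\<^sup>2) \<partial>lborel) = (\<integral>\<^sup>+q. g q \<partial>\<nu>)"
    unfolding \<mu>_def by (subst nn_integral_distr[symmetric]) auto
  also have "\<dots> = (\<integral>\<^sup>+q. ennreal pi * indicator {0..} q * g q \<partial>lborel)"
    unfolding \<nu>_def by (rule nn_integral_density) measurable
  also have "\<dots> \<le> (\<integral>\<^sup>+q. ennreal pi * g q \<partial>lborel)" by (intro nn_integral_mono) (auto simp: indicator_def)
  also have "\<dots> = ennreal pi * (\<integral>\<^sup>+q. g q \<partial>lborel)" by (rule nn_integral_cmult) simp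
  finally show ?thesis .
qed

text \<open>Archimedes: height and squared radius of a point have joint density at most \<pi>. After
  a rotation the height is the first coordinate a, and |\<omega>|^2 = a^2 + |z|^2 with z planar, to
  which \<open>planar_norm_sq\<close> applies for each a.\<close>

lemma hat_box:
  fixes e :: "real^3"
  assumes e: "norm e = 1" and D [measurable]: "D \<in> sets (borel :: (real \<times> real) measure)"
  shows "emeasure lborel {\<omega> :: real^3. (e \<bullet> \<omega>, (norm \<omega>)\<^sup>2) \<in> D} \<le> ennreal pi * emeasure lborel D"
proof -
  define e1 where "e1 = (axis 1 1 :: real^3)"
  have "norm e1 = 1" by (simp add: e1_def)
  then obtain f where f: "orthogonal_transformation f" and fe: "f e1 = e" using orthogonal_transformation_exists_1 e by metis
  have [measurable]: "f \<in> borel_measurable borel"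
    using orthogonal_transformation_linear[OF f]
    by (intro borel_measurable_continuous_onI linear_continuous_on linear_conv_bounded_linear[THEN iffD1])
  define X where "X = {\<omega> :: real^3. (e \<bullet> \<omega>, (norm \<omega>)\<^sup>2) \<in> D}"
  have [measurable]: "X \<in> sets borel" unfolding X_def by measurable
  have iX: "(a, a\<^sup>2 + (norm z)\<^sup>2) \<in> D \<longleftrightarrow> f (vec3 (a, z)) \<in> X" for a z
  proof -
    have 1: "e \<bullet> f (vec3 (a, z)) = a"
      unfolding fe[symmetric] using f by (simp add: orthogonal_transformation_def e1_def inner_commute[of "axis 1 1"] inner_axis)
    have "(norm (f (vec3 (a, z))))\<^sup>2 = (norm (vec3 (a, z)))\<^sup>2" using orthogonal_transformation_norm[OF f] by simp
    also have "\<dots> = a\<^sup>2 + (norm z)\<^sup>2"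
      unfolding power2_norm_eq_inner by (cases z) (simp add: inner_vec_def sum_3 power2_eq_square)
    finally show ?thesis using 1 by (simp add: X_def)
  qed
  have mD: "(\<lambda>q. indicator D q :: ennreal) \<in> borel_measurable borel" by measurable
  have "emeasure lborel X = emeasure (distr (distr lborel borel vec3) borel f) X"
    unfolding lborel_vec3 lborel_orthogonal[OF f] ..
  also have "\<dots> = (\<integral>\<^sup>+p. indicator X (f (vec3 p)) \<partial>lborel)"
    by (subst nn_integral_indicator[symmetric], simp, subst nn_integral_distr, simp, simp, subst nn_integral_distr) simp_all
  also have "\<dots> = (\<integral>\<^sup>+p. indicator D (fst p, (fst p)\<^sup>2 + (norm (snd (p :: real \<times> (real \<times> real))))\<^sup>2) \<partial>lborel)"
  proof (rule nn_integral_cong)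
    fix p :: "real \<times> (real \<times> real)"
    show "indicator X (f (vec3 p)) = (indicator D (fst p, (fst p)\<^sup>2 + (norm (snd p))\<^sup>2) :: ennreal)"
      using iX[of "fst p" "snd p"] by (simp add: indicator_def)
  qed
  also have "\<dots> = (\<integral>\<^sup>+a. \<integral>\<^sup>+z. indicator D (a, a\<^sup>2 + (norm (z :: real \<times> real))\<^sup>2) \<partial>lborel \<partial>lborel)"
    by (rule lborel_Fubini_nn(1)) (simp add: case_prod_beta')
  also have "\<dots> \<le> (\<integral>\<^sup>+a. ennreal pi * (\<integral>\<^sup>+q. indicator D (a, a\<^sup>2 + q) \<partial>lborel) \<partial>lborel)"
    by (intro nn_integral_mono planar_norm_sq) measurable
  also have "\<dots> = (\<integral>\<^sup>+a. ennreal pi * (\<integral>\<^sup>+p. indicator D (a, p) \<partial>lborel) \<partial>lborel)"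
  proof (rule nn_integral_cong)
    fix a :: real
    have "(\<lambda>p. indicator D (a, p) :: ennreal) \<in> borel_measurable borel" by measurable
    from lborel_nn_affine[OF this, of 1 "a\<^sup>2"]
    show "ennreal pi * (\<integral>\<^sup>+q. indicator D (a, a\<^sup>2 + q) \<partial>lborel) = ennreal pi * (\<integral>\<^sup>+p. indicator D (a, p) \<partial>lborel)" by simp
  qed
  also have "\<dots> = ennreal pi * (\<integral>\<^sup>+a. \<integral>\<^sup>+p. indicator D (a, p) \<partial>lborel \<partial>lborel)"
  proof (rule nn_integral_cmult)
    have "(\<lambda>(a, p). indicator D (a, p) :: ennreal) \<in> borel_measurable (lborel \<Otimes>\<^sub>M lborel)"
      using mD by (simp add: lborel_prod case_prod_beta')
    then show "(\<lambda>a. \<integral>\<^sup>+p. indicator D (a, p) \<partial>lborel) \<in> borel_measurable lborel"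
      by (rule lborel.borel_measurable_nn_integral)
  qed
  also have "(\<integral>\<^sup>+a. \<integral>\<^sup>+p. indicator D (a, p) \<partial>lborel \<partial>lborel) = (\<integral>\<^sup>+q. indicator D (fst q, snd q) \<partial>lborel)"
    by (rule lborel_Fubini_nn(1)[symmetric]) (use mD in \<open>simp add: case_prod_beta'\<close>)
  also have "\<dots> = emeasure lborel D" by simp
  finally show ?thesis unfolding X_def .
qed

lemma emeasure_slices_snd:
  fixes D :: "(real \<times> real) set"
  assumes D [measurable]: "D \<in> sets borel" and p: "\<And>z p. (z, p) \<in> D \<Longrightarrow> p0 \<le> p \<and> p \<le> p1"
    and sl: "\<And>p z z'. (z, p) \<in> D \<Longrightarrow> (z', p) \<in> D \<Longrightarrow> z \<le> z' \<Longrightarrow> z' - z \<le> \<delta>" and "p0 \<le> p1" "0 \<le> \<delta>"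
  shows "emeasure lborel D \<le> ennreal ((p1 - p0) * \<delta>)"
proof -
  have mD: "(\<lambda>q. indicator D q :: ennreal) \<in> borel_measurable borel" by measurable
  have "emeasure lborel D = (\<integral>\<^sup>+q. indicator D (fst q, snd q) \<partial>lborel)" by simp
  also have "\<dots> = (\<integral>\<^sup>+p. \<integral>\<^sup>+z. indicator D (z, p) \<partial>lborel \<partial>lborel)"
    by (rule lborel_Fubini_nn(2)) (use mD in \<open>simp add: case_prod_beta'\<close>)
  also have "\<dots> \<le> (\<integral>\<^sup>+p. ennreal \<delta> * indicator {p0..p1} p \<partial>lborel)"
  proof (rule nn_integral_mono)
    fix p :: real
    have [measurable]: "{z. (z, p) \<in> D} \<in> sets borel" by measurable
    have "(\<integral>\<^sup>+z. indicator D (z, p) \<partial>lborel) = (\<integral>\<^sup>+z. indicator {z. (z, p) \<in> D} z \<partial>lborel)"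
      by (intro nn_integral_cong) (auto simp: indicator_def)
    also have "\<dots> = emeasure lborel {z. (z, p) \<in> D}" by (rule nn_integral_indicator) simp
    also have "\<dots> \<le> ennreal \<delta> * indicator {p0..p1} p"
    proof (cases "p \<in> {p0..p1}")
      case True
      have "emeasure lborel {z. (z, p) \<in> D} \<le> ennreal \<delta>"
        by (rule emeasure_diameter) (use sl assms(5) in auto)
      then show ?thesis using True by simp
    next
      case False
      then have "{z. (z, p) \<in> D} = {}" using assms(2) by auto
      then show ?thesis by simp
    qed
    finally show "(\<integral>\<^sup>+z. indicator D (z, p) \<partial>lborel) \<le> ennreal \<delta> * indicator {p0..p1} p" .
  qed
  also have "\<dots> = ennreal \<delta> * emeasure lborel {p0..p1}" by (rule nn_integral_cmult_indicator) simp
  also have "\<dots> = ennreal ((p1 - p0) * \<delta>)" using assms(4,5) by (simp add: ennreal_mult[symmetric] mult.commute)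
  finally show ?thesis .
qed

lemma emeasure_slices_fst:
  fixes D :: "(real \<times> real) set"
  assumes D [measurable]: "D \<in> sets borel" and z: "\<And>z p. (z, p) \<in> D \<Longrightarrow> z0 \<le> z \<and> z \<le> z1"
    and sl: "\<And>z p p'. (z, p) \<in> D \<Longrightarrow> (z, p') \<in> D \<Longrightarrow> p \<le> p' \<Longrightarrow> p' - p \<le> \<delta>" and "z0 \<le> z1" "0 \<le> \<delta>"
  shows "emeasure lborel D \<le> ennreal ((z1 - z0) * \<delta>)"
proof -
  define D' where "D' = {q. (snd q, fst q) \<in> D}"
  have mD': "D' \<in> sets borel" unfolding D'_def by measurable
  have mD: "(\<lambda>q. indicator D q :: ennreal) \<in> borel_measurable borel" by measurable
  have "emeasure lborel D = (\<integral>\<^sup>+q. indicator D (fst q, snd q) \<partial>lborel)" by simp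
  also have "\<dots> = (\<integral>\<^sup>+z. \<integral>\<^sup>+p. indicator D (z, p) \<partial>lborel \<partial>lborel)"
    by (rule lborel_Fubini_nn(1)) (use mD in \<open>simp add: case_prod_beta'\<close>)
  also have "\<dots> = (\<integral>\<^sup>+z. \<integral>\<^sup>+p. indicator D' (p, z) \<partial>lborel \<partial>lborel)"
    by (intro nn_integral_cong) (auto simp: D'_def indicator_def)
  also have "\<dots> = (\<integral>\<^sup>+q. indicator D' (fst q, snd q) \<partial>lborel)"
    by (rule lborel_Fubini_nn(2)[symmetric]) (use mD' in \<open>simp add: case_prod_beta'\<close>)
  also have "\<dots> = emeasure lborel D'" using mD' by simp
  also have "\<dots> \<le> ennreal ((z1 - z0) * \<delta>)"
    by (rule emeasure_slices_snd[OF mD']) (use z sl assms(4,5) in \<open>auto simp: D'_def\<close>)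
  finally show ?thesis .
qed

section \<open>Thickness of the combined phases\<close>

lemma emeasure_reflect:
  fixes A :: "'a::euclidean_space set"
  assumes [measurable]: "A \<in> sets borel"
  shows "emeasure lborel A = emeasure lborel {\<omega>. \<xi> - \<omega> \<in> A}"
proof -
  have "(\<lambda>x. indicator A x :: ennreal) \<in> borel_measurable borel" by measurable
  from lborel_nn_affine[OF this, of "-1" \<xi>]
  have "(\<integral>\<^sup>+x. indicator A x \<partial>lborel) = (\<integral>\<^sup>+\<omega>. indicator A (\<xi> - \<omega>) \<partial>lborel)" by simp
  also have "\<dots> = (\<integral>\<^sup>+\<omega>. indicator {\<omega>. \<xi> - \<omega> \<in> A} \<omega> \<partial>lborel)" by (intro nn_integral_cong) (auto simp: indicator_def)
  also have "\<dots> = emeasure lborel {\<omega>. \<xi> - \<omega> \<in> A}" by (rule nn_integral_indicator) measurable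
  finally show ?thesis by simp
qed

lemma norm_diff_sq: "(norm (a - b))\<^sup>2 = (norm b)\<^sup>2 - 2 * (a \<bullet> b) + (norm a)\<^sup>2" for a b :: "'a::real_inner"
  unfolding power2_norm_eq_inner by (simp add: inner_diff_left inner_diff_right inner_commute)

text \<open>Hat-box coordinates z = \<open>e0\<close> \<bullet> \<omega> and p = |\<omega>|^2 of
  \<omega> = \<xi> - \<eta>. For fixed p the second phase is constant, and |\<eta>|^2 = p - 2 d z +
  d^2 is linear in z with slope -2 |\<xi>|. A window of length 2 l e for |\<eta>| \<le> B therefore
  confines z to length 2 l e B / |\<xi>|.\<close>

lemma thin_sphere:
  fixes \<xi> :: "real^3"
  assumes \<xi>: "\<xi> \<noteq> 0" and e: "0 < e" and B: "0 < B" and s: "s \<in> {1, - 1}" and p: "p0 \<le> p1"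
    and [measurable]: "\<psi> \<in> borel_measurable borel"
  shows "thin (pi * (p1 - p0) * (e * B / norm \<xi>)) {\<eta>. norm \<eta> \<le> B \<and> p0 \<le> (norm (\<xi> - \<eta>))\<^sup>2 \<and> (norm (\<xi> - \<eta>))\<^sup>2 \<le> p1}
     (\<lambda>\<eta>. s * (norm \<eta> / e) + \<psi> (norm (\<xi> - \<eta>)))"
  unfolding thin_def
proof (intro allI impI)
  fix w l :: real assume l: "0 < l"
  define d where "d = norm \<xi>"
  have d: "0 < d" using \<xi> by (simp add: d_def)
  define A where "A = {\<eta> \<in> {\<eta>. norm \<eta> \<le> B \<and> p0 \<le> (norm (\<xi> - \<eta>))\<^sup>2 \<and> (norm (\<xi> - \<eta>))\<^sup>2 \<le> p1}. \<bar>s * (norm \<eta> / e) + \<psi> (norm (\<xi> - \<eta>)) - w\<bar> < l}"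
  have A [measurable]: "A \<in> sets borel" unfolding A_def by measurable
  define R where "R z p = sqrt (p - 2 * d * z + d\<^sup>2)" for z p
  define D where "D = {q. p0 \<le> snd q \<and> snd q \<le> p1 \<and> 0 \<le> snd q - 2 * d * fst q + d\<^sup>2 \<and> R (fst q) (snd q) \<le> B \<and> \<bar>s * (R (fst q) (snd q) / e) + \<psi> (sqrt (snd q)) - w\<bar> < l}"
  have D [measurable]: "D \<in> sets borel" unfolding D_def R_def by measurable
  define e0 where "e0 = \<xi> /\<^sub>R d"
  have e0: "norm e0 = 1" using d by (simp add: e0_def d_def)
  have sub: "{\<omega>. \<xi> - \<omega> \<in> A} \<subseteq> {\<omega>. (e0 \<bullet> \<omega>, (norm \<omega>)\<^sup>2) \<in> D}"
  proof (rule subsetI, rule CollectI)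
    fix \<omega> assume "\<omega> \<in> {\<omega>. \<xi> - \<omega> \<in> A}"
    then have w: "norm (\<xi> - \<omega>) \<le> B" "p0 \<le> (norm \<omega>)\<^sup>2" "(norm \<omega>)\<^sup>2 \<le> p1" "\<bar>s * (norm (\<xi> - \<omega>) / e) + \<psi> (norm \<omega>) - w\<bar> < l"
      by (auto simp: A_def)
    have "d * (e0 \<bullet> \<omega>) = \<xi> \<bullet> \<omega>" using d by (simp add: e0_def)
    then have sq: "(norm (\<xi> - \<omega>))\<^sup>2 = (norm \<omega>)\<^sup>2 - 2 * d * (e0 \<bullet> \<omega>) + d\<^sup>2"
      unfolding norm_diff_sq[of \<xi> \<omega>] d_def by (simp add: mult.assoc)
    have "R (e0 \<bullet> \<omega>) ((norm \<omega>)\<^sup>2) = norm (\<xi> - \<omega>)" unfolding R_def sq[symmetric] by simp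
    then show "(e0 \<bullet> \<omega>, (norm \<omega>)\<^sup>2) \<in> D" using w unfolding D_def by (simp add: sq[symmetric])
  qed
  have "emeasure lborel A \<le> emeasure lborel {\<omega> :: real^3. (e0 \<bullet> \<omega>, (norm \<omega>)\<^sup>2) \<in> D}"
    unfolding emeasure_reflect[OF A, of \<xi>] by (rule emeasure_mono[OF sub]) measurable
  also have "\<dots> \<le> ennreal pi * emeasure lborel D" by (rule hat_box[OF e0 D])
  also have "\<dots> \<le> ennreal pi * ennreal ((p1 - p0) * (2 * l * e * B / d))"
  proof (intro mult_left_mono emeasure_slices_snd[OF D])
    fix p z z' assume q: "(z, p) \<in> D" "(z', p) \<in> D" and z: "z \<le> z'"
    have nn: "0 \<le> p - 2 * d * z + d\<^sup>2" "0 \<le> p - 2 * d * z' + d\<^sup>2" and RB: "R z p \<le> B" "R z' p \<le> B"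
      and ph: "\<bar>s * (R z p / e) + \<psi> (sqrt p) - w\<bar> < l" "\<bar>s * (R z' p / e) + \<psi> (sqrt p) - w\<bar> < l"
      using q by (auto simp: D_def)
    have "\<bar>a - b\<bar> < 2 * l" if "\<bar>a + c - w\<bar> < l" "\<bar>b + c - w\<bar> < l" for a b c using that by linarith
    from this[OF ph] have "\<bar>s * (R z p / e) - s * (R z' p / e)\<bar> < 2 * l" .
    moreover have "\<bar>s * (R z p / e) - s * (R z' p / e)\<bar> = \<bar>R z p - R z' p\<bar> / e"
      using s e by (auto simp: diff_divide_distrib[symmetric] abs_minus_commute)
    ultimately have dR: "R z p - R z' p \<le> 2 * l * e" using e by (simp add: pos_divide_less_eq)
    have R0: "0 \<le> R z p" "0 \<le> R z' p" using nn by (auto simp: R_def)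
    have "2 * d * (z' - z) = (R z p)\<^sup>2 - (R z' p)\<^sup>2" unfolding R_def using nn by (simp add: algebra_simps)
    also have "\<dots> = (R z p - R z' p) * (R z p + R z' p)" by (simp add: power2_eq_square algebra_simps)
    also have "\<dots> \<le> (2 * l * e) * (R z p + R z' p)" using dR R0 by (intro mult_right_mono) auto
    also have "\<dots> \<le> (2 * l * e) * (2 * B)" using RB l e by (intro mult_left_mono) auto
    finally have "2 * (d * (z' - z)) \<le> 2 * (2 * l * e * B)" by (simp only: mult_ac)
    then have "d * (z' - z) \<le> 2 * l * e * B" by (rule mult_left_le_imp_le) simp
    then show "z' - z \<le> 2 * l * e * B / d" using d by (simp add: pos_le_divide_eq mult.commute)
  qed (use p l e B d in \<open>auto simp: D_def\<close>)
  also have "\<dots> = ennreal (pi * (p1 - p0) * (e * B / norm \<xi>) * (2 * l))"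
    using p l e B d by (subst ennreal_mult[symmetric]) (auto simp: d_def mult_ac)
  finally show "emeasure lborel {\<eta> \<in> {\<eta>. norm \<eta> \<le> B \<and> p0 \<le> (norm (\<xi> - \<eta>))\<^sup>2 \<and> (norm (\<xi> - \<eta>))\<^sup>2 \<le> p1}. \<bar>s * (norm \<eta> / e) + \<psi> (norm (\<xi> - \<eta>)) - w\<bar> < l}
     \<le> ennreal (pi * (p1 - p0) * (e * B / norm \<xi>) * (2 * l))" unfolding A_def .
qed

text \<open>Hat-box coordinates z = \<open>e0\<close> \<bullet> \<eta> and p = |\<eta>|^2. For fixed
  z both arguments of \<psi>, namely p and p - 2 d z + d^2, move with p at unit speed, so the
  increments of the two terms add instead of cancelling and p is confined to length 2 l / k. The
  ball confines z to length 2 R.\<close>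

lemma thin_quadric:
  fixes \<xi> y0 :: "real^3"
  assumes mono: "\<And>p p'. 0 \<le> p \<Longrightarrow> p \<le> p' \<Longrightarrow> p' \<le> B\<^sup>2 \<Longrightarrow> k * (p' - p) \<le> \<psi> p' - \<psi> p" and k: "0 < k" and R: "0 \<le> R"
    and [measurable]: "\<psi> \<in> borel_measurable borel"
  shows "thin (pi * (2 * R) / k) {\<eta>. norm \<eta> \<le> B \<and> norm (\<xi> - \<eta>) \<le> B \<and> \<eta> \<in> cball y0 R}
     (\<lambda>\<eta>. \<psi> ((norm \<eta>)\<^sup>2) + \<psi> ((norm (\<xi> - \<eta>))\<^sup>2))"
  unfolding thin_def
proof (intro allI impI)
  fix w l :: real assume l: "0 < l"
  define d where "d = norm \<xi>"
  define A where "A = {\<eta> \<in> {\<eta>. norm \<eta> \<le> B \<and> norm (\<xi> - \<eta>) \<le> B \<and> \<eta> \<in> cball y0 R}. \<bar>\<psi> ((norm \<eta>)\<^sup>2) + \<psi> ((norm (\<xi> - \<eta>))\<^sup>2) - w\<bar> < l}"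
  \<comment> \<open>For \<xi> = 0 any unit vector serves as axis, since then d = 0 and both sides of
    \<open>de0\<close> vanish.\<close>
  define e0 where "e0 = (if \<xi> = 0 then axis 1 1 else \<xi> /\<^sub>R d)"
  have e0: "norm e0 = 1" by (auto simp: e0_def d_def)
  have de0: "d * (e0 \<bullet> \<omega>) = \<xi> \<bullet> \<omega>" for \<omega> by (auto simp: e0_def d_def)
  define D where "D = {q. e0 \<bullet> y0 - R \<le> fst q \<and> fst q \<le> e0 \<bullet> y0 + R \<and> 0 \<le> snd q \<and> snd q \<le> B\<^sup>2 \<and> 0 \<le> snd q - 2 * d * fst q + d\<^sup>2 \<and> snd q - 2 * d * fst q + d\<^sup>2 \<le> B\<^sup>2 \<and> \<bar>\<psi> (snd q) + \<psi> (snd q - 2 * d * fst q + d\<^sup>2) - w\<bar> < l}"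
  have D [measurable]: "D \<in> sets borel" unfolding D_def by measurable
  have sub: "A \<subseteq> {\<omega>. (e0 \<bullet> \<omega>, (norm \<omega>)\<^sup>2) \<in> D}"
  proof (rule subsetI, rule CollectI)
    fix \<omega> assume "\<omega> \<in> A"
    then have w: "norm \<omega> \<le> B" "norm (\<xi> - \<omega>) \<le> B" "norm (y0 - \<omega>) \<le> R" "\<bar>\<psi> ((norm \<omega>)\<^sup>2) + \<psi> ((norm (\<xi> - \<omega>))\<^sup>2) - w\<bar> < l"
      by (auto simp: A_def dist_norm)
    have sq: "(norm (\<xi> - \<omega>))\<^sup>2 = (norm \<omega>)\<^sup>2 - 2 * d * (e0 \<bullet> \<omega>) + d\<^sup>2"
      unfolding norm_diff_sq[of \<xi> \<omega>] de0[symmetric] by (simp add: d_def mult.assoc)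
    have "\<bar>e0 \<bullet> (y0 - \<omega>)\<bar> \<le> norm e0 * norm (y0 - \<omega>)" by (rule Cauchy_Schwarz_ineq2)
    then have "\<bar>e0 \<bullet> y0 - e0 \<bullet> \<omega>\<bar> \<le> R" using w(3) e0 by (simp add: inner_diff_right)
    then have "e0 \<bullet> y0 - R \<le> e0 \<bullet> \<omega>" "e0 \<bullet> \<omega> \<le> e0 \<bullet> y0 + R" by (auto simp: abs_le_iff)
    moreover have "(norm \<omega>)\<^sup>2 \<le> B\<^sup>2" "(norm (\<xi> - \<omega>))\<^sup>2 \<le> B\<^sup>2" using w(1,2) by (auto intro: power_mono)
    moreover have "0 \<le> (norm (\<xi> - \<omega>))\<^sup>2" by simp
    ultimately show "(e0 \<bullet> \<omega>, (norm \<omega>)\<^sup>2) \<in> D" using w(4) unfolding D_def sq by simp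
  qed
  have "emeasure lborel A \<le> emeasure lborel {\<omega> :: real^3. (e0 \<bullet> \<omega>, (norm \<omega>)\<^sup>2) \<in> D}"
    by (rule emeasure_mono[OF sub]) measurable
  also have "\<dots> \<le> ennreal pi * emeasure lborel D" by (rule hat_box[OF e0 D])
  also have "\<dots> \<le> ennreal pi * ennreal (((e0 \<bullet> y0 + R) - (e0 \<bullet> y0 - R)) * (2 * l / k))"
  proof (intro mult_left_mono emeasure_slices_fst[OF D])
    fix z p p' assume q: "(z, p) \<in> D" "(z, p') \<in> D" and pp: "p \<le> p'"
    define r where "r p = p - 2 * d * z + d\<^sup>2" for p
    have b: "0 \<le> p" "p' \<le> B\<^sup>2" "0 \<le> r p" "r p' \<le> B\<^sup>2" and ph: "\<bar>\<psi> p + \<psi> (r p) - w\<bar> < l" "\<bar>\<psi> p' + \<psi> (r p') - w\<bar> < l"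
      using q by (auto simp: D_def r_def)
    have "k * (p' - p) \<le> \<psi> p' - \<psi> p" using b pp by (intro mono)
    moreover have "k * (r p' - r p) \<le> \<psi> (r p') - \<psi> (r p)" using b pp by (intro mono) (auto simp: r_def)
    moreover have "0 \<le> k * (r p' - r p)" using k pp by (simp add: r_def)
    ultimately have "k * (p' - p) \<le> 2 * l" using ph by linarith
    then show "p' - p \<le> 2 * l / k" using k by (simp add: pos_le_divide_eq mult.commute)
  qed (use l k R in \<open>auto simp: D_def\<close>)
  also have "\<dots> = ennreal (pi * (2 * R) / k * (2 * l))"
    using l k R by (subst ennreal_mult[symmetric]) (auto simp: mult_ac)
  finally show "emeasure lborel {\<eta> \<in> {\<eta>. norm \<eta> \<le> B \<and> norm (\<xi> - \<eta>) \<le> B \<and> \<eta> \<in> cball y0 R}. \<bar>\<psi> ((norm \<eta>)\<^sup>2) + \<psi> ((norm (\<xi> - \<eta>))\<^sup>2) - w\<bar> < l}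
     \<le> ennreal (pi * (2 * R) / k * (2 * l))" unfolding A_def .
qed

text \<open>The radial derivative r / sqrt(1 + e^2 r^2) of the symbol increases with r, and the
  constant is its value at r = B. Multiplying the difference by the sum of the two square roots
  reduces it to |a|^2 - |b|^2.\<close>

lemma symbol_Lipschitz:
  assumes e: "0 < e" and a: "norm a \<le> B" "norm b \<le> B"
  shows "\<bar>schrodinger_symbol e a - schrodinger_symbol e b\<bar> \<le> (B / sqrt (1 + (e * B)\<^sup>2)) * norm (a - b)"
proof -
  define S where "S r = sqrt (1 + e\<^sup>2 * r\<^sup>2)" for r
  define \<beta> where "\<beta> = B / S B"
  have S1: "1 \<le> S r" for r by (simp add: S_def)
  have Sp: "0 < S r" for r using S1[of r] by linarith
  have B: "0 \<le> B" using a(1) norm_ge_zero order_trans by blast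
  have ratio: "r \<le> \<beta> * S r" if "0 \<le> r" "r \<le> B" for r
  proof -
    have "r\<^sup>2 * (1 + e\<^sup>2 * B\<^sup>2) \<le> B\<^sup>2 * (1 + e\<^sup>2 * r\<^sup>2)"
      using power_mono[OF that(2,1), of 2] by (simp add: algebra_simps)
    then have "sqrt (r\<^sup>2 * (1 + e\<^sup>2 * B\<^sup>2)) \<le> sqrt (B\<^sup>2 * (1 + e\<^sup>2 * r\<^sup>2))" by (rule real_sqrt_le_mono)
    then have "r * S B \<le> B * S r" using that B by (simp add: real_sqrt_mult S_def)
    then show ?thesis using Sp[of B] by (simp add: \<beta>_def pos_le_divide_eq)
  qed
  have beta: "0 \<le> \<beta>" using B Sp[of B] by (simp add: \<beta>_def)
  have diff: "\<bar>schrodinger_symbol e a - schrodinger_symbol e b\<bar> * (S (norm a) + S (norm b)) = \<bar>norm a - norm b\<bar> * (norm a + norm b)"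
  proof -
    have "schrodinger_symbol e a - schrodinger_symbol e b = (S (norm a) - S (norm b)) / e\<^sup>2"
      by (simp add: schrodinger_symbol_def S_def diff_divide_distrib)
    then have "(schrodinger_symbol e a - schrodinger_symbol e b) * (S (norm a) + S (norm b)) = ((S (norm a))\<^sup>2 - (S (norm b))\<^sup>2) / e\<^sup>2"
      by (simp add: power2_eq_square algebra_simps)
    also have "\<dots> = (norm a)\<^sup>2 - (norm b)\<^sup>2" using e by (simp add: S_def right_diff_distrib[symmetric])
    also have "\<dots> = (norm a - norm b) * (norm a + norm b)" by (simp add: power2_eq_square algebra_simps)
    finally have "\<bar>(schrodinger_symbol e a - schrodinger_symbol e b) * (S (norm a) + S (norm b))\<bar> = \<bar>(norm a - norm b) * (norm a + norm b)\<bar>" by simp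
    then show ?thesis using Sp[of "norm a"] Sp[of "norm b"] by (simp add: abs_mult)
  qed
  have "\<bar>norm a - norm b\<bar> * (norm a + norm b) \<le> norm (a - b) * (\<beta> * S (norm a) + \<beta> * S (norm b))"
    using a by (intro mult_mono norm_triangle_ineq3 add_mono ratio) auto
  then have "\<bar>schrodinger_symbol e a - schrodinger_symbol e b\<bar> * (S (norm a) + S (norm b)) \<le> (\<beta> * norm (a - b)) * (S (norm a) + S (norm b))"
    unfolding diff by (simp add: algebra_simps)
  then have "\<bar>schrodinger_symbol e a - schrodinger_symbol e b\<bar> \<le> \<beta> * norm (a - b)"
    using Sp[of "norm a"] Sp[of "norm b"] by (simp add: mult_le_cancel_right)
  then show ?thesis by (simp add: \<beta>_def S_def power_mult_distrib)
qed

text \<open>Averaging over the dilations \<open>\<eta> \<mapsto> \<kappa> \<eta>\<close>, \<open>1 \<le> \<kappa> \<le> 1 + R / \<rho>1\<close>, replaces polar coordinates: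
  along rays the wave phase grows at rate \<open>1 / e\<close>, strictly faster than the other phase can vary.\<close>

lemma thin_transversal:
  fixes \<xi> y0 :: "real^3"
  assumes e: "0 < e" and s: "s \<in> {1, - 1}" "\<tau> \<in> {1, - 1}" and R: "0 < R" and r: "0 < \<rho>0" "0 < \<rho>1"
    and c: "0 < c" "c \<le> 1 - e * B / sqrt (1 + (e * B)\<^sup>2)"
  shows "thin (e * R\<^sup>2 * (\<rho>1 / \<rho>0) * (1 + R / \<rho>1) ^ 4 * (32 / 3 * pi) / c)
     {\<eta>. \<eta> \<in> cball y0 R \<and> \<rho>0 \<le> norm \<eta> \<and> norm \<eta> \<le> \<rho>1 \<and> norm (\<xi> - \<eta>) \<le> B}
     (\<lambda>\<eta>. s * (norm \<eta> / e) + \<tau> * schrodinger_symbol e (\<xi> - \<eta>))"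
  unfolding thin_def
proof (intro allI impI)
  fix w l :: real assume l: "0 < l"
  define \<Phi> where "\<Phi> \<eta> = s * (norm \<eta> / e) + \<tau> * schrodinger_symbol e (\<xi> - \<eta>)" for \<eta>
  define A where "A = {\<eta> \<in> {\<eta>. \<eta> \<in> cball y0 R \<and> \<rho>0 \<le> norm \<eta> \<and> norm \<eta> \<le> \<rho>1 \<and> norm (\<xi> - \<eta>) \<le> B}. \<bar>\<Phi> \<eta> - w\<bar> < l}"
  have A [measurable]: "A \<in> sets borel" unfolding A_def \<Phi>_def by measurable
  \<comment> \<open>The dilations are limited so that \<omega> and \<kappa> \<omega> differ by at
    most L \<rho>1 = R; if \<kappa> \<omega> is in the ball of radius R, then \<omega> is in the
    ball of radius 2 R.\<close>
  define L where "L = R / \<rho>1"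
  have L: "0 < L" using R r by (simp add: L_def)
  \<comment> \<open>Admissible length along a ray: the phase changes at rate at least c |\<omega>| /
    e, its window has length 2 l, and |\<omega>| \<ge> \<rho>0 / (1 + L).\<close>
  define \<delta> where "\<delta> = 2 * l * e * (1 + L) / (c * \<rho>0)"
  have delta: "0 \<le> \<delta>" using l e L c r by (simp add: \<delta>_def)
  have slice: "emeasure lborel {\<kappa> \<in> {1..1 + L}. \<kappa> *\<^sub>R \<omega> \<in> A} \<le> ennreal \<delta> * indicator (cball y0 (2 * R)) \<omega>" for \<omega>
  proof (cases "{\<kappa> \<in> {1..1 + L}. \<kappa> *\<^sub>R \<omega> \<in> A} = {}")
    case True
    then have "emeasure lborel {\<kappa> \<in> {1..1 + L}. \<kappa> *\<^sub>R \<omega> \<in> A} = 0" by (simp only: emeasure_empty)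
    then show ?thesis by simp
  next
    case False
    then obtain \<kappa>0 where k0: "1 \<le> \<kappa>0" "\<kappa>0 \<le> 1 + L" "\<kappa>0 *\<^sub>R \<omega> \<in> A" by auto
    have n0: "norm (\<kappa>0 *\<^sub>R \<omega>) = \<kappa>0 * norm \<omega>" using k0 by simp
    have w1: "norm \<omega> \<le> \<rho>1"
    proof -
      have "1 * norm \<omega> \<le> \<kappa>0 * norm \<omega>" using k0 by (intro mult_right_mono) auto
      then show ?thesis using k0 n0 by (simp add: A_def)
    qed
    have w0: "\<rho>0 / (1 + L) \<le> norm \<omega>"
    proof -
      have "\<rho>0 \<le> \<kappa>0 * norm \<omega>" using k0 n0 by (simp add: A_def)
      also have "\<dots> \<le> (1 + L) * norm \<omega>" using k0 by (intro mult_right_mono) auto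
      finally show ?thesis using L by (simp add: pos_divide_le_eq mult.commute)
    qed
    have wpos: "0 < norm \<omega>" using w0 r L by (meson add_pos_pos divide_pos_pos less_le_trans zero_less_one)
    have ball: "\<omega> \<in> cball y0 (2 * R)"
    proof -
      have "norm (y0 - \<omega>) = norm ((y0 - \<kappa>0 *\<^sub>R \<omega>) + (\<kappa>0 - 1) *\<^sub>R \<omega>)" by (simp add: algebra_simps)
      also have "\<dots> \<le> norm (y0 - \<kappa>0 *\<^sub>R \<omega>) + norm ((\<kappa>0 - 1) *\<^sub>R \<omega>)" by (rule norm_triangle_ineq)
      also have "norm (y0 - \<kappa>0 *\<^sub>R \<omega>) \<le> R" using k0 by (simp add: A_def dist_norm)
      also have "norm ((\<kappa>0 - 1) *\<^sub>R \<omega>) \<le> L * \<rho>1" using k0 w1 L by (auto intro!: mult_mono)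
      also have "L * \<rho>1 = R" using r by (simp add: L_def)
      finally show ?thesis by (simp add: dist_norm)
    qed
    have "emeasure lborel {\<kappa> \<in> {1..1 + L}. \<kappa> *\<^sub>R \<omega> \<in> A} \<le> ennreal \<delta>"
    proof (rule emeasure_diameter[OF _ delta])
      fix x y assume xy: "x \<in> {\<kappa> \<in> {1..1 + L}. \<kappa> *\<^sub>R \<omega> \<in> A}" "y \<in> {\<kappa> \<in> {1..1 + L}. \<kappa> *\<^sub>R \<omega> \<in> A}" and le: "x \<le> y"
      have B: "norm (\<xi> - y *\<^sub>R \<omega>) \<le> B" "norm (\<xi> - x *\<^sub>R \<omega>) \<le> B" using xy by (auto simp: A_def)
      have gen: "q < 2 * l" if "\<bar>s * N + \<tau> * H\<bar> < 2 * l" "\<bar>H\<bar> \<le> N - q" for N H q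
        using that s by (auto simp: abs_less_iff abs_le_iff)
      have P1: "\<bar>\<Phi> (y *\<^sub>R \<omega>) - \<Phi> (x *\<^sub>R \<omega>)\<bar> < 2 * l" using xy unfolding A_def by auto
      have P2: "\<Phi> (y *\<^sub>R \<omega>) - \<Phi> (x *\<^sub>R \<omega>) = s * ((y - x) * norm \<omega> / e) + \<tau> * (schrodinger_symbol e (\<xi> - y *\<^sub>R \<omega>) - schrodinger_symbol e (\<xi> - x *\<^sub>R \<omega>))"
        using xy by (simp add: \<Phi>_def algebra_simps diff_divide_distrib)
      have P3: "\<bar>schrodinger_symbol e (\<xi> - y *\<^sub>R \<omega>) - schrodinger_symbol e (\<xi> - x *\<^sub>R \<omega>)\<bar> \<le> ((1 - c) / e) * ((y - x) * norm \<omega>)"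
      proof -
        have "\<bar>schrodinger_symbol e (\<xi> - y *\<^sub>R \<omega>) - schrodinger_symbol e (\<xi> - x *\<^sub>R \<omega>)\<bar> \<le> (B / sqrt (1 + (e * B)\<^sup>2)) * norm ((\<xi> - y *\<^sub>R \<omega>) - (\<xi> - x *\<^sub>R \<omega>))"
          by (rule symbol_Lipschitz[OF e B])
        also have "norm ((\<xi> - y *\<^sub>R \<omega>) - (\<xi> - x *\<^sub>R \<omega>)) = (y - x) * norm \<omega>"
        proof -
          have "(\<xi> - y *\<^sub>R \<omega>) - (\<xi> - x *\<^sub>R \<omega>) = (x - y) *\<^sub>R \<omega>" by (simp add: algebra_simps)
          then show ?thesis using le by simp
        qed
        also have "(B / sqrt (1 + (e * B)\<^sup>2)) * ((y - x) * norm \<omega>) \<le> ((1 - c) / e) * ((y - x) * norm \<omega>)"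
        proof (rule mult_right_mono)
          have "e * (B / sqrt (1 + (e * B)\<^sup>2)) \<le> 1 - c" using c(2) by simp
          then show "B / sqrt (1 + (e * B)\<^sup>2) \<le> (1 - c) / e" using e by (simp add: pos_le_divide_eq mult.commute)
        qed (use le in auto)
        finally show ?thesis .
      qed
      have P4: "((1 - c) / e) * ((y - x) * norm \<omega>) = (y - x) * norm \<omega> / e - c * ((y - x) * norm \<omega> / e)"
      proof -
        have "((1 - c) / e) * X = X / e - c * (X / e)" for X by (simp add: left_diff_distrib diff_divide_distrib)
        then show ?thesis .
      qed
      have "c * ((y - x) * norm \<omega> / e) < 2 * l" by (rule gen[OF P1[unfolded P2] P3[unfolded P4]])
      then have "(y - x) * (c * norm \<omega>) \<le> 2 * l * e" using e by (simp add: pos_divide_less_eq mult_ac)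
      moreover have "(y - x) * (c * (\<rho>0 / (1 + L))) \<le> (y - x) * (c * norm \<omega>)" using le c w0 by (intro mult_left_mono) auto
      ultimately have "(y - x) * (c * (\<rho>0 / (1 + L))) \<le> 2 * l * e" by linarith
      then have "(y - x) * (c * \<rho>0) \<le> 2 * l * e * (1 + L)" using L by (simp add: pos_divide_le_eq)
      then show "y - x \<le> \<delta>" using c r by (simp add: \<delta>_def pos_le_divide_eq)
    qed
    then show ?thesis using ball by simp
  qed
  define a where "a = emeasure lborel A"
  have mI: "(\<lambda>x. indicator A x :: ennreal) \<in> borel_measurable borel" by measurable
  have scale: "a \<le> ennreal ((1 + L) ^ 3) * (\<integral>\<^sup>+\<omega>. indicator A (\<kappa> *\<^sub>R \<omega>) \<partial>lborel)" if "\<kappa> \<in> {1..1 + L}" for \<kappa>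
  proof -
    have "a = (\<integral>\<^sup>+x. indicator A x \<partial>lborel)" by (simp add: a_def)
    also have "\<dots> = ennreal (\<bar>\<kappa>\<bar> ^ DIM(real^3)) * (\<integral>\<^sup>+\<omega>. indicator A (0 + \<kappa> *\<^sub>R \<omega>) \<partial>lborel)"
      using that by (intro lborel_nn_affine[OF mI]) auto
    also have "\<dots> \<le> ennreal ((1 + L) ^ 3) * (\<integral>\<^sup>+\<omega>. indicator A (\<kappa> *\<^sub>R \<omega>) \<partial>lborel)"
      using that by (auto intro!: mult_right_mono ennreal_leI power_mono)
    finally show ?thesis .
  qed
  have mP: "(\<lambda>p. indicator {1..1 + L} (fst p) * indicator A (fst p *\<^sub>R snd p) :: ennreal) \<in> borel_measurable borel"
    by measurable
  \<comment> \<open>By scaling, a is at most (1 + L)^3 times the measure of the rescaled set for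
    each \<kappa>. Integrating over \<kappa> and exchanging the integrals leaves only slices along
    rays, bounded by \<delta>.\<close>
  have "ennreal L * a = (\<integral>\<^sup>+\<kappa>. a * indicator {1..1 + L} \<kappa> \<partial>lborel)"
    using L by (subst nn_integral_cmult_indicator) (simp_all add: mult.commute)
  also have "\<dots> \<le> (\<integral>\<^sup>+\<kappa>. ennreal ((1 + L) ^ 3) * (\<integral>\<^sup>+\<omega>. indicator {1..1 + L} \<kappa> * indicator A (\<kappa> *\<^sub>R \<omega>) \<partial>lborel) \<partial>lborel)"
  proof (rule nn_integral_mono)
    fix \<kappa> :: real
    show "a * indicator {1..1 + L} \<kappa> \<le> ennreal ((1 + L) ^ 3) * (\<integral>\<^sup>+\<omega>. indicator {1..1 + L} \<kappa> * indicator A (\<kappa> *\<^sub>R \<omega>) \<partial>lborel)"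
      using scale[of \<kappa>] by (cases "\<kappa> \<in> {1..1 + L}") auto
  qed
  also have "\<dots> = ennreal ((1 + L) ^ 3) * (\<integral>\<^sup>+\<kappa>. (\<integral>\<^sup>+\<omega>. indicator {1..1 + L} \<kappa> * indicator A (\<kappa> *\<^sub>R \<omega>) \<partial>lborel) \<partial>lborel)"
  proof (rule nn_integral_cmult)
    have "(\<lambda>(\<kappa>, \<omega>). indicator {1..1 + L} \<kappa> * indicator A (\<kappa> *\<^sub>R \<omega>) :: ennreal) \<in> borel_measurable (lborel \<Otimes>\<^sub>M lborel)"
      using mP by (simp add: lborel_prod case_prod_beta')
    then show "(\<lambda>\<kappa>. \<integral>\<^sup>+\<omega>. indicator {1..1 + L} \<kappa> * indicator A (\<kappa> *\<^sub>R \<omega>) \<partial>lborel) \<in> borel_measurable lborel"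
      by (rule lborel.borel_measurable_nn_integral)
  qed
  also have "(\<integral>\<^sup>+\<kappa>. (\<integral>\<^sup>+\<omega>. indicator {1..1 + L} \<kappa> * indicator A (\<kappa> *\<^sub>R \<omega>) \<partial>lborel) \<partial>lborel)
     = (\<integral>\<^sup>+\<omega>. (\<integral>\<^sup>+\<kappa>. indicator {1..1 + L} \<kappa> * indicator A (\<kappa> *\<^sub>R \<omega>) \<partial>lborel) \<partial>lborel)"
  proof -
    have "(\<lambda>(\<kappa>, \<omega>). indicator {1..1 + L} \<kappa> * indicator A (\<kappa> *\<^sub>R \<omega>) :: ennreal) \<in> borel_measurable borel"
      using mP by (simp add: case_prod_beta')
    from lborel_Fubini_nn[OF this] show ?thesis by simp
  qed
  also have "\<dots> \<le> (\<integral>\<^sup>+\<omega>. ennreal \<delta> * indicator (cball y0 (2 * R)) \<omega> \<partial>lborel)"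
  proof (rule nn_integral_mono)
    fix \<omega> :: "real^3"
    have "(\<integral>\<^sup>+\<kappa>. indicator {1..1 + L} \<kappa> * indicator A (\<kappa> *\<^sub>R \<omega>) \<partial>lborel) = (\<integral>\<^sup>+\<kappa>. indicator {\<kappa> \<in> {1..1 + L}. \<kappa> *\<^sub>R \<omega> \<in> A} \<kappa> \<partial>lborel)"
      by (intro nn_integral_cong) (auto simp: indicator_def)
    also have "\<dots> = emeasure lborel {\<kappa> \<in> {1..1 + L}. \<kappa> *\<^sub>R \<omega> \<in> A}" by (rule nn_integral_indicator) measurable
    finally show "(\<integral>\<^sup>+\<kappa>. indicator {1..1 + L} \<kappa> * indicator A (\<kappa> *\<^sub>R \<omega>) \<partial>lborel) \<le> ennreal \<delta> * indicator (cball y0 (2 * R)) \<omega>"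
      using slice[of \<omega>] by simp
  qed
  also have "\<dots> = ennreal \<delta> * emeasure lborel (cball y0 (2 * R))" by (rule nn_integral_cmult_indicator) simp
  also have "emeasure lborel (cball y0 (2 * R)) = ennreal (32 / 3 * pi * R ^ 3)"
    using R emeasure_cball[of "2 * R" y0] by (simp add: eval_unit_ball_vol power_mult_distrib)
  also have "ennreal ((1 + L) ^ 3) * (ennreal \<delta> * ennreal (32 / 3 * pi * R ^ 3)) = ennreal ((1 + L) ^ 3 * (\<delta> * (32 / 3 * pi * R ^ 3)))"
  proof -
    have "ennreal a * (ennreal b * ennreal v) = ennreal (a * (b * v))" if "0 \<le> a" "0 \<le> b" "0 \<le> v" for a b v
      using that by (simp add: ennreal_mult)
    then show ?thesis using L delta R by simp
  qed
  finally have main: "ennreal L * a \<le> ennreal ((1 + L) ^ 3 * (\<delta> * (32 / 3 * pi * R ^ 3)))" by (simp add: mult_left_mono)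
  define X where "X = (1 + L) ^ 3 * (\<delta> * (32 / 3 * pi * R ^ 3))"
  have X: "0 \<le> X" using L delta R by (simp add: X_def)
  have "a \<le> ennreal (X / L)"
  proof (cases a)
    case (real x)
    then have "L * x \<le> X" using main L X unfolding X_def[symmetric] by (simp add: ennreal_mult[symmetric])
    then show ?thesis using real L by (intro ennreal_leI[of x, folded real(2)] ) (simp add: pos_le_divide_eq mult.commute)
  next
    case top
    then show ?thesis using main L by (simp add: ennreal_mult_top top_unique)
  qed
  also have "X / L = e * R\<^sup>2 * (\<rho>1 / \<rho>0) * (1 + R / \<rho>1) ^ 4 * (32 / 3 * pi) / c * (2 * l)"
  proof -
    have R3: "R ^ 3 / L = R\<^sup>2 * \<rho>1" using R r by (simp add: L_def power3_eq_cube power2_eq_square)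
    have "X / L = (1 + L) ^ 3 * \<delta> * (32 / 3 * pi) * (R ^ 3 / L)" by (simp add: X_def)
    also have "\<dots> = (1 + L) ^ 3 * \<delta> * (32 / 3 * pi) * (R\<^sup>2 * \<rho>1)" unfolding R3 ..
    also have "\<dots> = e * R\<^sup>2 * (\<rho>1 / \<rho>0) * ((1 + L) ^ 3 * (1 + L)) * (32 / 3 * pi) / c * (2 * l)"
      unfolding \<delta>_def by (simp add: field_simps)
    also have "(1 + L) ^ 3 * (1 + L) = (1 + R / \<rho>1) ^ 4" unfolding L_def by (simp add: power4_eq_xxxx power3_eq_cube)
    finally show ?thesis .
  qed
  finally show "emeasure lborel {\<eta> \<in> {\<eta>. \<eta> \<in> cball y0 R \<and> \<rho>0 \<le> norm \<eta> \<and> norm \<eta> \<le> \<rho>1 \<and> norm (\<xi> - \<eta>) \<le> B}. \<bar>s * (norm \<eta> / e) + \<tau> * schrodinger_symbol e (\<xi> - \<eta>) - w\<bar> < l}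
     \<le> ennreal (e * R\<^sup>2 * (\<rho>1 / \<rho>0) * (1 + R / \<rho>1) ^ 4 * (32 / 3 * pi) / c * (2 * l))"
    unfolding a_def A_def \<Phi>_def .
qed

section \<open>Bilinear estimates for the wave and the half Klein--Gordon propagator\<close>

definition wv :: "real \<Rightarrow> real \<Rightarrow> real^3 \<Rightarrow> real" where
  "wv e s \<xi> = s * (norm \<xi> / e)"

definition kg :: "real \<Rightarrow> real \<Rightarrow> real^3 \<Rightarrow> real" where
  "kg e \<tau> \<xi> = \<tau> * schrodinger_symbol e \<xi>"

lemma wv_measurable [measurable]: "wv e s \<in> borel_measurable borel"
  unfolding wv_def[abs_def] by measurable

lemma kg_measurable [measurable]: "kg e \<tau> \<in> borel_measurable borel"
  unfolding kg_def[abs_def] by measurable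

lemma bilinear_norm:
  assumes A: "L12 \<alpha>" "L12 \<gamma>" and m [measurable]: "\<phi>1 \<in> borel_measurable borel" "\<phi>2 \<in> borel_measurable borel"
    and le: "N2 (\<lambda>p. Eop \<phi>1 \<alpha> p * Eop \<phi>2 \<gamma> p) \<le> ennreal K * (N2 \<alpha> * N2 \<gamma>)" and K: "0 \<le> K"
  shows "in_L2 (\<lambda>p. Eop \<phi>1 \<alpha> p * Eop \<phi>2 \<gamma> p)"
    and "norm_L2 (\<lambda>p. Eop \<phi>1 \<alpha> p * Eop \<phi>2 \<gamma> p) \<le> sqrt K * norm_L2 \<alpha> * norm_L2 \<gamma>"
proof -
  have L: "in_L2 \<alpha>" "in_L2 \<gamma>" using A by (auto simp: L12_def)
  have [measurable]: "Eop \<phi>1 \<alpha> \<in> borel_measurable borel" "Eop \<phi>2 \<gamma> \<in> borel_measurable borel"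
    by (intro Eop_measurable m L12_measurable A)+
  have "ennreal K * (N2 \<alpha> * N2 \<gamma>) = ennreal ((sqrt K * norm_L2 \<alpha> * norm_L2 \<gamma>)\<^sup>2)"
    using K by (simp add: N2_norm_L2 L ennreal_mult[symmetric] power_mult_distrib mult.assoc)
  then have *: "N2 (\<lambda>p. Eop \<phi>1 \<alpha> p * Eop \<phi>2 \<gamma> p) \<le> ennreal ((sqrt K * norm_L2 \<alpha> * norm_L2 \<gamma>)\<^sup>2)" using le by simp
  have mm: "(\<lambda>p. Eop \<phi>1 \<alpha> p * Eop \<phi>2 \<gamma> p) \<in> borel_measurable borel" by measurable
  show "in_L2 (\<lambda>p. Eop \<phi>1 \<alpha> p * Eop \<phi>2 \<gamma> p)" "norm_L2 (\<lambda>p. Eop \<phi>1 \<alpha> p * Eop \<phi>2 \<gamma> p) \<le> sqrt K * norm_L2 \<alpha> * norm_L2 \<gamma>"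
    using in_L2_boundI[OF mm *] K by auto
qed

lemma thin_empty: "0 \<le> M \<Longrightarrow> thin M {} \<Phi>"
  by (simp add: thin_def)

text \<open>The separation forces |\<xi>| \<ge> b \<mu>, and the triangle inequality places |\<xi> -
  \<eta>|^2 in an interval of length 4 |\<xi>| b \<mu>. This factor |\<xi>| cancels the 1/|\<xi>| of
  \<open>thin_sphere\<close>, so the high frequency disappears from the bound.\<close>

lemma bilinear_low_high:
  assumes e: "0 < e" and b: "0 < b" and \<mu>: "0 < \<mu>" and s: "s \<in> {1, - 1}" and sep: "2 * (b * \<mu>) \<le> a'"
    and A: "L12 \<alpha>" "L12 \<gamma>" and sa: "\<And>\<eta>. \<alpha> \<eta> \<noteq> 0 \<Longrightarrow> norm \<eta> \<le> b * \<mu>" and sg: "\<And>\<zeta>. \<gamma> \<zeta> \<noteq> 0 \<Longrightarrow> a' \<le> norm \<zeta>"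
  shows "N2 (\<lambda>p. Eop (wv e s) \<alpha> p * Eop (kg e \<tau>) \<gamma> p) \<le> ennreal ((4 * pi * b\<^sup>2 * e * \<mu>\<^sup>2) * (2 * pi) ^ 4) * (N2 \<alpha> * N2 \<gamma>)"
proof (rule bilinear_estimate[OF A])
  show M: "0 \<le> 4 * pi * b\<^sup>2 * e * \<mu>\<^sup>2" using e by simp
  fix \<xi> :: "real^3"
  define d where "d = norm \<xi>"
  define \<psi> where "\<psi> r = \<tau> * ((sqrt (1 + e\<^sup>2 * r\<^sup>2) - 1) / e\<^sup>2)" for r
  have m [measurable]: "\<psi> \<in> borel_measurable borel" unfolding \<psi>_def[abs_def] by measurable
  have ph: "(\<lambda>\<eta>. wv e s \<eta> + kg e \<tau> (\<xi> - \<eta>)) = (\<lambda>\<eta>. s * (norm \<eta> / e) + \<psi> (norm (\<xi> - \<eta>)))"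
    by (simp add: wv_def kg_def \<psi>_def schrodinger_symbol_def)
  show "thin (4 * pi * b\<^sup>2 * e * \<mu>\<^sup>2) {\<eta>. \<alpha> \<eta> \<noteq> 0 \<and> \<gamma> (\<xi> - \<eta>) \<noteq> 0} (\<lambda>\<eta>. wv e s \<eta> + kg e \<tau> (\<xi> - \<eta>))"
  proof (cases "{\<eta>. \<alpha> \<eta> \<noteq> 0 \<and> \<gamma> (\<xi> - \<eta>) \<noteq> 0} = {}")
    case True
    then show ?thesis using M by (simp only: thin_empty)
  next
    case False
    then obtain \<eta> where "\<alpha> \<eta> \<noteq> 0" "\<gamma> (\<xi> - \<eta>) \<noteq> 0" by blast
    then have "norm \<eta> \<le> b * \<mu>" "a' \<le> norm (\<xi> - \<eta>)" using sa sg by auto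
    moreover have "norm (\<xi> - \<eta>) \<le> d + norm \<eta>" unfolding d_def by (rule norm_triangle_ineq4)
    ultimately have d: "b * \<mu> \<le> d" using sep by linarith
    have bm: "0 < b * \<mu>" using b \<mu> by simp
    then have d0: "0 < d" using d by linarith
    have p: "(d - b * \<mu>)\<^sup>2 \<le> (d + b * \<mu>)\<^sup>2" using d bm by (intro power_mono) auto
    define S where "S = {\<eta>. norm \<eta> \<le> b * \<mu> \<and> (d - b * \<mu>)\<^sup>2 \<le> (norm (\<xi> - \<eta>))\<^sup>2 \<and> (norm (\<xi> - \<eta>))\<^sup>2 \<le> (d + b * \<mu>)\<^sup>2}"
    have mS: "S \<in> sets borel" unfolding S_def by measurable
    have "thin (pi * ((d + b * \<mu>)\<^sup>2 - (d - b * \<mu>)\<^sup>2) * (e * (b * \<mu>) / norm \<xi>)) S (\<lambda>\<eta>. s * (norm \<eta> / e) + \<psi> (norm (\<xi> - \<eta>)))"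
      unfolding S_def using d0 by (intro thin_sphere e bm s p m) (auto simp: d_def)
    also have "pi * ((d + b * \<mu>)\<^sup>2 - (d - b * \<mu>)\<^sup>2) * (e * (b * \<mu>) / norm \<xi>) = 4 * pi * b\<^sup>2 * e * \<mu>\<^sup>2"
    proof -
      have "(d + b * \<mu>)\<^sup>2 - (d - b * \<mu>)\<^sup>2 = d * (4 * (b * \<mu>))" by (simp add: power2_eq_square algebra_simps)
      then have "pi * ((d + b * \<mu>)\<^sup>2 - (d - b * \<mu>)\<^sup>2) * (e * (b * \<mu>) / norm \<xi>) = pi * (d * (4 * (b * \<mu>))) * (e * (b * \<mu>) / d)" by (simp only: d_def)
      also have "\<dots> = 4 * pi * b\<^sup>2 * e * \<mu>\<^sup>2" using d0 by (simp add: power2_eq_square)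
      finally show ?thesis .
    qed
    finally have t: "thin (4 * pi * b\<^sup>2 * e * \<mu>\<^sup>2) S (\<lambda>\<eta>. s * (norm \<eta> / e) + \<psi> (norm (\<xi> - \<eta>)))" .
    have "{\<eta>. \<alpha> \<eta> \<noteq> 0 \<and> \<gamma> (\<xi> - \<eta>) \<noteq> 0} \<subseteq> S"
    proof (rule subsetI, unfold S_def, rule CollectI)
      fix \<eta> assume "\<eta> \<in> {\<eta>. \<alpha> \<eta> \<noteq> 0 \<and> \<gamma> (\<xi> - \<eta>) \<noteq> 0}"
      then have n: "norm \<eta> \<le> b * \<mu>" using sa by auto
      have "norm (\<xi> - \<eta>) \<le> d + norm \<eta>" unfolding d_def by (rule norm_triangle_ineq4)
      moreover have "d - norm \<eta> \<le> norm (\<xi> - \<eta>)" unfolding d_def by (rule norm_triangle_ineq2)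
      ultimately show "norm \<eta> \<le> b * \<mu> \<and> (d - b * \<mu>)\<^sup>2 \<le> (norm (\<xi> - \<eta>))\<^sup>2 \<and> (norm (\<xi> - \<eta>))\<^sup>2 \<le> (d + b * \<mu>)\<^sup>2"
        using n d by (auto intro!: power_mono)
    qed
    then show ?thesis unfolding ph by (rule thin_subset[OF t _ mS]) measurable
  qed
qed measurable

text \<open>Here |\<xi> - \<eta>|^2 lies in [0, l^2] and |\<xi>| \<ge> a'/2, so the factor B/|\<xi>|
  of \<open>thin_sphere\<close> is at most 2 B/a', a ratio of the two radii of one shell.\<close>

lemma bilinear_high_low:
  assumes e: "0 < e" and B: "0 < B" and a': "0 < a'" and s: "s \<in> {1, - 1}" and sep: "2 * l \<le> a'" and l: "0 \<le> l"
    and A: "L12 \<alpha>" "L12 \<gamma>" and sa: "\<And>\<eta>. \<alpha> \<eta> \<noteq> 0 \<Longrightarrow> a' \<le> norm \<eta> \<and> norm \<eta> \<le> B" and sg: "\<And>\<zeta>. \<gamma> \<zeta> \<noteq> 0 \<Longrightarrow> norm \<zeta> \<le> l"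
  shows "N2 (\<lambda>p. Eop (wv e s) \<alpha> p * Eop (kg e \<tau>) \<gamma> p) \<le> ennreal ((2 * pi * (B / a') * e * l\<^sup>2) * (2 * pi) ^ 4) * (N2 \<alpha> * N2 \<gamma>)"
proof (rule bilinear_estimate[OF A])
  show M: "0 \<le> 2 * pi * (B / a') * e * l\<^sup>2" using e B a' by simp
  fix \<xi> :: "real^3"
  define d where "d = norm \<xi>"
  define \<psi> where "\<psi> r = \<tau> * ((sqrt (1 + e\<^sup>2 * r\<^sup>2) - 1) / e\<^sup>2)" for r
  have m [measurable]: "\<psi> \<in> borel_measurable borel" unfolding \<psi>_def[abs_def] by measurable
  have ph: "(\<lambda>\<eta>. wv e s \<eta> + kg e \<tau> (\<xi> - \<eta>)) = (\<lambda>\<eta>. s * (norm \<eta> / e) + \<psi> (norm (\<xi> - \<eta>)))"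
    by (simp add: wv_def kg_def \<psi>_def schrodinger_symbol_def)
  show "thin (2 * pi * (B / a') * e * l\<^sup>2) {\<eta>. \<alpha> \<eta> \<noteq> 0 \<and> \<gamma> (\<xi> - \<eta>) \<noteq> 0} (\<lambda>\<eta>. wv e s \<eta> + kg e \<tau> (\<xi> - \<eta>))"
  proof (cases "{\<eta>. \<alpha> \<eta> \<noteq> 0 \<and> \<gamma> (\<xi> - \<eta>) \<noteq> 0} = {}")
    case True
    then show ?thesis using M by (simp only: thin_empty)
  next
    case False
    then obtain \<eta> where "\<alpha> \<eta> \<noteq> 0" "\<gamma> (\<xi> - \<eta>) \<noteq> 0" by blast
    then have "a' \<le> norm \<eta>" "norm (\<xi> - \<eta>) \<le> l" using sa sg by auto
    moreover have "norm \<eta> - norm \<xi> \<le> norm (\<eta> - \<xi>)" by (rule norm_triangle_ineq2)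
    ultimately have d: "a' / 2 \<le> d" using sep by (simp add: d_def norm_minus_commute)
    then have d0: "0 < d" using a' by linarith
    define S where "S = {\<eta>. norm \<eta> \<le> B \<and> 0 \<le> (norm (\<xi> - \<eta>))\<^sup>2 \<and> (norm (\<xi> - \<eta>))\<^sup>2 \<le> l\<^sup>2}"
    have mS: "S \<in> sets borel" unfolding S_def by measurable
    have t0: "thin (pi * (l\<^sup>2 - 0) * (e * B / norm \<xi>)) S (\<lambda>\<eta>. s * (norm \<eta> / e) + \<psi> (norm (\<xi> - \<eta>)))"
      unfolding S_def using d0 by (intro thin_sphere e B s m) (auto simp: d_def)
    have "e * B / norm \<xi> \<le> e * B / (a' / 2)"
      using d a' e B d0 by (intro divide_left_mono) (simp_all add: d_def)
    then have "pi * (l\<^sup>2 - 0) * (e * B / norm \<xi>) \<le> pi * (l\<^sup>2 - 0) * (e * B / (a' / 2))"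
      by (rule mult_left_mono) simp
    also have "\<dots> = 2 * pi * (B / a') * e * l\<^sup>2" by simp
    finally have t: "thin (2 * pi * (B / a') * e * l\<^sup>2) S (\<lambda>\<eta>. s * (norm \<eta> / e) + \<psi> (norm (\<xi> - \<eta>)))"
      by (rule thin_mono[OF t0])
    have "{\<eta>. \<alpha> \<eta> \<noteq> 0 \<and> \<gamma> (\<xi> - \<eta>) \<noteq> 0} \<subseteq> S" using sa sg by (auto simp: S_def intro!: power_mono)
    then show ?thesis unfolding ph by (rule thin_subset[OF t _ mS]) measurable
  qed
qed measurable

text \<open>The gap between the wave speed 1/e and the Klein-Gordon group velocity at frequency B,
  multiplied by e, where K = e B. It decays like 1/(2 K^2), so it gives a uniform bound only while e
  B stays bounded.\<close>

definition trans_const :: "real \<Rightarrow> real" where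
  "trans_const K = 1 - K / sqrt (1 + K\<^sup>2)"

lemma trans_const_pos: "0 < trans_const K" if "0 \<le> K"
proof -
  have "K = sqrt (K\<^sup>2)" using that by simp
  also have "\<dots> < sqrt (1 + K\<^sup>2)" by (rule real_sqrt_less_mono) simp
  finally show ?thesis using that by (simp add: trans_const_def add_pos_nonneg)
qed

lemma trans_const_antimono: assumes "0 \<le> x" "x \<le> K" shows "trans_const K \<le> 1 - x / sqrt (1 + x\<^sup>2)"
proof -
  have "x\<^sup>2 \<le> K\<^sup>2" using assms by (intro power_mono)
  then have "x\<^sup>2 * (1 + K\<^sup>2) \<le> K\<^sup>2 * (1 + x\<^sup>2)" by (simp add: algebra_simps)
  then have "sqrt (x\<^sup>2 * (1 + K\<^sup>2)) \<le> sqrt (K\<^sup>2 * (1 + x\<^sup>2))" by (rule real_sqrt_le_mono)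
  then have "x * sqrt (1 + K\<^sup>2) \<le> K * sqrt (1 + x\<^sup>2)" using assms by (simp add: real_sqrt_mult)
  then have "x / sqrt (1 + x\<^sup>2) \<le> K / sqrt (1 + K\<^sup>2)" by (simp add: divide_simps add_pos_nonneg)
  then show ?thesis by (simp add: trans_const_def)
qed

lemma bilinear_transversal:
  assumes e: "0 < e" and s: "s \<in> {1, - 1}" "\<tau> \<in> {1, - 1}" and R: "0 < R" and r: "0 < \<rho>0" "0 < \<rho>1" and B: "0 \<le> B" "e * B \<le> K"
    and A: "L12 \<alpha>" "L12 \<gamma>"
    and sa: "\<And>\<eta>. \<alpha> \<eta> \<noteq> 0 \<Longrightarrow> \<eta> \<in> cball y0 R \<and> \<rho>0 \<le> norm \<eta> \<and> norm \<eta> \<le> \<rho>1"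
    and sg: "\<And>\<zeta>. \<gamma> \<zeta> \<noteq> 0 \<Longrightarrow> norm \<zeta> \<le> B"
  shows "N2 (\<lambda>p. Eop (wv e s) \<alpha> p * Eop (kg e \<tau>) \<gamma> p)
     \<le> ennreal ((e * R\<^sup>2 * (\<rho>1 / \<rho>0) * (1 + R / \<rho>1) ^ 4 * (32 / 3 * pi) / trans_const K) * (2 * pi) ^ 4) * (N2 \<alpha> * N2 \<gamma>)"
proof (rule bilinear_estimate[OF A])
  have K: "0 \<le> K" using e B by (meson less_imp_le mult_nonneg_nonneg order_trans)
  have c: "0 < trans_const K" "trans_const K \<le> 1 - e * B / sqrt (1 + (e * B)\<^sup>2)"
    using trans_const_pos[OF K] trans_const_antimono[of "e * B" K] e B by auto
  show "0 \<le> e * R\<^sup>2 * (\<rho>1 / \<rho>0) * (1 + R / \<rho>1) ^ 4 * (32 / 3 * pi) / trans_const K" using e R r c by simp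
  fix \<xi> :: "real^3"
  define S where "S = {\<eta>. \<eta> \<in> cball y0 R \<and> \<rho>0 \<le> norm \<eta> \<and> norm \<eta> \<le> \<rho>1 \<and> norm (\<xi> - \<eta>) \<le> B}"
  have mS: "S \<in> sets borel" unfolding S_def by measurable
  have t: "thin (e * R\<^sup>2 * (\<rho>1 / \<rho>0) * (1 + R / \<rho>1) ^ 4 * (32 / 3 * pi) / trans_const K) S (\<lambda>\<eta>. s * (norm \<eta> / e) + \<tau> * schrodinger_symbol e (\<xi> - \<eta>))"
    unfolding S_def by (rule thin_transversal[OF e s R r c])
  have "{\<eta>. \<alpha> \<eta> \<noteq> 0 \<and> \<gamma> (\<xi> - \<eta>) \<noteq> 0} \<subseteq> S" using sa sg by (auto simp: S_def)
  then show "thin (e * R\<^sup>2 * (\<rho>1 / \<rho>0) * (1 + R / \<rho>1) ^ 4 * (32 / 3 * pi) / trans_const K) {\<eta>. \<alpha> \<eta> \<noteq> 0 \<and> \<gamma> (\<xi> - \<eta>) \<noteq> 0} (\<lambda>\<eta>. wv e s \<eta> + kg e \<tau> (\<xi> - \<eta>))"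
    unfolding wv_def kg_def by (rule thin_subset[OF t _ mS]) measurable
qed measurable

text \<open>Squaring pairs the phase with itself, so its sign s factors out of the sum
  (\<open>thin_uminus\<close>) and \<open>thin_quadric\<close> covers both signs.\<close>

lemma square_estimate:
  assumes mono: "\<And>p p'. 0 \<le> p \<Longrightarrow> p \<le> p' \<Longrightarrow> p' \<le> B\<^sup>2 \<Longrightarrow> k * (p' - p) \<le> \<psi> p' - \<psi> p" and k: "0 < k" and R: "0 \<le> R"
    and m: "\<psi> \<in> borel_measurable borel" and s: "s \<in> {1, - 1}" and \<phi>: "\<And>\<xi>. \<phi> \<xi> = s * \<psi> ((norm \<xi>)\<^sup>2)" and m\<phi> [measurable]: "\<phi> \<in> borel_measurable borel"
    and A: "L12 \<alpha>" and sa: "\<And>\<eta>. \<alpha> \<eta> \<noteq> 0 \<Longrightarrow> \<eta> \<in> cball y0 R \<and> norm \<eta> \<le> B"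
  shows "N2 (\<lambda>p. Eop \<phi> \<alpha> p * Eop \<phi> \<alpha> p) \<le> ennreal ((pi * (2 * R) / k) * (2 * pi) ^ 4) * (N2 \<alpha> * N2 \<alpha>)"
proof (rule bilinear_estimate[OF A A])
  show "0 \<le> pi * (2 * R) / k" using k R by simp
  fix \<xi> :: "real^3"
  define S where "S = {\<eta>. norm \<eta> \<le> B \<and> norm (\<xi> - \<eta>) \<le> B \<and> \<eta> \<in> cball y0 R}"
  have mS: "S \<in> sets borel" unfolding S_def by measurable
  have t: "thin (pi * (2 * R) / k) S (\<lambda>\<eta>. \<psi> ((norm \<eta>)\<^sup>2) + \<psi> ((norm (\<xi> - \<eta>))\<^sup>2))"
    unfolding S_def by (rule thin_quadric[OF mono k R m])
  have "thin (pi * (2 * R) / k) S (\<lambda>\<eta>. \<phi> \<eta> + \<phi> (\<xi> - \<eta>))"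
  proof (cases "s = 1")
    case True
    then show ?thesis using t by (simp add: \<phi>)
  next
    case False
    then have "s = - 1" using s by simp
    then show ?thesis using thin_uminus[OF t] by (simp add: \<phi>)
  qed
  moreover have "{\<eta>. \<alpha> \<eta> \<noteq> 0 \<and> \<alpha> (\<xi> - \<eta>) \<noteq> 0} \<subseteq> S" using sa by (auto simp: S_def)
  ultimately show "thin (pi * (2 * R) / k) {\<eta>. \<alpha> \<eta> \<noteq> 0 \<and> \<alpha> (\<xi> - \<eta>) \<noteq> 0} (\<lambda>\<eta>. \<phi> \<eta> + \<phi> (\<xi> - \<eta>))"
    by (rule thin_subset[OF _ _ mS]) measurable
qed measurable

text \<open>As a function of p = |\<eta>|^2 the phase is sqrt p / e, whose derivative on (0, B^2] is
  at least k = 1/(2 B e).\<close>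

lemma square_estimate_wv:
  assumes e: "0 < e" and B: "0 < B" and R: "0 \<le> R" and s: "s \<in> {1, - 1}"
    and A: "L12 \<alpha>" and sa: "\<And>\<eta>. \<alpha> \<eta> \<noteq> 0 \<Longrightarrow> \<eta> \<in> cball y0 R \<and> norm \<eta> \<le> B"
  shows "N2 (\<lambda>p. Eop (wv e s) \<alpha> p * Eop (wv e s) \<alpha> p) \<le> ennreal ((4 * pi * R * B * e) * (2 * pi) ^ 4) * (N2 \<alpha> * N2 \<alpha>)"
proof -
  have "N2 (\<lambda>p. Eop (wv e s) \<alpha> p * Eop (wv e s) \<alpha> p) \<le> ennreal ((pi * (2 * R) / (1 / (2 * B * e))) * (2 * pi) ^ 4) * (N2 \<alpha> * N2 \<alpha>)"
  proof (rule square_estimate[where \<psi>="\<lambda>p. sqrt p / e", OF _ _ R _ s _ _ A sa])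
    fix p p' :: real assume p: "0 \<le> p" "p \<le> p'" "p' \<le> B\<^sup>2"
    have "sqrt p' \<le> B" using p B by (intro real_le_lsqrt) auto
    moreover have "sqrt p \<le> sqrt p'" using p by (intro real_sqrt_le_mono)
    ultimately have b: "sqrt p' \<le> B" "sqrt p \<le> B" "sqrt p \<le> sqrt p'" by (blast intro: order_trans)+
    have "p' - p = (sqrt p' - sqrt p) * (sqrt p' + sqrt p)" using p by (simp add: algebra_simps)
    also have "\<dots> \<le> (sqrt p' - sqrt p) * (2 * B)"
    proof (rule mult_left_mono)
      show "sqrt p' + sqrt p \<le> 2 * B" "0 \<le> sqrt p' - sqrt p" using b by linarith+
    qed
    finally have "p' - p \<le> (sqrt p' - sqrt p) * (2 * B)" .
    then have "(p' - p) / (2 * B) \<le> sqrt p' - sqrt p" using B by (simp add: pos_divide_le_eq)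
    then have "(p' - p) / (2 * B) / e \<le> (sqrt p' - sqrt p) / e" using e by (intro divide_right_mono) auto
    then show "1 / (2 * B * e) * (p' - p) \<le> sqrt p' / e - sqrt p / e" by (simp add: diff_divide_distrib)
  qed (use e B in \<open>auto simp: wv_def\<close>)
  then show ?thesis by (simp add: mult_ac)
qed

text \<open>Here the derivative in p is 1/(2 sqrt(1 + e^2 p)), smallest at p = B^2. For large e B
  the bound has the same order R B e as for the wave.\<close>

lemma square_estimate_kg:
  assumes e: "0 < e" and B: "0 < B" and R: "0 \<le> R" and s: "s \<in> {1, - 1}"
    and A: "L12 \<alpha>" and sa: "\<And>\<eta>. \<alpha> \<eta> \<noteq> 0 \<Longrightarrow> \<eta> \<in> cball y0 R \<and> norm \<eta> \<le> B"
  shows "N2 (\<lambda>p. Eop (kg e s) \<alpha> p * Eop (kg e s) \<alpha> p) \<le> ennreal ((4 * pi * R * sqrt (1 + e\<^sup>2 * B\<^sup>2)) * (2 * pi) ^ 4) * (N2 \<alpha> * N2 \<alpha>)"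
proof -
  define S where "S p = sqrt (1 + e\<^sup>2 * p)" for p
  have S0: "0 < S (B\<^sup>2)" by (simp add: S_def add_pos_nonneg)
  have "N2 (\<lambda>p. Eop (kg e s) \<alpha> p * Eop (kg e s) \<alpha> p) \<le> ennreal ((pi * (2 * R) / (1 / (2 * S (B\<^sup>2)))) * (2 * pi) ^ 4) * (N2 \<alpha> * N2 \<alpha>)"
  proof (rule square_estimate[where \<psi>="\<lambda>p. (S p - 1) / e\<^sup>2", OF _ _ R _ s _ _ A sa])
    fix p p' :: real assume p: "0 \<le> p" "p \<le> p'" "p' \<le> B\<^sup>2"
    have b: "S p' \<le> S (B\<^sup>2)" "S p \<le> S (B\<^sup>2)" "S p \<le> S p'" using p unfolding S_def by (auto intro!: real_sqrt_le_mono mult_left_mono)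
    have sq: "(S p)\<^sup>2 = 1 + e\<^sup>2 * p" "(S p')\<^sup>2 = 1 + e\<^sup>2 * p'" using p by (auto simp: S_def add_nonneg_nonneg)
    have "e\<^sup>2 * (p' - p) = (S p')\<^sup>2 - (S p)\<^sup>2" unfolding sq by (simp add: algebra_simps)
    also have "\<dots> = (S p' - S p) * (S p' + S p)" by (simp add: power2_eq_square algebra_simps)
    also have "\<dots> \<le> (S p' - S p) * (2 * S (B\<^sup>2))" using b by (intro mult_left_mono) auto
    finally have "p' - p \<le> (S p' - S p) * (2 * S (B\<^sup>2)) / e\<^sup>2" using e by (simp add: pos_le_divide_eq mult.commute)
    then have "(p' - p) / (2 * S (B\<^sup>2)) \<le> (S p' - S p) / e\<^sup>2" using S0 by (simp add: pos_divide_le_eq)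
    then show "1 / (2 * S (B\<^sup>2)) * (p' - p) \<le> (S p' - 1) / e\<^sup>2 - (S p - 1) / e\<^sup>2" by (simp add: diff_divide_distrib)
  qed (use S0 in \<open>auto simp: kg_def S_def schrodinger_symbol_def\<close>)
  then show ?thesis by (simp add: S_def mult_ac)
qed

lemma N2_mult_le:
  assumes [measurable]: "u \<in> borel_measurable borel" "v \<in> borel_measurable borel"
  shows "(N2 (\<lambda>x. u x * v x))\<^sup>2 \<le> N2 (\<lambda>x. u x * u x) * N2 (\<lambda>x. v x * v x)"
proof -
  have "(N2 (\<lambda>x. u x * v x))\<^sup>2 = (\<integral>\<^sup>+x. ennreal ((cmod (u x))\<^sup>2) * ennreal ((cmod (v x))\<^sup>2) \<partial>lborel)\<^sup>2"
    unfolding N2_def norm_mult power_mult_distrib by (simp add: ennreal_mult)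
  also have "\<dots> \<le> (\<integral>\<^sup>+x. (ennreal ((cmod (u x))\<^sup>2))\<^sup>2 \<partial>lborel) * (\<integral>\<^sup>+x. (ennreal ((cmod (v x))\<^sup>2))\<^sup>2 \<partial>lborel)"
    by (rule Cauchy_Schwarz_nn_integral) auto
  also have "\<dots> = N2 (\<lambda>x. u x * u x) * N2 (\<lambda>x. v x * v x)"
  proof -
    have "(ennreal ((cmod z)\<^sup>2))\<^sup>2 = ennreal ((cmod (z * z))\<^sup>2)" for z
      unfolding norm_mult by (subst ennreal_power) (simp_all add: power2_eq_square)
    then show ?thesis unfolding N2_def by simp
  qed
  finally show ?thesis .
qed

text \<open>The Cauchy-Schwarz inequality for |u|^2 |v|^2 bounds the fourth power of the norm of u v
  by the product of the squared norms of u^2 and v^2. In these each phase meets only itself, which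
  removes the cancellation between the two speeds; K is a common bound for both squares.\<close>

lemma bilinear_square:
  assumes e: "0 < e" and B: "0 < B1" "0 < B2" and R: "0 \<le> R1" "0 \<le> R2" and s: "s \<in> {1, - 1}" "\<tau> \<in> {1, - 1}"
    and A: "L12 \<alpha>" "L12 \<gamma>" and sa: "\<And>\<eta>. \<alpha> \<eta> \<noteq> 0 \<Longrightarrow> \<eta> \<in> cball y1 R1 \<and> norm \<eta> \<le> B1"
    and sg: "\<And>\<zeta>. \<gamma> \<zeta> \<noteq> 0 \<Longrightarrow> \<zeta> \<in> cball y2 R2 \<and> norm \<zeta> \<le> B2"
    and K: "R1 * B1 * e \<le> K" "R2 * sqrt (1 + e\<^sup>2 * B2\<^sup>2) \<le> K"
  shows "N2 (\<lambda>p. Eop (wv e s) \<alpha> p * Eop (kg e \<tau>) \<gamma> p) \<le> ennreal ((4 * pi * K) * (2 * pi) ^ 4) * (N2 \<alpha> * N2 \<gamma>)"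
proof -
  have L: "in_L2 \<alpha>" "in_L2 \<gamma>" using A by (auto simp: L12_def)
  have m: "Eop (wv e s) \<alpha> \<in> borel_measurable borel" "Eop (kg e \<tau>) \<gamma> \<in> borel_measurable borel"
    by (intro Eop_measurable L12_measurable A; measurable)+
  define c where "c = (4 * pi * K) * (2 * pi) ^ 4"
  have K0: "0 \<le> K" using K(1) R(1) B(1) e by (meson less_imp_le mult_nonneg_nonneg order_trans)
  have c: "0 \<le> c" using K0 by (simp add: c_def)
  have 1: "N2 (\<lambda>p. Eop (wv e s) \<alpha> p * Eop (wv e s) \<alpha> p) \<le> ennreal c * (N2 \<alpha> * N2 \<alpha>)"
  proof -
    have "(4 * pi * R1 * B1 * e) * (2 * pi) ^ 4 \<le> c"
      unfolding c_def mult.assoc using K(1) by (intro mult_left_mono mult_right_mono) (auto simp: mult.assoc)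
    then show ?thesis
      using square_estimate_wv[OF e B(1) R(1) s(1) A(1) sa] by (meson ennreal_leI mult_right_mono order_trans zero_le)
  qed
  have 2: "N2 (\<lambda>p. Eop (kg e \<tau>) \<gamma> p * Eop (kg e \<tau>) \<gamma> p) \<le> ennreal c * (N2 \<gamma> * N2 \<gamma>)"
  proof -
    have "(4 * pi * R2 * sqrt (1 + e\<^sup>2 * B2\<^sup>2)) * (2 * pi) ^ 4 \<le> c"
      unfolding c_def mult.assoc using K(2) by (intro mult_left_mono mult_right_mono) auto
    then show ?thesis
      using square_estimate_kg[OF e B(2) R(2) s(2) A(2) sg] by (meson ennreal_leI mult_right_mono order_trans zero_le)
  qed
  have "(N2 (\<lambda>p. Eop (wv e s) \<alpha> p * Eop (kg e \<tau>) \<gamma> p))\<^sup>2 \<le> (ennreal c * (N2 \<alpha> * N2 \<alpha>)) * (ennreal c * (N2 \<gamma> * N2 \<gamma>))"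
    by (rule order_trans[OF N2_mult_le[OF m] mult_mono[OF 1 2]]) auto
  also have "\<dots> = (ennreal (c * ((norm_L2 \<alpha>)\<^sup>2 * (norm_L2 \<gamma>)\<^sup>2)))\<^sup>2"
    using c by (simp add: N2_norm_L2 L ennreal_mult[symmetric] power2_eq_square mult_ac)
  finally have "N2 (\<lambda>p. Eop (wv e s) \<alpha> p * Eop (kg e \<tau>) \<gamma> p) \<le> ennreal (c * ((norm_L2 \<alpha>)\<^sup>2 * (norm_L2 \<gamma>)\<^sup>2))"
    by (rule ennreal_power2_le_imp_le) (use c in auto)
  also have "\<dots> = ennreal c * (N2 \<alpha> * N2 \<gamma>)" using c by (simp add: N2_norm_L2 L ennreal_mult)
  finally show ?thesis unfolding c_def .
qed

section \<open>Products and Littlewood--Paley operators\<close>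

definition conv :: "(real^3 \<Rightarrow> complex) \<Rightarrow> (real^3 \<Rightarrow> complex) \<Rightarrow> real^3 \<Rightarrow> complex" where
  "conv a b \<xi> = (LINT \<eta>|lborel. a \<eta> * b (\<xi> - \<eta>))"

lemma in_L2_shift_reflect:
  assumes "in_L2 b" shows "in_L2 (\<lambda>\<eta>. b (\<xi> - \<eta>))" "norm_L2 (\<lambda>\<eta>. b (\<xi> - \<eta>)) = norm_L2 b"
proof -
  have [measurable]: "b \<in> borel_measurable borel" using assms by (rule in_L2_measurable)
  have m: "(\<lambda>\<eta>. b (\<xi> - \<eta>)) \<in> borel_measurable borel" by measurable
  have e: "\<xi> + (- 1) *\<^sub>R \<eta> = \<xi> - \<eta>" for \<eta> by simp
  have "N2 b = N2 (\<lambda>\<eta>. b (\<xi> - \<eta>))"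
    unfolding N2_def using lborel_nn_affine[of "\<lambda>x. ennreal ((cmod (b x))\<^sup>2)" "- 1" \<xi>] unfolding e by simp
  then have N: "N2 (\<lambda>\<eta>. b (\<xi> - \<eta>)) = ennreal ((norm_L2 b)\<^sup>2)" using N2_norm_L2[OF assms] by simp
  show L: "in_L2 (\<lambda>\<eta>. b (\<xi> - \<eta>))" using in_L2_boundI(1)[OF m eq_refl[OF N]] by simp
  have "ennreal ((norm_L2 (\<lambda>\<eta>. b (\<xi> - \<eta>)))\<^sup>2) = ennreal ((norm_L2 b)\<^sup>2)" using N N2_norm_L2[OF L] by simp
  then show "norm_L2 (\<lambda>\<eta>. b (\<xi> - \<eta>)) = norm_L2 b" by (simp add: power2_eq_iff_nonneg)
qed

lemma conv_integrable:
  assumes "in_L2 a" "in_L2 b"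
  shows "integrable lborel (\<lambda>\<eta>. a \<eta> * b (\<xi> - \<eta>))" and "cmod (conv a b \<xi>) \<le> norm_L2 a * norm_L2 b"
  using L2_Cauchy_Schwarz(1,3)[OF assms(1) in_L2_shift_reflect(1)[OF assms(2)]]
  unfolding conv_def in_L2_shift_reflect(2)[OF assms(2)] by auto

lemma conv_measurable:
  assumes [measurable]: "a \<in> borel_measurable borel" "b \<in> borel_measurable borel"
  shows "conv a b \<in> borel_measurable borel"
proof -
  have "(\<lambda>p. a (snd p) * b (fst p - snd p)) \<in> borel_measurable (borel :: ((real^3) \<times> (real^3)) measure)" by measurable
  then have "(\<lambda>(x, y). a y * b (x - y)) \<in> borel_measurable (borel \<Otimes>\<^sub>M (borel :: (real^3) measure))"
    by (simp add: borel_prod case_prod_beta')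
  then have "(\<lambda>(x, y). a y * b (x - y)) \<in> borel_measurable (borel \<Otimes>\<^sub>M (lborel :: (real^3) measure))"
    by (simp cong: measurable_cong_sets)
  then show ?thesis unfolding conv_def[abs_def]
    by (rule lborel.borel_measurable_lebesgue_integral)
qed

lemma integrable_shear:
  fixes a b :: "real^3 \<Rightarrow> complex"
  assumes "integrable lborel a" "integrable lborel b"
  shows "integrable lborel (\<lambda>(\<eta>, \<xi>). a \<eta> * b (\<xi> - \<eta>))"
proof -
  have [measurable]: "a \<in> borel_measurable borel" "b \<in> borel_measurable borel" using assms by (auto dest: integrable_borel)
  have m: "(\<lambda>p. a (fst p) * b (snd p - fst p)) \<in> borel_measurable (borel :: ((real^3) \<times> (real^3)) measure)" by measurable
  have s: "(\<integral>\<^sup>+\<xi>. ennreal (cmod (b (\<xi> - \<eta>))) \<partial>lborel) = (\<integral>\<^sup>+\<xi>. ennreal (cmod (b \<xi>)) \<partial>lborel)" for \<eta> :: "real^3"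
  proof -
    have e: "- \<eta> + 1 *\<^sub>R \<xi> = \<xi> - \<eta>" for \<xi> by simp
    show ?thesis using lborel_nn_affine[of "\<lambda>x. ennreal (cmod (b x))" 1 "- \<eta>"] unfolding e by simp
  qed
  have "(\<integral>\<^sup>+p. ennreal (cmod (a (fst p) * b (snd p - fst p))) \<partial>lborel)
      = (\<integral>\<^sup>+\<eta>. \<integral>\<^sup>+\<xi>. ennreal (cmod (a \<eta> * b (\<xi> - \<eta>))) \<partial>lborel \<partial>lborel)"
    using m by (intro lborel_Fubini_nn(1)[where f="\<lambda>\<eta> \<xi>. ennreal (cmod (a \<eta> * b (\<xi> - \<eta>)))"]) (simp add: case_prod_beta')
  also have "\<dots> = (\<integral>\<^sup>+\<eta>. ennreal (cmod (a \<eta>)) * (\<integral>\<^sup>+\<xi>. ennreal (cmod (b \<xi>)) \<partial>lborel) \<partial>lborel)"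
    by (simp add: norm_mult ennreal_mult nn_integral_cmult s)
  also have "\<dots> = (\<integral>\<^sup>+\<eta>. ennreal (cmod (a \<eta>)) \<partial>lborel) * (\<integral>\<^sup>+\<xi>. ennreal (cmod (b \<xi>)) \<partial>lborel)"
    by (simp add: nn_integral_multc)
  also have "\<dots> < \<infinity>" using assms by (simp add: integrable_iff_bounded ennreal_mult_less_top)
  finally show ?thesis using m by (simp add: integrable_iff_bounded case_prod_beta')
qed

lemma conv_L12:
  assumes "L12 a" "L12 b" shows "L12 (conv a b)"
proof -
  have L: "in_L2 a" "in_L2 b" "integrable lborel a" "integrable lborel b" using assms by (auto simp: L12_def)
  have [measurable]: "conv a b \<in> borel_measurable borel" using assms by (intro conv_measurable L12_measurable)
  have i: "integrable (lborel \<Otimes>\<^sub>M lborel) (\<lambda>(\<xi>, \<eta>). a \<eta> * b (\<xi> - \<eta>))"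
    using lborel_pair.integrable_product_swap[of "\<lambda>(\<eta>, \<xi>). a \<eta> * b (\<xi> - \<eta>)"] integrable_shear[OF L(3,4)]
    by (simp add: lborel_prod)
  have I: "integrable lborel (conv a b)"
    unfolding conv_def[abs_def] using lborel_pair.integrable_fst'[OF i] by simp
  define B where "B = norm_L2 a * norm_L2 b"
  have b: "cmod (conv a b \<xi>) \<le> B" for \<xi> unfolding B_def by (rule conv_integrable(2)[OF L(1,2)])
  have "integrable lborel (\<lambda>x. (cmod (conv a b x))\<^sup>2)"
  proof (rule Bochner_Integration.integrable_bound)
    show "integrable lborel (\<lambda>x. B * cmod (conv a b x))" using I by auto
    show "AE x in lborel. norm ((cmod (conv a b x))\<^sup>2) \<le> norm (B * cmod (conv a b x))"
      using b by (intro AE_I2) (auto simp: power2_eq_square abs_mult intro!: mult_right_mono intro: order_trans[OF b abs_ge_self])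
  qed measurable
  then show ?thesis using I by (simp add: L12_def in_L2_def)
qed

lemma ft_conv:
  assumes "L12 a" "L12 b" shows "ft (conv a b) x = ft a x * ft b x"
proof -
  have L: "integrable lborel a" "integrable lborel b" using assms by (auto simp: L12_def)
  have [measurable]: "a \<in> borel_measurable borel" "b \<in> borel_measurable borel" using L by (auto dest: integrable_borel)
  define a' b' where "a' \<xi> = cis (x \<bullet> \<xi>) * a \<xi>" and "b' \<xi> = cis (x \<bullet> \<xi>) * b \<xi>" for \<xi>
  have L': "integrable lborel a'" "integrable lborel b'"
    using osc_integrable[of "\<lambda>x. x", OF _ L(1)] osc_integrable[of "\<lambda>x. x", OF _ L(2)] unfolding a'_def[abs_def] b'_def[abs_def] by auto
  have [measurable]: "b' \<in> borel_measurable borel" using L' by (auto dest: integrable_borel)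
  have s: "(LINT \<xi>|lborel. b' (\<xi> - \<eta>)) = (LINT \<xi>|lborel. b' \<xi>)" for \<eta>
  proof -
    have e: "- \<eta> + 1 *\<^sub>R \<xi> = \<xi> - \<eta>" for \<xi> by simp
    show ?thesis using lborel_integral_affine[of b' 1 "- \<eta>"] unfolding e by simp
  qed
  have "ft (conv a b) x = (LINT \<xi>|lborel. LINT \<eta>|lborel. a' \<eta> * b' (\<xi> - \<eta>))"
    unfolding osc_def conv_def
  proof (intro Bochner_Integration.integral_cong refl)
    fix \<xi>
    have "cis (x \<bullet> \<xi>) * (a \<eta> * b (\<xi> - \<eta>)) = a' \<eta> * b' (\<xi> - \<eta>)" for \<eta>
    proof -
      have "cis (x \<bullet> \<xi>) = cis (x \<bullet> \<eta>) * cis (x \<bullet> (\<xi> - \<eta>))" by (simp add: cis_mult inner_diff_right)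
      then show ?thesis by (simp add: a'_def b'_def)
    qed
    then show "cis (x \<bullet> \<xi>) * (LINT \<eta>|lborel. a \<eta> * b (\<xi> - \<eta>)) = (LINT \<eta>|lborel. a' \<eta> * b' (\<xi> - \<eta>))"
      by (simp only: integral_mult_right_zero[symmetric])
  qed
  also have "\<dots> = (LINT \<eta>|lborel. LINT \<xi>|lborel. a' \<eta> * b' (\<xi> - \<eta>))"
    using lborel_Fubini[OF integrable_shear[OF L']] by simp
  also have "\<dots> = (LINT \<eta>|lborel. a' \<eta> * (LINT \<xi>|lborel. b' \<xi>))" by (simp only: integral_mult_right_zero s)
  also have "\<dots> = ft a x * ft b x" unfolding a'_def b'_def osc_def by simp
  finally show ?thesis .
qed

lemma L12_bounded_mult:
  assumes "L12 h" and m [measurable]: "m \<in> borel_measurable borel" and b: "\<And>\<xi>. cmod (m \<xi>) \<le> M"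
  shows "L12 (\<lambda>\<xi>. m \<xi> * h \<xi>)" "norm_L2 (\<lambda>\<xi>. m \<xi> * h \<xi>) \<le> M * norm_L2 h"
proof -
  have h: "integrable lborel h" "in_L2 h" using assms by (auto simp: L12_def)
  have [measurable]: "h \<in> borel_measurable borel" using assms(1) by (rule L12_measurable)
  have "integrable lborel (\<lambda>\<xi>. m \<xi> * h \<xi>)"
  proof (rule Bochner_Integration.integrable_bound)
    show "integrable lborel (\<lambda>x. M * cmod (h x))" using h by auto
    show "AE x in lborel. norm (m x * h x) \<le> norm (M * cmod (h x))"
      by (intro AE_I2) (auto simp: norm_mult abs_mult intro!: mult_right_mono intro: order_trans[OF b abs_ge_self])
  qed measurable
  then show "L12 (\<lambda>\<xi>. m \<xi> * h \<xi>)" using in_L2_bounded_mult(1)[OF h(2) m b] by (simp add: L12_def)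
  show "norm_L2 (\<lambda>\<xi>. m \<xi> * h \<xi>) \<le> M * norm_L2 h" by (rule in_L2_bounded_mult(2)[OF h(2) m b])
qed

text \<open>\<open>LP\<close> is defined through the representative \<open>fourier_L2\<close>; on
  transforms of \<open>L12\<close> functions the inversion theorem makes it an explicit multiplier.
  Products of two frequency bands are of this form by \<open>ft_conv\<close>.\<close>

lemma LP_ft:
  assumes h: "L12 h" and m [measurable]: "(\<lambda>\<xi>. \<beta> (\<xi> /\<^sub>R \<mu>)) \<in> borel_measurable borel"
  shows "LP \<beta> \<mu> (ft h) = ft (\<lambda>\<xi>. complex_of_real (\<beta> (\<xi> /\<^sub>R \<mu>)) * h \<xi>)"
proof -
  define c where "c = complex_of_real ((2 * pi) ^ 3)"
  have [measurable]: "h \<in> borel_measurable borel" using h by (rule L12_measurable)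
  have ci: "complex_of_real (1 / (2 * pi) ^ 3) * c = 1" unfolding c_def of_real_mult[symmetric] by simp
  have L: "L12 (\<lambda>\<xi>. c * h \<xi>)" using L12_bounded_mult(1)[OF h, of "\<lambda>_. c"] by auto
  have cm: "fourier_inv (\<lambda>\<xi>. c * k \<xi>) = ft k" for k
    by (rule ext) (simp only: fourier_inv_ft ft_cmult mult.assoc[symmetric] ci mult_1)
  have "in_L2 (fourier_inv (\<lambda>\<xi>. c * h \<xi>))" by (rule fourier_inv_in_L2(1)[OF L])
  then have [measurable]: "fourier_L2 (fourier_inv (\<lambda>\<xi>. c * h \<xi>)) \<in> borel_measurable borel"
    by (intro in_L2_measurable fourier_L2_in_L2)
  have "LP \<beta> \<mu> (ft h) = fourier_inv (\<lambda>\<xi>. complex_of_real (\<beta> (\<xi> /\<^sub>R \<mu>)) * fourier_L2 (fourier_inv (\<lambda>\<xi>. c * h \<xi>)) \<xi>)"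
    unfolding LP_def cm ..
  also have "\<dots> = fourier_inv (\<lambda>\<xi>. c * (complex_of_real (\<beta> (\<xi> /\<^sub>R \<mu>)) * h \<xi>))"
  proof (rule fourier_inv_cong_AE)
    show "AE \<xi> in lborel. complex_of_real (\<beta> (\<xi> /\<^sub>R \<mu>)) * fourier_L2 (fourier_inv (\<lambda>\<xi>. c * h \<xi>)) \<xi> = c * (complex_of_real (\<beta> (\<xi> /\<^sub>R \<mu>)) * h \<xi>)"
      using fourier_L2_fourier_inv[OF L] by eventually_elim simp
  qed measurable
  also have "\<dots> = ft (\<lambda>\<xi>. complex_of_real (\<beta> (\<xi> /\<^sub>R \<mu>)) * h \<xi>)" by (rule cm)
  finally show ?thesis .
qed

lemma N2_LP_ft_le:
  assumes h: "L12 h" and m [measurable]: "(\<lambda>\<xi>. \<beta> (\<xi> /\<^sub>R \<mu>)) \<in> borel_measurable borel" and b: "\<And>\<xi>. \<bar>\<beta> \<xi>\<bar> \<le> M"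
  shows "N2 (LP \<beta> \<mu> (ft h)) \<le> ennreal (M\<^sup>2) * N2 (ft h)"
proof -
  have [measurable]: "h \<in> borel_measurable borel" using h by (rule L12_measurable)
  define k where "k \<xi> = complex_of_real (\<beta> (\<xi> /\<^sub>R \<mu>)) * h \<xi>" for \<xi>
  have k: "L12 k" unfolding k_def[abs_def] by (rule L12_bounded_mult(1)[OF h, where M=M]) (auto simp: b)
  have "N2 k \<le> N2 (\<lambda>\<xi>. of_real M * h \<xi>)"
    by (rule N2_mono) (auto simp: k_def norm_mult intro!: mult_right_mono intro: order_trans[OF b abs_ge_self])
  also have "\<dots> = ennreal (M\<^sup>2) * N2 h" by (simp add: N2_cmult)
  finally have "N2 k \<le> ennreal (M\<^sup>2) * N2 h" .
  then have "ennreal ((2 * pi) ^ 3) * N2 k \<le> ennreal ((2 * pi) ^ 3) * (ennreal (M\<^sup>2) * N2 h)" by (rule mult_left_mono) simp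
  then show ?thesis unfolding LP_ft[OF h m] k_def[symmetric] N2_ft[OF k] N2_ft[OF h] by (simp add: mult.left_commute)
qed

lemma lp_bump_bounds:
  assumes "lp_bump \<beta>"
  obtains a b M where "0 < a" "a \<le> b" "0 < M" "\<And>\<xi>. \<bar>\<beta> \<xi>\<bar> \<le> M" "\<And>\<xi>. \<beta> \<xi> \<noteq> 0 \<Longrightarrow> a \<le> norm \<xi> \<and> norm \<xi> \<le> b" "\<beta> \<in> borel_measurable borel"
proof -
  from assms obtain a b where ab: "0 < a" "a \<le> b" and s: "\<And>\<xi>. \<beta> \<xi> \<noteq> 0 \<Longrightarrow> a \<le> norm \<xi> \<and> norm \<xi> \<le> b" and sm: "smooth \<beta>"
    unfolding lp_bump_def by blast
  have "iter_partial [] \<beta> differentiable (at x)" for x using sm unfolding smooth_def by blast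
  then have "isCont \<beta> x" for x by (simp add: differentiable_imp_continuous_within)
  then have c: "continuous_on UNIV \<beta>" by (simp add: continuous_at_imp_continuous_on)
  have "compact (\<beta> ` cball 0 b)" by (intro compact_continuous_image continuous_on_subset[OF c]) auto
  then obtain M where M: "0 < M" "\<And>\<xi>. \<xi> \<in> cball 0 b \<Longrightarrow> norm (\<beta> \<xi>) \<le> M"
    using compact_imp_bounded bounded_pos by (metis imageI)
  have "\<bar>\<beta> \<xi>\<bar> \<le> M" for \<xi> using M(2)[of \<xi>] s[of \<xi>] M(1) by (cases "\<beta> \<xi> = 0") auto
  then show thesis using that[OF ab M(1) _ s] borel_measurable_continuous_onI[OF c] by blast
qed

text \<open>The frequency content of the projection at \<Lambda>. Its support in a shell puts it in
  \<open>L12\<close> although f is only in L2.\<close>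

definition band :: "(real^3 \<Rightarrow> real) \<Rightarrow> real \<Rightarrow> (real^3 \<Rightarrow> complex) \<Rightarrow> real^3 \<Rightarrow> complex" where
  "band \<beta> \<Lambda> f \<xi> = complex_of_real (\<beta> (\<xi> /\<^sub>R \<Lambda>)) * fourier_L2 f \<xi>"

lemma band_facts:
  assumes f: "in_L2 f" and \<Lambda>: "0 < \<Lambda>" and M: "\<And>\<xi>. \<bar>\<beta> \<xi>\<bar> \<le> M" and s: "\<And>\<xi>. \<beta> \<xi> \<noteq> 0 \<Longrightarrow> a \<le> norm \<xi> \<and> norm \<xi> \<le> b"
    and [measurable]: "\<beta> \<in> borel_measurable borel"
  shows "L12 (band \<beta> \<Lambda> f)" and "\<And>\<xi>. band \<beta> \<Lambda> f \<xi> \<noteq> 0 \<Longrightarrow> a * \<Lambda> \<le> norm \<xi> \<and> norm \<xi> \<le> b * \<Lambda>"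
    and "norm_L2 (band \<beta> \<Lambda> f) = sqrt ((2 * pi) ^ 3) * norm_L2 (LP \<beta> \<Lambda> f)"
proof -
  show sup: "a * \<Lambda> \<le> norm \<xi> \<and> norm \<xi> \<le> b * \<Lambda>" if "band \<beta> \<Lambda> f \<xi> \<noteq> 0" for \<xi>
  proof -
    have "\<beta> (\<xi> /\<^sub>R \<Lambda>) \<noteq> 0" using that by (auto simp: band_def)
    from s[OF this] show ?thesis using \<Lambda> by (simp add: field_simps)
  qed
  have m: "(\<lambda>\<xi>. complex_of_real (\<beta> (\<xi> /\<^sub>R \<Lambda>))) \<in> borel_measurable borel" by measurable
  have L: "in_L2 (band \<beta> \<Lambda> f)"
    unfolding band_def[abs_def] by (rule in_L2_bounded_mult(1)[OF fourier_L2_in_L2[OF f] m, of M]) (simp add: M)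
  have "trunc (b * \<Lambda> + 1) (band \<beta> \<Lambda> f) = band \<beta> \<Lambda> f"
  proof
    fix \<xi> show "trunc (b * \<Lambda> + 1) (band \<beta> \<Lambda> f) \<xi> = band \<beta> \<Lambda> f \<xi>"
      using sup[of \<xi>] by (cases "band \<beta> \<Lambda> f \<xi> = 0") (auto simp: trunc_def)
  qed
  then show L12: "L12 (band \<beta> \<Lambda> f)" using trunc_L12[OF L, of "b * \<Lambda> + 1"] by simp
  have "LP \<beta> \<Lambda> f = fourier_inv (band \<beta> \<Lambda> f)" by (simp add: LP_def band_def[abs_def])
  then show "norm_L2 (band \<beta> \<Lambda> f) = sqrt ((2 * pi) ^ 3) * norm_L2 (LP \<beta> \<Lambda> f)"
    using fourier_inv_in_L2(2)[OF L12] by simp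
qed

lemma L12_cis: "\<phi> \<in> borel_measurable borel \<Longrightarrow> L12 \<alpha> \<Longrightarrow> L12 (\<lambda>\<xi>. cis (t * \<phi> \<xi>) * \<alpha> \<xi>)"
  by (rule L12_bounded_mult(1)[where M=1]) auto

text \<open>For each t the transforms agree only almost everywhere, but \<open>LP\<close> is an
  integral over frequencies, so the formula holds at every (t, x).\<close>

lemma LP_half_kg:
  assumes e: "0 < e" and \<sigma>: "\<sigma> \<in> {1, - 1}" and g: "in_L2 g" and sol: "half_kg_solution e \<sigma> g v"
    and [measurable]: "\<beta> \<in> borel_measurable borel"
  shows "LP \<beta> \<Lambda> (v t) x = complex_of_real (1 / (2 * pi) ^ 3) * Eop (kg e (- \<sigma>)) (band \<beta> \<Lambda> g) (t, x)"
proof -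
  have "in_L2 (v t)" using sol by (simp add: half_kg_solution_def continuous_into_L2_def)
  then have [measurable]: "fourier_L2 (v t) \<in> borel_measurable borel" "fourier_L2 g \<in> borel_measurable borel"
    using g by (auto intro: in_L2_measurable fourier_L2_in_L2)
  have "LP \<beta> \<Lambda> (v t) = fourier_inv (\<lambda>\<xi>. cis (t * kg e (- \<sigma>) \<xi>) * band \<beta> \<Lambda> g \<xi>)"
    unfolding LP_def
  proof (rule fourier_inv_cong_AE)
    show "AE \<xi> in lborel. complex_of_real (\<beta> (\<xi> /\<^sub>R \<Lambda>)) * fourier_L2 (v t) \<xi> = cis (t * kg e (- \<sigma>) \<xi>) * band \<beta> \<Lambda> g \<xi>"
      using half_kg_solution_fourier[OF e g \<sigma> sol, of t] by eventually_elim (simp add: kg_def band_def)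
  qed (unfold band_def, measurable)
  then show ?thesis by (simp only: fourier_inv_ft Eop_eq)
qed

text \<open>The cosine is the mean of two exponentials; the resulting half waves, of phases
  \<open>wv e 1\<close> and \<open>wv e (- 1)\<close>, are estimated separately.\<close>

lemma LP_wave:
  assumes e: "0 < e" and f: "in_L2 f" and sol: "wave_solution e f u"
    and m [measurable]: "\<beta> \<in> borel_measurable borel" and b: "L12 (band \<beta> \<Lambda> f)"
  shows "LP \<beta> \<Lambda> (u t) x = complex_of_real (1 / (2 * pi) ^ 3) * (1 / 2) *
    (Eop (wv e 1) (band \<beta> \<Lambda> f) (t, x) + Eop (wv e (- 1)) (band \<beta> \<Lambda> f) (t, x))"
proof -
  have "in_L2 (u t)" using sol by (simp add: wave_solution_def continuous_into_L2_def)
  then have [measurable]: "fourier_L2 (u t) \<in> borel_measurable borel" "fourier_L2 f \<in> borel_measurable borel"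
    using f by (auto intro: in_L2_measurable fourier_L2_in_L2)
  define A where "A s \<xi> = cis (t * wv e s \<xi>) * band \<beta> \<Lambda> f \<xi>" for s \<xi>
  have iA: "integrable lborel (A s)" for s
    using L12_cis[OF wv_measurable b, of t e s] unfolding A_def[abs_def] L12_def by blast
  have "LP \<beta> \<Lambda> (u t) = fourier_inv (\<lambda>\<xi>. (1 / 2) * (A 1 \<xi> + A (- 1) \<xi>))"
    unfolding LP_def
  proof (rule fourier_inv_cong_AE)
    have c: "complex_of_real (cos \<theta>) = (1 / 2) * (cis \<theta> + cis (- \<theta>))" for \<theta>
      by (simp add: complex_eq_iff)
    show "AE \<xi> in lborel. complex_of_real (\<beta> (\<xi> /\<^sub>R \<Lambda>)) * fourier_L2 (u t) \<xi> = (1 / 2) * (A 1 \<xi> + A (- 1) \<xi>)"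
      using wave_solution_fourier[OF e f sol, of t]
    proof eventually_elim
      case (elim \<xi>)
      show ?case unfolding elim c A_def wv_def band_def by (simp add: algebra_simps)
    qed
  qed (unfold band_def A_def, measurable)
  then have "LP \<beta> \<Lambda> (u t) x = complex_of_real (1 / (2 * pi) ^ 3) * ((1 / 2) * (ft (A 1) x + ft (A (- 1)) x))"
    by (simp only: fourier_inv_ft ft_cmult ft_add[OF iA iA])
  then show ?thesis by (simp only: A_def[abs_def] Eop_eq mult.assoc)
qed

section \<open>Projected products as functions on space-time\<close>

lemma measurable_LINT:
  fixes f :: "'a::euclidean_space \<times> 'b::euclidean_space \<Rightarrow> complex"
  assumes "f \<in> borel_measurable borel" shows "(\<lambda>x. LINT y|lborel. f (x, y)) \<in> borel_measurable borel"
proof -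
  have "(\<lambda>(x, y). f (x, y)) \<in> borel_measurable (borel \<Otimes>\<^sub>M (borel :: 'b measure))"
    using assms by (simp add: borel_prod)
  then have "(\<lambda>(x, y). f (x, y)) \<in> borel_measurable (borel \<Otimes>\<^sub>M (lborel :: 'b measure))"
    by (simp cong: measurable_cong_sets)
  then show ?thesis by (rule lborel.borel_measurable_lebesgue_integral)
qed

definition LPprod where
  "LPprod \<beta> \<mu> \<phi>1 \<alpha> \<phi>2 \<gamma> p = LP \<beta> \<mu> (\<lambda>y. Eop \<phi>1 \<alpha> (fst p, y) * Eop \<phi>2 \<gamma> (fst p, y)) (snd p)"

lemma Eop_prod_conv:
  assumes "\<phi>1 \<in> borel_measurable borel" "\<phi>2 \<in> borel_measurable borel" "L12 \<alpha>" "L12 \<gamma>"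
  shows "(\<lambda>y. Eop \<phi>1 \<alpha> (t, y) * Eop \<phi>2 \<gamma> (t, y)) = ft (conv (\<lambda>\<xi>. cis (t * \<phi>1 \<xi>) * \<alpha> \<xi>) (\<lambda>\<xi>. cis (t * \<phi>2 \<xi>) * \<gamma> \<xi>))"
  by (rule ext) (simp only: Eop_eq ft_conv[OF L12_cis L12_cis] assms)

lemma LPprod_eq:
  assumes m: "\<phi>1 \<in> borel_measurable borel" "\<phi>2 \<in> borel_measurable borel" "L12 \<alpha>" "L12 \<gamma>" and [measurable]: "\<beta> \<in> borel_measurable borel"
  shows "LPprod \<beta> \<mu> \<phi>1 \<alpha> \<phi>2 \<gamma> (t, x) = ft (\<lambda>\<xi>. complex_of_real (\<beta> (\<xi> /\<^sub>R \<mu>)) * conv (\<lambda>\<xi>. cis (t * \<phi>1 \<xi>) * \<alpha> \<xi>) (\<lambda>\<xi>. cis (t * \<phi>2 \<xi>) * \<gamma> \<xi>) \<xi>) x"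
proof -
  have "L12 (conv (\<lambda>\<xi>. cis (t * \<phi>1 \<xi>) * \<alpha> \<xi>) (\<lambda>\<xi>. cis (t * \<phi>2 \<xi>) * \<gamma> \<xi>))" by (intro conv_L12 L12_cis m)
  then show ?thesis unfolding LPprod_def fst_conv snd_conv Eop_prod_conv[OF m] by (subst LP_ft) measurable
qed

text \<open>Joint measurability in (t, x) is not visible in the definition, where \<open>LP\<close>
  acts for each t separately; it follows from writing the value as an iterated integral depending on
  parameters.\<close>

lemma LPprod_measurable:
  assumes [measurable]: "\<phi>1 \<in> borel_measurable borel" "\<phi>2 \<in> borel_measurable borel" and A: "L12 \<alpha>" "L12 \<gamma>" and [measurable]: "\<beta> \<in> borel_measurable borel"
  shows "LPprod \<beta> \<mu> \<phi>1 \<alpha> \<phi>2 \<gamma> \<in> borel_measurable borel"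
proof -
  have [measurable]: "\<alpha> \<in> borel_measurable borel" "\<gamma> \<in> borel_measurable borel" using A by (auto intro: L12_measurable)
  define H where "H q = (LINT \<eta>|lborel. (cis (fst q * \<phi>1 \<eta>) * \<alpha> \<eta>) * (cis (fst q * \<phi>2 (snd q - \<eta>)) * \<gamma> (snd q - \<eta>)))" for q :: "real \<times> (real^3)"
  have "(\<lambda>r. (cis (fst (fst r) * \<phi>1 (snd r)) * \<alpha> (snd r)) * (cis (fst (fst r) * \<phi>2 (snd (fst r) - snd r)) * \<gamma> (snd (fst r) - snd r)))
      \<in> borel_measurable (borel :: ((real \<times> (real^3)) \<times> (real^3)) measure)" by measurable
  from measurable_LINT[OF this] have [measurable]: "H \<in> borel_measurable borel" unfolding H_def[abs_def] by simp
  have "(\<lambda>r. cis (snd (fst r) \<bullet> snd r) * (complex_of_real (\<beta> (snd r /\<^sub>R \<mu>)) * H (fst (fst r), snd r)))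
      \<in> borel_measurable (borel :: ((real \<times> (real^3)) \<times> (real^3)) measure)" by measurable
  from measurable_LINT[OF this]
  have *: "(\<lambda>q. LINT \<xi>|lborel. cis (snd q \<bullet> \<xi>) * (complex_of_real (\<beta> (\<xi> /\<^sub>R \<mu>)) * H (fst q, \<xi>))) \<in> borel_measurable (borel :: (real \<times> (real^3)) measure)" by simp
  have "LPprod \<beta> \<mu> \<phi>1 \<alpha> \<phi>2 \<gamma> = (\<lambda>q. LINT \<xi>|lborel. cis (snd q \<bullet> \<xi>) * (complex_of_real (\<beta> (\<xi> /\<^sub>R \<mu>)) * H (fst q, \<xi>)))"
  proof
    fix q :: "real \<times> (real^3)"
    show "LPprod \<beta> \<mu> \<phi>1 \<alpha> \<phi>2 \<gamma> q = (LINT \<xi>|lborel. cis (snd q \<bullet> \<xi>) * (complex_of_real (\<beta> (\<xi> /\<^sub>R \<mu>)) * H (fst q, \<xi>)))"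
      by (cases q) (simp add: LPprod_eq A osc_def conv_def H_def)
  qed
  then show ?thesis using * by simp
qed

text \<open>Plancherel's theorem on each time slice, integrated in t by Tonelli's theorem.\<close>

lemma LPprod_N2_le:
  assumes m: "\<phi>1 \<in> borel_measurable borel" "\<phi>2 \<in> borel_measurable borel" and A: "L12 \<alpha>" "L12 \<gamma>" and b [measurable]: "\<beta> \<in> borel_measurable borel"
    and M: "\<And>\<xi>. \<bar>\<beta> \<xi>\<bar> \<le> M"
  shows "N2 (LPprod \<beta> \<mu> \<phi>1 \<alpha> \<phi>2 \<gamma>) \<le> ennreal (M\<^sup>2) * N2 (\<lambda>p. Eop \<phi>1 \<alpha> p * Eop \<phi>2 \<gamma> p)"
proof -
  have [measurable]: "Eop \<phi>1 \<alpha> \<in> borel_measurable borel" "Eop \<phi>2 \<gamma> \<in> borel_measurable borel"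
    by (intro Eop_measurable m L12_measurable A)+
  have [measurable]: "LPprod \<beta> \<mu> \<phi>1 \<alpha> \<phi>2 \<gamma> \<in> borel_measurable borel" by (intro LPprod_measurable m A b)
  have sl: "N2 F = (\<integral>\<^sup>+t. N2 (\<lambda>x. F (t, x)) \<partial>lborel)" if [measurable]: "F \<in> borel_measurable borel" for F :: "real \<times> (real^3) \<Rightarrow> complex"
    unfolding N2_def using lborel_Fubini_nn(1)[of "\<lambda>t x. ennreal ((cmod (F (t, x)))\<^sup>2)"] by simp
  have "(\<integral>\<^sup>+t. N2 (\<lambda>x. LPprod \<beta> \<mu> \<phi>1 \<alpha> \<phi>2 \<gamma> (t, x)) \<partial>lborel) \<le> (\<integral>\<^sup>+t. ennreal (M\<^sup>2) * N2 (\<lambda>x. Eop \<phi>1 \<alpha> (t, x) * Eop \<phi>2 \<gamma> (t, x)) \<partial>lborel)"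
  proof (rule nn_integral_mono)
    fix t
    have L: "L12 (conv (\<lambda>\<xi>. cis (t * \<phi>1 \<xi>) * \<alpha> \<xi>) (\<lambda>\<xi>. cis (t * \<phi>2 \<xi>) * \<gamma> \<xi>))" by (intro conv_L12 L12_cis m A)
    have "(\<lambda>x. LPprod \<beta> \<mu> \<phi>1 \<alpha> \<phi>2 \<gamma> (t, x)) = LP \<beta> \<mu> (\<lambda>y. Eop \<phi>1 \<alpha> (t, y) * Eop \<phi>2 \<gamma> (t, y))"
      by (simp add: LPprod_def)
    then show "N2 (\<lambda>x. LPprod \<beta> \<mu> \<phi>1 \<alpha> \<phi>2 \<gamma> (t, x)) \<le> ennreal (M\<^sup>2) * N2 (\<lambda>x. Eop \<phi>1 \<alpha> (t, x) * Eop \<phi>2 \<gamma> (t, x))"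
      unfolding Eop_prod_conv[OF m A] by (simp only:) (rule N2_LP_ft_le[OF L _ M], measurable)
  qed
  also have "\<dots> = ennreal (M\<^sup>2) * (\<integral>\<^sup>+t. N2 (\<lambda>x. Eop \<phi>1 \<alpha> (t, x) * Eop \<phi>2 \<gamma> (t, x)) \<partial>lborel)"
  proof (rule nn_integral_cmult)
    have "(\<lambda>(t, x). ennreal ((cmod (Eop \<phi>1 \<alpha> (t, x) * Eop \<phi>2 \<gamma> (t, x)))\<^sup>2)) \<in> borel_measurable (lborel \<Otimes>\<^sub>M lborel)"
    proof -
      have "(\<lambda>p. ennreal ((cmod (Eop \<phi>1 \<alpha> p * Eop \<phi>2 \<gamma> p))\<^sup>2)) \<in> borel_measurable borel" by measurable
      then show ?thesis by (simp add: lborel_prod case_prod_beta')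
    qed
    then show "(\<lambda>t. N2 (\<lambda>x. Eop \<phi>1 \<alpha> (t, x) * Eop \<phi>2 \<gamma> (t, x))) \<in> borel_measurable lborel"
      unfolding N2_def by (rule lborel.borel_measurable_nn_integral)
  qed
  finally show ?thesis by (subst (1 2) sl) measurable
qed

section \<open>Almost orthogonal decomposition into cubes\<close>

definition cellpt :: "int \<times> int \<times> int \<Rightarrow> real^3" where
  "cellpt n = vector [of_int (fst n), of_int (fst (snd n)), of_int (snd (snd n))]"

definition cell :: "real \<Rightarrow> real^3 \<Rightarrow> int \<times> int \<times> int" where
  "cell \<mu> \<eta> = (\<lfloor>\<eta> $ 1 / \<mu>\<rfloor>, \<lfloor>\<eta> $ 2 / \<mu>\<rfloor>, \<lfloor>\<eta> $ 3 / \<mu>\<rfloor>)"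

definition cube :: "real \<Rightarrow> int \<times> int \<times> int \<Rightarrow> (real^3) set" where
  "cube \<mu> n = {\<eta>. cell \<mu> \<eta> = n}"

text \<open>For r = b + 1 this box around minus the corner of \<open>cube \<mu> n\<close> contains
  every \<xi> - \<eta> with \<eta> in that cube and |\<xi>| \<le> b \<mu>.\<close>

definition dual_cube :: "real \<Rightarrow> real \<Rightarrow> int \<times> int \<times> int \<Rightarrow> (real^3) set" where
  "dual_cube r \<mu> n = {\<zeta>. \<forall>i. \<bar>\<zeta> $ i + \<mu> * cellpt n $ i\<bar> \<le> r * \<mu>}"

lemma cellpt_nth [simp]: "cellpt n $ 1 = of_int (fst n)" "cellpt n $ 2 = of_int (fst (snd n))" "cellpt n $ 3 = of_int (snd (snd n))"
  by (simp_all add: cellpt_def vector_3)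

lemma cube_measurable [measurable]: "cube \<mu> n \<in> sets borel"
proof -
  have "cube \<mu> n = {\<eta>. \<lfloor>\<eta> $ 1 / \<mu>\<rfloor> = fst n \<and> \<lfloor>\<eta> $ 2 / \<mu>\<rfloor> = fst (snd n) \<and> \<lfloor>\<eta> $ 3 / \<mu>\<rfloor> = snd (snd n)}"
    by (auto simp: cube_def cell_def)
  also have "\<dots> \<in> sets borel" unfolding floor_eq_iff by measurable
  finally show ?thesis .
qed

lemma dual_cube_measurable [measurable]: "dual_cube r \<mu> n \<in> sets borel"
  unfolding dual_cube_def forall_3 by measurable

lemma cell_near: "0 < \<mu> \<Longrightarrow> \<bar>\<eta> $ i - \<mu> * cellpt (cell \<mu> \<eta>) $ i\<bar> \<le> \<mu>"
proof -
  assume \<mu>: "0 < \<mu>"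
  have *: "\<bar>x - \<mu> * of_int \<lfloor>x / \<mu>\<rfloor>\<bar> \<le> \<mu>" for x
  proof -
    have "of_int \<lfloor>x / \<mu>\<rfloor> \<le> x / \<mu>" "x / \<mu> \<le> of_int \<lfloor>x / \<mu>\<rfloor> + 1" by linarith+
    then have "of_int \<lfloor>x / \<mu>\<rfloor> * \<mu> \<le> x" "x \<le> (of_int \<lfloor>x / \<mu>\<rfloor> + 1) * \<mu>"
      using \<mu> by (simp_all only: pos_le_divide_eq pos_divide_le_eq)
    then show ?thesis by (simp add: algebra_simps)
  qed
  have "\<forall>i. \<bar>\<eta> $ i - \<mu> * cellpt (cell \<mu> \<eta>) $ i\<bar> \<le> \<mu>"
    unfolding forall_3 by (simp add: cell_def *)
  then show ?thesis ..
qed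

lemma norm_le_3:
  fixes x :: "real^3" assumes "\<And>i. \<bar>x $ i\<bar> \<le> c" shows "norm x \<le> 3 * c"
proof -
  have "norm x \<le> (\<Sum>i\<in>UNIV. \<bar>x $ i\<bar>)" by (rule norm_le_l1_cart)
  also have "\<dots> \<le> (\<Sum>i\<in>(UNIV::3 set). c)" by (rule sum_mono) (rule assms)
  finally show ?thesis by simp
qed

lemma cube_subset: "0 < \<mu> \<Longrightarrow> cube \<mu> n \<subseteq> cball (\<mu> *\<^sub>R cellpt n) (3 * \<mu>)"
  using norm_le_3[of "_ - \<mu> *\<^sub>R cellpt n" \<mu>] cell_near by (auto simp: cube_def dist_norm norm_minus_commute)

lemma dual_cube_subset: "dual_cube r \<mu> n \<subseteq> cball (- \<mu> *\<^sub>R cellpt n) (3 * (r * \<mu>))"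
proof
  fix \<zeta> assume "\<zeta> \<in> dual_cube r \<mu> n"
  then have "norm (\<zeta> + \<mu> *\<^sub>R cellpt n) \<le> 3 * (r * \<mu>)" by (intro norm_le_3) (simp add: dual_cube_def)
  moreover have "dist (- \<mu> *\<^sub>R cellpt n) \<zeta> = norm (\<zeta> + \<mu> *\<^sub>R cellpt n)" by (simp add: dist_commute dist_norm)
  ultimately show "\<zeta> \<in> cball (- \<mu> *\<^sub>R cellpt n) (3 * (r * \<mu>))" by simp
qed

lemma mem_dual_cube:
  assumes \<mu>: "0 < \<mu>" and n: "\<eta> \<in> cube \<mu> n" and x: "norm \<xi> \<le> b * \<mu>"
  shows "\<xi> - \<eta> \<in> dual_cube (b + 1) \<mu> n"
proof -
  have "\<bar>\<xi> $ i - \<eta> $ i + \<mu> * cellpt n $ i\<bar> \<le> (b + 1) * \<mu>" for i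
  proof -
    have "\<bar>\<xi> $ i\<bar> \<le> b * \<mu>" using component_le_norm_cart[of \<xi> i] x by linarith
    moreover have "\<bar>\<eta> $ i - \<mu> * cellpt n $ i\<bar> \<le> \<mu>" using cell_near[OF \<mu>, of \<eta> i] n by (simp add: cube_def)
    ultimately have "\<bar>\<xi> $ i - \<eta> $ i + \<mu> * cellpt n $ i\<bar> \<le> b * \<mu> + \<mu>" by linarith
    then show ?thesis by (simp add: algebra_simps)
  qed
  then show ?thesis by (simp add: dual_cube_def)
qed

lemma card_ints_near:
  assumes "0 \<le> r" shows "finite {k::int. \<bar>x + of_int k\<bar> \<le> r}" "real (card {k::int. \<bar>x + of_int k\<bar> \<le> r}) \<le> 2 * r + 1"
proof -
  have eq: "{k::int. \<bar>x + of_int k\<bar> \<le> r} = {\<lceil>- r - x\<rceil>..\<lfloor>r - x\<rfloor>}" by (auto simp: le_floor_iff ceiling_le_iff)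
  show "finite {k::int. \<bar>x + of_int k\<bar> \<le> r}" unfolding eq by simp
  have "real_of_int \<lfloor>r - x\<rfloor> \<le> r - x" "- r - x \<le> real_of_int \<lceil>- r - x\<rceil>" by linarith+
  then have "real_of_int (\<lfloor>r - x\<rfloor> - \<lceil>- r - x\<rceil> + 1) \<le> 2 * r + 1" unfolding of_int_add of_int_diff of_int_1 by linarith
  then show "real (card {k::int. \<bar>x + of_int k\<bar> \<le> r}) \<le> 2 * r + 1" unfolding eq using assms by simp
qed

text \<open>A point lies in \<open>dual_cube r \<mu> n\<close> only if each component of n is an
  integer in an interval of length 2 r, which leaves at most 2 r + 1 choices per component.\<close>

lemma dual_cube_overlap:
  assumes \<mu>: "0 < \<mu>" and r: "0 \<le> r" and I: "finite I"
  shows "(\<Sum>n\<in>I. indicator (dual_cube r \<mu> n) \<zeta> :: real) \<le> (2 * r + 1) ^ 3"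
proof -
  define J where "J i = {k::int. \<bar>\<zeta> $ i / \<mu> + of_int k\<bar> \<le> r}" for i
  have J: "finite (J i)" "real (card (J i)) \<le> 2 * r + 1" for i unfolding J_def by (intro card_ints_near r)+
  have nr: "\<bar>z / \<mu> + c\<bar> \<le> r" if "\<bar>z + \<mu> * c\<bar> \<le> r * \<mu>" for z c
  proof -
    have "z / \<mu> + c = (z + \<mu> * c) / \<mu>" using \<mu> by (simp add: add_divide_distrib)
    then show ?thesis using that \<mu> by (simp add: abs_divide pos_divide_le_eq)
  qed
  have sub: "{n \<in> I. \<zeta> \<in> dual_cube r \<mu> n} \<subseteq> J 1 \<times> J 2 \<times> J 3"
  proof
    fix n assume "n \<in> {n \<in> I. \<zeta> \<in> dual_cube r \<mu> n}"
    then have "\<forall>i. \<bar>\<zeta> $ i / \<mu> + cellpt n $ i\<bar> \<le> r" using nr by (simp add: dual_cube_def)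
    then show "n \<in> J 1 \<times> J 2 \<times> J 3" unfolding forall_3 by (cases n) (simp add: J_def)
  qed
  have "(\<Sum>n\<in>I. indicator (dual_cube r \<mu> n) \<zeta> :: real) = (\<Sum>n\<in>{n \<in> I. \<zeta> \<in> dual_cube r \<mu> n}. 1)"
    by (rule sum.mono_neutral_cong_right) (auto simp: I)
  also have "\<dots> = real (card {n \<in> I. \<zeta> \<in> dual_cube r \<mu> n})" by simp
  also have "\<dots> \<le> real (card (J 1 \<times> J 2 \<times> J 3))" using J(1) by (intro of_nat_mono card_mono[OF _ sub]) simp
  also have "\<dots> = real (card (J 1)) * (real (card (J 2)) * real (card (J 3)))" by (simp add: card_cartesian_product)
  also have "\<dots> \<le> (2 * r + 1) * ((2 * r + 1) * (2 * r + 1))" using J(2) r by (intro mult_mono) auto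
  finally show ?thesis by (simp add: power3_eq_cube mult.assoc)
qed

lemma sum_localized_L2:
  assumes f: "in_L2 f" and I: "finite I" and S [measurable]: "\<And>n. S n \<in> sets borel" and le: "\<And>x. (\<Sum>n\<in>I. indicator (S n) x) \<le> (C::real)"
  shows "(\<Sum>n\<in>I. (norm_L2 (\<lambda>x. indicator (S n) x * f x))\<^sup>2) \<le> C * (norm_L2 f)\<^sup>2"
proof -
  have [measurable]: "f \<in> borel_measurable borel" using f by (rule in_L2_measurable)
  have i: "integrable lborel (\<lambda>x. (cmod (f x))\<^sup>2)" using f by (simp add: in_L2_def)
  have sq: "(norm_L2 g)\<^sup>2 = (LINT x|lborel. (cmod (g x))\<^sup>2)" for g :: "'a \<Rightarrow> complex" by (simp add: norm_L2_def)
  have ind: "(cmod (indicator (S n) x * f x))\<^sup>2 = indicator (S n) x * (cmod (f x))\<^sup>2" for n x by (simp add: indicator_def)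
  have ii: "integrable lborel (\<lambda>x. indicator (S n) x * (cmod (f x))\<^sup>2)" for n
    by (rule Bochner_Integration.integrable_bound[OF i]) (auto simp: indicator_def)
  have "(\<Sum>n\<in>I. (norm_L2 (\<lambda>x. indicator (S n) x * f x))\<^sup>2) = (LINT x|lborel. (\<Sum>n\<in>I. indicator (S n) x * (cmod (f x))\<^sup>2))"
    unfolding sq ind by (rule Bochner_Integration.integral_sum[symmetric]) (rule ii)
  also have "\<dots> \<le> (LINT x|lborel. C * (cmod (f x))\<^sup>2)"
  proof (rule integral_mono)
    show "integrable lborel (\<lambda>x. \<Sum>n\<in>I. indicator (S n) x * (cmod (f x))\<^sup>2)" by (intro Bochner_Integration.integrable_sum ii)
    show "integrable lborel (\<lambda>x. C * (cmod (f x))\<^sup>2)" using i by simp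
    show "(\<Sum>n\<in>I. indicator (S n) x * (cmod (f x))\<^sup>2) \<le> C * (cmod (f x))\<^sup>2" for x
      unfolding sum_distrib_right[symmetric] using le by (intro mult_right_mono) auto
  qed
  also have "\<dots> = C * (norm_L2 f)\<^sup>2" by (simp add: sq)
  finally show ?thesis .
qed

lemma ft_sum:
  assumes "finite I" "\<And>n. n \<in> I \<Longrightarrow> integrable lborel (h n)" "\<And>\<xi>. H \<xi> = (\<Sum>n\<in>I. h n \<xi>)"
  shows "ft H x = (\<Sum>n\<in>I. ft (h n) x)"
proof -
  have "H = (\<lambda>\<xi>. \<Sum>n\<in>I. h n \<xi>)" using assms(3) by auto
  then show ?thesis unfolding osc_def
    by (simp add: sum_distrib_left) (rule Bochner_Integration.integral_sum, intro osc_integrable assms(2), auto)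
qed

text \<open>On outputs with |\<xi>| \<le> b \<mu> the convolution splits exactly into the pieces of
  \<alpha> on a cube against those of \<gamma> on its dual cube. The pieces are added by the
  triangle inequality and Cauchy-Schwarz over n. Disjointness of the cubes gives the factor 1 for
  \<alpha>; the overlap count with r = b + 1 gives the factor (2 b + 3)^3 for \<gamma>, under a
  square root.\<close>

proposition LPprod_cells:
  assumes m: "\<phi>1 \<in> borel_measurable borel" "\<phi>2 \<in> borel_measurable borel" and A: "L12 \<alpha>" "L12 \<gamma>"
    and \<beta>: "\<beta> \<in> borel_measurable borel" "\<And>\<xi>. \<bar>\<beta> \<xi>\<bar> \<le> M" "\<And>\<xi>. \<beta> \<xi> \<noteq> 0 \<Longrightarrow> norm \<xi> \<le> b" and b: "0 < b" and \<mu>: "0 < \<mu>"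
    and supp: "\<And>\<eta>. \<alpha> \<eta> \<noteq> 0 \<Longrightarrow> norm \<eta> \<le> \<rho>" and K: "0 \<le> K"
    and bil: "\<And>y1 y2 \<alpha>' \<gamma>'. L12 \<alpha>' \<Longrightarrow> L12 \<gamma>' \<Longrightarrow> (\<And>\<eta>. \<alpha>' \<eta> \<noteq> 0 \<Longrightarrow> \<alpha> \<eta> \<noteq> 0 \<and> \<eta> \<in> cball y1 (3 * \<mu>)) \<Longrightarrow>
      (\<And>\<zeta>. \<gamma>' \<zeta> \<noteq> 0 \<Longrightarrow> \<gamma> \<zeta> \<noteq> 0 \<and> \<zeta> \<in> cball y2 (3 * ((b + 1) * \<mu>))) \<Longrightarrow>
      N2 (\<lambda>p. Eop \<phi>1 \<alpha>' p * Eop \<phi>2 \<gamma>' p) \<le> ennreal K * (N2 \<alpha>' * N2 \<gamma>')"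
  shows "in_L2 (LPprod \<beta> \<mu> \<phi>1 \<alpha> \<phi>2 \<gamma>)"
    and "norm_L2 (LPprod \<beta> \<mu> \<phi>1 \<alpha> \<phi>2 \<gamma>) \<le> M * sqrt K * sqrt ((2 * b + 3) ^ 3) * norm_L2 \<alpha> * norm_L2 \<gamma>"
proof -
  have M: "0 \<le> M" using \<beta>(2)[of 0] by linarith
  note \<beta>(1)[measurable] m[measurable]
  have [measurable]: "\<alpha> \<in> borel_measurable borel" "\<gamma> \<in> borel_measurable borel" using A by (auto intro: L12_measurable)
  have L: "in_L2 \<alpha>" "in_L2 \<gamma>" using A by (auto simp: L12_def)
  define \<alpha>n where "\<alpha>n n \<eta> = indicator (cube \<mu> n) \<eta> * \<alpha> \<eta>" for n \<eta>
  define \<gamma>n where "\<gamma>n n \<zeta> = indicator (dual_cube (b + 1) \<mu> n) \<zeta> * \<gamma> \<zeta>" for n \<zeta>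
  have An: "L12 (\<alpha>n n)" "L12 (\<gamma>n n)" for n
    unfolding \<alpha>n_def[abs_def] \<gamma>n_def[abs_def] by (rule L12_bounded_mult(1)[OF A(1), where M=1] L12_bounded_mult(1)[OF A(2), where M=1]; auto simp: indicator_def)+
  \<comment> \<open>The bounded support of \<alpha> meets only cubes with indices in [-N, N]^3, so
    all sums below are finite.\<close>
  define N where "N = \<lceil>\<rho> / \<mu>\<rceil>"
  define I where "I = {- N..N} \<times> {- N..N} \<times> {- N..N}"
  have I: "finite I" by (simp add: I_def)
  have inI: "cell \<mu> \<eta> \<in> I" if "\<alpha> \<eta> \<noteq> 0" for \<eta>
  proof -
    have "\<lfloor>\<eta> $ i / \<mu>\<rfloor> \<in> {- N..N}" for i
    proof -
      have "\<bar>\<eta> $ i\<bar> \<le> \<rho>" using component_le_norm_cart[of \<eta> i] supp[OF that] by linarith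
      then have "- (\<rho> / \<mu>) \<le> \<eta> $ i / \<mu>" "\<eta> $ i / \<mu> \<le> \<rho> / \<mu>" using \<mu> by (auto simp: field_simps)
      then show ?thesis unfolding N_def by simp linarith
    qed
    then show ?thesis by (simp add: I_def cell_def)
  qed
  have one: "(\<Sum>n\<in>I. indicator (cube \<mu> n) \<eta> :: real) \<le> 1" for \<eta>
  proof -
    have "(\<Sum>n\<in>I. indicator (cube \<mu> n) \<eta> :: real) = (\<Sum>n\<in>I. if n = cell \<mu> \<eta> then 1 else 0)"
      by (intro sum.cong refl) (simp add: cube_def indicator_def)
    also have "\<dots> \<le> 1" using I by simp
    finally show ?thesis .
  qed
  define k where "k \<alpha> \<gamma> t = conv (\<lambda>\<xi>. cis (t * \<phi>1 \<xi>) * \<alpha> \<xi>) (\<lambda>\<xi>. cis (t * \<phi>2 \<xi>) * \<gamma> \<xi>)" for \<alpha> \<gamma> :: "real^3 \<Rightarrow> complex" and t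
  \<comment> \<open>The factor \<beta> restricts to |\<xi>| \<le> b \<mu>. There \<eta> in
    \<open>cube \<mu> n\<close> implies that \<xi> - \<eta> is in the dual cube, so for each \<eta>
    the sum has exactly the term n = \<open>cell \<mu> \<eta>\<close>.\<close>
  have split: "complex_of_real (\<beta> (\<xi> /\<^sub>R \<mu>)) * k \<alpha> \<gamma> t \<xi> = (\<Sum>n\<in>I. complex_of_real (\<beta> (\<xi> /\<^sub>R \<mu>)) * k (\<alpha>n n) (\<gamma>n n) t \<xi>)" for t \<xi>
  proof (cases "\<beta> (\<xi> /\<^sub>R \<mu>) = 0")
    case False
    then have x: "norm \<xi> \<le> b * \<mu>" using \<beta>(3)[OF False] \<mu> by (simp add: field_simps)
    have eq: "(cis (t * \<phi>1 \<eta>) * \<alpha> \<eta>) * (cis (t * \<phi>2 (\<xi> - \<eta>)) * \<gamma> (\<xi> - \<eta>))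
        = (\<Sum>n\<in>I. (cis (t * \<phi>1 \<eta>) * \<alpha>n n \<eta>) * (cis (t * \<phi>2 (\<xi> - \<eta>)) * \<gamma>n n (\<xi> - \<eta>)))" for \<eta>
    proof (cases "\<alpha> \<eta> = 0")
      case False
      have "(\<Sum>n\<in>I. (cis (t * \<phi>1 \<eta>) * \<alpha>n n \<eta>) * (cis (t * \<phi>2 (\<xi> - \<eta>)) * \<gamma>n n (\<xi> - \<eta>)))
         = (\<Sum>n\<in>I. if n = cell \<mu> \<eta> then (cis (t * \<phi>1 \<eta>) * \<alpha> \<eta>) * (cis (t * \<phi>2 (\<xi> - \<eta>)) * \<gamma> (\<xi> - \<eta>)) else 0)"
      proof (intro sum.cong refl)
        fix n
        show "(cis (t * \<phi>1 \<eta>) * \<alpha>n n \<eta>) * (cis (t * \<phi>2 (\<xi> - \<eta>)) * \<gamma>n n (\<xi> - \<eta>))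
          = (if n = cell \<mu> \<eta> then (cis (t * \<phi>1 \<eta>) * \<alpha> \<eta>) * (cis (t * \<phi>2 (\<xi> - \<eta>)) * \<gamma> (\<xi> - \<eta>)) else 0)"
        proof (cases "n = cell \<mu> \<eta>")
          case True
          then have "\<eta> \<in> cube \<mu> n" by (simp add: cube_def)
          moreover from mem_dual_cube[OF \<mu> this x] have "\<xi> - \<eta> \<in> dual_cube (b + 1) \<mu> n" .
          ultimately show ?thesis using True by (simp add: \<alpha>n_def \<gamma>n_def)
        next
          case False
          then have "\<eta> \<notin> cube \<mu> n" by (auto simp: cube_def)
          then show ?thesis using False by (simp add: \<alpha>n_def)
        qed
      qed
      also have "\<dots> = (cis (t * \<phi>1 \<eta>) * \<alpha> \<eta>) * (cis (t * \<phi>2 (\<xi> - \<eta>)) * \<gamma> (\<xi> - \<eta>))"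
        using inI[OF False] I by simp
      finally show ?thesis ..
    qed (simp add: \<alpha>n_def)
    have "k \<alpha> \<gamma> t \<xi> = (\<Sum>n\<in>I. k (\<alpha>n n) (\<gamma>n n) t \<xi>)"
      unfolding k_def conv_def eq
    proof (rule Bochner_Integration.integral_sum)
      fix n
      have "in_L2 (\<lambda>\<eta>. cis (t * \<phi>1 \<eta>) * \<alpha>n n \<eta>)" "in_L2 (\<lambda>\<eta>. cis (t * \<phi>2 \<eta>) * \<gamma>n n \<eta>)"
        using L12_cis[OF m(1) An(1), of t n] L12_cis[OF m(2) An(2), of t n] by (auto simp: L12_def)
      then show "integrable lborel (\<lambda>\<eta>. (cis (t * \<phi>1 \<eta>) * \<alpha>n n \<eta>) * (cis (t * \<phi>2 (\<xi> - \<eta>)) * \<gamma>n n (\<xi> - \<eta>)))"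
        by (rule conv_integrable(1))
    qed
    then show ?thesis by (simp add: sum_distrib_left)
  qed simp
  have k12: "L12 (k (\<alpha>n n) (\<gamma>n n) t)" for n t unfolding k_def by (intro conv_L12 L12_cis m An)
  have ik: "integrable lborel (\<lambda>\<xi>. complex_of_real (\<beta> (\<xi> /\<^sub>R \<mu>)) * k (\<alpha>n n) (\<gamma>n n) t \<xi>)" for n t
    using L12_bounded_mult(1)[OF k12, of "\<lambda>\<xi>. complex_of_real (\<beta> (\<xi> /\<^sub>R \<mu>))" M n t] \<beta>(2) by (simp add: L12_def)
  have sum: "LPprod \<beta> \<mu> \<phi>1 \<alpha> \<phi>2 \<gamma> = (\<lambda>p. \<Sum>n\<in>I. LPprod \<beta> \<mu> \<phi>1 (\<alpha>n n) \<phi>2 (\<gamma>n n) p)"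
  proof
    fix p :: "real \<times> (real^3)"
    obtain t x where p: "p = (t, x)" by (cases p)
    show "LPprod \<beta> \<mu> \<phi>1 \<alpha> \<phi>2 \<gamma> p = (\<Sum>n\<in>I. LPprod \<beta> \<mu> \<phi>1 (\<alpha>n n) \<phi>2 (\<gamma>n n) p)"
      unfolding p LPprod_eq[OF m A \<beta>(1)] LPprod_eq[OF m An \<beta>(1)]
      by (rule ft_sum[OF I ik[unfolded k_def] split[unfolded k_def]])
  qed
  define c where "c = M * sqrt K"
  have c: "0 \<le> c" using M K by (simp add: c_def)
  have loc: "in_L2 (LPprod \<beta> \<mu> \<phi>1 (\<alpha>n n) \<phi>2 (\<gamma>n n)) \<and>
      norm_L2 (LPprod \<beta> \<mu> \<phi>1 (\<alpha>n n) \<phi>2 (\<gamma>n n)) \<le> c * (norm_L2 (\<alpha>n n) * norm_L2 (\<gamma>n n))" for n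
  proof -
    have Ln: "in_L2 (\<alpha>n n)" "in_L2 (\<gamma>n n)" using An by (auto simp: L12_def)
    have "N2 (\<lambda>p. Eop \<phi>1 (\<alpha>n n) p * Eop \<phi>2 (\<gamma>n n) p) \<le> ennreal K * (N2 (\<alpha>n n) * N2 (\<gamma>n n))"
    proof (rule bil[OF An])
      show "\<alpha> \<eta> \<noteq> 0 \<and> \<eta> \<in> cball (\<mu> *\<^sub>R cellpt n) (3 * \<mu>)" if "\<alpha>n n \<eta> \<noteq> 0" for \<eta>
        using that cube_subset[OF \<mu>, of n] by (auto simp: \<alpha>n_def indicator_def split: if_splits)
      show "\<gamma> \<zeta> \<noteq> 0 \<and> \<zeta> \<in> cball (- \<mu> *\<^sub>R cellpt n) (3 * ((b + 1) * \<mu>))" if "\<gamma>n n \<zeta> \<noteq> 0" for \<zeta>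
        using that dual_cube_subset[of "b + 1" \<mu> n] by (auto simp: \<gamma>n_def indicator_def split: if_splits)
    qed
    then have "N2 (LPprod \<beta> \<mu> \<phi>1 (\<alpha>n n) \<phi>2 (\<gamma>n n)) \<le> ennreal (M\<^sup>2) * (ennreal K * (N2 (\<alpha>n n) * N2 (\<gamma>n n)))"
      by (intro order_trans[OF LPprod_N2_le[OF m An \<beta>(1,2)] mult_left_mono]) auto
    also have "\<dots> = ennreal ((c * (norm_L2 (\<alpha>n n) * norm_L2 (\<gamma>n n)))\<^sup>2)"
      using K M by (simp add: N2_norm_L2 Ln ennreal_mult[symmetric] power_mult_distrib c_def mult.assoc)
    finally have "N2 (LPprod \<beta> \<mu> \<phi>1 (\<alpha>n n) \<phi>2 (\<gamma>n n)) \<le> ennreal ((c * (norm_L2 (\<alpha>n n) * norm_L2 (\<gamma>n n)))\<^sup>2)" .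
    from in_L2_boundI[OF LPprod_measurable[OF m An \<beta>(1)] this] c show ?thesis by simp
  qed
  have S: "in_L2 (LPprod \<beta> \<mu> \<phi>1 \<alpha> \<phi>2 \<gamma>) \<and> norm_L2 (LPprod \<beta> \<mu> \<phi>1 \<alpha> \<phi>2 \<gamma>) \<le> (\<Sum>n\<in>I. norm_L2 (LPprod \<beta> \<mu> \<phi>1 (\<alpha>n n) \<phi>2 (\<gamma>n n)))"
    unfolding sum using in_L2_sum[OF I, of "\<lambda>n. LPprod \<beta> \<mu> \<phi>1 (\<alpha>n n) \<phi>2 (\<gamma>n n)"] loc by blast
  then show "in_L2 (LPprod \<beta> \<mu> \<phi>1 \<alpha> \<phi>2 \<gamma>)" ..
  have "(\<Sum>n\<in>I. norm_L2 (LPprod \<beta> \<mu> \<phi>1 (\<alpha>n n) \<phi>2 (\<gamma>n n))) \<le> c * (\<Sum>n\<in>I. \<bar>norm_L2 (\<alpha>n n)\<bar> * \<bar>norm_L2 (\<gamma>n n)\<bar>)"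
    unfolding sum_distrib_left using loc by (intro sum_mono) simp
  also have "\<dots> \<le> c * (L2_set (\<lambda>n. norm_L2 (\<alpha>n n)) I * L2_set (\<lambda>n. norm_L2 (\<gamma>n n)) I)"
    by (rule mult_left_mono[OF L2_set_mult_ineq c])
  also have "\<dots> \<le> c * (norm_L2 \<alpha> * (sqrt ((2 * b + 3) ^ 3) * norm_L2 \<gamma>))"
  proof (intro mult_left_mono[OF _ c] mult_mono)
    have "(\<Sum>n\<in>I. (norm_L2 (\<alpha>n n))\<^sup>2) \<le> 1 * (norm_L2 \<alpha>)\<^sup>2"
      unfolding \<alpha>n_def by (rule sum_localized_L2[OF L(1) I _ one]) measurable
    then show "L2_set (\<lambda>n. norm_L2 (\<alpha>n n)) I \<le> norm_L2 \<alpha>" unfolding L2_set_def by (intro real_le_lsqrt) (auto intro: sum_nonneg)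
    have "(\<Sum>n\<in>I. (norm_L2 (\<gamma>n n))\<^sup>2) \<le> (2 * (b + 1) + 1) ^ 3 * (norm_L2 \<gamma>)\<^sup>2"
      unfolding \<gamma>n_def by (rule sum_localized_L2[OF L(2) I _ dual_cube_overlap[OF \<mu> _ I]]) (use b in auto)
    also have "\<dots> = (sqrt ((2 * b + 3) ^ 3) * norm_L2 \<gamma>)\<^sup>2"
    proof -
      have "2 * (b + 1) + 1 = 2 * b + 3" by simp
      then show ?thesis using b by (simp only: power_mult_distrib real_sqrt_pow2_iff[THEN iffD2] zero_le_power)
    qed
    finally show "L2_set (\<lambda>n. norm_L2 (\<gamma>n n)) I \<le> sqrt ((2 * b + 3) ^ 3) * norm_L2 \<gamma>"
      unfolding L2_set_def by (rule real_le_lsqrt[rotated -1]) (use b in \<open>auto intro: sum_nonneg\<close>)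
  qed (use b in \<open>auto intro: L2_set_nonneg\<close>)
  finally show "norm_L2 (LPprod \<beta> \<mu> \<phi>1 \<alpha> \<phi>2 \<gamma>) \<le> M * sqrt K * sqrt ((2 * b + 3) ^ 3) * norm_L2 \<alpha> * norm_L2 \<gamma>"
    using S by (simp add: c_def mult_ac)
qed

section \<open>The bilinear estimates\<close>

lemma N2_le_const: "N \<le> ennreal k * X \<Longrightarrow> k \<le> k' \<Longrightarrow> N \<le> ennreal k' * X"
  by (meson ennreal_leI mult_right_mono order_trans zero_le)

lemma L12_add: "L12 a \<Longrightarrow> L12 b \<Longrightarrow> L12 (\<lambda>x. a x + b x)"
  by (auto simp: L12_def in_L2_add(1))

lemma sqrt_mult_bound:
  assumes "0 \<le> k" "0 < e" "0 \<le> m" shows "sqrt (k * (e * m\<^sup>2)) = sqrt k * (e powr (1/2) * m)"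
  using assms by (simp add: real_sqrt_mult powr_half_sqrt)

text \<open>Bookkeeping of constants with w = (2\<pi>)^3: two inverse transforms give w^-2, the two
  band norms together give w, and the factor 1/2 averages the two half waves. What remains is w^-1
  \<le> 1, which is dropped.\<close>

lemma half_sum_bound:
  assumes F: "in_L2 F1" "in_L2 F2" and n: "norm_L2 F1 \<le> D * a * b" "norm_L2 F2 \<le> D * a * b"
    and D: "0 \<le> D" "0 \<le> A" "0 \<le> B" and ab: "a = sqrt ((2 * pi) ^ 3) * A" "b = sqrt ((2 * pi) ^ 3) * B"
    and T: "\<And>p. T p = (complex_of_real (1 / (2 * pi) ^ 3))\<^sup>2 * (1 / 2) * (F1 p + F2 p)"
  shows "in_L2 T" "norm_L2 T \<le> D * A * B"
proof -
  have T': "T = (\<lambda>p. (complex_of_real (1 / (2 * pi) ^ 3))\<^sup>2 * (1 / 2) * (F1 p + F2 p))" using T by auto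
  define w where "w = (2 * pi) ^ 3"
  have w: "1 \<le> w" unfolding w_def using pi_gt3 by (intro one_le_power) simp
  show "in_L2 T" unfolding T' by (intro in_L2_cmult(1) in_L2_add(1) F)
  have c: "cmod ((complex_of_real (1 / w))\<^sup>2 * (1 / 2)) = (1 / w)\<^sup>2 / 2" using w by (simp add: norm_mult norm_power norm_divide power_divide)
  have "norm_L2 T = (1 / w)\<^sup>2 / 2 * norm_L2 (\<lambda>p. F1 p + F2 p)"
    unfolding T' w_def[symmetric] by (subst in_L2_cmult(2)) (simp_all only: in_L2_add(1)[OF F] c)
  also have "\<dots> \<le> (1 / w)\<^sup>2 / 2 * (2 * (D * a * b))" using in_L2_add(2)[OF F] n by (intro mult_left_mono) auto
  also have "D * a * b = D * A * B * (sqrt w)\<^sup>2" unfolding ab w_def by (simp only: power2_eq_square mult_ac)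
  also have "(sqrt w)\<^sup>2 = w" using w by simp
  also have "(1 / w)\<^sup>2 / 2 * (2 * (D * A * B * w)) = D * A * B / w" using w by (simp add: power2_eq_square)
  also have "\<dots> \<le> D * A * B / 1" using w D by (intro divide_left_mono) auto
  finally show "norm_L2 T \<le> D * A * B" by simp
qed

lemma LP_product_formula:
  assumes e: "0 < e" and \<sigma>: "\<sigma> \<in> {1, - 1}" and fg: "in_L2 f" "in_L2 g" and sol: "wave_solution e f u" "half_kg_solution e \<sigma> g v"
    and m [measurable]: "\<beta> \<in> borel_measurable borel" and L: "L12 (band \<beta> \<Lambda> f)" "L12 (band \<beta> \<Lambda> g)" and M: "\<And>\<xi>. \<bar>\<beta> \<xi>\<bar> \<le> M"
  shows "LP \<beta> \<mu> (\<lambda>y. LP \<beta> \<Lambda> (u t) y * LP \<beta> \<Lambda> (v t) y) x = (complex_of_real (1 / (2 * pi) ^ 3))\<^sup>2 * (1 / 2) *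
    (LPprod \<beta> \<mu> (wv e 1) (band \<beta> \<Lambda> f) (kg e (- \<sigma>)) (band \<beta> \<Lambda> g) (t, x) + LPprod \<beta> \<mu> (wv e (- 1)) (band \<beta> \<Lambda> f) (kg e (- \<sigma>)) (band \<beta> \<Lambda> g) (t, x))"
proof -
  define h where "h s = conv (\<lambda>\<xi>. cis (t * wv e s \<xi>) * band \<beta> \<Lambda> f \<xi>) (\<lambda>\<xi>. cis (t * kg e (- \<sigma>) \<xi>) * band \<beta> \<Lambda> g \<xi>)" for s
  define c where "c = (complex_of_real (1 / (2 * pi) ^ 3))\<^sup>2 * (1 / 2)"
  have h: "L12 (h s)" for s unfolding h_def by (intro conv_L12 L12_cis L wv_measurable kg_measurable)
  have ih: "integrable lborel (h s)" for s using h by (simp add: L12_def)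
  have Lp: "LPprod \<beta> \<mu> (wv e s) (band \<beta> \<Lambda> f) (kg e (- \<sigma>)) (band \<beta> \<Lambda> g) (t, x) = ft (\<lambda>\<xi>. complex_of_real (\<beta> (\<xi> /\<^sub>R \<mu>)) * h s \<xi>) x" for s
    unfolding h_def by (rule LPprod_eq[OF wv_measurable kg_measurable L m])
  have i\<beta>: "integrable lborel (\<lambda>\<xi>. complex_of_real (\<beta> (\<xi> /\<^sub>R \<mu>)) * h s \<xi>)" for s
    using L12_bounded_mult(1)[OF h, of "\<lambda>\<xi>. complex_of_real (\<beta> (\<xi> /\<^sub>R \<mu>))" M s] M by (simp add: L12_def)
  have H: "L12 (\<lambda>\<xi>. c * (h 1 \<xi> + h (- 1) \<xi>))"
    by (rule L12_bounded_mult(1)[where M="cmod c", OF L12_add[OF h h]]) auto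
  have E: "Eop (wv e s) (band \<beta> \<Lambda> f) (t, y) * Eop (kg e (- \<sigma>)) (band \<beta> \<Lambda> g) (t, y) = ft (h s) y" for s y
    unfolding h_def by (rule Eop_prod_conv[OF wv_measurable kg_measurable L, THEN fun_cong])
  have "LP \<beta> \<Lambda> (u t) y * LP \<beta> \<Lambda> (v t) y = ft (\<lambda>\<xi>. c * (h 1 \<xi> + h (- 1) \<xi>)) y" for y
  proof -
    have "LP \<beta> \<Lambda> (u t) y * LP \<beta> \<Lambda> (v t) y
      = c * (Eop (wv e 1) (band \<beta> \<Lambda> f) (t, y) * Eop (kg e (- \<sigma>)) (band \<beta> \<Lambda> g) (t, y) + Eop (wv e (- 1)) (band \<beta> \<Lambda> f) (t, y) * Eop (kg e (- \<sigma>)) (band \<beta> \<Lambda> g) (t, y))"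
      unfolding LP_wave[OF e fg(1) sol(1) m L(1)] LP_half_kg[OF e \<sigma> fg(2) sol(2) m] c_def by (simp add: power2_eq_square algebra_simps)
    also have "\<dots> = c * (ft (h 1) y + ft (h (- 1)) y)"
      unfolding E ..
    also have "\<dots> = ft (\<lambda>\<xi>. c * (h 1 \<xi> + h (- 1) \<xi>)) y" by (simp only: ft_cmult ft_add[OF ih ih])
    finally show ?thesis .
  qed
  then have "LP \<beta> \<mu> (\<lambda>y. LP \<beta> \<Lambda> (u t) y * LP \<beta> \<Lambda> (v t) y) = LP \<beta> \<mu> (ft (\<lambda>\<xi>. c * (h 1 \<xi> + h (- 1) \<xi>)))" by presburger
  also have "\<dots> = ft (\<lambda>\<xi>. complex_of_real (\<beta> (\<xi> /\<^sub>R \<mu>)) * (c * (h 1 \<xi> + h (- 1) \<xi>)))" by (rule LP_ft[OF H]) measurable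
  also have "\<dots> = ft (\<lambda>\<xi>. c * (complex_of_real (\<beta> (\<xi> /\<^sub>R \<mu>)) * h 1 \<xi> + complex_of_real (\<beta> (\<xi> /\<^sub>R \<mu>)) * h (- 1) \<xi>))"
    by (rule arg_cong[where f=ft]) (simp add: algebra_simps)
  finally show ?thesis unfolding Lp c_def[symmetric] by (simp only: ft_cmult ft_add[OF i\<beta> i\<beta>])
qed

text \<open>Reduces the estimates of a projected product to data supported in balls of radii 3 \<mu>
  and 3 (b + 1) \<mu> inside the shell at \<Lambda>; the radii are those of
  \<open>cube_subset\<close> and \<open>dual_cube_subset\<close>.\<close>

lemma LP_product_estimate:
  assumes e: "0 < e" and \<sigma>: "\<sigma> \<in> {1, - 1}" and fg: "in_L2 f" "in_L2 g" and sol: "wave_solution e f u" "half_kg_solution e \<sigma> g v"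
    and \<beta>: "\<beta> \<in> borel_measurable borel" "\<And>\<xi>. \<bar>\<beta> \<xi>\<bar> \<le> M" "\<And>\<xi>. \<beta> \<xi> \<noteq> 0 \<Longrightarrow> a \<le> norm \<xi> \<and> norm \<xi> \<le> b"
    and b: "0 < b" and \<mu>: "0 < \<mu>" and \<Lambda>: "0 < \<Lambda>" and K: "0 \<le> K"
    and bil: "\<And>s y1 y2 \<alpha> \<gamma>. s \<in> {1, - 1} \<Longrightarrow> L12 \<alpha> \<Longrightarrow> L12 \<gamma> \<Longrightarrow>
      (\<And>\<eta>. \<alpha> \<eta> \<noteq> 0 \<Longrightarrow> \<eta> \<in> cball y1 (3 * \<mu>) \<and> a * \<Lambda> \<le> norm \<eta> \<and> norm \<eta> \<le> b * \<Lambda>) \<Longrightarrow>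
      (\<And>\<zeta>. \<gamma> \<zeta> \<noteq> 0 \<Longrightarrow> \<zeta> \<in> cball y2 (3 * ((b + 1) * \<mu>)) \<and> a * \<Lambda> \<le> norm \<zeta> \<and> norm \<zeta> \<le> b * \<Lambda>) \<Longrightarrow>
      N2 (\<lambda>p. Eop (wv e s) \<alpha> p * Eop (kg e (- \<sigma>)) \<gamma> p) \<le> ennreal K * (N2 \<alpha> * N2 \<gamma>)"
  shows "in_L2 (\<lambda>(t, x). LP \<beta> \<mu> (\<lambda>y. LP \<beta> \<Lambda> (u t) y * LP \<beta> \<Lambda> (v t) y) x)"
    and "norm_L2 (\<lambda>(t, x). LP \<beta> \<mu> (\<lambda>y. LP \<beta> \<Lambda> (u t) y * LP \<beta> \<Lambda> (v t) y) x)
      \<le> M * sqrt K * sqrt ((2 * b + 3) ^ 3) * norm_L2 (LP \<beta> \<Lambda> f) * norm_L2 (LP \<beta> \<Lambda> g)"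
proof -
  have bf: "L12 (band \<beta> \<Lambda> f)" "\<And>\<xi>. band \<beta> \<Lambda> f \<xi> \<noteq> 0 \<Longrightarrow> a * \<Lambda> \<le> norm \<xi> \<and> norm \<xi> \<le> b * \<Lambda>"
    "norm_L2 (band \<beta> \<Lambda> f) = sqrt ((2 * pi) ^ 3) * norm_L2 (LP \<beta> \<Lambda> f)"
    and bg: "L12 (band \<beta> \<Lambda> g)" "\<And>\<xi>. band \<beta> \<Lambda> g \<xi> \<noteq> 0 \<Longrightarrow> a * \<Lambda> \<le> norm \<xi> \<and> norm \<xi> \<le> b * \<Lambda>"
    "norm_L2 (band \<beta> \<Lambda> g) = sqrt ((2 * pi) ^ 3) * norm_L2 (LP \<beta> \<Lambda> g)"
    using band_facts[of _ \<Lambda> \<beta> M a b] fg \<Lambda> \<beta> by blast+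
  define F where "F s = LPprod \<beta> \<mu> (wv e s) (band \<beta> \<Lambda> f) (kg e (- \<sigma>)) (band \<beta> \<Lambda> g)" for s
  have M: "0 \<le> M" using \<beta>(2)[of 0] by linarith
  have F: "in_L2 (F s)" "norm_L2 (F s) \<le> (M * sqrt K * sqrt ((2 * b + 3) ^ 3)) * norm_L2 (band \<beta> \<Lambda> f) * norm_L2 (band \<beta> \<Lambda> g)" if s: "s \<in> {1, - 1}" for s
  proof -
    have nb: "norm \<xi> \<le> b" if "\<beta> \<xi> \<noteq> 0" for \<xi> using \<beta>(3)[OF that] by simp
    have nf: "norm \<eta> \<le> b * \<Lambda>" if "band \<beta> \<Lambda> f \<eta> \<noteq> 0" for \<eta> using bf(2)[OF that] by simp
    have bl: "N2 (\<lambda>p. Eop (wv e s) \<alpha>' p * Eop (kg e (- \<sigma>)) \<gamma>' p) \<le> ennreal K * (N2 \<alpha>' * N2 \<gamma>')"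
      if "L12 \<alpha>'" "L12 \<gamma>'" "\<And>\<eta>. \<alpha>' \<eta> \<noteq> 0 \<Longrightarrow> band \<beta> \<Lambda> f \<eta> \<noteq> 0 \<and> \<eta> \<in> cball y1 (3 * \<mu>)"
        "\<And>\<zeta>. \<gamma>' \<zeta> \<noteq> 0 \<Longrightarrow> band \<beta> \<Lambda> g \<zeta> \<noteq> 0 \<and> \<zeta> \<in> cball y2 (3 * ((b + 1) * \<mu>))" for y1 y2 \<alpha>' \<gamma>'
      using that(3,4) bf(2) bg(2) by (intro bil[OF s that(1,2)]) blast+
    show "in_L2 (F s)" unfolding F_def
      by (rule LPprod_cells(1)[where b=b and M=M and K=K and \<rho>="b * \<Lambda>", OF wv_measurable kg_measurable bf(1) bg(1) \<beta>(1,2) _ b \<mu> _ K]; fact nb nf bl)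
    show "norm_L2 (F s) \<le> (M * sqrt K * sqrt ((2 * b + 3) ^ 3)) * norm_L2 (band \<beta> \<Lambda> f) * norm_L2 (band \<beta> \<Lambda> g)" unfolding F_def
      by (rule LPprod_cells(2)[where b=b and M=M and K=K and \<rho>="b * \<Lambda>", OF wv_measurable kg_measurable bf(1) bg(1) \<beta>(1,2) _ b \<mu> _ K]; fact nb nf bl)
  qed
  have T: "(\<lambda>(t, x). LP \<beta> \<mu> (\<lambda>y. LP \<beta> \<Lambda> (u t) y * LP \<beta> \<Lambda> (v t) y) x) p = (complex_of_real (1 / (2 * pi) ^ 3))\<^sup>2 * (1 / 2) * (F 1 p + F (- 1) p)" for p
    unfolding F_def by (cases p) (simp only: prod.case LP_product_formula[OF e \<sigma> fg sol \<beta>(1) bf(1) bg(1) \<beta>(2)])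
  have D: "0 \<le> M * sqrt K * sqrt ((2 * b + 3) ^ 3)" using M K b by simp
  note * = half_sum_bound[OF F(1) F(1) F(2) F(2) D norm_L2_nonneg norm_L2_nonneg bf(3) bg(3) T]
  show "in_L2 (\<lambda>(t, x). LP \<beta> \<mu> (\<lambda>y. LP \<beta> \<Lambda> (u t) y * LP \<beta> \<Lambda> (v t) y) x)" by (rule *) auto
  show "norm_L2 (\<lambda>(t, x). LP \<beta> \<mu> (\<lambda>y. LP \<beta> \<Lambda> (u t) y * LP \<beta> \<Lambda> (v t) y) x)
      \<le> M * sqrt K * sqrt ((2 * b + 3) ^ 3) * norm_L2 (LP \<beta> \<Lambda> f) * norm_L2 (LP \<beta> \<Lambda> g)" by (rule *) auto
qed

lemma min_bound:
  assumes "0 < \<mu>" "0 < \<Lambda>" "1 \<le> q" "\<mu> \<le> q * \<Lambda>" "\<Lambda> \<le> q * (\<mu>::real)"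
  shows "\<mu>\<^sup>2 \<le> q\<^sup>2 * (min \<mu> \<Lambda>)\<^sup>2" "\<Lambda>\<^sup>2 \<le> q\<^sup>2 * (min \<mu> \<Lambda>)\<^sup>2"
proof -
  have "1 * \<mu> \<le> q * \<mu>" "1 * \<Lambda> \<le> q * \<Lambda>" using assms by (intro mult_right_mono; simp)+
  then have "\<mu> \<le> q * min \<mu> \<Lambda>" "\<Lambda> \<le> q * min \<mu> \<Lambda>" using assms by (auto simp: min_def)
  then show "\<mu>\<^sup>2 \<le> q\<^sup>2 * (min \<mu> \<Lambda>)\<^sup>2" "\<Lambda>\<^sup>2 \<le> q\<^sup>2 * (min \<mu> \<Lambda>)\<^sup>2"
    unfolding power_mult_distrib[symmetric] using assms by (intro power_mono; simp)+
qed

text \<open>For e \<Lambda> \<ge> 1 the summand 1 is absorbed, so the Klein-Gordon symbol behaves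
  like that of the wave equation.\<close>

lemma sqrt_symbol_bound: "sqrt (1 + e\<^sup>2 * (b * \<Lambda>)\<^sup>2) \<le> (1 + b) * (e * \<Lambda>)" if "1 \<le> e * \<Lambda>" "0 \<le> b"
proof (rule real_le_lsqrt)
  have "(1 + b)\<^sup>2 = 1 + b\<^sup>2 + 2 * b" by (simp add: power2_eq_square algebra_simps)
  then have "(1 + b\<^sup>2) * (e * \<Lambda>)\<^sup>2 \<le> (1 + b)\<^sup>2 * (e * \<Lambda>)\<^sup>2" using that by (intro mult_right_mono) auto
  moreover have "1 \<le> (e * \<Lambda>)\<^sup>2" using that by (intro one_le_power)
  moreover have "e\<^sup>2 * (b * \<Lambda>)\<^sup>2 = b\<^sup>2 * (e * \<Lambda>)\<^sup>2" by (simp add: power_mult_distrib)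
  ultimately have "1 + e\<^sup>2 * (b * \<Lambda>)\<^sup>2 \<le> (1 + b)\<^sup>2 * (e * \<Lambda>)\<^sup>2" unfolding distrib_right[of 1] by linarith
  then show "1 + e\<^sup>2 * (b * \<Lambda>)\<^sup>2 \<le> ((1 + b) * (e * \<Lambda>))\<^sup>2" by (simp only: power_mult_distrib)
qed (use that in \<open>auto intro: add_nonneg_nonneg mult_nonneg_nonneg\<close>)

text \<open>One summand for each case of \<open>bilinear_separate\<close>: low against high, high
  against low, comparable frequencies by transversality, comparable frequencies by squares. The
  ratio 2 b / a delimits comparable frequencies, and (2\<pi>)^4 is the factor of
  \<open>bilinear_estimate\<close>.\<close>

definition separate_const :: "real \<Rightarrow> real \<Rightarrow> real" where
  "separate_const a b = (4 * pi * b\<^sup>2 + 2 * pi * (b / a) * b\<^sup>2 + (2 * b / a)\<^sup>2 * b\<^sup>2 * (b / a) * 16 * (32 / 3 * pi) / trans_const b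
     + 4 * pi * (1 + b)\<^sup>2 * (2 * b / a)\<^sup>2) * (2 * pi) ^ 4"

text \<open>For shells far apart \<open>thin_sphere\<close> applies and only the lower frequency
  enters the bound. For comparable shells \<mu>^2 and \<Lambda>^2 may both be replaced by the
  squared minimum at the cost of q^2, so a bound in terms of either suffices.\<close>

lemma bilinear_separate:
  assumes e: "0 < e" and s: "s \<in> {1, - 1}" "\<tau> \<in> {1, - 1}" and ab: "0 < a" "a \<le> b" and pos: "0 < \<mu>" "0 < \<Lambda>"
    and A: "L12 \<alpha>" "L12 \<gamma>" and sa: "\<And>\<eta>. \<alpha> \<eta> \<noteq> 0 \<Longrightarrow> a * \<mu> \<le> norm \<eta> \<and> norm \<eta> \<le> b * \<mu>"
    and sg: "\<And>\<zeta>. \<gamma> \<zeta> \<noteq> 0 \<Longrightarrow> a * \<Lambda> \<le> norm \<zeta> \<and> norm \<zeta> \<le> b * \<Lambda>"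
  shows "N2 (\<lambda>p. Eop (wv e s) \<alpha> p * Eop (kg e \<tau>) \<gamma> p) \<le> ennreal (separate_const a b * (e * (min \<mu> \<Lambda>)\<^sup>2)) * (N2 \<alpha> * N2 \<gamma>)"
proof -
  have b: "0 < b" using ab by simp
  have tc: "0 < trans_const b" using trans_const_pos b by simp
  define q where "q = 2 * b / a"
  have q1: "1 \<le> q" using ab by (simp add: q_def)
  define k1 where "k1 = 4 * pi * b\<^sup>2"
  define k2 where "k2 = 2 * pi * (b / a) * b\<^sup>2"
  define k3 where "k3 = q\<^sup>2 * b\<^sup>2 * (b / a) * 16 * (32 / 3 * pi) / trans_const b"
  define k4 where "k4 = 4 * pi * (1 + b)\<^sup>2 * q\<^sup>2"
  have k: "0 \<le> k1" "0 \<le> k2" "0 \<le> k3" "0 \<le> k4" using ab b tc by (simp_all add: k1_def k2_def k3_def k4_def)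
  have sc: "separate_const a b = (k1 + k2 + k3 + k4) * (2 * pi) ^ 4" by (simp add: separate_const_def k1_def k2_def k3_def k4_def q_def)
  define n where "n = min \<mu> \<Lambda>"
  define X where "X = e * n\<^sup>2"
  have X: "0 \<le> X" using e by (simp add: X_def)
  have fin: "N2 (\<lambda>p. Eop (wv e s) \<alpha> p * Eop (kg e \<tau>) \<gamma> p) \<le> ennreal (separate_const a b * (e * (min \<mu> \<Lambda>)\<^sup>2)) * (N2 \<alpha> * N2 \<gamma>)"
    if le: "N2 (\<lambda>p. Eop (wv e s) \<alpha> p * Eop (kg e \<tau>) \<gamma> p) \<le> ennreal (c * (2 * pi) ^ 4) * (N2 \<alpha> * N2 \<gamma>)"
      and c: "c \<le> k' * X" and k': "k' \<le> k1 + k2 + k3 + k4" for c k'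
  proof -
    have "c \<le> (k1 + k2 + k3 + k4) * X" using c mult_right_mono[OF k' X] by linarith
    then have "c * (2 * pi) ^ 4 \<le> (k1 + k2 + k3 + k4) * X * (2 * pi) ^ 4" by (intro mult_right_mono) auto
    also have "\<dots> = separate_const a b * X" unfolding sc by simp
    finally show ?thesis unfolding n_def[symmetric] X_def[symmetric] by (rule N2_le_const[OF le])
  qed
  consider "2 * (b * \<mu>) \<le> a * \<Lambda>" | "2 * (b * \<Lambda>) \<le> a * \<mu>" | "a * \<Lambda> \<le> 2 * (b * \<mu>)" "a * \<mu> \<le> 2 * (b * \<Lambda>)" by linarith
  then show ?thesis
  proof cases
    case 1
    have "a * \<Lambda> \<le> b * \<Lambda>" using ab pos by simp
    then have "b * \<mu> \<le> b * \<Lambda>" using 1 b pos by (smt (verit) mult_pos_pos)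
    then have "n = \<mu>" using b by (simp add: n_def)
    then have c: "4 * pi * b\<^sup>2 * e * \<mu>\<^sup>2 \<le> k1 * X" by (simp add: k1_def X_def)
    have "N2 (\<lambda>p. Eop (wv e s) \<alpha> p * Eop (kg e \<tau>) \<gamma> p) \<le> ennreal ((4 * pi * b\<^sup>2 * e * \<mu>\<^sup>2) * (2 * pi) ^ 4) * (N2 \<alpha> * N2 \<gamma>)"
      by (rule bilinear_low_high[OF e b pos(1) s(1) 1 A]) (use sa sg in auto)
    then show ?thesis by (rule fin[OF _ c]) (use k in simp)
  next
    case 2
    have "a * \<mu> \<le> b * \<mu>" using ab pos by simp
    then have "b * \<Lambda> \<le> b * \<mu>" using 2 b pos by (smt (verit) mult_pos_pos)
    then have n: "n = \<Lambda>" using b by (simp add: n_def)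
    have r: "b * \<mu> / (a * \<mu>) = b / a" using pos by simp
    have c: "2 * pi * (b * \<mu> / (a * \<mu>)) * e * (b * \<Lambda>)\<^sup>2 \<le> k2 * X"
      unfolding r k2_def X_def n power_mult_distrib by (rule eq_refl) (simp only: mult_ac)
    have "N2 (\<lambda>p. Eop (wv e s) \<alpha> p * Eop (kg e \<tau>) \<gamma> p) \<le> ennreal ((2 * pi * (b * \<mu> / (a * \<mu>)) * e * (b * \<Lambda>)\<^sup>2) * (2 * pi) ^ 4) * (N2 \<alpha> * N2 \<gamma>)"
      by (rule bilinear_high_low[where a'="a * \<mu>" and B="b * \<mu>" and l="b * \<Lambda>", OF e]) (use sa sg s A ab b pos 2 in auto)
    then show ?thesis by (rule fin[OF _ c]) (use k in simp)
  next
    case 3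
    have "\<mu> \<le> q * \<Lambda>" "\<Lambda> \<le> q * \<mu>" using 3 ab by (simp_all add: q_def field_simps)
    then have mb: "\<mu>\<^sup>2 \<le> q\<^sup>2 * n\<^sup>2" "\<Lambda>\<^sup>2 \<le> q\<^sup>2 * n\<^sup>2" unfolding n_def using min_bound[OF pos q1] by auto
    show ?thesis
    \<comment> \<open>In the first case e times a Klein-Gordon frequency is at most b, whence
      \<open>trans_const b\<close>. In the second the gap of the speeds has no uniform lower bound,
      and squares are used.\<close>
    proof (cases "e * \<Lambda> \<le> 1")
      case True
      have K: "e * (b * \<Lambda>) \<le> b" using True b mult_left_mono[of "e * \<Lambda>" 1 b] by (simp add: mult.left_commute)
      have r: "b * \<mu> / (a * \<mu>) = b / a" "b * \<mu> / (b * \<mu>) = 1" using pos b by simp_all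
      have "e * (b * \<mu>)\<^sup>2 * (b * \<mu> / (a * \<mu>)) * (1 + b * \<mu> / (b * \<mu>)) ^ 4 * (32 / 3 * pi) / trans_const b
          = (b\<^sup>2 * (b / a) * 16 * (32 / 3 * pi) / trans_const b * e) * \<mu>\<^sup>2"
        unfolding r power_mult_distrib by simp
      also have "\<dots> \<le> (b\<^sup>2 * (b / a) * 16 * (32 / 3 * pi) / trans_const b * e) * (q\<^sup>2 * n\<^sup>2)"
        using mb(1) ab b tc e by (intro mult_left_mono) auto
      also have "\<dots> = k3 * X" by (simp add: k3_def X_def)
      finally have c: "e * (b * \<mu>)\<^sup>2 * (b * \<mu> / (a * \<mu>)) * (1 + b * \<mu> / (b * \<mu>)) ^ 4 * (32 / 3 * pi) / trans_const b \<le> k3 * X" .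
      show ?thesis
      \<comment> \<open>The ball of radius b \<mu> about 0 contains the whole shell of \<alpha>, and
        R / \<rho>1 = 1 makes the dilation factor 2^4 = 16.\<close>
      proof (rule fin[OF bilinear_transversal[where ?y0.0=0 and R="b * \<mu>" and ?\<rho>0.0="a * \<mu>" and ?\<rho>1.0="b * \<mu>" and B="b * \<Lambda>" and K=b, OF e s] c])
      qed (use sa sg k A ab b pos K in auto)
    next
      case False
      then have l: "1 \<le> e * \<Lambda>" by simp
      define Z where "Z = (1 + b)\<^sup>2 * q\<^sup>2 * X"
      have bb: "b * b \<le> (1 + b)\<^sup>2" "b * (1 + b) \<le> (1 + b)\<^sup>2" using b by (simp_all add: power2_eq_square mult_right_mono mult_mono)
      have "b * \<mu> * (b * \<mu>) * e = (b * b) * (e * \<mu>\<^sup>2)" by (simp add: power2_eq_square)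
      also have "\<dots> \<le> (1 + b)\<^sup>2 * (e * (q\<^sup>2 * n\<^sup>2))" using bb mb e by (intro mult_mono) auto
      also have "\<dots> = Z" by (simp add: Z_def X_def)
      finally have Z1: "b * \<mu> * (b * \<mu>) * e \<le> Z" .
      have "b * \<Lambda> * sqrt (1 + e\<^sup>2 * (b * \<Lambda>)\<^sup>2) \<le> b * \<Lambda> * ((1 + b) * (e * \<Lambda>))"
        using b pos l by (intro mult_left_mono sqrt_symbol_bound) auto
      also have "\<dots> = (b * (1 + b)) * (e * \<Lambda>\<^sup>2)" by (simp add: power2_eq_square)
      also have "\<dots> \<le> (1 + b)\<^sup>2 * (e * (q\<^sup>2 * n\<^sup>2))" using bb mb e by (intro mult_mono) auto
      also have "\<dots> = Z" by (simp add: Z_def X_def)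
      finally have Z2: "b * \<Lambda> * sqrt (1 + e\<^sup>2 * (b * \<Lambda>)\<^sup>2) \<le> Z" .
      have c: "4 * pi * Z \<le> k4 * X" by (simp add: k4_def Z_def)
      show ?thesis
      proof (rule fin[OF bilinear_square[where ?y1.0=0 and ?y2.0=0 and ?R1.0="b * \<mu>" and ?B1.0="b * \<mu>" and ?R2.0="b * \<Lambda>" and ?B2.0="b * \<Lambda>" and K=Z, OF e] c])
      qed (use sa sg k A b pos s Z1 Z2 in auto)
    qed
  qed
qed

lemma dyadic_pos: "dyadic \<mu> \<Longrightarrow> 0 < \<mu>"
  by (auto simp: dyadic_def)

text \<open>Transversality for pieces of radius R = 3 \<mu> in the shell at \<Lambda>, with
  thickness of order e R^2. The factor 9 is 3^2; \<mu> \<le> A \<Lambda> gives R / \<rho>1 \<le> 3 A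
  / b; and e b \<Lambda> \<le> b A makes \<open>trans_const (b * A)\<close> a lower bound for the
  gap of the speeds.\<close>

lemma estimate_low_frequency:
  assumes e: "0 < e" and \<sigma>: "\<sigma> \<in> {1, - 1}" and fg: "in_L2 f" "in_L2 g" and sol: "wave_solution e f u" "half_kg_solution e \<sigma> g v"
    and \<beta>: "\<beta> \<in> borel_measurable borel" "\<And>\<xi>. \<bar>\<beta> \<xi>\<bar> \<le> M" "\<And>\<xi>. \<beta> \<xi> \<noteq> 0 \<Longrightarrow> a \<le> norm \<xi> \<and> norm \<xi> \<le> b"
    and ab: "0 < a" "a \<le> b" and pos: "0 < \<mu>" "0 < \<Lambda>" and A: "0 < A" "\<mu> \<le> A * \<Lambda>" "\<Lambda> \<le> A * (1 / e)"
    and K: "K = 9 * (b / a) * (1 + 3 * A / b) ^ 4 * (32 / 3 * pi) / trans_const (b * A) * (2 * pi) ^ 4"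
    and C: "M * sqrt K * sqrt ((2 * b + 3) ^ 3) \<le> C"
  shows "in_L2 (\<lambda>(t, x). LP \<beta> \<mu> (\<lambda>y. LP \<beta> \<Lambda> (u t) y * LP \<beta> \<Lambda> (v t) y) x) \<and>
    norm_L2 (\<lambda>(t, x). LP \<beta> \<mu> (\<lambda>y. LP \<beta> \<Lambda> (u t) y * LP \<beta> \<Lambda> (v t) y) x)
      \<le> C * e powr (1/2) * \<mu> * norm_L2 (LP \<beta> \<Lambda> f) * norm_L2 (LP \<beta> \<Lambda> g)"
proof -
  have b: "0 < b" using ab by simp
  have tc: "0 < trans_const (b * A)" using trans_const_pos b A by simp
  have K0: "0 \<le> K" unfolding K using ab b tc A by simp
  have KK: "0 \<le> K * (e * \<mu>\<^sup>2)" using K0 e by simp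
  have eL: "e * (b * \<Lambda>) \<le> b * A"
  proof -
    have "e * \<Lambda> \<le> A" using A(3) e by (simp add: pos_le_divide_eq mult.commute)
    then show ?thesis using b mult_left_mono[of "e * \<Lambda>" A b] by (simp add: mult.left_commute)
  qed
  have "3 * \<mu> / (b * \<Lambda>) \<le> 3 * A / b" using A(2) pos b by (simp add: field_simps)
  then have P: "(1 + 3 * \<mu> / (b * \<Lambda>)) ^ 4 \<le> (1 + 3 * A / b) ^ 4" using pos b by (intro power_mono add_left_mono) auto
  define W where "W = 9 * e * \<mu>\<^sup>2 * (b / a) * (32 / 3 * pi) / trans_const (b * A) * (2 * pi) ^ 4"
  have W: "0 \<le> W" unfolding W_def using e ab b tc by simp
  have r: "b * \<Lambda> / (a * \<Lambda>) = b / a" using pos by simp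
  have "e * (3 * \<mu>)\<^sup>2 * (b * \<Lambda> / (a * \<Lambda>)) * (1 + 3 * \<mu> / (b * \<Lambda>)) ^ 4 * (32 / 3 * pi) / trans_const (b * A) * (2 * pi) ^ 4
      = W * (1 + 3 * \<mu> / (b * \<Lambda>)) ^ 4"
    unfolding W_def r power_mult_distrib by simp
  also have "\<dots> \<le> W * (1 + 3 * A / b) ^ 4" by (rule mult_left_mono[OF P W])
  also have "\<dots> = K * (e * \<mu>\<^sup>2)" unfolding W_def K by simp
  finally have c: "e * (3 * \<mu>)\<^sup>2 * (b * \<Lambda> / (a * \<Lambda>)) * (1 + 3 * \<mu> / (b * \<Lambda>)) ^ 4 * (32 / 3 * pi) / trans_const (b * A) * (2 * pi) ^ 4 \<le> K * (e * \<mu>\<^sup>2)" .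
  have s: "- \<sigma> \<in> {1, - 1}" using \<sigma> by auto
  have bil: "N2 (\<lambda>p. Eop (wv e s) \<alpha> p * Eop (kg e (- \<sigma>)) \<gamma> p) \<le> ennreal (K * (e * \<mu>\<^sup>2)) * (N2 \<alpha> * N2 \<gamma>)"
    if "s \<in> {1, - 1}" and L: "L12 \<alpha>" "L12 \<gamma>" and sa: "\<And>\<eta>. \<alpha> \<eta> \<noteq> 0 \<Longrightarrow> \<eta> \<in> cball y1 (3 * \<mu>) \<and> a * \<Lambda> \<le> norm \<eta> \<and> norm \<eta> \<le> b * \<Lambda>"
      and sg: "\<And>\<zeta>. \<gamma> \<zeta> \<noteq> 0 \<Longrightarrow> \<zeta> \<in> cball y2 (3 * ((b + 1) * \<mu>)) \<and> a * \<Lambda> \<le> norm \<zeta> \<and> norm \<zeta> \<le> b * \<Lambda>" for s y1 y2 \<alpha> \<gamma>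
  proof (rule N2_le_const[OF bilinear_transversal[where ?y0.0=y1 and R="3 * \<mu>" and ?\<rho>0.0="a * \<Lambda>" and ?\<rho>1.0="b * \<Lambda>" and B="b * \<Lambda>" and K="b * A", OF e that(1) s _ _ _ _ eL L] c])
    show "\<eta> \<in> cball y1 (3 * \<mu>) \<and> a * \<Lambda> \<le> norm \<eta> \<and> norm \<eta> \<le> b * \<Lambda>" if "\<alpha> \<eta> \<noteq> 0" for \<eta> using sa[OF that] .
    show "norm \<zeta> \<le> b * \<Lambda>" if "\<gamma> \<zeta> \<noteq> 0" for \<zeta> using sg[OF that] by simp
  qed (use pos ab b in auto)
  note est = LP_product_estimate[where M=M and a=a and b=b and K="K * (e * \<mu>\<^sup>2)", OF e \<sigma> fg sol \<beta>(1,2) _ b pos KK]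
  have 1: "in_L2 (\<lambda>(t, x). LP \<beta> \<mu> (\<lambda>y. LP \<beta> \<Lambda> (u t) y * LP \<beta> \<Lambda> (v t) y) x)"
    by (rule est(1); fact \<beta>(3) bil)
  have "norm_L2 (\<lambda>(t, x). LP \<beta> \<mu> (\<lambda>y. LP \<beta> \<Lambda> (u t) y * LP \<beta> \<Lambda> (v t) y) x)
      \<le> M * sqrt (K * (e * \<mu>\<^sup>2)) * sqrt ((2 * b + 3) ^ 3) * norm_L2 (LP \<beta> \<Lambda> f) * norm_L2 (LP \<beta> \<Lambda> g)"
    by (rule est(2); fact \<beta>(3) bil)
  also have "sqrt (K * (e * \<mu>\<^sup>2)) = sqrt K * (e powr (1/2) * \<mu>)" using K0 e pos by (simp add: sqrt_mult_bound)
  also have "M * (sqrt K * (e powr (1/2) * \<mu>)) * sqrt ((2 * b + 3) ^ 3) = (M * sqrt K * sqrt ((2 * b + 3) ^ 3)) * e powr (1/2) * \<mu>" by simp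
  also have "\<dots> * norm_L2 (LP \<beta> \<Lambda> f) * norm_L2 (LP \<beta> \<Lambda> g) \<le> C * e powr (1/2) * \<mu> * norm_L2 (LP \<beta> \<Lambda> f) * norm_L2 (LP \<beta> \<Lambda> g)"
    using C pos by (intro mult_right_mono) auto
  finally show ?thesis using 1 by blast
qed

text \<open>With radii of order \<mu> and frequencies of order \<Lambda> the square estimates give e
  \<mu> \<Lambda> for the wave and \<mu> sqrt(1 + e^2 \<Lambda>^2) for the other factor, again of
  order e \<mu> \<Lambda> because e \<Lambda> \<ge> 1. In K, 12 \<pi> is 4 \<pi> times the 3 of the
  radii.\<close>

lemma estimate_high_frequency:
  assumes e: "0 < e" and \<sigma>: "\<sigma> \<in> {1, - 1}" and fg: "in_L2 f" "in_L2 g" and sol: "wave_solution e f u" "half_kg_solution e \<sigma> g v"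
    and \<beta>: "\<beta> \<in> borel_measurable borel" "\<And>\<xi>. \<bar>\<beta> \<xi>\<bar> \<le> M" "\<And>\<xi>. \<beta> \<xi> \<noteq> 0 \<Longrightarrow> a \<le> norm \<xi> \<and> norm \<xi> \<le> b"
    and b: "0 < b" and pos: "0 < \<mu>" "0 < \<Lambda>" and l: "1 \<le> e * \<Lambda>"
    and K: "K = 12 * pi * (1 + b)\<^sup>2 * (2 * pi) ^ 4"
    and C: "M * sqrt K * sqrt ((2 * b + 3) ^ 3) \<le> C"
  shows "in_L2 (\<lambda>(t, x). LP \<beta> \<mu> (\<lambda>y. LP \<beta> \<Lambda> (u t) y * LP \<beta> \<Lambda> (v t) y) x) \<and>
    norm_L2 (\<lambda>(t, x). LP \<beta> \<mu> (\<lambda>y. LP \<beta> \<Lambda> (u t) y * LP \<beta> \<Lambda> (v t) y) x)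
      \<le> C * e powr (1/2) * \<mu> powr (1/2) * \<Lambda> powr (1/2) * norm_L2 (LP \<beta> \<Lambda> f) * norm_L2 (LP \<beta> \<Lambda> g)"
proof -
  have K0: "0 \<le> K" unfolding K using b by simp
  define X where "X = e * (\<mu> * \<Lambda>)"
  have X: "0 \<le> X" using e pos by (simp add: X_def)
  have KK: "0 \<le> K * X" using K0 X by simp
  define Z where "Z = 3 * (1 + b)\<^sup>2 * X"
  have "b \<le> (1 + b)\<^sup>2" using b by (simp add: power2_eq_square algebra_simps)
  then have "3 * X * b \<le> 3 * X * (1 + b)\<^sup>2" using X by (intro mult_left_mono) auto
  then have Z1: "3 * \<mu> * (b * \<Lambda>) * e \<le> Z" by (simp add: Z_def X_def mult_ac)
  have "3 * ((b + 1) * \<mu>) * sqrt (1 + e\<^sup>2 * (b * \<Lambda>)\<^sup>2) \<le> 3 * ((b + 1) * \<mu>) * ((1 + b) * (e * \<Lambda>))"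
    using b pos l by (intro mult_left_mono sqrt_symbol_bound) auto
  also have "\<dots> = Z" by (simp add: Z_def X_def power2_eq_square add.commute)
  finally have Z2: "3 * ((b + 1) * \<mu>) * sqrt (1 + e\<^sup>2 * (b * \<Lambda>)\<^sup>2) \<le> Z" .
  have c: "4 * pi * Z * (2 * pi) ^ 4 \<le> K * X" by (simp add: K Z_def)
  have s: "- \<sigma> \<in> {1, - 1}" using \<sigma> by auto
  have bil: "N2 (\<lambda>p. Eop (wv e s) \<alpha> p * Eop (kg e (- \<sigma>)) \<gamma> p) \<le> ennreal (K * X) * (N2 \<alpha> * N2 \<gamma>)"
    if "s \<in> {1, - 1}" and L: "L12 \<alpha>" "L12 \<gamma>" and sa: "\<And>\<eta>. \<alpha> \<eta> \<noteq> 0 \<Longrightarrow> \<eta> \<in> cball y1 (3 * \<mu>) \<and> a * \<Lambda> \<le> norm \<eta> \<and> norm \<eta> \<le> b * \<Lambda>"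
      and sg: "\<And>\<zeta>. \<gamma> \<zeta> \<noteq> 0 \<Longrightarrow> \<zeta> \<in> cball y2 (3 * ((b + 1) * \<mu>)) \<and> a * \<Lambda> \<le> norm \<zeta> \<and> norm \<zeta> \<le> b * \<Lambda>" for s y1 y2 \<alpha> \<gamma>
  proof (rule N2_le_const[OF bilinear_square[where ?y1.0=y1 and ?y2.0=y2 and ?R1.0="3 * \<mu>" and ?B1.0="b * \<Lambda>" and ?R2.0="3 * ((b + 1) * \<mu>)" and ?B2.0="b * \<Lambda>", OF e _ _ _ _ that(1) s L _ _ Z1 Z2] c])
    show "\<eta> \<in> cball y1 (3 * \<mu>) \<and> norm \<eta> \<le> b * \<Lambda>" if "\<alpha> \<eta> \<noteq> 0" for \<eta> using sa[OF that] by simp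
    show "\<zeta> \<in> cball y2 (3 * ((b + 1) * \<mu>)) \<and> norm \<zeta> \<le> b * \<Lambda>" if "\<gamma> \<zeta> \<noteq> 0" for \<zeta> using sg[OF that] by simp
  qed (use pos b in auto)
  note est = LP_product_estimate[where M=M and a=a and b=b and K="K * X", OF e \<sigma> fg sol \<beta>(1,2) _ b pos KK]
  have 1: "in_L2 (\<lambda>(t, x). LP \<beta> \<mu> (\<lambda>y. LP \<beta> \<Lambda> (u t) y * LP \<beta> \<Lambda> (v t) y) x)"
    by (rule est(1); fact \<beta>(3) bil)
  have "norm_L2 (\<lambda>(t, x). LP \<beta> \<mu> (\<lambda>y. LP \<beta> \<Lambda> (u t) y * LP \<beta> \<Lambda> (v t) y) x)
      \<le> M * sqrt (K * X) * sqrt ((2 * b + 3) ^ 3) * norm_L2 (LP \<beta> \<Lambda> f) * norm_L2 (LP \<beta> \<Lambda> g)"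
    by (rule est(2); fact \<beta>(3) bil)
  also have "sqrt (K * X) = sqrt K * (e powr (1/2) * (\<mu> powr (1/2) * \<Lambda> powr (1/2)))"
    using K0 e pos by (simp add: X_def powr_half_sqrt real_sqrt_mult)
  also have "M * (sqrt K * (e powr (1/2) * (\<mu> powr (1/2) * \<Lambda> powr (1/2)))) * sqrt ((2 * b + 3) ^ 3) = (M * sqrt K * sqrt ((2 * b + 3) ^ 3)) * e powr (1/2) * \<mu> powr (1/2) * \<Lambda> powr (1/2)" by simp
  also have "\<dots> * norm_L2 (LP \<beta> \<Lambda> f) * norm_L2 (LP \<beta> \<Lambda> g) \<le> C * e powr (1/2) * \<mu> powr (1/2) * \<Lambda> powr (1/2) * norm_L2 (LP \<beta> \<Lambda> f) * norm_L2 (LP \<beta> \<Lambda> g)"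
    using C by (intro mult_right_mono) auto
  finally show ?thesis using 1 by blast
qed

text \<open>This product carries no outer projection, so \<open>bilinear_separate\<close> is applied
  to the full bands, without a decomposition into cubes.\<close>

lemma estimate_separate:
  assumes e: "0 < e" and \<sigma>: "\<sigma> \<in> {1, - 1}" and fg: "in_L2 f" "in_L2 g" and sol: "wave_solution e f u" "half_kg_solution e \<sigma> g v"
    and \<beta>: "\<beta> \<in> borel_measurable borel" "\<And>\<xi>. \<bar>\<beta> \<xi>\<bar> \<le> M" "\<And>\<xi>. \<beta> \<xi> \<noteq> 0 \<Longrightarrow> a \<le> norm \<xi> \<and> norm \<xi> \<le> b"
    and ab: "0 < a" "a \<le> b" and pos: "0 < \<mu>" "0 < \<Lambda>" and C: "sqrt (separate_const a b) \<le> C"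
  shows "in_L2 (\<lambda>(t, x). LP \<beta> \<mu> (u t) x * LP \<beta> \<Lambda> (v t) x) \<and>
    norm_L2 (\<lambda>(t, x). LP \<beta> \<mu> (u t) x * LP \<beta> \<Lambda> (v t) x)
      \<le> C * e powr (1/2) * min \<mu> \<Lambda> * norm_L2 (LP \<beta> \<mu> f) * norm_L2 (LP \<beta> \<Lambda> g)"
proof -
  have bf: "L12 (band \<beta> \<mu> f)" "\<And>\<xi>. band \<beta> \<mu> f \<xi> \<noteq> 0 \<Longrightarrow> a * \<mu> \<le> norm \<xi> \<and> norm \<xi> \<le> b * \<mu>"
    "norm_L2 (band \<beta> \<mu> f) = sqrt ((2 * pi) ^ 3) * norm_L2 (LP \<beta> \<mu> f)"
    and bg: "L12 (band \<beta> \<Lambda> g)" "\<And>\<xi>. band \<beta> \<Lambda> g \<xi> \<noteq> 0 \<Longrightarrow> a * \<Lambda> \<le> norm \<xi> \<and> norm \<xi> \<le> b * \<Lambda>"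
    "norm_L2 (band \<beta> \<Lambda> g) = sqrt ((2 * pi) ^ 3) * norm_L2 (LP \<beta> \<Lambda> g)"
    using band_facts[of _ _ \<beta> M a b] fg pos \<beta> by blast+
  define F where "F s p = Eop (wv e s) (band \<beta> \<mu> f) p * Eop (kg e (- \<sigma>)) (band \<beta> \<Lambda> g) p" for s p
  define K where "K = separate_const a b * (e * (min \<mu> \<Lambda>)\<^sup>2)"
  have b: "0 < b" using ab by simp
  have "0 < trans_const b" using trans_const_pos b by simp
  then have sc: "0 \<le> separate_const a b" unfolding separate_const_def using ab b by (intro mult_nonneg_nonneg add_nonneg_nonneg divide_nonneg_nonneg) auto
  then have K: "0 \<le> K" using e by (simp add: K_def)
  have s: "- \<sigma> \<in> {1, - 1}" using \<sigma> by auto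
  have F: "in_L2 (F s)" "norm_L2 (F s) \<le> sqrt K * norm_L2 (band \<beta> \<mu> f) * norm_L2 (band \<beta> \<Lambda> g)" if "s \<in> {1, - 1}" for s
  proof -
    have "N2 (\<lambda>p. Eop (wv e s) (band \<beta> \<mu> f) p * Eop (kg e (- \<sigma>)) (band \<beta> \<Lambda> g) p) \<le> ennreal K * (N2 (band \<beta> \<mu> f) * N2 (band \<beta> \<Lambda> g))"
      unfolding K_def by (rule bilinear_separate[OF e that s ab pos bf(1) bg(1)]; fact bf(2) bg(2))
    from bilinear_norm[OF bf(1) bg(1) wv_measurable kg_measurable this K]
    show "in_L2 (F s)" "norm_L2 (F s) \<le> sqrt K * norm_L2 (band \<beta> \<mu> f) * norm_L2 (band \<beta> \<Lambda> g)" unfolding F_def[abs_def] by auto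
  qed
  have T: "(\<lambda>(t, x). LP \<beta> \<mu> (u t) x * LP \<beta> \<Lambda> (v t) x) p = (complex_of_real (1 / (2 * pi) ^ 3))\<^sup>2 * (1 / 2) * (F 1 p + F (- 1) p)" for p
  proof -
    obtain t x where p: "p = (t, x)" by (cases p)
    show ?thesis unfolding p prod.case F_def LP_wave[OF e fg(1) sol(1) \<beta>(1) bf(1)] LP_half_kg[OF e \<sigma> fg(2) sol(2) \<beta>(1)]
      by (simp add: power2_eq_square algebra_simps)
  qed
  have sK: "0 \<le> sqrt K" using K by simp
  note * = half_sum_bound[OF F(1) F(1) F(2) F(2) sK norm_L2_nonneg norm_L2_nonneg bf(3) bg(3) T]
  have 1: "in_L2 (\<lambda>(t, x). LP \<beta> \<mu> (u t) x * LP \<beta> \<Lambda> (v t) x)" by (rule *) auto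
  have "norm_L2 (\<lambda>(t, x). LP \<beta> \<mu> (u t) x * LP \<beta> \<Lambda> (v t) x) \<le> sqrt K * norm_L2 (LP \<beta> \<mu> f) * norm_L2 (LP \<beta> \<Lambda> g)" by (rule *) auto
  also have "sqrt K = sqrt (separate_const a b) * e powr (1/2) * min \<mu> \<Lambda>"
    unfolding K_def using sc e pos by (subst sqrt_mult_bound) auto
  also have "\<dots> * norm_L2 (LP \<beta> \<mu> f) * norm_L2 (LP \<beta> \<Lambda> g) \<le> C * e powr (1/2) * min \<mu> \<Lambda> * norm_L2 (LP \<beta> \<mu> f) * norm_L2 (LP \<beta> \<Lambda> g)"
    using C pos by (intro mult_right_mono) auto
  finally show ?thesis using 1 by blast
qed

theorem theorem3p1:
  fixes \<beta> :: "real^3 \<Rightarrow> real"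
  assumes "lp_bump \<beta>"
  shows
    "(\<forall>A>0. \<exists>C>0. \<forall>\<epsilon> \<mu> \<Lambda> \<sigma> f g u v.
       0 < \<epsilon> \<longrightarrow> \<epsilon> < 1 \<longrightarrow> dyadic \<mu> \<longrightarrow> dyadic \<Lambda> \<longrightarrow> \<sigma> \<in> {1, -1} \<longrightarrow>
       in_L2 f \<longrightarrow> in_L2 g \<longrightarrow> wave_solution \<epsilon> f u \<longrightarrow> half_kg_solution \<epsilon> \<sigma> g v \<longrightarrow>
       \<mu> \<le> A * \<Lambda> \<longrightarrow> \<Lambda> \<le> A * (1 / \<epsilon>) \<longrightarrow>
       in_L2 (\<lambda>(t, x). LP \<beta> \<mu> (\<lambda>y. LP \<beta> \<Lambda> (u t) y * LP \<beta> \<Lambda> (v t) y) x) \<and>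
       norm_L2 (\<lambda>(t, x). LP \<beta> \<mu> (\<lambda>y. LP \<beta> \<Lambda> (u t) y * LP \<beta> \<Lambda> (v t) y) x)
         \<le> C * \<epsilon> powr (1/2) * \<mu> * norm_L2 (LP \<beta> \<Lambda> f) * norm_L2 (LP \<beta> \<Lambda> g)) \<and>
     (\<exists>A\<^sub>0>0. \<forall>A>0. \<exists>C>0. \<forall>\<epsilon> \<mu> \<Lambda> \<sigma> f g u v.
       0 < \<epsilon> \<longrightarrow> \<epsilon> < 1 \<longrightarrow> dyadic \<mu> \<longrightarrow> dyadic \<Lambda> \<longrightarrow> \<sigma> \<in> {1, -1} \<longrightarrow>
       in_L2 f \<longrightarrow> in_L2 g \<longrightarrow> wave_solution \<epsilon> f u \<longrightarrow> half_kg_solution \<epsilon> \<sigma> g v \<longrightarrow>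
       \<mu> \<le> A * \<Lambda> \<longrightarrow> \<Lambda> \<ge> A\<^sub>0 * (1 / \<epsilon>) \<longrightarrow>
       in_L2 (\<lambda>(t, x). LP \<beta> \<mu> (\<lambda>y. LP \<beta> \<Lambda> (u t) y * LP \<beta> \<Lambda> (v t) y) x) \<and>
       norm_L2 (\<lambda>(t, x). LP \<beta> \<mu> (\<lambda>y. LP \<beta> \<Lambda> (u t) y * LP \<beta> \<Lambda> (v t) y) x)
         \<le> C * \<epsilon> powr (1/2) * \<mu> powr (1/2) * \<Lambda> powr (1/2) * norm_L2 (LP \<beta> \<Lambda> f) * norm_L2 (LP \<beta> \<Lambda> g)) \<and>
     (\<exists>C>0. \<forall>\<epsilon> \<mu> \<Lambda> \<sigma> f g u v.
       0 < \<epsilon> \<longrightarrow> \<epsilon> < 1 \<longrightarrow> dyadic \<mu> \<longrightarrow> dyadic \<Lambda> \<longrightarrow> \<sigma> \<in> {1, -1} \<longrightarrow>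
       in_L2 f \<longrightarrow> in_L2 g \<longrightarrow> wave_solution \<epsilon> f u \<longrightarrow> half_kg_solution \<epsilon> \<sigma> g v \<longrightarrow>
       in_L2 (\<lambda>(t, x). LP \<beta> \<mu> (u t) x * LP \<beta> \<Lambda> (v t) x) \<and>
       norm_L2 (\<lambda>(t, x). LP \<beta> \<mu> (u t) x * LP \<beta> \<Lambda> (v t) x)
         \<le> C * \<epsilon> powr (1/2) * min \<mu> \<Lambda> * norm_L2 (LP \<beta> \<mu> f) * norm_L2 (LP \<beta> \<Lambda> g))"
proof -
  obtain a b M where ab: "0 < a" "a \<le> b" and M: "0 < M" and \<beta>: "\<And>\<xi>. \<bar>\<beta> \<xi>\<bar> \<le> M" "\<And>\<xi>. \<beta> \<xi> \<noteq> 0 \<Longrightarrow> a \<le> norm \<xi> \<and> norm \<xi> \<le> b"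
    and m: "\<beta> \<in> borel_measurable borel" using lp_bump_bounds[OF assms] by metis
  have b: "0 < b" using ab by simp
  show ?thesis
  proof (intro conjI allI impI)
    fix A :: real assume A: "0 < A"
    define K where "K = 9 * (b / a) * (1 + 3 * A / b) ^ 4 * (32 / 3 * pi) / trans_const (b * A) * (2 * pi) ^ 4"
    \<comment> \<open>The maximum with 1 makes C positive.\<close>
    define C where "C = max 1 (M * sqrt K * sqrt ((2 * b + 3) ^ 3))"
    show "\<exists>C>0. \<forall>\<epsilon> \<mu> \<Lambda> \<sigma> f g u v.
       0 < \<epsilon> \<longrightarrow> \<epsilon> < 1 \<longrightarrow> dyadic \<mu> \<longrightarrow> dyadic \<Lambda> \<longrightarrow> \<sigma> \<in> {1, -1} \<longrightarrow>
       in_L2 f \<longrightarrow> in_L2 g \<longrightarrow> wave_solution \<epsilon> f u \<longrightarrow> half_kg_solution \<epsilon> \<sigma> g v \<longrightarrow>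
       \<mu> \<le> A * \<Lambda> \<longrightarrow> \<Lambda> \<le> A * (1 / \<epsilon>) \<longrightarrow>
       in_L2 (\<lambda>(t, x). LP \<beta> \<mu> (\<lambda>y. LP \<beta> \<Lambda> (u t) y * LP \<beta> \<Lambda> (v t) y) x) \<and>
       norm_L2 (\<lambda>(t, x). LP \<beta> \<mu> (\<lambda>y. LP \<beta> \<Lambda> (u t) y * LP \<beta> \<Lambda> (v t) y) x)
       \<le> C * \<epsilon> powr (1/2) * \<mu> * norm_L2 (LP \<beta> \<Lambda> f) * norm_L2 (LP \<beta> \<Lambda> g)"
    proof (rule exI[of _ C], intro conjI allI impI)
      show "0 < C" by (simp add: C_def)
      fix \<epsilon> \<mu> \<Lambda> \<sigma> :: real and f g u v
      assume *: "0 < \<epsilon>" "dyadic \<mu>" "dyadic \<Lambda>" "\<sigma> \<in> {1, -1}" "in_L2 f" "in_L2 g" "wave_solution \<epsilon> f u" "half_kg_solution \<epsilon> \<sigma> g v" "\<mu> \<le> A * \<Lambda>" "\<Lambda> \<le> A * (1 / \<epsilon>)"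
      have "M * sqrt K * sqrt ((2 * b + 3) ^ 3) \<le> C" by (simp add: C_def)
      note E = estimate_low_frequency[OF *(1,4-8) m \<beta> ab dyadic_pos[OF *(2)] dyadic_pos[OF *(3)] A *(9,10) K_def this]
      show "in_L2 (\<lambda>(t, x). LP \<beta> \<mu> (\<lambda>y. LP \<beta> \<Lambda> (u t) y * LP \<beta> \<Lambda> (v t) y) x)"
        "norm_L2 (\<lambda>(t, x). LP \<beta> \<mu> (\<lambda>y. LP \<beta> \<Lambda> (u t) y * LP \<beta> \<Lambda> (v t) y) x)
       \<le> C * \<epsilon> powr (1/2) * \<mu> * norm_L2 (LP \<beta> \<Lambda> f) * norm_L2 (LP \<beta> \<Lambda> g)" using E by auto
    qed
  next
    define K where "K = 12 * pi * (1 + b)\<^sup>2 * (2 * pi) ^ 4"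
    define C where "C = max 1 (M * sqrt K * sqrt ((2 * b + 3) ^ 3))"
    show "\<exists>A\<^sub>0>0. \<forall>A>0. \<exists>C>0. \<forall>\<epsilon> \<mu> \<Lambda> \<sigma> f g u v.
       0 < \<epsilon> \<longrightarrow> \<epsilon> < 1 \<longrightarrow> dyadic \<mu> \<longrightarrow> dyadic \<Lambda> \<longrightarrow> \<sigma> \<in> {1, -1} \<longrightarrow>
       in_L2 f \<longrightarrow> in_L2 g \<longrightarrow> wave_solution \<epsilon> f u \<longrightarrow> half_kg_solution \<epsilon> \<sigma> g v \<longrightarrow>
       \<mu> \<le> A * \<Lambda> \<longrightarrow> \<Lambda> \<ge> A\<^sub>0 * (1 / \<epsilon>) \<longrightarrow>
       in_L2 (\<lambda>(t, x). LP \<beta> \<mu> (\<lambda>y. LP \<beta> \<Lambda> (u t) y * LP \<beta> \<Lambda> (v t) y) x) \<and>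
       norm_L2 (\<lambda>(t, x). LP \<beta> \<mu> (\<lambda>y. LP \<beta> \<Lambda> (u t) y * LP \<beta> \<Lambda> (v t) y) x)
         \<le> C * \<epsilon> powr (1/2) * \<mu> powr (1/2) * \<Lambda> powr (1/2) * norm_L2 (LP \<beta> \<Lambda> f) * norm_L2 (LP \<beta> \<Lambda> g)"
    \<comment> \<open>The threshold 1 is sufficiently large: \<epsilon> \<Lambda> \<ge> 1 is the
      condition under which \<open>sqrt_symbol_bound\<close> absorbs the summand 1 of the
      symbol.\<close>
    proof (rule exI[of _ 1], intro conjI allI impI, simp, rule exI[of _ C], intro conjI allI impI)
      show "0 < C" by (simp add: C_def)
      fix \<epsilon> \<mu> \<Lambda> \<sigma> :: real and f g u v
      assume *: "0 < \<epsilon>" "dyadic \<mu>" "dyadic \<Lambda>" "\<sigma> \<in> {1, -1}" "in_L2 f" "in_L2 g" "wave_solution \<epsilon> f u" "half_kg_solution \<epsilon> \<sigma> g v" "\<Lambda> \<ge> 1 * (1 / \<epsilon>)"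
      have l: "1 \<le> \<epsilon> * \<Lambda>" using *(1,9) by (simp add: pos_divide_le_eq mult.commute)
      have "M * sqrt K * sqrt ((2 * b + 3) ^ 3) \<le> C" by (simp add: C_def)
      note E = estimate_high_frequency[OF *(1,4-8) m \<beta> b dyadic_pos[OF *(2)] dyadic_pos[OF *(3)] l K_def this]
      show "in_L2 (\<lambda>(t, x). LP \<beta> \<mu> (\<lambda>y. LP \<beta> \<Lambda> (u t) y * LP \<beta> \<Lambda> (v t) y) x)"
        "norm_L2 (\<lambda>(t, x). LP \<beta> \<mu> (\<lambda>y. LP \<beta> \<Lambda> (u t) y * LP \<beta> \<Lambda> (v t) y) x)
         \<le> C * \<epsilon> powr (1/2) * \<mu> powr (1/2) * \<Lambda> powr (1/2) * norm_L2 (LP \<beta> \<Lambda> f) * norm_L2 (LP \<beta> \<Lambda> g)"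
        using E by auto
    qed
  next
    define C where "C = max 1 (sqrt (separate_const a b))"
    show "\<exists>C>0. \<forall>\<epsilon> \<mu> \<Lambda> \<sigma> f g u v.
       0 < \<epsilon> \<longrightarrow> \<epsilon> < 1 \<longrightarrow> dyadic \<mu> \<longrightarrow> dyadic \<Lambda> \<longrightarrow> \<sigma> \<in> {1, -1} \<longrightarrow>
       in_L2 f \<longrightarrow> in_L2 g \<longrightarrow> wave_solution \<epsilon> f u \<longrightarrow> half_kg_solution \<epsilon> \<sigma> g v \<longrightarrow>
       in_L2 (\<lambda>(t, x). LP \<beta> \<mu> (u t) x * LP \<beta> \<Lambda> (v t) x) \<and>
       norm_L2 (\<lambda>(t, x). LP \<beta> \<mu> (u t) x * LP \<beta> \<Lambda> (v t) x)
         \<le> C * \<epsilon> powr (1/2) * min \<mu> \<Lambda> * norm_L2 (LP \<beta> \<mu> f) * norm_L2 (LP \<beta> \<Lambda> g)"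
    proof (rule exI[of _ C], intro conjI allI impI)
      show "0 < C" by (simp add: C_def)
      fix \<epsilon> \<mu> \<Lambda> \<sigma> :: real and f g u v
      assume *: "0 < \<epsilon>" "dyadic \<mu>" "dyadic \<Lambda>" "\<sigma> \<in> {1, -1}" "in_L2 f" "in_L2 g" "wave_solution \<epsilon> f u" "half_kg_solution \<epsilon> \<sigma> g v"
      have "sqrt (separate_const a b) \<le> C" by (simp add: C_def)
      note E = estimate_separate[OF *(1,4-8) m \<beta> ab dyadic_pos[OF *(2)] dyadic_pos[OF *(3)] this]
      show "in_L2 (\<lambda>(t, x). LP \<beta> \<mu> (u t) x * LP \<beta> \<Lambda> (v t) x)"
        "norm_L2 (\<lambda>(t, x). LP \<beta> \<mu> (u t) x * LP \<beta> \<Lambda> (v t) x)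
         \<le> C * \<epsilon> powr (1/2) * min \<mu> \<Lambda> * norm_L2 (LP \<beta> \<mu> f) * norm_L2 (LP \<beta> \<Lambda> g)" using E by auto
    qed
  qed
qed

end
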